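(* Let $P$ be an $n$-dimensional Gorenstein polytope of degree $2$ with $h^*$-polynomial $1+at+t^2$ where $a\in\{0,1,2\}$, i.e. $\mathrm{Vol}_{\mathbb{N}}(P)=a+2\le 4$. Assume that $P$ is not a pyramid over an $(n-1)$-dimensional Gorenstein polytope. Write the graded Gorenstein ring $S_P$ as a quotient of a polynomial ring $K[x_1,\dots,x_l]$ modulo an ideal $J$ generated by binomials. Then $n\le 5$, and up to isomorphism there are exactly the following $15$ possibilities for $P$, characterized by the listed binomial relations generating $J$ (in the variables that occur): (1) $\dim P=2$: $\Delta_1$: $x_1x_2x_3=x_4^3$; $\Delta_2$: $x_1x_2=x_5^2,\ x_3x_4=x_5^2$; $\Delta_3$: $x_1x_2=x_5^2,\ x_3x_4=x_1x_5$; $\Delta_4$: $x_1x_2=x_5^2,\ x_3x_4=x_1^2$. (2) $\dim P=3$: $P_1$: $x_1x_2x_3x_4=x_5^2$; $P_2$: $x_1x_2x_3=x_4x_5^2$; $P_3$: $x_1x_2=x_3^2,\ x_4x_5=x_6^2$; $P_4$: $x_1x_2=x_3^2,\ x_1x_4=x_5x_6$; $P_5$: $x_1x_2=x_3^2,\ x_3x_4=x_5x_6$; $P_6$: $x_1x_2=x_3x_4,\ x_1x_5=x_2x_6$; $P_7$: $x_1x_2=x_5x_6,\ x_1x_2=x_3x_4$. (3) $\dim P=4$: $Q_1$: $x_1x_2x_3=x_4x_5x_6$; $Q_2$: $x_1x_2=x_3x_4,\ x_5x_6=x_7x_1$; $Q_3$: $x_1x_2=x_3x_4,\ x_5x_6=x_7^2$.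 (4) $\dim P=5$: $R_1$: $x_1x_2=x_3x_4,\ x_5x_6=x_7x_8$. (All variables have degree $1$, except $x_5$ in the case $P_1$, which has degree $2$.)
   Context: Let $M\cong\mathbb{Z}^n$ be a lattice, $N=\mathrm{Hom}(M,\mathbb{Z})$, $M_{\mathbb{R}}=M\otimes\mathbb{R}$. A lattice polytope is the convex hull of finitely many points of $M$; isomorphism means affine isomorphism of lattices carrying one polytope to the other. For an $n$-dimensional lattice polytope $P$: $\mathrm{Vol}_{\mathbb{N}}(P)=n!\cdot\mathrm{vol}(P)$; $h^*_P(t):=(1-t)^{n+1}\sum_{k\ge 0}|kP\cap M|t^k$ is a polynomial, and $\deg P:=\deg h^*_P$. An $n$-dimensional lattice polytope $\Delta$ with $0$ in its interior is reflexive if $\{y\in N_{\mathbb{R}}:\langle x,y\rangle\ge -1\ \forall x\in\Delta\}$ is a lattice polytope; it is reflexive with respect to an interior lattice point $m$ if $\Delta-m$ is reflexive. $P$ is Gorenstein of index $r\ge1$ if $rP$ is reflexive with respect to some interior lattice point; then $\deg P=n+1-r$. The pyramid over an $(n-1)$-dimensional lattice polytope $P'\subset M'_{\mathbb{R}}$ is $\mathrm{conv}(P'\times\{0\}\cup\{(0,1)\})\subset(M'\oplus\mathbb{Z})_{\mathbb{R}}$ (up to isomorphism). Let $K$ be a field of characteristic $0$, $C_P=\{(\lambda x,\lambda):\lambda\ge0,\ x\in P\}\subset(M\oplus\mathbb{Z})_{\mathbb{R}}$, and $S_P=K[C_P\cap(M\oplus\mathbb{Z})]$ the semigroup algebra graded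 by the last coordinate. The presentation of $S_P$ is the one in which the variables $x_1,\dots,x_l$ map bijectively to the monomials of the minimal generating set of the semigroup $C_P\cap(M\oplus\mathbb{Z})$, and $J$ is the kernel. *)

theory Defs
  imports
    "HOL-Analysis.Analysis"
    "HOL-Analysis.Finite_Function_Topology"
    "HOL-Computational_Algebra.Computational_Algebra"
begin

text \<open>
  The dimension \<open>n\<close> has to vary inside the statements, so everything lives in the space
  of finitely supported real sequences, with \<open>\<real>\<^sup>n\<close> as the subspace of sequences
  supported on \<open>{..<n}\<close>. In particular \<open>\<real>\<^sup>n\<close> is \<open>\<real>\<^sup>n \<times> {0}\<close> inside \<open>\<real>\<^sup>n\<^sup>+\<^sup>1\<close>. The dual
  lattice \<open>N\<close> is identified with \<open>\<int>\<^sup>n\<close> through the standard pairing.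
\<close>

type_synonym vec = "nat \<Rightarrow>\<^sub>0 real"

definition rspace :: "nat \<Rightarrow> vec set" where
  "rspace n = {x. Poly_Mapping.keys x \<subseteq> {..<n}}"

definition lattice :: "nat \<Rightarrow> vec set" where
  "lattice n = {x \<in> rspace n. \<forall>i. Poly_Mapping.lookup x i \<in> \<int>}"

definition pairing :: "nat \<Rightarrow> vec \<Rightarrow> vec \<Rightarrow> real" where
  "pairing n x y = (\<Sum>i<n. Poly_Mapping.lookup x i * Poly_Mapping.lookup y i)"


section \<open>Lattice polytopes\<close>

definition lattice_polytope :: "nat \<Rightarrow> vec set \<Rightarrow> bool" where
  "lattice_polytope n P \<longleftrightarrow> (\<exists>V. finite V \<and> V \<subseteq> lattice n \<and> P = convex hull V)"

definition full_lattice_polytope :: "nat \<Rightarrow> vec set \<Rightarrow> bool" where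
  "full_lattice_polytope n P \<longleftrightarrow> lattice_polytope n P \<and> affine hull P = rspace n"

text \<open>The linear part \<open>A\<close> is total on \<open>vec\<close>, but only its restriction to
  \<open>rspace n\<close> is constrained.\<close>

definition lattice_iso :: "nat \<Rightarrow> vec set \<Rightarrow> nat \<Rightarrow> vec set \<Rightarrow> bool" where
  "lattice_iso n P m Q \<longleftrightarrow>
     (\<exists>A b. linear A \<and> bij_betw (\<lambda>x. A x + b) (lattice n) (lattice m) \<and>
            (\<lambda>x. A x + b) ` P = Q)"

definition normalized_volume :: "nat \<Rightarrow> vec set \<Rightarrow> real" where
  "normalized_volume n P =
     fact n * measure (\<Pi>\<^sub>M i\<in>{..<n}. lborel)
                      ((\<lambda>x. restrict (Poly_Mapping.lookup x) {..<n}) ` P)"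

definition dilate :: "nat \<Rightarrow> vec set \<Rightarrow> vec set" where
  "dilate k P = (\<lambda>x. real k *\<^sub>R x) ` P"

text \<open>\<open>h\<^sup>*\<close> as a power series; that it is a polynomial is asserted wherever it is used.\<close>

definition hstar :: "nat \<Rightarrow> vec set \<Rightarrow> int fps" where
  "hstar n P = (1 - fps_X) ^ (n + 1) * Abs_fps (\<lambda>k. int (card (dilate k P \<inter> lattice n)))"

definition has_hstar_degree :: "nat \<Rightarrow> vec set \<Rightarrow> nat \<Rightarrow> bool" where
  "has_hstar_degree n P d \<longleftrightarrow> (\<exists>p. hstar n P = fps_of_poly p \<and> degree p = d)"


section \<open>Reflexive and Gorenstein polytopes, pyramids\<close>

definition interior_in :: "nat \<Rightarrow> vec set \<Rightarrow> vec set" where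
  "interior_in n P = top_of_set (rspace n) interior_of P"

definition dual_polytope :: "nat \<Rightarrow> vec set \<Rightarrow> vec set" where
  "dual_polytope n D = {y \<in> rspace n. \<forall>x\<in>D. pairing n x y \<ge> -1}"

definition reflexive :: "nat \<Rightarrow> vec set \<Rightarrow> bool" where
  "reflexive n D \<longleftrightarrow>
     full_lattice_polytope n D \<and> 0 \<in> interior_in n D \<and> lattice_polytope n (dual_polytope n D)"

definition reflexive_wrt :: "nat \<Rightarrow> vec set \<Rightarrow> vec \<Rightarrow> bool" where
  "reflexive_wrt n D m \<longleftrightarrow>
     m \<in> lattice n \<and> m \<in> interior_in n D \<and> reflexive n ((\<lambda>x. x - m) ` D)"

definition gorenstein_of_index :: "nat \<Rightarrow> nat \<Rightarrow> vec set \<Rightarrow> bool" where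
  "gorenstein_of_index n r P \<longleftrightarrow>
     r \<ge> 1 \<and> full_lattice_polytope n P \<and> (\<exists>m. reflexive_wrt n (dilate r P) m)"

definition gorenstein :: "nat \<Rightarrow> vec set \<Rightarrow> bool" where
  "gorenstein n P \<longleftrightarrow> (\<exists>r. gorenstein_of_index n r P)"

text \<open>For \<open>P' \<subseteq> rspace m\<close>, the pyramid in \<open>rspace (Suc m)\<close> with apex the new unit vector.\<close>

definition pyramid :: "nat \<Rightarrow> vec set \<Rightarrow> vec set" where
  "pyramid m P' = convex hull (insert (Poly_Mapping.single m 1) P')"

definition gorenstein_pyramid :: "nat \<Rightarrow> vec set \<Rightarrow> bool" where
  "gorenstein_pyramid n P \<longleftrightarrow>
     (\<exists>m P'. n = Suc m \<and> gorenstein m P' \<and> lattice_iso n P n (pyramid m P'))"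

definition small_degree_two_polytope :: "nat \<Rightarrow> vec set \<Rightarrow> nat \<Rightarrow> bool" where
  "small_degree_two_polytope n P a \<longleftrightarrow>
     gorenstein n P \<and> has_hstar_degree n P 2 \<and>
     a \<in> {0, 1, 2} \<and> hstar n P = fps_of_poly [:1, int a, 1:] \<and>
     \<not> gorenstein_pyramid n P"


section \<open>Semigroup algebras and their presentations\<close>

definition cone_over :: "vec set \<Rightarrow> (vec \<times> real) set" where
  "cone_over P = {(t *\<^sub>R x, t) | t x. t \<ge> 0 \<and> x \<in> P}"

definition cone_semigroup :: "nat \<Rightarrow> vec set \<Rightarrow> (vec \<times> real) set" where
  "cone_semigroup n P = cone_over P \<inter> (lattice n \<times> \<int>)"

definition generates_monoid :: "'a::comm_monoid_add set \<Rightarrow> 'a set \<Rightarrow> bool" where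
  "generates_monoid G S \<longleftrightarrow> (\<lambda>T. 0 \<in> T \<and> (\<forall>x\<in>T. \<forall>y\<in>T. x + y \<in> T)) hull G = S"

definition minimal_generating_set :: "'a::comm_monoid_add set \<Rightarrow> 'a set \<Rightarrow> bool" where
  "minimal_generating_set G S \<longleftrightarrow>
     generates_monoid G S \<and> (\<forall>H. generates_monoid H S \<longrightarrow> G \<subseteq> H)"

text \<open>The product on \<open>_ \<Rightarrow>\<^sub>0 'k\<close> is convolution: \<open>vec \<times> real \<Rightarrow>\<^sub>0 'k\<close> is the algebra of the
  additive group \<open>vec \<times> real\<close>, and \<open>(nat \<Rightarrow>\<^sub>0 nat) \<Rightarrow>\<^sub>0 'k\<close> is the polynomial ring in variables
  indexed by \<open>nat\<close>.\<close>

definition semigroup_algebra :: "nat \<Rightarrow> vec set \<Rightarrow> (vec \<times> real \<Rightarrow>\<^sub>0 'k::field_char_0) set" where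
  "semigroup_algebra n P = {f. Poly_Mapping.keys f \<subseteq> cone_semigroup n P}"

type_synonym 'k mpoly = "(nat \<Rightarrow>\<^sub>0 nat) \<Rightarrow>\<^sub>0 'k"

definition var :: "nat \<Rightarrow> 'k::field_char_0 mpoly" where
  "var i = Poly_Mapping.single (Poly_Mapping.single i 1) 1"

definition poly_ring :: "nat \<Rightarrow> 'k::field_char_0 mpoly set" where
  "poly_ring l = {f. \<forall>m\<in>Poly_Mapping.keys f. Poly_Mapping.keys m \<subseteq> {1..l}}"

definition generated_ideal :: "nat \<Rightarrow> 'k::field_char_0 mpoly set \<Rightarrow> 'k mpoly set" where
  "generated_ideal l R = {\<Sum>r\<in>R. q r * r | q. \<forall>r\<in>R. q r \<in> poly_ring l}"

text \<open>The \<open>K\<close>-algebra homomorphism sending \<open>x\<^sub>j\<close> to the monomial with exponent \<open>g j\<close>.\<close>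

definition monomial_hom ::
    "(nat \<Rightarrow> vec \<times> real) \<Rightarrow> 'k::field_char_0 mpoly \<Rightarrow> (vec \<times> real \<Rightarrow>\<^sub>0 'k)" where
  "monomial_hom g f =
     (\<Sum>m\<in>Poly_Mapping.keys f. Poly_Mapping.single 0 (Poly_Mapping.lookup f m) *
        (\<Prod>j\<in>Poly_Mapping.keys m. Poly_Mapping.single (g j) 1 ^ Poly_Mapping.lookup m j))"

text \<open>\<open>presents n P l R g\<close>: numbering the minimal generators as \<open>g 1, \<dots>, g l\<close>, the algebra
  \<open>S\<^sub>P\<close> is \<open>K[x\<^sub>1, \<dots>, x\<^sub>l] / J\<close> with \<open>J\<close> generated by the finite set \<open>R\<close>.\<close>

definition presents ::
    "nat \<Rightarrow> vec set \<Rightarrow> nat \<Rightarrow> 'k::field_char_0 mpoly set \<Rightarrow> (nat \<Rightarrow> vec \<times> real) \<Rightarrow> bool" where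
  "presents n P l R g \<longleftrightarrow>
     (\<exists>G. minimal_generating_set G (cone_semigroup n P) \<and> bij_betw g {1..l} G) \<and>
     monomial_hom g ` (poly_ring l :: 'k mpoly set) = semigroup_algebra n P \<and>
     {f \<in> poly_ring l :: 'k mpoly set. monomial_hom g f = 0} = generated_ideal l R"


section \<open>The list\<close>

datatype label =
  Delta1 | Delta2 | Delta3 | Delta4 | P1 | P2 | P3 | P4 | P5 | P6 | P7 | Q1 | Q2 | Q3 | R1

fun label_dim :: "label \<Rightarrow> nat" where
  "label_dim Delta1 = 2" | "label_dim Delta2 = 2" | "label_dim Delta3 = 2" | "label_dim Delta4 = 2"
| "label_dim P1 = 3" | "label_dim P2 = 3" | "label_dim P3 = 3" | "label_dim P4 = 3"
| "label_dim P5 = 3" | "label_dim P6 = 3" | "label_dim P7 = 3"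
| "label_dim Q1 = 4" | "label_dim Q2 = 4" | "label_dim Q3 = 4"
| "label_dim R1 = 5"

text \<open>The number of variables that occur in the relations.\<close>

fun num_vars :: "label \<Rightarrow> nat" where
  "num_vars Delta1 = 4" | "num_vars Delta2 = 5" | "num_vars Delta3 = 5" | "num_vars Delta4 = 5"
| "num_vars P1 = 5" | "num_vars P2 = 5" | "num_vars P3 = 6" | "num_vars P4 = 6"
| "num_vars P5 = 6" | "num_vars P6 = 6" | "num_vars P7 = 6"
| "num_vars Q1 = 6" | "num_vars Q2 = 7" | "num_vars Q3 = 7"
| "num_vars R1 = 8"

fun var_degree :: "label \<Rightarrow> nat \<Rightarrow> real" where
  "var_degree i j = (if i = P1 \<and> j = 5 then 2 else 1)"

text \<open>A relation \<open>u = v\<close> is represented by the binomial \<open>u - v\<close>.\<close>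

fun relations :: "label \<Rightarrow> 'k::field_char_0 mpoly set" where
  "relations Delta1 = {var 1 * var 2 * var 3 - var 4 ^ 3}"
| "relations Delta2 = {var 1 * var 2 - var 5 ^ 2, var 3 * var 4 - var 5 ^ 2}"
| "relations Delta3 = {var 1 * var 2 - var 5 ^ 2, var 3 * var 4 - var 1 * var 5}"
| "relations Delta4 = {var 1 * var 2 - var 5 ^ 2, var 3 * var 4 - var 1 ^ 2}"
| "relations P1 = {var 1 * var 2 * var 3 * var 4 - var 5 ^ 2}"
| "relations P2 = {var 1 * var 2 * var 3 - var 4 * var 5 ^ 2}"
| "relations P3 = {var 1 * var 2 - var 3 ^ 2, var 4 * var 5 - var 6 ^ 2}"
| "relations P4 = {var 1 * var 2 - var 3 ^ 2, var 1 * var 4 - var 5 * var 6}"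
| "relations P5 = {var 1 * var 2 - var 3 ^ 2, var 3 * var 4 - var 5 * var 6}"
| "relations P6 = {var 1 * var 2 - var 3 * var 4, var 1 * var 5 - var 2 * var 6}"
| "relations P7 = {var 1 * var 2 - var 5 * var 6, var 1 * var 2 - var 3 * var 4}"
| "relations Q1 = {var 1 * var 2 * var 3 - var 4 * var 5 * var 6}"
| "relations Q2 = {var 1 * var 2 - var 3 * var 4, var 5 * var 6 - var 7 * var 1}"
| "relations Q3 = {var 1 * var 2 - var 3 * var 4, var 5 * var 6 - var 7 ^ 2}"
| "relations R1 = {var 1 * var 2 - var 3 * var 4, var 5 * var 6 - var 7 * var 8}"

end

theory Submission
  imports Defs
begin

text \<open>
  Let \<open>A\<close> be the set of lattice points of \<open>P\<close> in degree one of the cone over \<open>P\<close>. A lexicographic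
  triangulation of the cone into half-open simplicial cones over \<open>A\<close> shows that the coefficients of
  \<open>h\<^sup>*\<close> count box points, so every box point has degree at most \<open>deg P = 2\<close> and the semigroup is
  generated in degrees one and two. By Gorenstein symmetry an indecomposable element of degree two
  forces \<open>a = 0\<close>. If \<open>a > 0\<close>, comparing \<open>h\<^sup>*\<close> with the Hilbert series of a polynomial ring shows that
  the \<open>n + 1 + a\<close> generators satisfy exactly one cubic relation (\<open>a = 1\<close>) or two quadratic relations
  (\<open>a = 2\<close>); if \<open>a = 0\<close>, then \<open>n + 1\<close> generators of degree one are independent and twice the extra
  generator is a sum of four of them. Normality excludes relations for which a midpoint of two
  generators would be missing, and a variable that occurs in no relation is the apex of a pyramid.

  The remaining systems of relations are triangular: each has squarefree leading terms on pairwise disjoint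
  sets of variables. Such a system determines \<open>P\<close> up to isomorphism, yields a polytope whose cone has
  explicit facet functionals, and has unique normal forms, which give the presentation and \<open>h\<^sup>*\<close>. The
  labels are told apart by the quadratic and cubic coincidences between generators, and the volume is the
  limit of the normalized number of lattice points in dilates.
\<close>

text \<open>The three cases are modelled on complete intersections:
  \<open>1 + t^2 = (1 - t^4) / (1 - t^2)\<close>, \<open>1 + t + t^2 = (1 - t^3) / (1 - t)\<close>
  and \<open>1 + 2t + t^2 = (1 - t^2)^2 / (1 - t)^2\<close>. Such an identity predicts the relations
  only once generation in degree one is known. For this the Gorenstein property is used in the form
  of integral functionals that cut out the cone and all take the value 1 at one lattice point
  \<open>w\<close>: a lattice point on which they are all positive differs from \<open>w\<close> by
  a point of the cone. A squarefree leading term allows reduction of real exponents: the relation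
  times the minimum over its leading variables is subtracted. So a single calculus of normal forms
  serves the real cone, the semigroup and the polynomial ring, and the normal form of a lattice
  point is integral, which gives normality of the models. For the triangulation, the numbering of
  the generators defines the lexicographic order, and points on common faces are assigned to one
  cone by a displacement along a curve on which no coordinate vanishes identically.\<close>

abbreviation (input) lookup :: "('a \<Rightarrow>\<^sub>0 'b::zero) \<Rightarrow> 'a \<Rightarrow> 'b" where "lookup \<equiv> Poly_Mapping.lookup"
abbreviation (input) single :: "'a \<Rightarrow> 'b \<Rightarrow> 'a \<Rightarrow>\<^sub>0 'b::zero" where "single \<equiv> Poly_Mapping.single"
abbreviation (input) keys :: "('a \<Rightarrow>\<^sub>0 'b::zero) \<Rightarrow> 'a set" where "keys \<equiv> Poly_Mapping.keys"

section \<open>Cones over lattice polytopes\<close>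

lemma lookup_scaleR [simp]:
  "lookup (r *\<^sub>R x) i = r *\<^sub>R lookup (x :: 'a \<Rightarrow>\<^sub>0 'b::real_vector) i"
proof -
  have "finite {i. r *\<^sub>R lookup x i \<noteq> 0}"
    by (rule finite_subset[OF _ finite_lookup[of x]]) auto
  then show ?thesis by (simp add: scaleR_poly_mapping_def)
qed

lemma lookup_sum': "lookup (sum f A) i = (\<Sum>a\<in>A. lookup (f a) i)"
  by (induction A rule: infinite_finite_induct) (auto simp: lookup_add)

text \<open>\<open>VV n\<close> and \<open>Lam n\<close> are the ambient space of the cone and its
  lattice; the last component is the degree. In \<open>ev n u p\<close> the functional
  \<open>u\<close> comes first. The standard pairing lets functionals be points of the same space,
  integral ones lying in \<open>Lam n\<close>.\<close>

definition VV :: "nat \<Rightarrow> (vec \<times> real) set" where "VV n = rspace n \<times> UNIV"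
definition Lam :: "nat \<Rightarrow> (vec \<times> real) set" where "Lam n = lattice n \<times> \<int>"
definition ev :: "nat \<Rightarrow> vec \<times> real \<Rightarrow> vec \<times> real \<Rightarrow> real" where
  "ev n u p = pairing n (fst p) (fst u) + snd u * snd p"

lemma rspace_iff: "x \<in> rspace n \<longleftrightarrow> (\<forall>i\<ge>n. lookup x i = 0)"
  unfolding rspace_def by (auto simp: subset_iff in_keys_iff) (meson not_le)

lemma rspace_subspace: "subspace (rspace n)"
  by (auto simp: subspace_def rspace_iff lookup_add)
lemmas rspace_add = subspace_add[OF rspace_subspace]
lemmas rspace_diff = subspace_diff[OF rspace_subspace]
lemmas rspace_scale = subspace_scale[OF rspace_subspace]
lemmas rspace_0 [simp] = subspace_0[OF rspace_subspace]
lemmas rspace_sum = subspace_sum[OF rspace_subspace]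

lemma rspace_eqI: "x \<in> rspace n \<Longrightarrow> y \<in> rspace n \<Longrightarrow> (\<And>i. i < n \<Longrightarrow> lookup x i = lookup y i) \<Longrightarrow> x = y"
  by (rule poly_mapping_eqI) (metis rspace_iff not_le)

lemma VV_subspace: "subspace (VV n)"
  unfolding VV_def by (rule subspace_Times[OF rspace_subspace subspace_UNIV])
lemmas VV_add = subspace_add[OF VV_subspace]
lemmas VV_diff = subspace_diff[OF VV_subspace]
lemmas VV_scale = subspace_scale[OF VV_subspace]
lemmas VV_sum = subspace_sum[OF VV_subspace]
lemma lattice_iff: "x \<in> lattice n \<longleftrightarrow> x \<in> rspace n \<and> (\<forall>i. lookup x i \<in> \<int>)"
  by (simp add: lattice_def)
lemma lattice_rspace: "x \<in> lattice n \<Longrightarrow> x \<in> rspace n" by (simp add: lattice_def)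
lemma lattice_0 [simp]: "0 \<in> lattice n" by (simp add: lattice_iff)
lemma lattice_add: "x \<in> lattice n \<Longrightarrow> y \<in> lattice n \<Longrightarrow> x + y \<in> lattice n"
  by (simp add: lattice_iff rspace_add lookup_add)
lemma lattice_scale: "x \<in> lattice n \<Longrightarrow> r \<in> \<int> \<Longrightarrow> r *\<^sub>R x \<in> lattice n"
  by (simp add: lattice_iff rspace_scale)
lemma lattice_diff: "x \<in> lattice n \<Longrightarrow> y \<in> lattice n \<Longrightarrow> x - y \<in> lattice n"
  by (simp add: lattice_iff rspace_diff lookup_minus)

lemma Lam_VV: "p \<in> Lam n \<Longrightarrow> p \<in> VV n"
  by (auto simp: Lam_def VV_def lattice_rspace)
lemma Lam_0 [simp]: "0 \<in> Lam n" by (simp add: Lam_def zero_prod_def)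
lemma Lam_add: "x \<in> Lam n \<Longrightarrow> y \<in> Lam n \<Longrightarrow> x + y \<in> Lam n"
  by (auto simp: Lam_def lattice_add)
lemma Lam_diff: "x \<in> Lam n \<Longrightarrow> y \<in> Lam n \<Longrightarrow> x - y \<in> Lam n"
  by (auto simp: Lam_def lattice_diff)
lemma Lam_scale: "x \<in> Lam n \<Longrightarrow> r \<in> \<int> \<Longrightarrow> r *\<^sub>R x \<in> Lam n"
  by (auto simp: Lam_def lattice_scale)
lemma Lam_sum: "(\<And>i. i \<in> A \<Longrightarrow> f i \<in> Lam n) \<Longrightarrow> sum f A \<in> Lam n"
  by (induction A rule: infinite_finite_induct) (auto intro: Lam_add)

lemma pairing_add: "pairing n (x + y) z = pairing n x z + pairing n y z"
  by (simp add: pairing_def lookup_add algebra_simps sum.distrib)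
lemma pairing_commute: "pairing n x y = pairing n y x"
  by (simp add: pairing_def mult.commute)
lemma pairing_add_right: "pairing n z (x + y) = pairing n z x + pairing n z y"
  by (metis pairing_add pairing_commute)
lemma pairing_scale: "pairing n (r *\<^sub>R x) z = r * pairing n x z"
  by (simp add: pairing_def sum_distrib_left algebra_simps)
lemma pairing_scale_right: "pairing n z (r *\<^sub>R x) = r * pairing n z x"
  by (metis pairing_scale pairing_commute)
lemma pairing_diff: "pairing n (x - y) z = pairing n x z - pairing n y z"
  by (simp add: pairing_def lookup_minus algebra_simps sum_subtractf)
lemma pairing_diff_right: "pairing n z (x - y) = pairing n z x - pairing n z y"
  by (metis pairing_diff pairing_commute)
lemma pairing_0 [simp]: "pairing n 0 z = 0" "pairing n z 0 = 0"
  by (simp_all add: pairing_def)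
lemma pairing_self: "pairing n x x \<ge> 0"
  by (simp add: pairing_def sum_nonneg)
lemma pairing_self_eq_0: "x \<in> rspace n \<Longrightarrow> pairing n x x = 0 \<Longrightarrow> x = 0"
  by (rule rspace_eqI) (auto simp: pairing_def sum_nonneg_eq_0_iff)
lemma pairing_Ints: "x \<in> lattice n \<Longrightarrow> y \<in> lattice n \<Longrightarrow> pairing n x y \<in> \<int>"
  by (auto simp: pairing_def lattice_iff intro!: Ints_sum)
lemma linear_pairing: "linear (\<lambda>x. pairing n x z)"
  by (rule linearI) (simp_all add: pairing_add pairing_scale)

lemma ev_add: "ev n u (p + q) = ev n u p + ev n u q"
  by (simp add: ev_def pairing_add algebra_simps)
lemma ev_scale: "ev n u (r *\<^sub>R p) = r * ev n u p"
  by (simp add: ev_def pairing_scale algebra_simps)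
lemma ev_diff: "ev n u (p - q) = ev n u p - ev n u q"
  by (simp add: ev_def pairing_diff algebra_simps)
lemma ev_0 [simp]: "ev n u 0 = 0" by (simp add: ev_def)
lemma ev_sum: "ev n u (sum f A) = (\<Sum>a\<in>A. ev n u (f a))"
  by (induction A rule: infinite_finite_induct) (auto simp: ev_add)
lemma ev_Ints: "u \<in> Lam n \<Longrightarrow> p \<in> Lam n \<Longrightarrow> ev n u p \<in> \<int>"
  by (auto simp: Lam_def ev_def intro!: pairing_Ints)

section \<open>Continuity, separation and hulls of finite sets\<close>

lemma abs_lookup_le_norm: "\<bar>lookup x i\<bar> \<le> norm (x :: vec)"
proof (cases "i \<in> keys x")
  case True
  have "norm x = (\<Sum>n\<in>keys x. \<bar>lookup x n\<bar>)"
    by (simp add: norm_poly_mapping_def dist_poly_mapping_def)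
  then show ?thesis using True member_le_sum[of i "keys x" "\<lambda>n. \<bar>lookup x n\<bar>"] by simp
qed (simp add: in_keys_iff)

lemma continuous_lookup: "continuous_on S (\<lambda>x :: vec. lookup x i)"
proof -
  have "bounded_linear (\<lambda>x :: vec. lookup x i)"
    by (rule bounded_linear_intro[where K = 1]) (auto simp: lookup_add abs_lookup_le_norm)
  then show ?thesis by (rule linear_continuous_on)
qed

lemma continuous_pairing: "continuous_on S f \<Longrightarrow> continuous_on S g \<Longrightarrow> continuous_on S (\<lambda>x. pairing n (f x) (g x))"
  unfolding pairing_def
  by (intro continuous_intros continuous_on_compose2[OF continuous_lookup[of UNIV]]) auto

text \<open>Nearest-point argument: the squared Euclidean distance to \<open>w\<close> attains its
  minimum on the compact hull, and the vector from \<open>w\<close> to the minimiser separates. It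
  is carried out with \<open>pairing\<close> because the norm of \<open>vec\<close> is a sum of
  absolute values.\<close>

lemma separation_finite_hull:
  assumes K: "finite K" "K \<subseteq> rspace n" "w \<in> rspace n" "w \<notin> convex hull K"
  shows "\<exists>y\<in>rspace n. \<exists>c. pairing n y w < c \<and> (\<forall>k\<in>convex hull K. c < pairing n y k)"
proof (cases "K = {}")
  case True then show ?thesis by (auto intro!: bexI[of _ 0] exI[of _ 1])
next
  case False
  let ?f = "\<lambda>k. pairing n (k - w) (k - w)"
  have hr: "convex hull K \<subseteq> rspace n"
    by (rule hull_minimal) (use K in \<open>auto intro: subspace_imp_convex rspace_subspace\<close>)
  have "\<exists>k0\<in>convex hull K. \<forall>k\<in>convex hull K. ?f k0 \<le> ?f k"
    using False K by (intro continuous_attains_inf finite_imp_compact_convex_hull continuous_pairing continuous_intros) auto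
  then obtain k0 where k0: "k0 \<in> convex hull K" "\<And>k. k \<in> convex hull K \<Longrightarrow> ?f k0 \<le> ?f k" by blast
  define y where "y = k0 - w"
  have y: "y \<in> rspace n" using k0 hr K unfolding y_def by (intro rspace_diff) auto
  have yy: "pairing n y y > 0"
    using pairing_self[of n y] pairing_self_eq_0[OF y] k0(1) K(4) by (cases "pairing n y y = 0") (auto simp: y_def)
  have ge: "pairing n y (k - k0) \<ge> 0" if k: "k \<in> convex hull K" for k
  proof (rule ccontr)
    assume "\<not> ?thesis"
    then have neg: "pairing n y (k - k0) < 0" by simp
    define a where "a = - pairing n y (k - k0)"
    define b where "b = pairing n (k - k0) (k - k0)"
    have a: "a > 0" and b: "b \<ge> 0" using neg pairing_self by (auto simp: a_def b_def)
    \<comment> \<open>Moving by \<open>t\<close> towards \<open>k\<close> changes the squared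
      distance by \<open>- 2 * t * a + t * t * b\<close>, and \<open>t * (b + 1) \<le> a\<close>
      makes this negative.\<close>
    define t where "t = min 1 (a / (b + 1))"
    have t: "0 < t" "t \<le> 1" using a b by (auto simp: t_def)
    have "t \<le> a / (b + 1)" by (simp add: t_def)
    then have t3: "t * (b + 1) \<le> a" using b by (simp add: pos_le_divide_eq)
    have "(1 - t) *\<^sub>R k0 + t *\<^sub>R k \<in> convex hull K"
      using t k0 k by (intro convexD_alt[OF convex_convex_hull]) auto
    then have "?f k0 \<le> ?f ((1 - t) *\<^sub>R k0 + t *\<^sub>R k)" by (rule k0)
    also have "(1 - t) *\<^sub>R k0 + t *\<^sub>R k - w = y + t *\<^sub>R (k - k0)" by (simp add: y_def algebra_simps)
    also have "pairing n (y + t *\<^sub>R (k - k0)) (y + t *\<^sub>R (k - k0)) = pairing n y y - 2 * t * a + t * t * b"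
      using pairing_commute[of n "k - k0" y]
      by (simp only: pairing_add pairing_add_right pairing_scale pairing_scale_right a_def b_def) (simp add: algebra_simps)
    finally have "2 * t * a \<le> t * t * b" by (simp add: y_def)
    then have "2 * a \<le> t * b" using t by (simp add: mult.assoc)
    with t t3 a b show False by (simp add: algebra_simps)
  qed
  show ?thesis
  \<comment> \<open>The threshold lies halfway between the values at \<open>w\<close> and at
    \<open>k0\<close>, which differ by \<open>pairing n y y\<close>.\<close>
  proof (intro bexI[of _ y] exI[of _ "pairing n y w + pairing n y y / 2"] conjI ballI)
    fix k assume "k \<in> convex hull K"
    from ge[OF this] have "pairing n y k \<ge> pairing n y k0" by (simp add: pairing_diff_right)
    also have "k0 = w + y" by (simp add: y_def)
    finally show "pairing n y w + pairing n y y / 2 < pairing n y k" using yy by (simp add: pairing_add_right)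
  qed (use yy y in auto)
qed

lemma pairing_hull_ge:
  assumes "\<And>v. v \<in> K \<Longrightarrow> c \<le> pairing n v y" "x \<in> convex hull K"
  shows "c \<le> pairing n x y"
proof -
  have "convex {x. c \<le> pairing n x y}"
    using convex_linear_vimage[OF linear_pairing[of n y] convex_real_interval(1)[of c]] by (simp add: vimage_def)
  then have "convex hull K \<subseteq> {x. c \<le> pairing n x y}" using assms by (intro hull_minimal) auto
  then show ?thesis using assms by auto
qed

lemma lattice_polytope_image_affine:
  assumes "lattice_polytope n P" "linear A" "\<And>x. x \<in> lattice n \<Longrightarrow> A x + b \<in> lattice m"
  shows "lattice_polytope m ((\<lambda>x. A x + b) ` P)"
proof -
  obtain V where V: "finite V" "V \<subseteq> lattice n" "P = convex hull V" using assms by (auto simp: lattice_polytope_def)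
  have "(\<lambda>x. A x + b) ` P = (+) b ` A ` P" by (auto simp: add.commute image_image)
  also have "\<dots> = convex hull ((+) b ` A ` V)"
    by (simp only: V convex_hull_linear_image[OF assms(2)] convex_hull_translation)
  also have "(+) b ` A ` V = (\<lambda>x. A x + b) ` V" by (auto simp: add.commute image_image)
  finally show ?thesis using V assms(3) unfolding lattice_polytope_def by (auto intro!: exI[of _ "(\<lambda>x. A x + b) ` V"])
qed

lemma lattice_polytope_rspace:
  assumes "lattice_polytope n P" shows "P \<subseteq> rspace n"
proof -
  obtain V where V: "V \<subseteq> lattice n" "P = convex hull V" using assms unfolding lattice_polytope_def by blast
  have "V \<subseteq> rspace n" using V(1) lattice_rspace by blast
  moreover have "convex (rspace n)" by (rule subspace_imp_convex[OF rspace_subspace])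
  ultimately show ?thesis unfolding V(2) by (rule hull_minimal)
qed

lemma convex_hull_affine_image:
  assumes "linear A" shows "(\<lambda>x. A x + b) ` (convex hull V) = convex hull ((\<lambda>x. A x + b) ` V)"
proof -
  have *: "(\<lambda>x. A x + b) ` X = (+) b ` A ` X" for X by (auto simp: add.commute image_image)
  show ?thesis by (simp only: * convex_hull_linear_image[OF assms] convex_hull_translation)
qed

section \<open>Gorenstein polytopes described by integral functionals\<close>

lemma hull_pairing_bounded:
  assumes "finite K" shows "\<exists>M. \<forall>x\<in>convex hull K. pairing n x z \<le> M"
proof -
  define M where "M = Max ((\<lambda>x. pairing n x z) ` K)"
  have "- M \<le> pairing n x (- 1 *\<^sub>R z)" if "x \<in> convex hull K" for x
  proof (rule pairing_hull_ge[OF _ that])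
    fix v assume "v \<in> K"
    then have "pairing n v z \<le> M" unfolding M_def using assms by (intro Max_ge) auto
    then show "- M \<le> pairing n v (- 1 *\<^sub>R z)" by (simp only: pairing_scale_right)
  qed
  then show ?thesis unfolding pairing_scale_right by auto
qed

text \<open>Boundedness: pairing with \<open>z\<close> is bounded on the hull but would grow
  linearly along the ray.\<close>

lemma hull_ray_0:
  assumes "finite K" "z \<in> rspace n" "\<And>s. s \<ge> 0 \<Longrightarrow> s *\<^sub>R z \<in> convex hull K"
  shows "z = 0"
proof -
  obtain M where M: "\<And>x. x \<in> convex hull K \<Longrightarrow> pairing n x z \<le> M" using hull_pairing_bounded[OF assms(1)] by blast
  have M0: "M \<ge> 0" using M[OF assms(3)[of 0]] by simp
  have "pairing n z z = 0"
  proof (rule ccontr)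
    assume "pairing n z z \<noteq> 0"
    then have p: "pairing n z z > 0" using pairing_self[of n z] by simp
    have "(M + 1) / pairing n z z * pairing n z z \<le> M"
      using M[OF assms(3)[of "(M + 1) / pairing n z z"]] p M0 by (simp add: pairing_scale)
    then show False using p by simp
  qed
  then show ?thesis using pairing_self_eq_0 assms by blast
qed

text \<open>The facets of the reflexive polytope \<open>D = r P - m\<close> lie at level -1, and a
  facet functional \<open>v\<close> attains its minimum on \<open>P\<close> at a lattice point.
  Taking this minimum as constant term keeps the homogenised functional integral, and at
  \<open>(m, r)\<close> it then has the value 1.\<close>

lemma gorenstein_functionals:
  assumes gor: "gorenstein n P" and n: "n \<ge> 1"
  shows "\<exists>U w. finite U \<and> U \<subseteq> Lam n \<and> w \<in> Lam n \<and> (\<forall>u\<in>U. ev n u w = 1) \<and>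
    cone_over P = {p \<in> VV n. \<forall>u\<in>U. 0 \<le> ev n u p}"
proof -
  obtain r m where r: "r \<ge> 1" and full: "full_lattice_polytope n P" and refl: "reflexive_wrt n (dilate r P) m"
    using gor by (auto simp: gorenstein_def gorenstein_of_index_def)
  obtain W where W: "finite W" "W \<subseteq> lattice n" "P = convex hull W"
    using full by (auto simp: full_lattice_polytope_def lattice_polytope_def)
  define D where "D = (\<lambda>x. x - m) ` dilate r P"
  have D_eq: "D = (\<lambda>x. real r *\<^sub>R x - m) ` P" by (auto simp: D_def dilate_def image_image)
  have mlat: "m \<in> lattice n" and rD: "reflexive n D" using refl by (auto simp: reflexive_wrt_def D_def)
  obtain V where V: "finite V" "V \<subseteq> lattice n" "dual_polytope n D = convex hull V"
    using rD by (auto simp: reflexive_def lattice_polytope_def)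
  define W' where "W' = (\<lambda>x. real r *\<^sub>R x - m) ` W"
  have W': "finite W'" "W' \<subseteq> rspace n" "D = convex hull W'"
  proof -
    show "finite W'" by (simp add: W'_def W)
    show "W' \<subseteq> rspace n" using W mlat unfolding W'_def by (auto intro!: rspace_diff rspace_scale dest: lattice_rspace)
    have "linear (\<lambda>x :: vec. real r *\<^sub>R x)" by (rule linear_scaleR)
    from convex_hull_affine_image[OF this, of "- m" W] show "D = convex hull W'" by (simp add: D_eq W W'_def)
  qed
  have D0: "0 \<in> D" using rD interior_of_subset[of "top_of_set (rspace n)" D] by (auto simp: reflexive_def interior_in_def)
  have Dr: "D \<subseteq> rspace n" unfolding W'(3) using W'(2) by (intro hull_minimal subspace_imp_convex rspace_subspace)
  \<comment> \<open>Bipolar argument: a point outside \<open>D\<close> is separated from it, and as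
    0 lies in \<open>D\<close> the separating functional can be scaled into the dual
    polytope.\<close>
  have D1: "y \<in> D" if y: "y \<in> rspace n" "\<And>v. v \<in> V \<Longrightarrow> -1 \<le> pairing n y v" for y
  proof (rule ccontr)
    assume "y \<notin> D"
    then obtain z c where z: "z \<in> rspace n" "pairing n z y < c" "\<And>k. k \<in> D \<Longrightarrow> c < pairing n z k"
      using separation_finite_hull[of W' n y] W' y(1) by metis
    have c: "c < 0" using z(3)[OF D0] by simp
    have "(1 / - c) *\<^sub>R z \<in> dual_polytope n D"
      unfolding dual_polytope_def
    proof (intro CollectI conjI ballI)
      show "-1 \<le> pairing n x ((1 / - c) *\<^sub>R z)" if "x \<in> D" for x
        using z(3)[OF that] c unfolding pairing_scale_right pairing_commute[of n x z] by (simp add: field_simps)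
    qed (intro rspace_scale z)
    then have "-1 \<le> pairing n ((1 / - c) *\<^sub>R z) y" unfolding V(3)
      by (rule pairing_hull_ge[rotated]) (use y(2) in \<open>auto simp: pairing_commute\<close>)
    then show False using z(2) c unfolding pairing_scale by (simp add: field_simps)
  qed
  have DV: "-1 \<le> pairing n y v" if "y \<in> D" "v \<in> V" for y v
  proof -
    have "v \<in> dual_polytope n D" using that V hull_inc by metis
    then show ?thesis using that by (auto simp: dual_polytope_def)
  qed
  \<comment> \<open>The finite set \<open>V\<close> may contain points that are nowhere tight on
    \<open>D\<close>. Those could give a fractional constant term, so only the tight ones are
    kept.\<close>
  define T where "T = {v \<in> V. \<exists>x\<in>W. real r * pairing n x v - pairing n m v = -1}"
  have D2: "y \<in> D" if y: "y \<in> rspace n" "\<And>v. v \<in> T \<Longrightarrow> -1 \<le> pairing n y v" for y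
  proof (rule ccontr)
    assume yD: "y \<notin> D"
    then obtain v0 where v0: "v0 \<in> V" "pairing n y v0 < -1" using D1[OF y(1)] by fastforce
    obtain v where v: "v \<in> V" "\<And>v'. v' \<in> V \<Longrightarrow> pairing n y v \<le> pairing n y v'"
      using ex_is_arg_min_if_finite[OF V(1), of "\<lambda>v. pairing n y v"] v0 by (auto simp: is_arg_min_linorder)
    have neg: "pairing n y v < -1" using v(2)[OF v0(1)] v0 by linarith
    \<comment> \<open>Shrinking \<open>y\<close> until its worst inequality becomes an equality
      lands in \<open>D\<close>, and a functional that reaches -1 on \<open>D\<close> does so at a
      point of \<open>W'\<close>.\<close>
    define th where "th = -1 / pairing n y v"
    have th: "th > 0" "th < 1" "th * pairing n y v = -1" using neg by (auto simp: th_def field_simps)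
    have "th *\<^sub>R y \<in> D"
    proof (rule D1)
      fix v' assume "v' \<in> V"
      have "th * pairing n y v \<le> th * pairing n y v'" using v(2)[OF \<open>v' \<in> V\<close>] th(1) by (intro mult_left_mono) auto
      then show "-1 \<le> pairing n (th *\<^sub>R y) v'" using th by (simp add: pairing_scale)
    qed (use y in \<open>auto intro: rspace_scale\<close>)
    have "\<exists>w\<in>W'. pairing n w v \<le> -1"
    proof (rule ccontr)
      assume none: "\<not> ?thesis"
      have ne: "W' \<noteq> {}" using D0 W' by auto
      define c where "c = Min ((\<lambda>w. pairing n w v) ` W')"
      have "c \<in> (\<lambda>w. pairing n w v) ` W'" unfolding c_def using ne W' by (intro Min_in) auto
      then have "c > -1" using none by auto
      moreover have "c \<le> pairing n (th *\<^sub>R y) v"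
      proof (rule pairing_hull_ge[of W'])
        show "c \<le> pairing n v' v" if "v' \<in> W'" for v' unfolding c_def using that W' by (intro Min_le) auto
      qed (use \<open>th *\<^sub>R y \<in> D\<close> W' in simp)
      ultimately show False using th by (simp add: pairing_scale)
    qed
    then obtain w where w: "w \<in> W'" "pairing n w v \<le> -1" by blast
    then have "pairing n w v = -1" using DV[of w v] W' v hull_inc[of w W'] by fastforce
    then have "v \<in> T" using w v by (auto simp: T_def W'_def pairing_diff pairing_scale)
    then show False using y(2) neg by force
  qed
  have DT: "D = {y \<in> rspace n. \<forall>v\<in>T. -1 \<le> pairing n y v}"
    using D2 DV Dr by (auto simp: T_def)
  have "\<exists>f. \<forall>v\<in>T. f v \<in> W \<and> real r * pairing n (f v) v - pairing n m v = -1"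
    by (rule bchoice) (auto simp: T_def)
  then obtain f where f: "\<And>v. v \<in> T \<Longrightarrow> f v \<in> W" "\<And>v. v \<in> T \<Longrightarrow> real r * pairing n (f v) v - pairing n m v = -1"
    by blast
  \<comment> \<open>Division of \<open>r <x, v> - <m, v> \<ge> -1\<close> by \<open>r\<close> leaves
    \<open><x, v> \<ge> <f v, v>\<close>, an inequality with integral coefficients.\<close>
  define U where "U = (\<lambda>v. (v, - pairing n (f v) v)) ` T"
  define w where "w = (m, real r)"
  have evw: "ev n u w = 1" if "u \<in> U" for u
  proof -
    obtain v where v: "v \<in> T" "u = (v, - pairing n (f v) v)" using \<open>u \<in> U\<close> unfolding U_def by blast
    show ?thesis using f(2)[OF v(1)] by (simp add: v(2) w_def ev_def algebra_simps)
  qed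
  \<comment> \<open>Positive dimension enters here: without inequalities \<open>D\<close> would be
    the whole space, which is unbounded for \<open>n \<ge> 1\<close>.\<close>
  have Tne: "T \<noteq> {}"
  proof
    assume "T = {}"
    then have Dn: "D = rspace n" using DT by simp
    have e: "single 0 (1::real) \<in> rspace n" using n by (auto simp: rspace_iff lookup_one when_def)
    have "s *\<^sub>R single 0 (1::real) \<in> convex hull W'" for s
      using rspace_scale[OF e, of s] Dn W'(3) by metis
    from hull_ray_0[OF W'(1) e this] show False by simp
  qed
  have "cone_over P = {p \<in> VV n. \<forall>u\<in>U. 0 \<le> ev n u p}"
  proof (intro equalityI subsetI)
    fix p assume "p \<in> cone_over P"
    then obtain x t where x: "p = (t *\<^sub>R x, t)" "t \<ge> 0" "x \<in> P" by (auto simp: cone_over_def)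
    have xr: "x \<in> rspace n" using x full lattice_polytope_rspace by (auto simp: full_lattice_polytope_def)
    have "0 \<le> ev n u p" if "u \<in> U" for u
    proof -
      obtain v where v: "v \<in> T" "u = (v, - pairing n (f v) v)" using \<open>u \<in> U\<close> by (auto simp: U_def)
      have "real r *\<^sub>R x - m \<in> D" using x by (auto simp: D_eq)
      then have "-1 \<le> pairing n (real r *\<^sub>R x - m) v" using v DT by auto
      then have "real r * pairing n (f v) v \<le> real r * pairing n x v"
        using f(2)[OF v(1)] by (simp add: pairing_diff pairing_scale)
      then have "pairing n (f v) v \<le> pairing n x v" using r by simp
      then have "0 \<le> t * (pairing n x v - pairing n (f v) v)" using x by simp
      then show ?thesis by (simp add: v ev_def x pairing_scale algebra_simps)
    qed
    then show "p \<in> {p \<in> VV n. \<forall>u\<in>U. 0 \<le> ev n u p}" using x xr by (auto simp: VV_def rspace_scale)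
  next
    fix p assume p: "p \<in> {p \<in> VV n. \<forall>u\<in>U. 0 \<le> ev n u p}"
    obtain z t where zt: "p = (z, t)" by fastforce
    have z: "z \<in> rspace n" using p zt by (auto simp: VV_def)
    have evp: "pairing n z v \<ge> t * pairing n (f v) v" if "v \<in> T" for v
      using p zt that by (force simp: U_def ev_def algebra_simps)
    show "p \<in> cone_over P"
    proof (cases "t > 0")
      case True
      have "(real r / t) *\<^sub>R z - m \<in> D"
        unfolding DT
      proof (intro CollectI conjI ballI)
        show "(real r / t) *\<^sub>R z - m \<in> rspace n" using z lattice_rspace[OF mlat] by (intro rspace_diff rspace_scale)
        fix v assume v: "v \<in> T"
        have "real r / t * pairing n z v \<ge> real r / t * (t * pairing n (f v) v)"
          using evp[OF v] True by (intro mult_left_mono) auto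
        then show "-1 \<le> pairing n ((real r / t) *\<^sub>R z - m) v"
          using f(2)[OF v] True by (simp add: pairing_diff pairing_scale)
      qed
      then obtain x where x: "x \<in> P" "(real r / t) *\<^sub>R z - m = real r *\<^sub>R x - m" by (auto simp: D_eq)
      then have "(t / real r) *\<^sub>R ((real r / t) *\<^sub>R z) = (t / real r) *\<^sub>R (real r *\<^sub>R x)" by simp
      then have "z = t *\<^sub>R x" using True r by simp
      then show ?thesis using x True zt by (auto simp: cone_over_def)
    next
      case False
      \<comment> \<open>Adding \<open>th\<close> times \<open>(m, r)\<close> brings \<open>p\<close>
        to degree 0, at \<open>z'\<close>. A point of degree 0 satisfying all inequalities spans a
        ray inside the bounded set \<open>D\<close>, so \<open>z' = 0\<close>; then
        \<open>th = 0\<close>, because every functional is at least \<open>th\<close> there.\<close>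
      define th where "th = - t / real r"
      have th: "th \<ge> 0" using False r by (auto simp: th_def divide_le_0_iff)
      define z' where "z' = z + th *\<^sub>R m"
      have ge: "pairing n z' v \<ge> th" if v: "v \<in> T" for v
      proof -
        have "t * pairing n (f v) v = - th * (real r * pairing n (f v) v)" using r by (simp add: th_def)
        also have "real r * pairing n (f v) v = pairing n m v - 1" using f(2)[OF v] by linarith
        finally show ?thesis using evp[OF v] by (simp add: z'_def pairing_add pairing_scale algebra_simps)
      qed
      have z'r: "z' \<in> rspace n" unfolding z'_def using z lattice_rspace[OF mlat] by (intro rspace_add rspace_scale)
      have "s *\<^sub>R z' \<in> D" if "s \<ge> 0" for s
        unfolding DT
      proof (intro CollectI conjI ballI)
        fix v assume "v \<in> T"
        then have "0 \<le> s * pairing n z' v" using ge[of v] th that by (intro mult_nonneg_nonneg) auto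
        then show "-1 \<le> pairing n (s *\<^sub>R z') v" by (simp add: pairing_scale)
      qed (intro rspace_scale z'r)
      then have z'0: "z' = 0" using hull_ray_0[OF W'(1) z'r] W' by simp
      obtain v where "v \<in> T" using Tne by blast
      from ge[OF this] z'0 th have "th = 0" by simp
      then have "t = 0" "z = 0" using r z'0 by (auto simp: th_def z'_def)
      moreover have "P \<noteq> {}" using D0 D_eq by auto
      ultimately show ?thesis using zt by (auto simp: cone_over_def)
    qed
  qed
  moreover have "finite U" using V by (auto simp: U_def T_def)
  moreover have "U \<subseteq> Lam n"
  proof
    fix u assume "u \<in> U"
    then obtain v where v: "v \<in> T" "u = (v, - pairing n (f v) v)" by (auto simp: U_def)
    have "v \<in> lattice n" "f v \<in> lattice n" using v f(1)[OF v(1)] V(2) W(2) by (auto simp: T_def)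
    then show "u \<in> Lam n" using v by (auto simp: Lam_def intro!: pairing_Ints)
  qed
  moreover have "w \<in> Lam n" using mlat by (simp add: w_def Lam_def)
  ultimately show ?thesis using evw by (intro exI[of _ U] exI[of _ w] conjI ballI)
qed

lemma affine_hull_affine_image_rspace:
  assumes "affine hull P = rspace n" "r \<noteq> 0" "m \<in> rspace n"
  shows "affine hull ((\<lambda>x. r *\<^sub>R x + m) ` P) = rspace n"
proof -
  have *: "(\<lambda>x. r *\<^sub>R x + m) ` X = (+) m ` (\<lambda>x. r *\<^sub>R x) ` X" for X by (auto simp: add.commute image_image)
  have "affine hull ((*\<^sub>R) r ` P) = (*\<^sub>R) r ` rspace n"
    using affine_hull_linear_image[OF bounded_linear_scaleR_right, of r P] assms(1) by simp
  then have "affine hull ((\<lambda>x. r *\<^sub>R x + m) ` P) = (\<lambda>x. r *\<^sub>R x + m) ` rspace n"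
    by (simp only: * affine_hull_translation)
  also have "\<dots> = rspace n"
  proof (intro equalityI subsetI)
    fix x assume "x \<in> rspace n"
    then have "(1/r) *\<^sub>R (x - m) \<in> rspace n" using assms by (intro rspace_scale rspace_diff)
    then show "x \<in> (\<lambda>x. r *\<^sub>R x + m) ` rspace n" using assms(2) by (intro image_eqI[of _ _ "(1/r) *\<^sub>R (x - m)"]) auto
  qed (use assms in \<open>auto intro: rspace_add rspace_scale\<close>)
  finally show ?thesis .
qed

lemma open_pairing_halfspace: "open {y. pairing n (y - a) v > c}"
proof -
  have "continuous_on UNIV (\<lambda>y. pairing n (y - a) v)" by (intro continuous_pairing continuous_intros)
  from open_Collect_less[OF continuous_on_const this] show ?thesis by auto
qed

text \<open>The point \<open>w = (m, r)\<close> provides the index and the interior point. Since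
  every functional is 1 at \<open>w\<close>, the inequalities of \<open>r P - m\<close> all have the
  right-hand side -1, and the dual polytope is the hull of the integral linear parts of
  \<open>U\<close>.\<close>

lemma gorenstein_if_functionals:
  assumes lp: "lattice_polytope n P" and aff: "affine hull P = rspace n"
    and U: "finite U" "U \<subseteq> Lam n" and w: "w \<in> Lam n" "\<And>u. u \<in> U \<Longrightarrow> ev n u w = 1" "snd w \<ge> 1"
    and cone: "cone_over P = {p \<in> VV n. \<forall>u\<in>U. 0 \<le> ev n u p}"
  shows "gorenstein n P"
proof -
  define m where "m = fst w"
  have m: "m \<in> lattice n" using w by (auto simp: m_def Lam_def)
  obtain r :: nat where r: "real r = snd w"
  proof -
    from w have "snd w \<in> \<int>" by (auto simp: Lam_def)
    then obtain k :: int where "snd w = of_int k" by (auto elim: Ints_cases)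
    then show ?thesis using w(3) by (intro that[of "nat k"]) auto
  qed
  have r1: "r \<ge> 1" using w(3) r by linarith
  have evw: "pairing n m (fst u) + snd u * real r = 1" if "u \<in> U" for u
    using w(2)[OF that] by (simp add: ev_def m_def r)
  obtain W where W: "finite W" "W \<subseteq> lattice n" "P = convex hull W" using lp by (auto simp: lattice_polytope_def)
  have Pr: "P \<subseteq> rspace n" using lp by (rule lattice_polytope_rspace)
  have rP: "dilate r P = {x \<in> rspace n. \<forall>u\<in>U. -1 \<le> pairing n (x - m) (fst u)}"
  proof (intro equalityI subsetI)
    fix y assume "y \<in> dilate r P"
    then obtain x where x: "x \<in> P" "y = real r *\<^sub>R x" by (auto simp: dilate_def)
    then have "(real r *\<^sub>R x, real r) \<in> cone_over P" by (auto simp: cone_over_def)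
    then have "0 \<le> ev n u (y, real r)" if "u \<in> U" for u using cone x that by auto
    then have "-1 \<le> pairing n (y - m) (fst u)" if "u \<in> U" for u
      using evw[OF that] that by (fastforce simp: ev_def pairing_diff)
    then show "y \<in> {x \<in> rspace n. \<forall>u\<in>U. -1 \<le> pairing n (x - m) (fst u)}" using x Pr by (auto intro: rspace_scale)
  next
    fix y assume y: "y \<in> {x \<in> rspace n. \<forall>u\<in>U. -1 \<le> pairing n (x - m) (fst u)}"
    then have "0 \<le> ev n u (y, real r)" if "u \<in> U" for u
      using evw[OF that] that by (fastforce simp: ev_def pairing_diff)
    then have "(y, real r) \<in> cone_over P" using cone y by (auto simp: VV_def)
    then show "y \<in> dilate r P" by (auto simp: cone_over_def dilate_def)
  qed
  define D where "D = (\<lambda>x. x - m) ` dilate r P"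
  have D: "D = {y \<in> rspace n. \<forall>u\<in>U. -1 \<le> pairing n y (fst u)}"
  proof (intro equalityI subsetI)
    fix y assume y: "y \<in> {y \<in> rspace n. \<forall>u\<in>U. -1 \<le> pairing n y (fst u)}"
    then have "y + m \<in> dilate r P" using m unfolding rP by (auto intro: rspace_add lattice_rspace)
    then show "y \<in> D" unfolding D_def by (intro image_eqI[of _ _ "y + m"]) auto
  qed (use m in \<open>auto simp: D_def rP intro: rspace_diff lattice_rspace\<close>)
  have D_eq: "D = (\<lambda>x. real r *\<^sub>R x + (- m)) ` P" by (auto simp: D_def dilate_def image_image)
  have mneg: "- m \<in> lattice n" using lattice_diff[OF lattice_0 m] by simp
  have fullD: "full_lattice_polytope n D"
    unfolding full_lattice_polytope_def D_eq
  proof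
    show "lattice_polytope n ((\<lambda>x. real r *\<^sub>R x + - m) ` P)"
      using mneg by (intro lattice_polytope_image_affine[OF lp] linear_scaleR lattice_add lattice_scale) auto
    show "affine hull ((\<lambda>x. real r *\<^sub>R x + - m) ` P) = rspace n"
      using r1 mneg by (intro affine_hull_affine_image_rspace[OF aff] lattice_rspace) auto
  qed
  have int: "a \<in> interior_in n {x \<in> rspace n. \<forall>u\<in>U. -1 \<le> pairing n (x - a) (fst u)}" if "a \<in> rspace n" for a
  proof -
    let ?T = "rspace n \<inter> (\<Inter>u\<in>U. {y. pairing n (y - a) (fst u) > -1})"
    have "openin (top_of_set (rspace n)) ?T"
      by (intro openin_open_Int open_INT U ballI open_pairing_halfspace)
    moreover have "a \<in> ?T" using that by simp
    moreover have "?T \<subseteq> {x \<in> rspace n. \<forall>u\<in>U. -1 \<le> pairing n (x - a) (fst u)}" by (auto intro: less_imp_le)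
    ultimately show ?thesis unfolding interior_in_def interior_of_def by blast
  qed
  obtain K where K: "finite K" "D = convex hull K"
    using fullD by (auto simp: full_lattice_polytope_def lattice_polytope_def)
  have fU: "fst ` U \<subseteq> rspace n" using U by (auto simp: Lam_def lattice_rspace)
  \<comment> \<open>A direction on which all linear parts are positive would generate a ray in the
    bounded set \<open>D\<close>. Hence 0 lies in their hull, which later makes the separation
    constant negative.\<close>
  have z0: "0 \<in> convex hull (fst ` U)"
  proof (rule ccontr)
    assume "\<not> ?thesis"
    from separation_finite_hull[OF finite_imageI[OF U(1)] fU rspace_0 this]
    obtain y c where y: "y \<in> rspace n" "pairing n y 0 < c" "\<And>k. k \<in> convex hull (fst ` U) \<Longrightarrow> c < pairing n y k"
      by blast
    have "s *\<^sub>R y \<in> D" if "s \<ge> 0" for s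
      unfolding D
    proof (intro CollectI conjI ballI)
      fix u assume "u \<in> U"
      then have "c < pairing n y (fst u)" by (intro y(3) hull_inc) auto
      then have "0 \<le> s * pairing n y (fst u)" using that y(2) by simp
      then show "-1 \<le> pairing n (s *\<^sub>R y) (fst u)" by (simp add: pairing_scale)
    qed (intro rspace_scale y)
    then have "y = 0" using hull_ray_0[OF K(1) y(1)] K(2) by simp
    moreover obtain k where "k \<in> U" using r1 w U y
    proof -
      show ?thesis
      proof (cases "U = {}")
        case True
        have "(0, -1) \<in> cone_over P" using True cone by (simp add: VV_def)
        then show ?thesis by (auto simp: cone_over_def)
      qed (use that in blast)
    qed
    ultimately show False using y(2) y(3)[OF hull_inc, of "fst k"] by auto
  qed
  have dual: "dual_polytope n D = convex hull (fst ` U)"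
  proof (intro equalityI subsetI)
    fix y assume y: "y \<in> dual_polytope n D"
    show "y \<in> convex hull (fst ` U)"
    proof (rule ccontr)
      assume "\<not> ?thesis"
      have "y \<in> rspace n" using y by (simp add: dual_polytope_def)
      from separation_finite_hull[OF finite_imageI[OF U(1)] fU this \<open>\<not> ?thesis\<close>]
      obtain z c where z: "z \<in> rspace n" "pairing n z y < c" "\<And>k. k \<in> convex hull (fst ` U) \<Longrightarrow> c < pairing n z k"
        by blast
      have c: "c < 0" using z(3)[OF z0] by simp
      have "(1 / - c) *\<^sub>R z \<in> D"
        unfolding D
      proof (intro CollectI conjI ballI)
        show "-1 \<le> pairing n ((1 / - c) *\<^sub>R z) (fst u)" if "u \<in> U" for u
          using z(3)[OF hull_inc, of "fst u"] that c unfolding pairing_scale by (simp add: field_simps)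
      qed (intro rspace_scale z)
      then have "-1 \<le> pairing n ((1 / - c) *\<^sub>R z) y" using y by (auto simp: dual_polytope_def)
      then show False using z(2) c unfolding pairing_scale by (simp add: field_simps)
    qed
  next
    fix y assume y: "y \<in> convex hull (fst ` U)"
    have "fst ` U \<subseteq> rspace n" using U by (auto simp: Lam_def lattice_rspace)
    then have "convex hull (fst ` U) \<subseteq> rspace n" by (intro hull_minimal subspace_imp_convex rspace_subspace)
    moreover have "-1 \<le> pairing n x y" if "x \<in> D" for x
      using pairing_hull_ge[of "fst ` U" "-1" n x y] y that D by (auto simp: pairing_commute[of n x])
    ultimately show "y \<in> dual_polytope n D" using y by (auto simp: dual_polytope_def)
  qed
  have "reflexive_wrt n (dilate r P) m"
    unfolding reflexive_wrt_def reflexive_def D_def[symmetric]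
  proof (intro conjI fullD m)
    show "m \<in> interior_in n (dilate r P)" unfolding rP by (intro int lattice_rspace m)
    show "0 \<in> interior_in n D" using int[of 0] by (simp add: D)
    show "lattice_polytope n (dual_polytope n D)"
      unfolding dual lattice_polytope_def using U by (intro exI[of _ "fst ` U"]) (auto simp: Lam_def)
  qed
  then show ?thesis using r1 lp aff
    by (auto simp: gorenstein_def gorenstein_of_index_def full_lattice_polytope_def)
qed

section \<open>Triangular systems of binomial relations\<close>

text \<open>A pair \<open>(L, e)\<close> encodes the relation equating the squarefree product of the
  variables in \<open>L\<close> with the monomial of exponent vector \<open>e\<close>.\<close>

type_synonym rel = "nat set \<times> (nat \<Rightarrow> nat)"

definition rvec :: "rel \<Rightarrow> nat \<Rightarrow> real" where
  "rvec r j = (if j \<in> fst r then 1 else 0) - real (snd r j)"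

text \<open>Later relations do not involve the leading variables of earlier ones, whereas the tail
  of an earlier relation may involve later leading variables. Therefore reduction in list order
  never disturbs a lead already treated.\<close>

fun triangular :: "nat set \<Rightarrow> rel list \<Rightarrow> bool" where
  "triangular J [] = True"
| "triangular J (r # rs) \<longleftrightarrow> fst r \<noteq> {} \<and> fst r \<subseteq> J \<and> (\<forall>j. snd r j \<noteq> 0 \<longrightarrow> j \<in> J - fst r) \<and>
     (\<forall>s\<in>set rs. fst s \<inter> fst r = {} \<and> (\<forall>j\<in>fst r. snd s j = 0)) \<and> triangular J rs"

fun in_span :: "rel list \<Rightarrow> (nat \<Rightarrow> real) \<Rightarrow> bool" where
  "in_span [] f \<longleftrightarrow> (\<forall>j. f j = 0)"
| "in_span (r # rs) f \<longleftrightarrow> (\<exists>a. in_span rs (\<lambda>j. f j - a * rvec r j))"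

text \<open>No leading monomial divides such an exponent vector. Real entries are allowed, since the
  same normal forms are used for points of the real cone.\<close>

definition normal :: "rel list \<Rightarrow> (nat \<Rightarrow> real) \<Rightarrow> bool" where
  "normal rs u \<longleftrightarrow> (\<forall>r\<in>set rs. \<exists>j\<in>fst r. u j = 0)"

lemma in_span_0: "(\<And>j. f j = 0) \<Longrightarrow> in_span rs f"
  by (induction rs arbitrary: f) (auto intro: exI[of _ 0])

lemma in_span_add: "in_span rs f \<Longrightarrow> in_span rs g \<Longrightarrow> in_span rs (\<lambda>j. f j + g j)"
proof (induction rs arbitrary: f g)
  case (Cons r rs)
  then obtain a b where "in_span rs (\<lambda>j. f j - a * rvec r j)" "in_span rs (\<lambda>j. g j - b * rvec r j)" by auto
  from Cons.IH[OF this] show ?case by (auto simp: algebra_simps intro!: exI[of _ "a + b"])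
qed auto

lemma in_span_scale: "in_span rs f \<Longrightarrow> in_span rs (\<lambda>j. c * f j)"
proof (induction rs arbitrary: f)
  case (Cons r rs)
  then obtain a where "in_span rs (\<lambda>j. f j - a * rvec r j)" by auto
  from Cons.IH[OF this] show ?case by (auto simp: algebra_simps intro!: exI[of _ "c * a"])
qed auto

lemma in_span_diff: "in_span rs f \<Longrightarrow> in_span rs g \<Longrightarrow> in_span rs (\<lambda>j. f j - g j)"
  using in_span_add[of rs f "\<lambda>j. (-1) * g j"] in_span_scale[of rs g "-1"] by simp

lemma in_span_rvec: "r \<in> set rs \<Longrightarrow> in_span rs (rvec r)"
proof (induction rs)
  case (Cons s rs)
  show ?case
  proof (cases "r = s")
    case True then show ?thesis by (auto intro!: exI[of _ 1] in_span_0)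
  next
    case False then show ?thesis using Cons by (auto intro!: exI[of _ 0])
  qed
qed simp

lemma in_span_vanish:
  "in_span rs f \<Longrightarrow> (\<And>s. s \<in> set rs \<Longrightarrow> rvec s j = 0) \<Longrightarrow> f j = 0"
proof (induction rs arbitrary: f)
  case (Cons r rs)
  then obtain a where "in_span rs (\<lambda>j. f j - a * rvec r j)" by auto
  from Cons.IH[OF this] Cons.prems(2) show ?case by simp
qed auto

lemma triangular_mem: "triangular J rs \<Longrightarrow> s \<in> set rs \<Longrightarrow> fst s \<subseteq> J \<and> fst s \<noteq> {} \<and> (\<forall>j. snd s j \<noteq> 0 \<longrightarrow> j \<in> J - fst s)"
  by (induction rs) auto

lemma rvec_outside: "triangular J rs \<Longrightarrow> s \<in> set rs \<Longrightarrow> j \<notin> J \<Longrightarrow> rvec s j = 0"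
  using triangular_mem[of J rs s] by (auto simp: rvec_def)

lemma rvec_lead: "triangular J (r # rs) \<Longrightarrow> j \<in> fst r \<Longrightarrow> rvec r j = 1"
  by (auto simp: rvec_def)

lemma rvec_tail: "triangular J (r # rs) \<Longrightarrow> j \<in> fst r \<Longrightarrow> s \<in> set rs \<Longrightarrow> rvec s j = 0"
  by (auto simp: rvec_def)

lemma in_span_outside: "triangular J rs \<Longrightarrow> in_span rs f \<Longrightarrow> j \<notin> J \<Longrightarrow> f j = 0"
  using in_span_vanish rvec_outside by metis

lemma in_span_lead: "triangular J (r # rs) \<Longrightarrow> in_span rs f \<Longrightarrow> j \<in> fst r \<Longrightarrow> f j = 0"
  using in_span_vanish rvec_tail by metis

text \<open>Subtracting the first relation, multiplied by the minimum of \<open>u\<close> over its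
  lead, creates a zero there, and triangularity preserves it. The closure conditions on
  \<open>D\<close> cover nonnegative reals, natural numbers and all reals.\<close>

lemma normal_form_exists:
  assumes D: "\<And>a b. a \<in> D \<Longrightarrow> b \<in> D \<Longrightarrow> b \<le> a \<Longrightarrow> a - b \<in> D" "\<And>a b m. a \<in> D \<Longrightarrow> b \<in> D \<Longrightarrow> a + b * real m \<in> D"
    and J: "finite J" and t: "triangular J rs" and u: "\<And>j. u j \<in> (D :: real set)"
  shows "\<exists>v. in_span rs (\<lambda>j. u j - v j) \<and> (\<forall>j. v j \<in> D) \<and> normal rs v \<and>
    (\<forall>r\<in>set rs. \<forall>j\<in>fst r. 0 \<le> v j)"
  using t u
proof (induction rs arbitrary: u)
  case Nil
  then show ?case by (intro exI[of _ u]) (auto simp: normal_def)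
next
  case (Cons r rs)
  have fin: "finite (fst r)" "fst r \<noteq> {}" using Cons.prems(1) J finite_subset by auto
  define k where "k = Min (u ` fst r)"
  have "k \<in> u ` fst r" unfolding k_def using fin by (intro Min_in) auto
  then obtain j0 where j0: "j0 \<in> fst r" "u j0 = k" by auto
  have kle: "k \<le> u j" if "j \<in> fst r" for j unfolding k_def using fin that by (intro Min_le) auto
  have kD: "k \<in> D" using Cons.prems(2)[of j0] j0 by simp
  define w where "w = (\<lambda>j. u j - k * rvec r j)"
  have wD: "w j \<in> D" for j
  proof (cases "j \<in> fst r")
    case True
    then show ?thesis using D(1)[OF Cons.prems(2) kD kle] rvec_lead[OF Cons.prems(1) True] by (simp add: w_def)
  next
    case False
    then show ?thesis using D(2)[OF Cons.prems(2) kD, of j "snd r j"] by (simp add: w_def rvec_def)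
  qed
  have "triangular J rs" using Cons.prems by simp
  from Cons.IH[OF this wD] obtain v where IH: "in_span rs (\<lambda>j. w j - v j) \<and> (\<forall>j. v j \<in> D) \<and> normal rs v \<and>
    (\<forall>r\<in>set rs. \<forall>j\<in>fst r. 0 \<le> v j)" by (rule exE)
  then have v: "in_span rs (\<lambda>j. w j - v j)" "\<forall>j. v j \<in> D" "normal rs v"
    "\<forall>r\<in>set rs. \<forall>j\<in>fst r. 0 \<le> v j" by simp_all
  have vw: "v j = w j" if "j \<in> fst r" for j
    using in_span_lead[OF Cons.prems(1) v(1) that] by simp
  have w0: "w j0 = 0" using j0 rvec_lead[OF Cons.prems(1) j0(1)] by (simp add: w_def)
  have wge: "w j \<ge> 0" if "j \<in> fst r" for j using kle[OF that] rvec_lead[OF Cons.prems(1) that] by (simp add: w_def)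
  show ?case
  proof (intro exI[of _ v] conjI)
    show "in_span (r # rs) (\<lambda>j. u j - v j)"
      using v(1) by (auto simp: w_def algebra_simps intro!: exI[of _ k])
    show "normal (r # rs) v" using v(3) j0 w0 vw[OF j0(1)] by (auto simp: normal_def)
    show "\<forall>r\<in>set (r # rs). \<forall>j\<in>fst r. 0 \<le> v j" using v(4) vw wge by auto
  qed (use v in auto)
qed

text \<open>On the lead of the first relation \<open>u - v\<close> equals its coefficient
  \<open>a\<close>. A zero of \<open>u\<close> there gives \<open>a \<le> 0\<close> and a zero of
  \<open>v\<close> gives \<open>a \<ge> 0\<close>.\<close>

lemma normal_form_unique:
  assumes "triangular J rs" "normal rs u" "normal rs v" "in_span rs (\<lambda>j. u j - v j)"
    "\<And>r j. r \<in> set rs \<Longrightarrow> j \<in> fst r \<Longrightarrow> 0 \<le> u j \<and> 0 \<le> v j"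
  shows "u = v"
  using assms
proof (induction rs)
  case Nil then show ?case by auto
next
  case (Cons r rs)
  then obtain a where a: "in_span rs (\<lambda>j. u j - v j - a * rvec r j)" by auto
  have diff: "u j - v j = a" if "j \<in> fst r" for j
    using in_span_lead[OF Cons.prems(1) a that] rvec_lead[OF Cons.prems(1) that] by simp
  obtain i k where "i \<in> fst r" "u i = 0" "k \<in> fst r" "v k = 0" using Cons.prems(2,3) by (auto simp: normal_def)
  then have "a = 0" using diff[of i] diff[of k] Cons.prems(5)[of r i] Cons.prems(5)[of r k] by force
  then have "in_span rs (\<lambda>j. u j - v j)" using a by simp
  moreover have "triangular J rs" "normal rs u" "normal rs v" using Cons.prems by (simp_all add: normal_def)
  moreover have "0 \<le> u j \<and> 0 \<le> v j" if "s \<in> set rs" "j \<in> fst s" for s j using Cons.prems(5)[of s j] that by simp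
  ultimately show ?case using Cons.IH by blast
qed

text \<open>A zero of \<open>u\<close> on a lead reveals the coefficient of the relation as minus an
  entry of \<open>w\<close>. This is the source of normality: the real normal form of a lattice
  point of the cone has integral entries.\<close>

lemma normal_form_integral:
  assumes "triangular J rs" "normal rs u" "\<And>j. w j \<in> \<int>" "in_span rs (\<lambda>j. u j - w j)"
  shows "u j \<in> \<int>"
  using assms
proof (induction rs arbitrary: w)
  case Nil then show ?case by (metis eq_iff_diff_eq_0 in_span.simps(1))
next
  case (Cons r rs)
  then obtain a where a: "in_span rs (\<lambda>j. u j - w j - a * rvec r j)" by auto
  obtain i where i: "i \<in> fst r" "u i = 0" using Cons.prems(2) by (auto simp: normal_def)
  have "u i - w i - a * rvec r i = 0" by (rule in_span_lead[OF Cons.prems(1) a i(1)])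
  then have "a = - w i" using i rvec_lead[OF Cons.prems(1) i(1)] by simp
  then have aZ: "a \<in> \<int>" using Cons.prems(3) by simp
  show ?case
  proof (rule Cons.IH)
    show "w j + a * rvec r j \<in> \<int>" for j using aZ Cons.prems(3) by (auto simp: rvec_def)
    show "in_span rs (\<lambda>j. u j - (w j + a * rvec r j))" using a by (simp add: algebra_simps)
  qed (use Cons.prems in \<open>auto simp: normal_def\<close>)
qed

definition leads :: "rel list \<Rightarrow> nat set" where "leads rs = (\<Union>r\<in>set rs. fst r)"

text \<open>Nonnegative integral functionals on the exponents that respect all relations: such a functional is
  determined by a variable \<open>i\<close> outside the leading terms and one variable in each leading term.\<close>

fun facet_functionals :: "nat set \<Rightarrow> nat set \<Rightarrow> rel list \<Rightarrow> (nat \<Rightarrow> real) set" where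
  "facet_functionals J B [] = (\<lambda>i j. if j = i then 1 else 0) ` B"
| "facet_functionals J B (r # rs) =
    (\<lambda>(u, j0) j. if j \<in> fst r then (if j = j0 then \<Sum>i\<in>J. real (snd r i) * u i else 0) else u j) `
      (facet_functionals J B rs \<times> fst r)"

lemma finite_facet_functionals: "finite J \<Longrightarrow> triangular J rs \<Longrightarrow> finite B \<Longrightarrow> finite (facet_functionals J B rs)"
proof (induction rs)
  case (Cons r rs)
  have "finite (fst r)" using Cons.prems finite_subset[of "fst r" J] by simp
  then show ?case using Cons by (simp add: finite_cartesian_product)
qed simp

lemma sum_Nats: "(\<And>i. i \<in> A \<Longrightarrow> f i \<in> \<nat>) \<Longrightarrow> sum f A \<in> (\<nat> :: 'a::semiring_1 set)"
  by (induction A rule: infinite_finite_induct) auto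

lemma facet_functionals_Nats: "u \<in> facet_functionals J B rs \<Longrightarrow> u j \<in> \<nat>"
  by (induction rs arbitrary: u j) (auto intro!: sum_Nats)

lemma facet_functionals_support:
  "u \<in> facet_functionals J B rs \<Longrightarrow> j \<notin> B \<Longrightarrow> j \<notin> leads rs \<Longrightarrow> u j = 0"
  by (induction rs arbitrary: u) (auto simp: leads_def)

lemma sum_split_lead:
  fixes f :: "nat \<Rightarrow> real"
  assumes "finite J" "L \<subseteq> J" "j0 \<in> L"
  shows "(\<Sum>j\<in>J. c j * (if j \<in> L then (if j = j0 then x else 0) else f j)) = c j0 * x + (\<Sum>j\<in>J - L. c j * f j)"
proof -
  have "(\<Sum>j\<in>J. c j * (if j \<in> L then (if j = j0 then x else 0) else f j)) =
    (\<Sum>j\<in>L. c j * (if j = j0 then x else 0)) + (\<Sum>j\<in>J - L. c j * f j)"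
    using assms by (subst sum.subset_diff[of L J]) (auto intro!: sum.cong)
  also have "(\<Sum>j\<in>L. c j * (if j = j0 then x else 0)) = c j0 * x"
    using assms finite_subset[of L J] by (simp add: if_distrib cong: if_cong)
  finally show ?thesis .
qed

text \<open>The chosen variable \<open>j0\<close> of a lead receives the weight of the tail and the
  rest of the lead receives 0, so both sides of the relation weigh the same.\<close>

lemma facet_functionals_compat:
  assumes "finite J" "triangular J rs" "u \<in> facet_functionals J B rs" "s \<in> set rs" "B \<inter> leads rs = {}"
  shows "(\<Sum>j\<in>J. rvec s j * u j) = 0"
  using assms
proof (induction rs arbitrary: u)
  case (Cons r rs)
  then obtain u' j0 where u: "u' \<in> facet_functionals J B rs" "j0 \<in> fst r"
    "u = (\<lambda>j. if j \<in> fst r then (if j = j0 then \<Sum>i\<in>J. real (snd r i) * u' i else 0) else u' j)" by auto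
  have rJ: "fst r \<subseteq> J" using Cons.prems by simp
  have B: "B \<inter> leads rs = {}" using Cons.prems by (auto simp: leads_def)
  have 1: "(\<Sum>j\<in>J. rvec s j * u j) = rvec s j0 * (\<Sum>i\<in>J. real (snd r i) * u' i) + (\<Sum>j\<in>J - fst r. rvec s j * u' j)"
    unfolding u(3) by (rule sum_split_lead[OF Cons.prems(1) rJ u(2)])
  show ?case
  proof (cases "s = r")
    case True
    have "(\<Sum>j\<in>J - fst r. rvec s j * u' j) = (\<Sum>j\<in>J - fst r. - (real (snd r j) * u' j))"
      using True by (intro sum.cong) (auto simp: rvec_def)
    also have "\<dots> = (\<Sum>j\<in>J. - (real (snd r j) * u' j))"
      using Cons.prems(1,2) by (intro sum.mono_neutral_left) auto
    also have "\<dots> = - (\<Sum>j\<in>J. real (snd r j) * u' j)" by (simp add: sum_negf)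
    finally show ?thesis using 1 True rvec_lead[OF Cons.prems(2) u(2)] by simp
  next
    case False
    then have s: "s \<in> set rs" using Cons.prems by simp
    have "(\<Sum>j\<in>J - fst r. rvec s j * u' j) = (\<Sum>j\<in>J. rvec s j * u' j)"
      using Cons.prems(1) rvec_tail[OF Cons.prems(2) _ s] by (intro sum.mono_neutral_left) auto
    also have "\<dots> = 0" using Cons.IH[OF Cons.prems(1) _ u(1) s B] Cons.prems(2) by simp
    finally show ?thesis using 1 rvec_tail[OF Cons.prems(2) u(2) s] by simp
  qed
qed simp

text \<open>Extending over a lead changes nothing on \<open>B\<close>, and the initial functional is
  the indicator of one element of \<open>B\<close>. So the sum of the generators in \<open>B\<close>
  will be the point where all facet functionals are 1.\<close>

lemma facet_functionals_weight:
  assumes "finite B" "u \<in> facet_functionals J B rs" "B \<inter> leads rs = {}"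
  shows "(\<Sum>j\<in>B. u j) = 1"
  using assms(2,3)
proof (induction rs arbitrary: u)
  case Nil
  then show ?case using assms(1) by auto
next
  case (Cons r rs)
  then obtain u' j0 where u: "u' \<in> facet_functionals J B rs"
    "u = (\<lambda>j. if j \<in> fst r then (if j = j0 then \<Sum>i\<in>J. real (snd r i) * u' i else 0) else u' j)" by auto
  have "(\<Sum>j\<in>B. u j) = (\<Sum>j\<in>B. u' j)" using Cons.prems(2) by (intro sum.cong) (auto simp: u(2) leads_def)
  then show ?case using Cons u(1) by (auto simp: leads_def)
qed

text \<open>In each lead the distinguished variable is chosen among the zeros of \<open>v\<close>,
  so no lead contributes.\<close>

lemma facet_functionals_eval:
  assumes "finite J" "triangular J rs" "B \<subseteq> J" "B \<inter> leads rs = {}" "normal rs v" "i \<in> B"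
  shows "\<exists>u\<in>facet_functionals J B rs. (\<Sum>j\<in>J. v j * u j) = v i"
  using assms
proof (induction rs)
  case Nil
  then show ?case by (auto intro!: bexI[of _ "\<lambda>j. if j = i then 1 else 0"] simp: if_distrib cong: if_cong)
next
  case (Cons r rs)
  have "B \<inter> leads rs = {}" "triangular J rs" "normal rs v" using Cons.prems by (auto simp: leads_def normal_def)
  then obtain u' where u': "u' \<in> facet_functionals J B rs" "(\<Sum>j\<in>J. v j * u' j) = v i"
    using Cons.IH Cons.prems by blast
  obtain j0 where j0: "j0 \<in> fst r" "v j0 = 0" using Cons.prems(5) by (auto simp: normal_def)
  let ?u = "\<lambda>j. if j \<in> fst r then (if j = j0 then \<Sum>i\<in>J. real (snd r i) * u' i else 0) else u' j"
  have rJ: "fst r \<subseteq> J" using Cons.prems by simp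
  have z: "u' j = 0" if "j \<in> fst r" for j
    using that Cons.prems(2,4) by (intro facet_functionals_support[OF u'(1)]) (auto simp: leads_def)
  have "(\<Sum>j\<in>J. v j * ?u j) = (\<Sum>j\<in>J - fst r. v j * u' j)"
    using sum_split_lead[OF Cons.prems(1) rJ j0(1)] j0(2) by simp
  also have "\<dots> = (\<Sum>j\<in>J. v j * u' j)" using Cons.prems(1) z by (intro sum.mono_neutral_left) auto
  finally have "(\<Sum>j\<in>J. v j * ?u j) = v i" using u' by simp
  moreover have "?u \<in> facet_functionals J B (r # rs)"
    using u'(1) j0(1) by (auto intro!: image_eqI[of _ _ "(u', j0)"])
  ultimately show ?case by (rule bexI)
qed

section \<open>Generators of a lattice with prescribed relations\<close>

definition comb :: "nat set \<Rightarrow> (nat \<Rightarrow> vec \<times> real) \<Rightarrow> (nat \<Rightarrow> real) \<Rightarrow> vec \<times> real" where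
  "comb J g f = (\<Sum>j\<in>J. f j *\<^sub>R g j)"

lemma comb_add: "comb J g (\<lambda>j. f j + h j) = comb J g f + comb J g h"
  by (simp add: comb_def scaleR_add_left sum.distrib)
lemma comb_diff: "comb J g (\<lambda>j. f j - h j) = comb J g f - comb J g h"
  by (simp add: comb_def scaleR_diff_left sum_subtractf)
lemma comb_scale: "comb J g (\<lambda>j. c * f j) = c *\<^sub>R comb J g f"
  by (simp add: comb_def scaleR_sum_right)
lemma comb_0 [simp]: "comb J g (\<lambda>j. 0) = 0" by (simp add: comb_def)
lemma comb_cong: "(\<And>j. j \<in> J \<Longrightarrow> f j = h j) \<Longrightarrow> comb J g f = comb J g h"
  by (simp add: comb_def)
lemma comb_restrict: "comb J g (\<lambda>j. if j \<in> J then f j else 0) = comb J g f"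
  by (rule comb_cong) simp
lemma comb_sum: "comb J g (\<lambda>j. \<Sum>i\<in>I. f i j) = (\<Sum>i\<in>I. comb J g (f i))"
  by (simp add: comb_def scaleR_sum_left sum.swap[of _ _ J])
lemma comb_unit: "finite J \<Longrightarrow> i \<in> J \<Longrightarrow> comb J g (\<lambda>j. if j = i then 1 else 0) = g i"
  by (simp add: comb_def if_distrib[of "\<lambda>c. c *\<^sub>R _"] cong: if_cong)

text \<open>In effect \<open>Lam n\<close> is presented as the quotient of \<open>Z^J\<close> by the
  relations, graded by \<open>d\<close>; no polytope is involved yet.\<close>

definition premodel :: "nat \<Rightarrow> nat set \<Rightarrow> rel list \<Rightarrow> (nat \<Rightarrow> nat) \<Rightarrow> (nat \<Rightarrow> vec \<times> real) \<Rightarrow> bool" where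
  "premodel n J rs d g \<longleftrightarrow> finite J \<and> triangular J rs \<and>
     (\<forall>j\<in>J. g j \<in> Lam n \<and> snd (g j) = real (d j) \<and> d j \<ge> 1) \<and>
     (\<forall>r\<in>set rs. comb J g (rvec r) = 0) \<and>
     (\<forall>f. (\<forall>j. j \<notin> J \<longrightarrow> f j = 0) \<longrightarrow> comb J g f = 0 \<longrightarrow> in_span rs f) \<and>
     (\<forall>p\<in>Lam n. \<exists>f. (\<forall>j. f j \<in> \<int>) \<and> comb J g f = p)"

text \<open>A variable outside all leads is required so that the sum of these variables has positive
  degree; it becomes the Gorenstein point. Generators of higher degree only need to lie in the
  cone.\<close>

definition model :: "nat \<Rightarrow> nat set \<Rightarrow> rel list \<Rightarrow> (nat \<Rightarrow> nat) \<Rightarrow> (nat \<Rightarrow> vec \<times> real) \<Rightarrow> vec set \<Rightarrow> bool" where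
  "model n J rs d g P \<longleftrightarrow> premodel n J rs d g \<and> J - leads rs \<noteq> {} \<and>
     P = convex hull (fst ` g ` {j\<in>J. d j = 1}) \<and> (\<forall>j\<in>J. g j \<in> cone_over P)"

lemma comb_in_span: "(\<And>r. r \<in> set rs \<Longrightarrow> comb J g (rvec r) = 0) \<Longrightarrow> in_span rs f \<Longrightarrow> comb J g f = 0"
proof (induction rs arbitrary: f)
  case (Cons r rs)
  then obtain a where "in_span rs (\<lambda>j. f j - a * rvec r j)" by auto
  then have "comb J g (\<lambda>j. f j - a * rvec r j) = 0" using Cons by simp
  then show ?case using Cons.prems(1)[of r] by (simp add: comb_diff comb_scale)
qed (simp add: comb_def)

context
  fixes n J rs d g assumes pm: "premodel n J rs d g"
begin

lemma pm_fin: "finite J" and pm_tri: "triangular J rs" and pm_Lam: "j \<in> J \<Longrightarrow> g j \<in> Lam n"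
  and pm_deg: "j \<in> J \<Longrightarrow> snd (g j) = real (d j)" and pm_pos: "j \<in> J \<Longrightarrow> d j \<ge> 1"
  and pm_rel: "r \<in> set rs \<Longrightarrow> comb J g (rvec r) = 0"
  and pm_ker: "(\<And>j. j \<notin> J \<Longrightarrow> f j = 0) \<Longrightarrow> comb J g f = 0 \<Longrightarrow> in_span rs f"
  and pm_gen: "p \<in> Lam n \<Longrightarrow> \<exists>f. (\<forall>j. f j \<in> \<int>) \<and> comb J g f = p"
  using pm unfolding premodel_def by blast+

lemma pm_comb_eq_iff:
  assumes "\<And>j. j \<notin> J \<Longrightarrow> f j = 0" "\<And>j. j \<notin> J \<Longrightarrow> h j = 0"
  shows "comb J g f = comb J g h \<longleftrightarrow> in_span rs (\<lambda>j. f j - h j)"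
proof
  assume "comb J g f = comb J g h"
  then show "in_span rs (\<lambda>j. f j - h j)" using assms by (intro pm_ker) (auto simp: comb_diff)
next
  assume "in_span rs (\<lambda>j. f j - h j)"
  from comb_in_span[OF pm_rel this] show "comb J g f = comb J g h" by (simp add: comb_diff)
qed

lemma pm_gen': "p \<in> Lam n \<Longrightarrow> \<exists>f. (\<forall>j. f j \<in> \<int>) \<and> (\<forall>j. j \<notin> J \<longrightarrow> f j = 0) \<and> comb J g f = p"
proof -
  assume "p \<in> Lam n"
  then obtain f where "\<forall>j. f j \<in> \<int>" "comb J g f = p" using pm_gen by blast
  then show ?thesis by (intro exI[of _ "\<lambda>j. if j \<in> J then f j else 0"]) (auto simp: comb_restrict)
qed

end

lemma VV_decomp:
  assumes "p \<in> VV n"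
  shows "p = (\<Sum>i<n. lookup (fst p) i *\<^sub>R (single i 1, 0)) + snd p *\<^sub>R (0, 1)"
proof -
  obtain z t where p: "p = (z, t)" by fastforce
  have z: "z \<in> rspace n" using assms p by (simp add: VV_def)
  have zs: "z = (\<Sum>i<n. lookup z i *\<^sub>R single i 1)"
  proof (rule rspace_eqI[OF z])
    show "(\<Sum>i<n. lookup z i *\<^sub>R single i 1) \<in> rspace n"
      by (intro rspace_sum rspace_scale) (auto simp: rspace_iff lookup_single when_def)
    fix i assume "i < n"
    then show "lookup z i = lookup (\<Sum>i<n. lookup z i *\<^sub>R single i 1) i"
      by (simp add: lookup_sum' lookup_single when_def if_distrib cong: if_cong)
  qed
  show ?thesis by (simp add: p prod_eq_iff fst_sum snd_sum zs[symmetric])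
qed

lemma unit_in_Lam: "i < n \<Longrightarrow> (single i 1, 0) \<in> Lam n" "(0, 1) \<in> Lam n"
  by (auto simp: Lam_def lattice_iff rspace_iff lookup_single when_def)

lemma VV_induct_linear:
  assumes "linear F" "linear G" "\<And>p. p \<in> Lam n \<Longrightarrow> F p = G p" "p \<in> VV n"
  shows "F p = G p"
proof -
  let ?q = "(\<Sum>i<n. lookup (fst p) i *\<^sub>R (single i 1, 0)) + snd p *\<^sub>R (0, 1)"
  have "F ?q = G ?q"
    by (simp add: linear_add[OF assms(1)] linear_add[OF assms(2)] linear_sum[OF assms(1)] linear_sum[OF assms(2)]
      linear_scale[OF assms(1)] linear_scale[OF assms(2)] unit_in_Lam assms(3) del: scaleR_Pair)
  then show ?thesis using VV_decomp[OF assms(4)] by metis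
qed

lemma premodel_spans:
  assumes pm: "premodel n J rs d g" and p: "p \<in> VV n"
  shows "\<exists>f. (\<forall>j. j \<notin> J \<longrightarrow> f j = 0) \<and> comb J g f = p"
proof -
  have "\<exists>f. \<forall>i<n. (\<forall>j. f i j \<in> \<int>) \<and> comb J g (f i) = (single i 1, 0)"
    using pm_gen[OF pm unit_in_Lam(1)] by metis
  then obtain f where f: "\<And>i. i < n \<Longrightarrow> comb J g (f i) = (single i 1, 0)" by blast
  obtain f0 where f0: "comb J g f0 = (0, 1)" using pm_gen[OF pm unit_in_Lam(2)] by blast
  let ?f = "\<lambda>j. (\<Sum>i<n. lookup (fst p) i * f i j) + snd p * f0 j"
  have "comb J g ?f = (\<Sum>i<n. lookup (fst p) i *\<^sub>R comb J g (f i)) + snd p *\<^sub>R comb J g f0"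
    by (simp only: comb_add comb_sum comb_scale)
  also have "\<dots> = p" using VV_decomp[OF p] by (simp add: f f0)
  finally show ?thesis by (intro exI[of _ "\<lambda>j. if j \<in> J then ?f j else 0"]) (auto simp: comb_restrict)
qed

text \<open>A weight that vanishes on all relations is well defined on the lattice presented by the
  generators; its values on the unit vectors are the coordinates of the functional.\<close>

lemma compatible_functional:
  assumes pm: "premodel n J rs d g" and u: "\<And>j. u j \<in> \<int>" "\<And>s. s \<in> set rs \<Longrightarrow> (\<Sum>j\<in>J. rvec s j * u j) = 0"
  shows "\<exists>a\<in>Lam n. \<forall>f. ev n a (comb J g f) = (\<Sum>j\<in>J. f j * u j)"
proof -
  have span0: "(\<Sum>j\<in>J. f j * u j) = 0" if "in_span rs' f" "set rs' \<subseteq> set rs" for f rs'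
    using that
  proof (induction rs' arbitrary: f)
    case (Cons r rs')
    then obtain b where "in_span rs' (\<lambda>j. f j - b * rvec r j)" by auto
    then have "(\<Sum>j\<in>J. (f j - b * rvec r j) * u j) = 0" using Cons by simp
    then have "(\<Sum>j\<in>J. f j * u j) - b * (\<Sum>j\<in>J. rvec r j * u j) = 0"
      by (simp add: algebra_simps sum_subtractf sum_distrib_left)
    then show ?case using u(2)[of r] Cons.prems by simp
  qed simp
  have wd: "(\<Sum>j\<in>J. f j * u j) = (\<Sum>j\<in>J. h j * u j)" if "comb J g f = comb J g h" for f h
  proof -
    let ?f = "\<lambda>j. if j \<in> J then f j else 0" and ?h = "\<lambda>j. if j \<in> J then h j else 0"
    have "in_span rs (\<lambda>j. ?f j - ?h j)" using that by (subst pm_comb_eq_iff[OF pm, symmetric]) (auto simp: comb_restrict)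
    from span0[OF this] have "(\<Sum>j\<in>J. (?f j - ?h j) * u j) = 0" by simp
    also have "(\<Sum>j\<in>J. (?f j - ?h j) * u j) = (\<Sum>j\<in>J. f j * u j) - (\<Sum>j\<in>J. h j * u j)"
      by (simp add: sum_subtractf left_diff_distrib)
    finally show ?thesis by simp
  qed
  have "\<exists>f. \<forall>i<n. (\<forall>j. f i j \<in> \<int>) \<and> comb J g (f i) = (single i 1, 0)"
    using pm_gen[OF pm unit_in_Lam(1)] by metis
  then obtain f where f: "\<And>i j. i < n \<Longrightarrow> f i j \<in> \<int>" "\<And>i. i < n \<Longrightarrow> comb J g (f i) = (single i 1, 0)" by blast
  obtain f0 where f0: "\<And>j. f0 j \<in> \<int>" "comb J g f0 = (0, 1)" using pm_gen[OF pm unit_in_Lam(2)] by blast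
  define y :: vec where "y = (\<Sum>i<n. (\<Sum>j\<in>J. f i j * u j) *\<^sub>R single i 1)"
  define a where "a = (y, \<Sum>j\<in>J. f0 j * u j)"
  have ly: "lookup y i = (if i < n then \<Sum>j\<in>J. f i j * u j else 0)" for i
    by (auto simp: y_def lookup_sum' lookup_single when_def if_distrib cong: if_cong)
  have aL: "a \<in> Lam n"
    using u f(1) f0(1) by (auto simp: a_def Lam_def lattice_iff rspace_iff ly intro!: Ints_sum Ints_mult)
  have "ev n a (comb J g h) = (\<Sum>j\<in>J. h j * u j)" for h
  proof -
    define p where "p = comb J g h"
    have pV: "p \<in> VV n" unfolding p_def comb_def by (intro VV_sum VV_scale Lam_VV pm_Lam[OF pm])
    let ?f = "\<lambda>j. (\<Sum>i<n. lookup (fst p) i * f i j) + snd p * f0 j"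
    have "comb J g ?f = (\<Sum>i<n. lookup (fst p) i *\<^sub>R comb J g (f i)) + snd p *\<^sub>R comb J g f0"
      by (simp only: comb_add comb_sum comb_scale)
    also have "\<dots> = p" using VV_decomp[OF pV] by (simp add: f f0)
    finally have "(\<Sum>j\<in>J. h j * u j) = (\<Sum>j\<in>J. ?f j * u j)" unfolding p_def by (intro wd) simp
    also have "\<dots> = (\<Sum>j\<in>J. \<Sum>i<n. lookup (fst p) i * (f i j * u j)) + snd p * (\<Sum>j\<in>J. f0 j * u j)"
      by (simp add: distrib_right sum.distrib sum_distrib_left sum_distrib_right mult.assoc)
    also have "(\<Sum>j\<in>J. \<Sum>i<n. lookup (fst p) i * (f i j * u j)) =
        (\<Sum>i<n. lookup (fst p) i * (\<Sum>j\<in>J. f i j * u j))"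
      by (subst sum.swap) (simp add: sum_distrib_left)
    also have "\<dots> = pairing n (fst p) y" by (simp add: pairing_def ly)
    finally show ?thesis by (simp add: ev_def a_def p_def mult.commute)
  qed
  then show ?thesis using aL by blast
qed

section \<open>Cone, semigroup and Gorenstein property of a model\<close>

lemma cone_over_add:
  assumes "convex P" "p \<in> cone_over P" "q \<in> cone_over P" shows "p + q \<in> cone_over P"
proof -
  obtain x s y t where p: "p = (s *\<^sub>R x, s)" "s \<ge> 0" "x \<in> P" and q: "q = (t *\<^sub>R y, t)" "t \<ge> 0" "y \<in> P"
    using assms by (auto simp: cone_over_def)
  show ?thesis
  proof (cases "s + t = 0")
    case True
    then have "s = 0" "t = 0" using p q by auto
    then show ?thesis using p q by (auto simp: cone_over_def)
  next
    case False
    then have st: "s + t > 0" using p q by auto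
    have "(s / (s + t)) *\<^sub>R x + (t / (s + t)) *\<^sub>R y \<in> P"
      using p q st by (intro convexD[OF assms(1)]) (auto simp: add_divide_distrib[symmetric])
    moreover have "p + q = ((s + t) *\<^sub>R ((s / (s + t)) *\<^sub>R x + (t / (s + t)) *\<^sub>R y), s + t)"
      using st by (simp add: p q scaleR_add_right)
    ultimately show ?thesis using st by (auto simp: cone_over_def intro!: exI[of _ "s + t"] less_imp_le)
  qed
qed

lemma cone_over_scale:
  assumes "p \<in> cone_over P" "c \<ge> 0" shows "c *\<^sub>R p \<in> cone_over P"
proof -
  obtain t x where p: "p = (t *\<^sub>R x, t)" "t \<ge> 0" "x \<in> P" using assms by (auto simp: cone_over_def)
  then have "c *\<^sub>R p = ((c * t) *\<^sub>R x, c * t)" "c * t \<ge> 0" using assms by auto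
  then show ?thesis using p unfolding cone_over_def by blast
qed

lemma cone_over_0: "P \<noteq> {} \<Longrightarrow> 0 \<in> cone_over P"
  by (auto simp: cone_over_def zero_prod_def)

lemma cone_over_sum:
  assumes "convex P" "P \<noteq> {}" "\<And>i. i \<in> I \<Longrightarrow> f i \<in> cone_over P"
  shows "sum f I \<in> cone_over P"
  using assms(3) by (induction I rule: infinite_finite_induct) (auto intro: cone_over_add[OF assms(1)] cone_over_0[OF assms(2)])

text \<open>It suffices that the points at height one of the cone of combinations form a convex set
  containing the degree-one generators.\<close>

lemma model_cone:
  assumes m: "model n J rs d g P"
  shows "cone_over P = {comb J g f |f. \<forall>j. f j \<ge> 0}"
proof -
  have pm: "premodel n J rs d g" and P: "P = convex hull (fst ` g ` {j\<in>J. d j = 1})"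
    and gc: "\<And>j. j \<in> J \<Longrightarrow> g j \<in> cone_over P" and ne: "J \<noteq> {}" using m by (auto simp: model_def)
  note fin = pm_fin[OF pm]
  have cP: "convex P" by (simp add: P)
  have Pne: "P \<noteq> {}" using ne gc by (auto simp: cone_over_def)
  let ?K = "{comb J g f |f. \<forall>j. f j \<ge> 0}"
  have "convex {x. (x, 1) \<in> ?K}"
  proof (rule convexI)
    fix x y :: vec and u v :: real
    assume xy: "x \<in> {x. (x, 1) \<in> ?K}" "y \<in> {x. (x, 1) \<in> ?K}" and uv: "0 \<le> u" "0 \<le> v" "u + v = 1"
    obtain f f' where a: "(x, 1) = comb J g f" "\<forall>j. 0 \<le> f j" "(y, 1) = comb J g f'" "\<forall>j. 0 \<le> f' j" using xy by blast
    have "(u *\<^sub>R x + v *\<^sub>R y, 1) = u *\<^sub>R (x, 1::real) + v *\<^sub>R (y, 1::real)" using uv by simp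
    also have "\<dots> = comb J g (\<lambda>j. u * f j + v * f' j)" by (simp only: a comb_add comb_scale)
    finally show "u *\<^sub>R x + v *\<^sub>R y \<in> {x. (x, 1) \<in> ?K}" using a uv by auto
  qed
  moreover have "fst ` g ` {j\<in>J. d j = 1} \<subseteq> {x. (x, 1) \<in> ?K}"
  proof
    fix x assume "x \<in> fst ` g ` {j\<in>J. d j = 1}"
    then obtain j where j: "j \<in> J" "d j = 1" and x: "x = fst (g j)" by blast
    then have "(fst (g j), 1) = comb J g (\<lambda>i. if i = j then 1 else 0)"
      using comb_unit[OF fin j(1)] pm_deg[OF pm j(1)] by (simp add: prod_eq_iff)
    then show "x \<in> {x. (x, 1) \<in> ?K}" unfolding x by (intro CollectI exI conjI) auto
  qed
  ultimately have PK: "P \<subseteq> {x. (x, 1) \<in> ?K}" unfolding P by (rule hull_minimal[rotated])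
  show ?thesis
  proof (intro equalityI subsetI)
    fix p assume "p \<in> cone_over P"
    then obtain x t where x: "x \<in> P" "t \<ge> 0" "p = (t *\<^sub>R x, t)" by (auto simp: cone_over_def)
    then obtain f where f: "(x, 1) = comb J g f" "\<forall>j. f j \<ge> 0" using PK by blast
    have "p = t *\<^sub>R (x, 1)" by (simp add: x)
    also have "\<dots> = comb J g (\<lambda>j. t * f j)" by (simp only: f comb_scale)
    finally show "p \<in> ?K" using f x by auto
  next
    fix p assume "p \<in> ?K"
    then show "p \<in> cone_over P"
      unfolding comb_def by (auto intro!: cone_over_sum cP Pne cone_over_scale gc)
  qed
qed

text \<open>A lattice point of the cone has a nonnegative real representation and an integral one.
  The normal form of the first is nonnegative, and integral by comparison with the second.\<close>

lemma model_semigroup: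
  assumes m: "model n J rs d g P"
  shows "cone_semigroup n P = {comb J g f |f. (\<forall>j. f j \<in> \<nat>) \<and> (\<forall>j. j \<notin> J \<longrightarrow> f j = 0)}"
proof -
  have pm: "premodel n J rs d g" using m by (auto simp: model_def)
  have sg: "cone_semigroup n P = cone_over P \<inter> Lam n" by (simp add: cone_semigroup_def Lam_def)
  show ?thesis
  proof (intro equalityI subsetI)
    fix p assume "p \<in> cone_semigroup n P"
    then have p: "p \<in> Lam n" "p \<in> cone_over P" by (auto simp: sg)
    then obtain f where f: "p = comb J g f" "\<And>j. f j \<ge> 0" using model_cone[OF m] by auto
    let ?f = "\<lambda>j. if j \<in> J then f j else 0"
    obtain w where w: "\<And>j. w j \<in> \<int>" "\<And>j. j \<notin> J \<Longrightarrow> w j = 0" "comb J g w = p" using pm_gen'[OF pm p(1)] by blast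
    obtain v where v: "in_span rs (\<lambda>j. ?f j - v j)" "\<And>j. v j \<ge> 0" "normal rs v"
    proof -
      have "?f j \<in> {0..}" for j using f(2) by simp
      from normal_form_exists[of "{0..}" J rs ?f, OF _ _ pm_fin[OF pm] pm_tri[OF pm] this] show ?thesis using that by auto
    qed
    have v0: "v j = 0" if "j \<notin> J" for j using in_span_outside[OF pm_tri[OF pm] v(1) that] that by simp
    have "comb J g v = comb J g ?f" using v(1) v0 by (subst eq_commute, subst pm_comb_eq_iff[OF pm]) auto
    then have vp: "comb J g v = p" by (simp add: comb_restrict f)
    then have "in_span rs (\<lambda>j. v j - w j)" using w v0 by (subst pm_comb_eq_iff[OF pm, symmetric]) auto
    from normal_form_integral[OF pm_tri[OF pm] v(3) w(1) this] have "v j \<in> \<int>" for j .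
    then have "v j \<in> \<nat>" for j using v(2)[of j] by (auto simp: Nats_altdef2)
    then show "p \<in> {comb J g f |f. (\<forall>j. f j \<in> \<nat>) \<and> (\<forall>j. j \<notin> J \<longrightarrow> f j = 0)}" using vp v0 by blast
  next
    fix p assume "p \<in> {comb J g f |f. (\<forall>j. f j \<in> \<nat>) \<and> (\<forall>j. j \<notin> J \<longrightarrow> f j = 0)}"
    then obtain f where f: "p = comb J g f" "\<And>j. f j \<in> \<nat>" by blast
    have "p \<in> cone_over P" using f by (auto simp: model_cone[OF m] Nats_altdef2)
    moreover have "p \<in> Lam n" unfolding f comb_def
      using f(2) by (intro Lam_sum Lam_scale pm_Lam[OF pm]) (auto simp: Nats_altdef2)
    ultimately show "p \<in> cone_semigroup n P" by (simp add: sg)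
  qed
qed

lemma affine_hull_eq_rspace:
  assumes P: "P \<subseteq> rspace n" "convex P" and span: "\<And>p. p \<in> VV n \<Longrightarrow> \<exists>a\<in>cone_over P. \<exists>b\<in>cone_over P. p = a - b"
  shows "affine hull P = rspace n"
proof (intro equalityI subsetI)
  fix x assume "x \<in> rspace n"
  then have "(x, 1) \<in> VV n" by (simp add: VV_def)
  then obtain a b where ab: "a \<in> cone_over P" "b \<in> cone_over P" "(x, 1) = a - b" using span by blast
  then obtain y s z t where "y \<in> P" "z \<in> P" "a = (s *\<^sub>R y, s)" "b = (t *\<^sub>R z, t)" by (auto simp: cone_over_def)
  with ab(3) have "x = s *\<^sub>R y + (- t) *\<^sub>R z" "s + (- t) = 1" by auto
  moreover have "s *\<^sub>R y + (- t) *\<^sub>R z \<in> affine hull P"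
    using \<open>y \<in> P\<close> \<open>z \<in> P\<close> \<open>s + (- t) = 1\<close> by (intro mem_affine affine_affine_hull hull_inc)
  ultimately show "x \<in> affine hull P" by simp
next
  fix x assume "x \<in> affine hull P"
  moreover have "affine hull P \<subseteq> rspace n" using P(1) by (intro hull_minimal subspace_imp_affine rspace_subspace)
  ultimately show "x \<in> rspace n" by blast
qed

lemma model_lattice_polytope: "model n J rs d g P \<Longrightarrow> lattice_polytope n P"
  unfolding lattice_polytope_def model_def
  by (intro exI[of _ "fst ` g ` {j\<in>J. d j = 1}"])
     (use pm_Lam[of n J rs d g] pm_fin[of n J rs d g] in \<open>auto simp: Lam_def mem_Times_iff\<close>)

text \<open>The Gorenstein point is the sum of the generators outside the leads. The inequalities
  suffice because the normal form of an arbitrary vector is nonnegative on the leads anyway, and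
  each of its other coordinates is the value of one facet functional.\<close>

lemma model_gorenstein:
  assumes m: "model n J rs d g P"
  shows "gorenstein n P" "full_lattice_polytope n P"
proof -
  have pm: "premodel n J rs d g" and ne: "J - leads rs \<noteq> {}" and P: "P = convex hull (fst ` g ` {j\<in>J. d j = 1})"
    and gc: "\<And>j. j \<in> J \<Longrightarrow> g j \<in> cone_over P" using m by (auto simp: model_def)
  note fin = pm_fin[OF pm] and tri = pm_tri[OF pm]
  have lp: "lattice_polytope n P" using m by (rule model_lattice_polytope)
  have aff: "affine hull P = rspace n"
  proof (rule affine_hull_eq_rspace)
    show "P \<subseteq> rspace n" using lp by (rule lattice_polytope_rspace)
    show "convex P" by (simp add: P)
    fix p assume "p \<in> VV n"
    then obtain f where f: "comb J g f = p" using premodel_spans[OF pm] by blast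
    have "p = comb J g (\<lambda>j. max 0 (f j)) - comb J g (\<lambda>j. max 0 (- f j))"
      unfolding comb_diff[symmetric] f[symmetric] by (intro comb_cong) auto
    then show "\<exists>a\<in>cone_over P. \<exists>b\<in>cone_over P. p = a - b" unfolding model_cone[OF m] by fastforce
  qed
  define B where "B = J - leads rs"
  have B: "finite B" "B \<subseteq> J" "B \<inter> leads rs = {}" "B \<noteq> {}" using fin ne by (auto simp: B_def)
  define FF where "FF = facet_functionals J B rs"
  have FZ: "u j \<in> \<int>" "u j \<ge> 0" if "u \<in> FF" for u j
    using facet_functionals_Nats[OF that[unfolded FF_def], of j] by (auto simp: Nats_altdef2)
  have "\<exists>a. \<forall>u\<in>FF. a u \<in> Lam n \<and> (\<forall>f. ev n (a u) (comb J g f) = (\<Sum>j\<in>J. f j * u j))"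
  proof (rule bchoice, rule ballI)
    fix u assume u: "u \<in> FF"
    have "\<exists>a\<in>Lam n. \<forall>f. ev n a (comb J g f) = (\<Sum>j\<in>J. f j * u j)"
      using FZ(1)[OF u] facet_functionals_compat[OF fin tri u[unfolded FF_def] _ B(3)] by (rule compatible_functional[OF pm])
    then show "\<exists>a. a \<in> Lam n \<and> (\<forall>f. ev n a (comb J g f) = (\<Sum>j\<in>J. f j * u j))" by blast
  qed
  then obtain a where a: "\<And>u. u \<in> FF \<Longrightarrow> a u \<in> Lam n" "\<And>u f. u \<in> FF \<Longrightarrow> ev n (a u) (comb J g f) = (\<Sum>j\<in>J. f j * u j)"
    by blast
  define w where "w = comb J g (\<lambda>j. if j \<in> B then 1 else 0)"
  have wsum: "w = (\<Sum>j\<in>B. g j)"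
    unfolding w_def comb_def using fin B by (simp add: if_distrib[of "\<lambda>c. c *\<^sub>R _"] sum.inter_restrict[symmetric] inf.absorb2 cong: if_cong)
  have gor: "gorenstein n P"
  proof (rule gorenstein_if_functionals[OF lp aff])
    show "finite (a ` FF)" unfolding FF_def using finite_facet_functionals[OF fin tri B(1)] by simp
    show "a ` FF \<subseteq> Lam n" using a by auto
    show "w \<in> Lam n" unfolding wsum using B by (intro Lam_sum pm_Lam[OF pm]) auto
    show "ev n u w = 1" if "u \<in> a ` FF" for u
    proof -
      obtain u' where u': "u' \<in> FF" "u = a u'" using \<open>u \<in> a ` FF\<close> by blast
      have "ev n u w = (\<Sum>j\<in>J. (if j \<in> B then 1 else 0) * u' j)" unfolding w_def u'(2) by (rule a(2)[OF u'(1)])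
      also have "\<dots> = (\<Sum>j\<in>B. u' j)"
        using fin B by (simp add: if_distrib[of "\<lambda>c. c * _"] sum.inter_restrict[symmetric] inf.absorb2 cong: if_cong)
      also have "\<dots> = 1" using facet_functionals_weight[OF B(1) u'(1)[unfolded FF_def] B(3)] .
      finally show ?thesis .
    qed
    obtain b where b: "b \<in> B" using B by blast
    have "1 \<le> real (d b)" using pm_pos[OF pm] b B by auto
    also have "\<dots> \<le> (\<Sum>j\<in>B. real (d j))" using b B by (intro member_le_sum) auto
    also have "\<dots> = snd w" unfolding wsum snd_sum using B pm_deg[OF pm] by (intro sum.cong) auto
    finally show "snd w \<ge> 1" .
    show "cone_over P = {p \<in> VV n. \<forall>u\<in>a ` FF. 0 \<le> ev n u p}"
    proof (intro equalityI subsetI)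
      fix p assume "p \<in> cone_over P"
      then obtain f where f: "p = comb J g f" "\<And>j. f j \<ge> 0" using model_cone[OF m] by auto
      have "p \<in> VV n" unfolding f comb_def by (intro VV_sum VV_scale Lam_VV pm_Lam[OF pm])
      moreover have "0 \<le> ev n (a u) p" if "u \<in> FF" for u
        unfolding f a(2)[OF that] using f(2) FZ(2)[OF that] by (intro sum_nonneg mult_nonneg_nonneg)
      ultimately show "p \<in> {p \<in> VV n. \<forall>u\<in>a ` FF. 0 \<le> ev n u p}" by auto
    next
      fix p assume p: "p \<in> {p \<in> VV n. \<forall>u\<in>a ` FF. 0 \<le> ev n u p}"
      then obtain f where f: "\<And>j. j \<notin> J \<Longrightarrow> f j = 0" "comb J g f = p" using premodel_spans[OF pm] by blast
      obtain v where v: "in_span rs (\<lambda>j. f j - v j)" "normal rs v" "\<And>r j. r \<in> set rs \<Longrightarrow> j \<in> fst r \<Longrightarrow> 0 \<le> v j"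
        using normal_form_exists[of UNIV J rs f] fin tri by auto
      have v0: "v j = 0" if "j \<notin> J" for j using in_span_outside[OF tri v(1) that] f(1)[OF that] by simp
      have vp: "comb J g v = p" using v(1) v0 f pm_comb_eq_iff[OF pm, of f v] by simp
      have "v j \<ge> 0" for j
      proof (cases "j \<in> B")
        case True
        then obtain u where u: "u \<in> FF" "(\<Sum>j\<in>J. v j * u j) = v j"
          using facet_functionals_eval[OF fin tri B(2,3) v(2)] by (auto simp: FF_def)
        then show ?thesis using p a(2)[OF u(1), of v] vp by auto
      next
        case False
        then show ?thesis using v(3) v0 by (cases "j \<in> J") (auto simp: B_def leads_def)
      qed
      then show "p \<in> cone_over P" unfolding model_cone[OF m] using vp by blast
    qed
  qed
  then show "gorenstein n P" .
  show "full_lattice_polytope n P" using lp aff by (simp add: full_lattice_polytope_def)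
qed

section \<open>Construction and comparison of models\<close>

lemma triangular_subset:
  "triangular J rs \<Longrightarrow> (\<And>s j. s \<in> set rs \<Longrightarrow> j \<in> J - K \<Longrightarrow> j \<notin> fst s \<and> snd s j = 0) \<Longrightarrow> triangular (J \<inter> K) rs"
proof (induction rs)
  case (Cons r rs)
  have r: "j \<notin> fst r" "snd r j = 0" if "j \<in> J - K" for j using Cons.prems(2)[of r j] that by auto
  have "fst r \<subseteq> J \<inter> K" using Cons.prems(1) r by auto
  moreover have "j \<in> J \<inter> K - fst r" if "snd r j \<noteq> 0" for j
  proof -
    have "j \<in> J" "j \<notin> fst r" using Cons.prems(1) that by auto
    then show ?thesis using r(2)[of j] that by auto
  qed
  moreover have "triangular (J \<inter> K) rs"
  proof (rule Cons.IH)
    show "triangular J rs" using Cons.prems(1) by simp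
    show "j \<notin> fst s \<and> snd s j = 0" if "s \<in> set rs" "j \<in> J - K" for s j using Cons.prems(2)[of s j] that by simp
  qed
  moreover have "fst r \<noteq> {}" "\<forall>s\<in>set rs. fst s \<inter> fst r = {} \<and> (\<forall>j\<in>fst r. snd s j = 0)" using Cons.prems(1) by simp_all
  ultimately show ?case by simp
qed simp

lemma triangular_mono: "triangular J rs \<Longrightarrow> J \<subseteq> K \<Longrightarrow> triangular K rs"
  by (induction rs) auto

lemma comb_fun_upd:
  assumes "finite J" "j0 \<in> J" "g = g'(j0 := - comb (J - {j0}) g' c)"
  shows "comb J g f = comb (J - {j0}) g' (\<lambda>j. f j - f j0 * c j)"
proof -
  have "comb J g f = f j0 *\<^sub>R g j0 + comb (J - {j0}) g' f"
    unfolding comb_def using assms(1,2) by (subst sum.remove[of J j0]) (auto simp: assms(3) intro!: sum.cong)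
  also have "f j0 *\<^sub>R g j0 = - comb (J - {j0}) g' (\<lambda>j. f j0 * c j)" by (simp add: assms(3) comb_scale)
  finally show ?thesis by (simp add: comb_diff)
qed

lemma snd_comb: "(\<And>j. j \<in> J \<Longrightarrow> snd (g j) = real (d j)) \<Longrightarrow> snd (comb J g f) = (\<Sum>j\<in>J. f j * real (d j))"
  unfolding comb_def snd_sum by (intro sum.cong) auto

lemma rvec_Ints: "rvec r j \<in> \<int>" by (simp add: rvec_def)

text \<open>Without relations the variables other than \<open>o'\<close> become the unit vectors,
  lifted to their degrees, and \<open>o'\<close> becomes the origin at height one. A relation is
  realised by solving it for a leading variable different from \<open>o'\<close>, which occurs in no
  later relation.\<close>

lemma premodel_exists:
  assumes "finite J" "triangular J rs" "\<And>r. r \<in> set rs \<Longrightarrow> (\<Sum>j\<in>J. rvec r j * real (d j)) = 0"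
    "\<And>j. j \<in> J \<Longrightarrow> d j \<ge> 1" "o' \<in> J" "d o' = 1" "\<And>r. r \<in> set rs \<Longrightarrow> \<exists>j\<in>fst r. j \<noteq> o'"
    "card J = n + 1 + length rs"
  shows "\<exists>g. premodel n J rs d g"
  using assms
proof (induction rs arbitrary: J)
  case Nil
  have card: "card (J - {o'}) = n" using Nil by simp
  obtain e where e: "bij_betw e (J - {o'}) {0..<n}"
    using ex_bij_betw_finite_nat[of "J - {o'}"] Nil.prems(1) card by auto
  define g where "g = (\<lambda>j. if j = o' then (0, 1) else (single (e j) 1 :: vec, real (d j)))"
  have eb: "e j < n" if "j \<in> J" "j \<noteq> o'" for j using e that by (auto simp: bij_betw_def)
  have lk: "lookup (fst (comb J g f)) (e k) = f k" if "k \<in> J" "k \<noteq> o'" for f k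
  proof -
    have "lookup (fst (comb J g f)) (e k) = (\<Sum>j\<in>J. if j = k then f j else 0)"
      unfolding comb_def fst_sum lookup_sum'
    proof (intro sum.cong refl)
      fix j assume "j \<in> J"
      show "lookup (fst (f j *\<^sub>R g j)) (e k) = (if j = k then f j else 0)"
        using e that \<open>j \<in> J\<close> by (auto simp: g_def lookup_single when_def bij_betw_def inj_on_def)
    qed
    then show ?thesis using that Nil.prems(1) by simp
  qed
  have gL: "g j \<in> Lam n" if "j \<in> J" for j
    using eb[OF that] by (auto simp: g_def Lam_def lattice_iff rspace_iff lookup_single when_def)
  have gd: "snd (g j) = real (d j)" for j using Nil.prems by (simp add: g_def)
  have ker: "f j = 0" if f: "\<And>j. j \<notin> J \<Longrightarrow> f j = 0" "comb J g f = 0" for f j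
  proof -
    have z: "f k = 0" if "k \<in> J" "k \<noteq> o'" for k using lk[OF that, of f] f(2) by simp
    have "0 = snd (comb J g f)" using f(2) by simp
    also have "\<dots> = (\<Sum>j\<in>J. f j * real (d j))" by (rule snd_comb) (rule gd)
    also have "\<dots> = (\<Sum>j\<in>{o'}. f j * real (d j))" using z Nil.prems by (intro sum.mono_neutral_right) auto
    finally have "f o' = 0" using Nil.prems by simp
    then show ?thesis using z f(1) by (cases "j \<in> J"; cases "j = o'") auto
  qed
  have gen: "\<exists>f. (\<forall>j. f j \<in> \<int>) \<and> comb J g f = p" if p: "p \<in> Lam n" for p
  proof -
    obtain z t where zt: "p = (z, t)" by fastforce
    have z: "z \<in> lattice n" "t \<in> \<int>" using p zt by (auto simp: Lam_def)
    define f where "f = (\<lambda>j. if j = o' then t - (\<Sum>k\<in>J - {o'}. lookup z (e k) * real (d k)) else lookup z (e j))"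
    have fZ: "f j \<in> \<int>" for j using z by (auto simp: f_def lattice_iff intro!: Ints_diff Ints_sum)
    have "comb J g f \<in> VV n" unfolding comb_def by (intro VV_sum VV_scale Lam_VV gL)
    then have "fst (comb J g f) \<in> rspace n" by (simp add: VV_def mem_Times_iff)
    then have 1: "fst (comb J g f) = z"
    proof (rule rspace_eqI[OF _ lattice_rspace[OF z(1)]])
      fix i assume "i < n"
      then have "i \<in> e ` (J - {o'})" using e by (simp add: bij_betw_def)
      then obtain k where "k \<in> J" "k \<noteq> o'" "i = e k" by blast
      then show "lookup (fst (comb J g f)) i = lookup z i" using lk by (simp add: f_def)
    qed
    have "snd (comb J g f) = (\<Sum>j\<in>J. f j * real (d j))" by (rule snd_comb) (rule gd)
    also have "\<dots> = f o' * real (d o') + (\<Sum>j\<in>J - {o'}. f j * real (d j))" using Nil.prems by (intro sum.remove) auto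
    also have "(\<Sum>j\<in>J - {o'}. f j * real (d j)) = (\<Sum>k\<in>J - {o'}. lookup z (e k) * real (d k))"
      by (intro sum.cong) (auto simp: f_def)
    finally have "snd (comb J g f) = t" using Nil.prems by (simp add: f_def)
    then show ?thesis using 1 fZ zt by (intro exI[of _ f]) (auto simp: prod_eq_iff)
  qed
  have "premodel n J [] d g"
    unfolding premodel_def using Nil.prems gL gd ker gen by auto
  then show ?case by blast
next
  case (Cons r rs)
  obtain j0 where j0: "j0 \<in> fst r" "j0 \<noteq> o'" using Cons.prems(7)[of r] by auto
  note tri = Cons.prems(2)
  have j0J: "j0 \<in> J" using tri j0 by auto
  have r1: "rvec r j0 = 1" by (rule rvec_lead[OF tri j0(1)])
  have s0: "rvec s j0 = 0" if "s \<in> set rs" for s by (rule rvec_tail[OF tri j0(1) that])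
  have J': "J - {j0} = J \<inter> (- {j0})" by auto
  have tri': "triangular (J - {j0}) rs"
    unfolding J' by (rule triangular_subset) (use tri j0 in auto)
  have hom': "(\<Sum>j\<in>J - {j0}. rvec s j * real (d j)) = 0" if "s \<in> set rs" for s
    using Cons.prems(3)[of s] that s0[OF that] Cons.prems(1) j0J by (simp add: sum.remove[of J j0])
  have c: "card (J - {j0}) = n + 1 + length rs" using Cons.prems j0J by simp
  have "\<exists>g. premodel n (J - {j0}) rs d g"
    by (rule Cons.IH) (use Cons.prems tri' hom' c j0 in auto)
  then obtain g' where g': "premodel n (J - {j0}) rs d g'" by blast
  define g where "g = g'(j0 := - comb (J - {j0}) g' (rvec r))"
  note cg = comb_fun_upd[OF Cons.prems(1) j0J g_def]
  have "g j0 \<in> Lam n"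
  proof -
    have "comb (J - {j0}) g' (rvec r) \<in> Lam n"
      unfolding comb_def by (intro Lam_sum Lam_scale pm_Lam[OF g'] rvec_Ints)
    then show ?thesis using Lam_diff[OF Lam_0, of _ n] by (simp add: g_def)
  qed
  moreover have "snd (g j0) = real (d j0)"
  proof -
    have "snd (g j0) = - (\<Sum>j\<in>J - {j0}. rvec r j * real (d j))"
      using snd_comb[of "J - {j0}" g' d "rvec r"] pm_deg[OF g'] by (simp add: g_def)
    also have "\<dots> = real (d j0)" using Cons.prems(3)[of r] Cons.prems(1) j0J r1 by (simp add: sum.remove[of J j0])
    finally show ?thesis .
  qed
  ultimately have 1: "\<forall>j\<in>J. g j \<in> Lam n \<and> snd (g j) = real (d j) \<and> d j \<ge> 1"
    using pm_Lam[OF g'] pm_deg[OF g'] Cons.prems(4) by (auto simp: g_def)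
  have 2: "comb J g (rvec s) = 0" if "s \<in> set (r # rs)" for s
  proof (cases "s = r")
    case True then show ?thesis unfolding cg using r1 by simp
  next
    case False
    then have "s \<in> set rs" using that by simp
    then show ?thesis unfolding cg using s0 pm_rel[OF g'] by simp
  qed
  have 3: "in_span (r # rs) f" if f: "\<forall>j. j \<notin> J \<longrightarrow> f j = 0" "comb J g f = 0" for f
  proof -
    have "in_span rs (\<lambda>j. f j - f j0 * rvec r j)"
    proof (rule pm_ker[OF g'])
      fix j assume "j \<notin> J - {j0}"
      then show "f j - f j0 * rvec r j = 0" using f(1) r1 rvec_outside[OF tri, of r j] by (cases "j = j0") auto
    qed (use f(2) cg in simp)
    then show ?thesis by auto
  qed
  have 4: "\<exists>f. (\<forall>j. f j \<in> \<int>) \<and> comb J g f = p" if p: "p \<in> Lam n" for p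
  proof -
    obtain f where f: "\<forall>j. f j \<in> \<int>" "\<forall>j. j \<notin> J - {j0} \<longrightarrow> f j = 0" "comb (J - {j0}) g' f = p" using pm_gen'[OF g' p] by blast
    then show ?thesis by (intro exI[of _ f]) (simp add: cg)
  qed
  show ?case using Cons.prems(1) tri 1 2 3 4 unfolding premodel_def by (intro exI[of _ g]) blast
qed

text \<open>Such a relation writes a multiple of \<open>g j\<close> as a sum of degree-one
  generators, which places \<open>g j\<close> in the cone even if its degree exceeds one.\<close>

definition single_power :: "rel list \<Rightarrow> (nat \<Rightarrow> nat) \<Rightarrow> nat \<Rightarrow> bool" where
  "single_power rs d j \<longleftrightarrow> (\<exists>r\<in>set rs. \<exists>c\<ge>1. (\<forall>i\<in>fst r. d i = 1) \<and> snd r = (\<lambda>i. if i = j then c else 0))"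

lemma model_of_premodel:
  assumes pm: "premodel n J rs d g" and ne: "J - leads rs \<noteq> {}"
    and deg: "\<And>j. j \<in> J \<Longrightarrow> d j = 1 \<or> single_power rs d j" and one: "\<exists>j\<in>J. d j = 1"
  shows "model n J rs d g (convex hull (fst ` g ` {j\<in>J. d j = 1}))"
proof -
  let ?P = "convex hull (fst ` g ` {j\<in>J. d j = 1})"
  note fin = pm_fin[OF pm] and tri = pm_tri[OF pm]
  have g1: "g j \<in> cone_over ?P" if "j \<in> J" "d j = 1" for j
  proof -
    have "fst (g j) \<in> ?P" using that by (intro hull_inc) auto
    moreover have "g j = (1 *\<^sub>R fst (g j), 1)" using pm_deg[OF pm that(1)] that by (simp add: prod_eq_iff)
    ultimately show ?thesis unfolding cone_over_def
      by (intro CollectI exI[of _ "1::real"] exI[of _ "fst (g j)"] conjI) auto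
  qed
  have "g j \<in> cone_over ?P" if j: "j \<in> J" for j
    using deg[OF j]
  proof
    assume "single_power rs d j"
    then obtain r c where r: "r \<in> set rs" "c \<ge> 1" "\<forall>i\<in>fst r. d i = 1" "snd r = (\<lambda>i. if i = j then c else 0)"
      by (auto simp: single_power_def)
    have rJ: "fst r \<subseteq> J" using triangular_mem[OF tri r(1)] by simp
    have "0 = comb J g (rvec r)" using pm_rel[OF pm r(1)] by simp
    also have "\<dots> = (\<Sum>i\<in>J. (if i \<in> fst r then g i else 0) - (if i = j then real c *\<^sub>R g i else 0))"
      unfolding comb_def by (intro sum.cong) (auto simp: rvec_def r(4) scaleR_diff_left)
    also have "\<dots> = (\<Sum>i\<in>fst r. g i) - real c *\<^sub>R g j"
      using fin rJ j by (simp add: sum_subtractf sum.inter_restrict[symmetric] inf.absorb2)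
    finally have "real c *\<^sub>R g j = (\<Sum>i\<in>fst r. g i)" by simp
    then have "(1 / real c) *\<^sub>R (real c *\<^sub>R g j) = (1 / real c) *\<^sub>R (\<Sum>i\<in>fst r. g i)" by simp
    then have "g j = (1 / real c) *\<^sub>R (\<Sum>i\<in>fst r. g i)" using r(2) by simp
    moreover have "?P \<noteq> {}" using one by auto
    ultimately show ?thesis using g1 r(3) rJ by (auto intro!: cone_over_scale cone_over_sum)
  qed (use g1 j in auto)
  then show ?thesis unfolding model_def using pm ne by blast
qed

text \<open>\<open>lattice_iso\<close> asks for a linear map on all of \<open>vec\<close>, while
  isomorphisms are first built on lattice points; the standard basis determines the
  extension.\<close>

lemma additive_lattice_linear:
  fixes F :: "vec \<times> real \<Rightarrow> 'b::real_vector"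
  assumes add: "\<And>x y. x \<in> Lam n \<Longrightarrow> y \<in> Lam n \<Longrightarrow> F (x + y) = F x + F y"
  shows "\<exists>G. linear G \<and> (\<forall>p\<in>Lam n. G p = F p)"
proof -
  have F0: "F 0 = 0" using add[of 0 0] by simp
  have Fneg: "F (- x) = - F x" if "x \<in> Lam n" for x
    using add[of x "- x"] Lam_diff[OF Lam_0 that] that F0 by (simp add: eq_neg_iff_add_eq_0 add.commute)
  have Fnat: "F (real k *\<^sub>R x) = real k *\<^sub>R F x" if "x \<in> Lam n" for k x
  proof (induction k)
    case (Suc k)
    have "F (real (Suc k) *\<^sub>R x) = F (x + real k *\<^sub>R x)" by (simp add: scaleR_add_left)
    also have "\<dots> = F x + real k *\<^sub>R F x" using that Suc by (subst add) (auto intro: Lam_scale)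
    finally show ?case by (simp add: scaleR_add_left)
  qed (simp add: F0)
  have Fint: "F (c *\<^sub>R x) = c *\<^sub>R F x" if x: "x \<in> Lam n" and c: "c \<in> \<int>" for c x
  proof -
    obtain k :: int where k: "c = of_int k" using c by (auto elim: Ints_cases)
    show ?thesis
    proof (cases "k \<ge> 0")
      case True
      then have "c = real (nat k)" using k by simp
      then show ?thesis using Fnat[OF x] by simp
    next
      case False
      then have c': "c = - real (nat (- k))" using k by simp
      have "F (c *\<^sub>R x) = F (- (real (nat (- k)) *\<^sub>R x))" by (simp add: c')
      also have "\<dots> = - F (real (nat (- k)) *\<^sub>R x)" using x by (intro Fneg Lam_scale) auto
      finally show ?thesis using Fnat[OF x] by (simp add: c')
    qed
  qed
  have Fsum: "F (sum h A) = (\<Sum>a\<in>A. F (h a))" if "\<And>a. a \<in> A \<Longrightarrow> h a \<in> Lam n" for h and A :: "nat set"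
    using that
  proof (induction A rule: infinite_finite_induct)
    case (insert a A)
    then show ?case by (subst sum.insert) (auto simp: add Lam_sum)
  qed (simp_all add: F0)
  define G where "G = (\<lambda>p. (\<Sum>i<n. lookup (fst p) i *\<^sub>R F (single i 1, 0)) + snd p *\<^sub>R F (0, 1))"
  have "linear G"
    unfolding G_def by (rule linearI) (simp_all add: lookup_add scaleR_add_left sum.distrib scaleR_add_right scaleR_sum_right)
  moreover have "G p = F p" if p: "p \<in> Lam n" for p
  proof -
    have Z: "lookup (fst p) i \<in> \<int>" "snd p \<in> \<int>" for i using p by (auto simp: Lam_def lattice_iff)
    have "F p = F ((\<Sum>i<n. lookup (fst p) i *\<^sub>R (single i 1, 0)) + snd p *\<^sub>R (0, 1))"
      using VV_decomp[OF Lam_VV[OF p]] by simp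
    also have "\<dots> = (\<Sum>i<n. F (lookup (fst p) i *\<^sub>R (single i 1, 0))) + F (snd p *\<^sub>R (0, 1))"
    proof (subst add)
      show "(\<Sum>i<n. lookup (fst p) i *\<^sub>R (single i 1, 0)) \<in> Lam n"
        by (intro Lam_sum Lam_scale Z unit_in_Lam) auto
      show "snd p *\<^sub>R (0, 1) \<in> Lam n" by (intro Lam_scale Z unit_in_Lam)
    qed (subst Fsum, auto simp del: scaleR_Pair intro!: Lam_scale Z unit_in_Lam)
    also have "\<dots> = G p" unfolding G_def
      using Fint[OF unit_in_Lam(1) Z(1)] Fint[OF unit_in_Lam(2) Z(2)] by (intro arg_cong2[where f = "(+)"] sum.cong) auto
    finally show ?thesis by simp
  qed
  ultimately show ?thesis by blast
qed

text \<open>Dehomogenisation: a degree-preserving linear map restricts to height one, where it is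
  affine with linear part given by \<open>G (z, 0)\<close> and translation by
  \<open>G (0, 1)\<close>.\<close>

lemma graded_lattice_iso:
  assumes lin: "linear G" and bij: "bij_betw G (Lam n) (Lam m)" and deg: "\<And>p. p \<in> Lam n \<Longrightarrow> snd (G p) = snd p"
  shows "lattice_iso n (convex hull W) m (convex hull ((\<lambda>w. fst (G (w, 1))) ` W))"
proof -
  define A where "A = (\<lambda>z. fst (G (z, 0)))"
  define b where "b = fst (G (0, 1))"
  have Apair: "fst (G (z, 1)) = A z + b" for z
  proof -
    have "G (z, 1) = G ((z, 0) + (0, 1))" by simp
    then show ?thesis unfolding A_def b_def linear_add[OF lin] by simp
  qed
  have linA: "linear A"
  proof (rule linearI)
    show "A (x + y) = A x + A y" for x y
      using linear_add[OF lin, of "(x, 0)" "(y, 0)"] by (simp add: A_def)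
    show "A (c *\<^sub>R x) = c *\<^sub>R A x" for c x
      using linear_scale[OF lin, of c "(x, 0)"] by (simp add: A_def)
  qed
  have "bij_betw (\<lambda>x. A x + b) (lattice n) (lattice m)"
  proof (rule bij_betw_imageI)
    have L: "(x, 1) \<in> Lam n" if "x \<in> lattice n" for x using that by (simp add: Lam_def)
    have G1: "G (x, 1) = (A x + b, 1)" if "x \<in> lattice n" for x
      using deg[OF L[OF that]] Apair by (simp add: prod_eq_iff)
    show "inj_on (\<lambda>x. A x + b) (lattice n)"
    proof (rule inj_onI)
      fix x y assume "x \<in> lattice n" "y \<in> lattice n" "A x + b = A y + b"
      then show "x = y" using bij G1 L unfolding bij_betw_def inj_on_def by (metis prod.inject)
    qed
    show "(\<lambda>x. A x + b) ` lattice n = lattice m"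
    proof (intro equalityI subsetI)
      fix y assume "y \<in> (\<lambda>x. A x + b) ` lattice n"
      then obtain x where x: "x \<in> lattice n" "y = A x + b" by blast
      have "G (x, 1) \<in> Lam m" using bij L[OF x(1)] by (auto simp: bij_betw_def)
      then show "y \<in> lattice m" using G1[OF x(1)] x(2) by (simp add: Lam_def)
    next
      fix y assume "y \<in> lattice m"
      then have "(y, 1) \<in> Lam m" by (simp add: Lam_def)
      then obtain p where p: "p \<in> Lam n" "G p = (y, 1)" using bij unfolding bij_betw_def by (metis imageE)
      then have "p = (fst p, 1)" using deg[OF p(1)] by (simp add: prod_eq_iff)
      moreover have "fst p \<in> lattice n" using p by (auto simp: Lam_def)
      ultimately show "y \<in> (\<lambda>x. A x + b) ` lattice n" using G1[of "fst p"] p(2) by (intro image_eqI[of _ _ "fst p"]) auto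
    qed
  qed
  moreover have "(\<lambda>x. A x + b) ` (convex hull W) = convex hull ((\<lambda>w. fst (G (w, 1))) ` W)"
    unfolding convex_hull_affine_image[OF linA] Apair ..
  ultimately show ?thesis unfolding lattice_iso_def using linA by blast
qed

text \<open>Both families of generators have the same relations, so sending
  \<open>comb J g f\<close> to \<open>comb J h f\<close> is well defined and injective on the
  lattice; surjectivity is generation.\<close>

lemma models_isomorphic:
  assumes m1: "model n J rs d g P" and m2: "model m J rs d h Q"
  shows "lattice_iso n P m Q"
proof -
  have p1: "premodel n J rs d g" and p2: "premodel m J rs d h" using m1 m2 by (auto simp: model_def)
  have "\<exists>c. \<forall>p\<in>Lam n. (\<forall>j. c p j \<in> \<int>) \<and> (\<forall>j. j \<notin> J \<longrightarrow> c p j = 0) \<and> comb J g (c p) = p"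
    by (rule bchoice) (use pm_gen'[OF p1] in blast)
  then obtain c where c: "\<And>p j. p \<in> Lam n \<Longrightarrow> c p j \<in> \<int>" "\<And>p j. p \<in> Lam n \<Longrightarrow> j \<notin> J \<Longrightarrow> c p j = 0"
    "\<And>p. p \<in> Lam n \<Longrightarrow> comb J g (c p) = p" by blast
  define F where "F = (\<lambda>p. comb J h (c p))"
  have Lcomb: "comb J g f \<in> Lam n" if "\<And>j. f j \<in> \<int>" for f
    unfolding comb_def by (intro Lam_sum Lam_scale pm_Lam[OF p1] that)
  have Lcomb2: "comb J h f \<in> Lam m" if "\<And>j. f j \<in> \<int>" for f
    unfolding comb_def by (intro Lam_sum Lam_scale pm_Lam[OF p2] that)
  have F: "F (comb J g f) = comb J h f" if f: "\<And>j. f j \<in> \<int>" "\<And>j. j \<notin> J \<Longrightarrow> f j = 0" for f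
  proof -
    note L = Lcomb[OF f(1)]
    have "in_span rs (\<lambda>j. c (comb J g f) j - f j)"
      using pm_comb_eq_iff[OF p1, of "c (comb J g f)" f] c(2)[OF L] c(3)[OF L] f(2) by auto
    then show ?thesis unfolding F_def using pm_comb_eq_iff[OF p2, of "c (comb J g f)" f] c(2)[OF L] f(2) by auto
  qed
  have "F (x + y) = F x + F y" if "x \<in> Lam n" "y \<in> Lam n" for x y
  proof -
    have "x + y = comb J g (\<lambda>j. c x j + c y j)" using that by (simp add: comb_add c)
    then have "F (x + y) = comb J h (\<lambda>j. c x j + c y j)" using that c by (simp add: F)
    then show ?thesis by (simp add: comb_add F_def)
  qed
  from additive_lattice_linear[of n F, OF this] obtain G where G: "linear G" "\<And>p. p \<in> Lam n \<Longrightarrow> G p = F p" by blast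
  have bij: "bij_betw G (Lam n) (Lam m)"
  proof (rule bij_betw_imageI)
    show "inj_on G (Lam n)"
    proof (rule inj_onI)
      fix x y assume xy: "x \<in> Lam n" "y \<in> Lam n" "G x = G y"
      then have "comb J h (c x) = comb J h (c y)" using G(2) by (simp add: F_def)
      then have "comb J g (c x) = comb J g (c y)"
        using pm_comb_eq_iff[OF p2, of "c x" "c y"] pm_comb_eq_iff[OF p1, of "c x" "c y"] c(2) xy by auto
      then show "x = y" using c(3) xy by simp
    qed
    show "G ` Lam n = Lam m"
    proof (intro equalityI subsetI)
      fix y assume "y \<in> G ` Lam n"
      then show "y \<in> Lam m" using G(2) c(1) by (auto simp: F_def intro!: Lcomb2)
    next
      fix y assume "y \<in> Lam m"
      then obtain f where f: "\<And>j. f j \<in> \<int>" "\<And>j. j \<notin> J \<Longrightarrow> f j = 0" "comb J h f = y" using pm_gen'[OF p2] by blast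
      then show "y \<in> G ` Lam n" using F[OF f(1,2)] G(2)[OF Lcomb[OF f(1)]] Lcomb[OF f(1)] by (intro image_eqI[of _ _ "comb J g f"]) auto
    qed
  qed
  have sndG: "snd (G p) = snd p" if "p \<in> Lam n" for p
  proof -
    have "snd (comb J h (c p)) = snd (comb J g (c p))"
      by (simp add: snd_comb[of J h d, OF pm_deg[OF p2]] snd_comb[of J g d, OF pm_deg[OF p1]])
    then show ?thesis using G(2)[OF that] c(3)[OF that] by (simp add: F_def)
  qed
  have "(\<lambda>w. fst (G (w, 1))) ` fst ` g ` {j\<in>J. d j = 1} = fst ` h ` {j\<in>J. d j = 1}"
    unfolding image_image
  proof (rule image_cong[OF refl])
    fix j assume j: "j \<in> {j\<in>J. d j = 1}"
    then have g: "(fst (g j), 1) = g j" using pm_deg[OF p1, of j] by (simp add: prod_eq_iff)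
    have "G (g j) = F (comb J g (\<lambda>i. if i = j then 1 else 0))"
      using j comb_unit[OF pm_fin[OF p1]] G(2) pm_Lam[OF p1] by simp
    also have "\<dots> = h j" using j by (subst F) (auto simp: comb_unit[OF pm_fin[OF p1]])
    finally show "fst (G (fst (g j), 1)) = fst (h j)" using g by simp
  qed
  then show ?thesis using graded_lattice_iso[OF G(1) bij sndG, of "fst ` g ` {j\<in>J. d j = 1}"] m1 m2 by (simp add: model_def)
qed

text \<open>The homogenised affine isomorphism moves the generators. It is controlled only on
  lattice points, so the injectivity on real vectors that the relations need comes from a linear
  extension of the inverse.\<close>

lemma model_transport:
  assumes m: "model n J rs d g P" and iso: "lattice_iso n P m Q"
  shows "\<exists>h. model m J rs d h Q"
proof -
  have pm: "premodel n J rs d g" using m by (auto simp: model_def)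
  obtain A b where A: "linear A" "bij_betw (\<lambda>x. A x + b) (lattice n) (lattice m)" "(\<lambda>x. A x + b) ` P = Q"
    using iso by (auto simp: lattice_iso_def)
  define G where "G = (\<lambda>p :: vec \<times> real. (A (fst p) + snd p *\<^sub>R b, snd p))"
  have linG: "linear G"
    unfolding G_def by (rule linearI) (simp_all add: linear_add[OF A(1)] linear_scale[OF A(1)] scaleR_add_left scaleR_add_right)
  have b: "b \<in> lattice m" using A(2) linear_0[OF A(1)] by (auto simp: bij_betw_def intro!: rev_image_eqI[of 0])
  have AL: "A x + b \<in> lattice m" if "x \<in> lattice n" for x using A(2) that by (auto simp: bij_betw_def)
  have A': "A x \<in> lattice m" if "x \<in> lattice n" for x using lattice_diff[OF AL[OF that] b] by simp
  have bij: "bij_betw G (Lam n) (Lam m)"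
  proof (rule bij_betw_imageI)
    show "inj_on G (Lam n)"
    proof (rule inj_onI)
      fix p q assume pq: "p \<in> Lam n" "q \<in> Lam n" "G p = G q"
      then have "A (fst p) + b = A (fst q) + b" "snd p = snd q" by (auto simp: G_def)
      moreover have "fst p \<in> lattice n" "fst q \<in> lattice n" using pq by (auto simp: Lam_def)
      ultimately have "fst p = fst q" using A(2) by (auto simp: bij_betw_def inj_on_def)
      then show "p = q" using \<open>snd p = snd q\<close> by (simp add: prod_eq_iff)
    qed
    show "G ` Lam n = Lam m"
    proof (intro equalityI subsetI)
      fix y assume "y \<in> G ` Lam n"
      then show "y \<in> Lam m" by (auto simp: G_def Lam_def intro!: lattice_add A' lattice_scale b)
    next
      fix y assume y: "y \<in> Lam m"
      then have "fst y - snd y *\<^sub>R b + b \<in> lattice m" by (auto simp: Lam_def intro!: lattice_add lattice_diff lattice_scale b)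
      then have "fst y - snd y *\<^sub>R b + b \<in> (\<lambda>x. A x + b) ` lattice n" using A(2) by (simp add: bij_betw_def)
      then obtain x where x: "x \<in> lattice n" "A x + b = fst y - snd y *\<^sub>R b + b" by auto
      then have "G (x, snd y) = y" by (simp add: G_def prod_eq_iff)
      moreover have "(x, snd y) \<in> Lam n" using x y by (auto simp: Lam_def)
      ultimately show "y \<in> G ` Lam n" by (metis imageI)
    qed
  qed
  define H where "H = inv_into (Lam n) G"
  have HL: "H y \<in> Lam n" "G (H y) = y" if "y \<in> Lam m" for y
    using bij that by (auto simp: H_def bij_betw_def inv_into_into f_inv_into_f)
  have HG: "H (G x) = x" if "x \<in> Lam n" for x using bij that by (auto simp: H_def bij_betw_def)
  have "H (x + y) = H x + H y" if "x \<in> Lam m" "y \<in> Lam m" for x y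
  proof -
    have "G (H x + H y) = x + y" using HL that by (simp add: linear_add[OF linG])
    then show ?thesis using HG[OF Lam_add[OF HL(1)[OF that(1)] HL(1)[OF that(2)]]] by simp
  qed
  from additive_lattice_linear[of m H, OF this] obtain H' where H': "linear H'" "\<And>y. y \<in> Lam m \<Longrightarrow> H' y = H y" by blast
  have H'G: "H' (G p) = p" if "p \<in> VV n" for p
  proof -
    have "(H' \<circ> G) p = id p"
    proof (rule VV_induct_linear[OF linear_compose[OF linG H'(1)] _ _ that])
      show "linear (id :: vec \<times> real \<Rightarrow> _)" by (simp add: linear_iff)
      fix p assume "p \<in> Lam n"
      then show "(H' \<circ> G) p = id p" using H'(2)[of "G p"] HG bij by (auto simp: bij_betw_def)
    qed
    then show ?thesis by simp
  qed
  define h where "h = (\<lambda>j. G (g j))"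
  have ch: "comb J h f = G (comb J g f)" for f
    by (simp add: comb_def h_def linear_sum[OF linG] linear_scale[OF linG])
  have gV: "comb J g f \<in> VV n" for f unfolding comb_def by (intro VV_sum VV_scale Lam_VV pm_Lam[OF pm])
  have "premodel m J rs d h"
    unfolding premodel_def
  proof (intro conjI ballI allI impI)
    show "finite J" "triangular J rs" using pm_fin[OF pm] pm_tri[OF pm] .
    fix j assume "j \<in> J"
    then show "h j \<in> Lam m" "snd (h j) = real (d j)" "1 \<le> d j"
      using pm_Lam[OF pm] pm_deg[OF pm] pm_pos[OF pm] bij by (auto simp: h_def bij_betw_def) (auto simp: G_def)
  next
    fix r assume "r \<in> set rs"
    then show "comb J h (rvec r) = 0" using pm_rel[OF pm] linear_0[OF linG] by (simp add: ch)
  next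
    fix f assume f: "\<forall>j. j \<notin> J \<longrightarrow> f j = 0" "comb J h f = 0"
    then have "comb J g f = 0" using H'G[OF gV, of f] linear_0[OF H'(1)] by (simp add: ch)
    then show "in_span rs f" using f pm_ker[OF pm] by blast
  next
    fix p assume p: "p \<in> Lam m"
    then show "\<exists>f. (\<forall>j. f j \<in> \<int>) \<and> comb J h f = p" using pm_gen[OF pm HL(1)[OF p]] HL(2)[OF p] unfolding ch by metis
  qed
  moreover have "Q = convex hull (fst ` h ` {j\<in>J. d j = 1})"
  proof -
    have Pc: "P = convex hull (fst ` g ` {j\<in>J. d j = 1})" using m by (simp add: model_def)
    have "Q = convex hull ((\<lambda>x. A x + b) ` fst ` g ` {j\<in>J. d j = 1})"
      unfolding A(3)[symmetric] Pc by (rule convex_hull_affine_image[OF A(1)])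
    also have "(\<lambda>x. A x + b) ` fst ` g ` {j\<in>J. d j = 1} = fst ` h ` {j\<in>J. d j = 1}"
      unfolding image_image by (rule image_cong[OF refl]) (auto simp: h_def G_def pm_deg[OF pm])
    finally show ?thesis .
  qed
  moreover have "h j \<in> cone_over Q" if "j \<in> J" for j
  proof -
    obtain x t where x: "g j = (t *\<^sub>R x, t)" "t \<ge> 0" "x \<in> P" using m \<open>j \<in> J\<close> by (fastforce simp: model_def cone_over_def)
    have "h j = (t *\<^sub>R (A x + b), t)" by (simp add: h_def G_def x linear_scale[OF A(1)] scaleR_add_right)
    then show ?thesis using x A(3) by (auto simp: cone_over_def)
  qed
  ultimately show ?thesis using m unfolding model_def by blast
qed

section \<open>Free variables and pyramids\<close>

lemma premodel_insert:
  assumes pm: "premodel m J rs d h" and l: "l \<notin> J" "d l = 1"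
  shows "premodel (Suc m) (insert l J) rs d (h(l := (single m 1, 1)))" (is "premodel _ _ _ _ ?h")
proof -
  have fin: "finite J" by (rule pm_fin[OF pm])
  have c: "comb (insert l J) ?h f = f l *\<^sub>R (single m 1, 1) + comb J h f" for f
    unfolding comb_def using fin l(1) by (auto simp: intro!: sum.cong)
  have lat: "lattice m \<subseteq> lattice (Suc m)" by (auto simp: lattice_iff rspace_iff)
  have rl: "rvec r l = 0" if "r \<in> set rs" for r using rvec_outside[OF pm_tri[OF pm] that l(1)] .
  have lookm: "lookup (fst (comb J h f)) m = 0" for f
  proof -
    have "comb J h f \<in> VV m" unfolding comb_def by (intro VV_sum VV_scale Lam_VV pm_Lam[OF pm])
    then show ?thesis by (auto simp: VV_def rspace_iff mem_Times_iff)
  qed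
  show ?thesis
    unfolding premodel_def
  proof (intro conjI ballI allI impI)
    show "finite (insert l J)" using fin by simp
    show "triangular (insert l J) rs" using pm_tri[OF pm] triangular_mono by blast
    fix j assume j: "j \<in> insert l J"
    show "?h j \<in> Lam (Suc m)"
    proof (cases "j = l")
      case True then show ?thesis by (auto simp: Lam_def lattice_iff rspace_iff lookup_single when_def)
    next
      case False then show ?thesis using j pm_Lam[OF pm, of j] lat by (auto simp: Lam_def)
    qed
    show "snd (?h j) = real (d j)" "1 \<le> d j" using j l pm_deg[OF pm] pm_pos[OF pm] by auto
  next
    fix r assume "r \<in> set rs"
    then show "comb (insert l J) ?h (rvec r) = 0" using pm_rel[OF pm] rl by (simp add: c zero_prod_def)
  next
    fix f assume f: "\<forall>j. j \<notin> insert l J \<longrightarrow> f j = 0" "comb (insert l J) ?h f = 0"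
    have "lookup (fst (comb (insert l J) ?h f)) m = f l" unfolding c using lookm by (simp add: lookup_add)
    then have fl: "f l = 0" using f(2) by simp
    then have "comb J h f = 0" using f(2) c by (simp add: zero_prod_def[symmetric])
    then show "in_span rs f" using f(1) fl by (intro pm_ker[OF pm]) auto
  next
    fix p assume p: "p \<in> Lam (Suc m)"
    define k where "k = lookup (fst p) m"
    have k: "k \<in> \<int>" using p by (auto simp: k_def Lam_def lattice_iff mem_Times_iff)
    have "p - k *\<^sub>R (single m 1, 1) \<in> Lam m"
    proof -
      have "snd p - k \<in> \<int>" using p k by (auto simp: Lam_def mem_Times_iff)
      moreover have "fst p - k *\<^sub>R single m 1 \<in> lattice m"
        unfolding lattice_iff rspace_iff
      proof (intro conjI allI impI)
        fix i assume "m \<le> i"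
        then show "lookup (fst p - k *\<^sub>R single m 1) i = 0"
          using p by (cases "i = m") (auto simp: lookup_minus lookup_single when_def k_def Lam_def lattice_iff rspace_iff mem_Times_iff)
      next
        fix i show "lookup (fst p - k *\<^sub>R single m 1) i \<in> \<int>"
          using p k by (auto simp: lookup_minus lookup_single when_def Lam_def lattice_iff mem_Times_iff)
      qed
      ultimately show ?thesis by (auto simp: Lam_def mem_Times_iff)
    qed
    then obtain f where f: "\<forall>j. f j \<in> \<int>" "\<forall>j. j \<notin> J \<longrightarrow> f j = 0" "comb J h f = p - k *\<^sub>R (single m 1, 1)"
      using pm_gen'[OF pm] by blast
    have "comb (insert l J) ?h (f(l := k)) = k *\<^sub>R (single m 1, 1) + comb J h (f(l := k))" by (simp add: c)
    also have "comb J h (f(l := k)) = comb J h f" using l by (intro comb_cong) auto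
    also have "k *\<^sub>R (single m 1, 1) + comb J h f = p" unfolding f(3) by (simp del: scaleR_Pair)
    finally have "comb (insert l J) ?h (f(l := k)) = p" .
    moreover have "\<forall>j. (f(l := k)) j \<in> \<int>" using f(1) k by simp
    ultimately show "\<exists>f. (\<forall>j. f j \<in> \<int>) \<and> comb (insert l J) ?h f = p" by blast
  qed
qed

lemma model_insert_pyramid:
  assumes m: "model m J rs d h P" and l: "l \<notin> J" "d l = 1"
  shows "model (Suc m) (insert l J) rs d (h(l := (single m 1, 1))) (pyramid m P)" (is "model _ _ _ _ ?h _")
proof -
  have pm: "premodel m J rs d h" and P: "P = convex hull (fst ` h ` {j\<in>J. d j = 1})" using m by (auto simp: model_def)
  have "{j\<in>insert l J. d j = 1} = insert l {j\<in>J. d j = 1}" using l by auto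
  moreover have "fst ` ?h ` {j\<in>J. d j = 1} = fst ` h ` {j\<in>J. d j = 1}" using l by (auto simp: image_iff)
  ultimately have "fst ` ?h ` {j\<in>insert l J. d j = 1} = insert (single m 1) (fst ` h ` {j\<in>J. d j = 1})"
    by (simp only: image_insert fun_upd_same fst_conv)
  then have Q: "pyramid m P = convex hull (fst ` ?h ` {j\<in>insert l J. d j = 1})"
    unfolding pyramid_def P by (simp add: hull_insert[symmetric])
  have sub: "P \<subseteq> pyramid m P" unfolding pyramid_def by (meson hull_subset insert_subset)
  have "?h j \<in> cone_over (pyramid m P)" if "j \<in> insert l J" for j
  proof (cases "j = l")
    case True
    have "single m 1 \<in> pyramid m P" unfolding pyramid_def by (intro hull_inc) auto
    then show ?thesis using True by (auto simp: cone_over_def intro!: exI[of _ "1::real"])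
  next
    case False
    then have "h j \<in> cone_over P" using m that by (auto simp: model_def)
    then show ?thesis using False sub by (auto simp: cone_over_def)
  qed
  moreover have "insert l J - leads rs \<noteq> {}" using m by (auto simp: model_def)
  ultimately show ?thesis unfolding model_def using premodel_insert[OF pm l] Q by blast
qed

text \<open>Deleting the free variable leaves a system with a model one dimension lower. The pyramid
  over that model is a model of the same system as \<open>P\<close>, and a model is unique up to
  isomorphism.\<close>

lemma free_variable_pyramid:
  assumes m: "model (Suc m) (insert l J) rs d g P" and l: "l \<notin> J" "d l = 1"
    and J: "finite J" "triangular J rs" "o' \<in> J" "d o' = 1" "\<And>r. r \<in> set rs \<Longrightarrow> \<exists>j\<in>fst r. j \<noteq> o'"
      "card J = m + 1 + length rs" "J - leads rs \<noteq> {}"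
    and deg: "\<And>j. j \<in> J \<Longrightarrow> d j = 1 \<or> single_power rs d j"
  shows "gorenstein_pyramid (Suc m) P"
proof -
  have pm: "premodel (Suc m) (insert l J) rs d g" using m by (auto simp: model_def)
  have "(\<Sum>j\<in>J. rvec r j * real (d j)) = 0" if r: "r \<in> set rs" for r
  proof -
    have "0 = snd (comb (insert l J) g (rvec r))" using pm_rel[OF pm r] by simp
    also have "\<dots> = (\<Sum>j\<in>insert l J. rvec r j * real (d j))" by (rule snd_comb[OF pm_deg[OF pm]])
    finally show ?thesis using J(1) l(1) rvec_outside[OF J(2) r l(1)] by simp
  qed
  then obtain h where h: "premodel m J rs d h" using premodel_exists[of J rs d o' m] J pm_pos[OF pm] by blast
  define P' where "P' = convex hull (fst ` h ` {j\<in>J. d j = 1})"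
  have m': "model m J rs d h P'" unfolding P'_def using h J deg by (intro model_of_premodel) auto
  have "lattice_iso (Suc m) P (Suc m) (pyramid m P')" by (rule models_isomorphic[OF m model_insert_pyramid[OF m' l]])
  then show ?thesis unfolding gorenstein_pyramid_def using model_gorenstein(1)[OF m'] by blast
qed

section \<open>Presentations of semigroup algebras\<close>

text \<open>The semigroup element to which \<open>monomial_hom\<close> sends the monomial
  \<open>m\<close>, written additively.\<close>

definition phi :: "(nat \<Rightarrow> vec \<times> real) \<Rightarrow> (nat \<Rightarrow>\<^sub>0 nat) \<Rightarrow> vec \<times> real" where
  "phi g m = (\<Sum>j\<in>keys m. real (lookup m j) *\<^sub>R g j)"

lemma phi_superset:
  assumes "finite J" "keys m \<subseteq> J"
  shows "phi g m = comb J g (\<lambda>j. real (lookup m j))"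
  unfolding phi_def comb_def using assms by (intro sum.mono_neutral_left) (auto simp: in_keys_iff)

lemma phi_add: "phi g (a + b) = phi g a + phi g b"
proof -
  let ?J = "keys a \<union> keys b"
  have "keys (a + b) \<subseteq> ?J" by (rule keys_add)
  then show ?thesis
    by (simp add: phi_superset[of ?J] lookup_add comb_add[symmetric])
qed

lemma single_power_monomial: "single (a :: vec \<times> real) (1 :: 'k::comm_semiring_1) ^ k = single (real k *\<^sub>R a) 1"
  by (induction k) (auto simp: mult_single scaleR_add_left zero_prod_def single_one[symmetric] simp del: single_one)

lemma prod_single_monomial:
  "(\<Prod>j\<in>A. single (h j :: 'a::comm_monoid_add) (1 :: 'k::comm_semiring_1)) = single (\<Sum>j\<in>A. h j) 1"
  by (induction A rule: infinite_finite_induct) (auto simp: mult_single)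

text \<open>Termwise extension of \<open>F\<close> to polynomials. It covers
  \<open>monomial_hom\<close> as well as the sum of coefficients over a congruence class of
  exponents; both vanish on the ideal of the relations.\<close>

definition psi :: "('a \<Rightarrow> 'k \<Rightarrow> 'b::comm_monoid_add) \<Rightarrow> ('a \<Rightarrow>\<^sub>0 'k::zero) \<Rightarrow> 'b" where
  "psi F f = (\<Sum>m\<in>keys f. F m (lookup f m))"

lemma monomial_hom_psi: "monomial_hom g f = psi (\<lambda>m c. single (phi g m) c) f"
  unfolding monomial_hom_def psi_def
  by (intro sum.cong refl) (simp add: single_power_monomial prod_single_monomial mult_single phi_def)

lemma psi_superset:
  assumes "\<And>m. F m 0 = 0" "finite A" "keys f \<subseteq> A"
  shows "psi F f = (\<Sum>m\<in>A. F m (lookup f m))"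
  unfolding psi_def using assms by (intro sum.mono_neutral_left) (auto simp: in_keys_iff)

lemma psi_add:
  fixes F :: "'a \<Rightarrow> 'k::monoid_add \<Rightarrow> 'b::comm_monoid_add"
  assumes "\<And>m. F m 0 = 0" "\<And>m a b. F m (a + b) = F m a + F m b"
  shows "psi F (f + g) = psi F f + psi F g"
proof -
  let ?A = "keys f \<union> keys g"
  have "keys (f + g) \<subseteq> ?A" by (rule keys_add)
  then show ?thesis using psi_superset[of F ?A, OF assms(1)] by (simp add: lookup_add assms(2) sum.distrib)
qed

lemma psi_0 [simp]: "psi F 0 = 0" by (simp add: psi_def)

lemma psi_single: "(\<And>m. F m 0 = 0) \<Longrightarrow> psi F (single m c) = F m c"
  by (cases "c = 0") (auto simp: psi_def)

lemma psi_sum: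
  fixes F :: "'a \<Rightarrow> 'k::comm_monoid_add \<Rightarrow> 'b::comm_monoid_add"
  assumes "\<And>m. F m 0 = 0" "\<And>m a b. F m (a + b) = F m a + F m b"
  shows "psi F (sum h A) = (\<Sum>a\<in>A. psi F (h a))"
  by (induction A rule: infinite_finite_induct) (auto simp: psi_add[of F, OF assms])

lemma psi_diff:
  fixes F :: "'a \<Rightarrow> 'k::ab_group_add \<Rightarrow> 'b::ab_group_add"
  assumes "\<And>m. F m 0 = 0" "\<And>m a b. F m (a + b) = F m a + F m b"
  shows "psi F (f - g) = psi F f - psi F g"
  using psi_add[of F "f - g" g, OF assms] by (simp add: algebra_simps)

lemma sum_monomials: "(\<Sum>m\<in>keys q. single m (lookup q m)) = q"
  by (rule poly_mapping_eqI) (simp add: lookup_sum' lookup_single when_def in_keys_iff)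

lemma psi_mult_binomial:
  fixes F :: "(nat \<Rightarrow>\<^sub>0 nat) \<Rightarrow> 'k::comm_ring_1 \<Rightarrow> 'b::ab_group_add"
  assumes F: "\<And>m. F m 0 = 0" "\<And>m a b. F m (a + b) = F m a + F m b"
    and ab: "\<And>m c. F (m + a) c = F (m + b) c"
  shows "psi F (q * (single a 1 - single b 1)) = 0"
proof -
  have q: "q = (\<Sum>m\<in>keys q. single m (lookup q m))"
    by (rule sum_monomials[symmetric])
  have "psi F (q * (single a 1 - single b 1)) =
    psi F (\<Sum>m\<in>keys q. single (m + a) (lookup q m) - single (m + b) (lookup q m))"
    by (subst q) (simp add: sum_distrib_right right_diff_distrib mult_single sum_subtractf)
  also have "\<dots> = 0" by (simp add: psi_sum[of F, OF F] psi_diff[of F, OF F] psi_single[of F, OF F(1)] ab)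
  finally show ?thesis .
qed

definition mon :: "nat set \<Rightarrow> (nat \<Rightarrow> nat) \<Rightarrow> nat \<Rightarrow>\<^sub>0 nat" where
  "mon J u = (\<Sum>j\<in>J. single j (u j))"

lemma lookup_mon: "finite J \<Longrightarrow> lookup (mon J u) j = (if j \<in> J then u j else 0)"
  by (simp add: mon_def lookup_sum' lookup_single when_def)

lemma keys_mon: "finite J \<Longrightarrow> keys (mon J u) \<subseteq> J"
  by (auto simp: in_keys_iff lookup_mon split: if_splits)

definition binomial_of :: "nat set \<Rightarrow> rel \<Rightarrow> 'k::field_char_0 mpoly" where
  "binomial_of J r = single (mon (fst r) (\<lambda>_. 1)) 1 - single (mon J (snd r)) 1"

text \<open>Signs are left free because the lead of a relation may be either of its two
  sides.\<close>

definition represents :: "nat set \<Rightarrow> 'k::field_char_0 mpoly set \<Rightarrow> rel list \<Rightarrow> bool" where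
  "represents J R rs \<longleftrightarrow> finite R \<and> (\<forall>r\<in>set rs. binomial_of J r \<in> R \<or> - binomial_of J r \<in> R) \<and>
     (\<forall>p\<in>R. \<exists>r\<in>set rs. p = binomial_of J r \<or> p = - binomial_of J r)"

lemma lookup_mon_rvec:
  assumes "finite J" "triangular J rs" "r \<in> set rs"
  shows "real (lookup (mon (fst r) (\<lambda>_. 1)) j) - real (lookup (mon J (snd r)) j) = rvec r j"
proof -
  have "finite (fst r)" using triangular_mem[OF assms(2,3)] assms(1) finite_subset by blast
  then show ?thesis using triangular_mem[OF assms(2,3)] assms(1) by (auto simp: lookup_mon rvec_def)
qed

lemma poly_ring_add: "f \<in> poly_ring l \<Longrightarrow> g \<in> poly_ring l \<Longrightarrow> f + g \<in> poly_ring l"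
  unfolding poly_ring_def using keys_add[of f g] by blast
lemma poly_ring_uminus: "f \<in> poly_ring l \<Longrightarrow> - f \<in> poly_ring l"
  unfolding poly_ring_def by simp
lemma poly_ring_diff: "f \<in> poly_ring l \<Longrightarrow> g \<in> poly_ring l \<Longrightarrow> f - g \<in> poly_ring l"
  using poly_ring_add[OF _ poly_ring_uminus] by fastforce
lemma poly_ring_0 [simp]: "0 \<in> poly_ring l" by (simp add: poly_ring_def)
lemma poly_ring_sum: "(\<And>i. i \<in> A \<Longrightarrow> f i \<in> poly_ring l) \<Longrightarrow> sum f A \<in> poly_ring l"
  by (induction A rule: infinite_finite_induct) (auto intro: poly_ring_add)
lemma poly_ring_single: "keys m \<subseteq> {1..l} \<Longrightarrow> single m c \<in> poly_ring l"
  by (simp add: poly_ring_def)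
lemma poly_ring_mult: assumes "f \<in> poly_ring l" "g \<in> poly_ring l" shows "f * g \<in> poly_ring l"
proof -
  have "keys m \<subseteq> {1..l}" if "m \<in> keys (f * g)" for m
  proof -
    obtain a b where ab: "a \<in> keys f" "b \<in> keys g" "m = a + b"
      using keys_mult[of f g] \<open>m \<in> _\<close> by blast
    then show ?thesis using keys_add[of a b] assms unfolding poly_ring_def by blast
  qed
  then show ?thesis by (simp add: poly_ring_def)
qed
lemma poly_ring_1 [simp]: "1 \<in> poly_ring l" unfolding single_one[symmetric] by (rule poly_ring_single) simp
lemma poly_ring_power: "f \<in> poly_ring l \<Longrightarrow> f ^ k \<in> poly_ring l"
  by (induction k) (auto intro: poly_ring_mult)

lemma ideal_add: "f \<in> generated_ideal l R \<Longrightarrow> g \<in> generated_ideal l R \<Longrightarrow> f + g \<in> generated_ideal l R"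
proof -
  assume "f \<in> generated_ideal l R" "g \<in> generated_ideal l R"
  then obtain p q where pq: "f = (\<Sum>r\<in>R. p r * r)" "\<forall>r\<in>R. p r \<in> poly_ring l" "g = (\<Sum>r\<in>R. q r * r)" "\<forall>r\<in>R. q r \<in> poly_ring l"
    unfolding generated_ideal_def by blast
  then have "f + g = (\<Sum>r\<in>R. (p r + q r) * r)" by (simp add: distrib_right sum.distrib)
  moreover have "\<forall>r\<in>R. p r + q r \<in> poly_ring l" using pq poly_ring_add by blast
  ultimately show ?thesis unfolding generated_ideal_def by (intro CollectI exI[of _ "\<lambda>r. p r + q r"] conjI)
qed

lemma ideal_0 [simp]: "0 \<in> generated_ideal l R"
  unfolding generated_ideal_def by (auto intro!: exI[of _ "\<lambda>_. 0"])

lemma ideal_sum: "(\<And>i. i \<in> A \<Longrightarrow> f i \<in> generated_ideal l R) \<Longrightarrow> sum f A \<in> generated_ideal l R"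
  by (induction A rule: infinite_finite_induct) (auto intro: ideal_add)

lemma ideal_gen: assumes "finite R" "r \<in> R" "a \<in> poly_ring l" shows "a * r \<in> generated_ideal l R"
proof -
  have "a * r = (\<Sum>s\<in>R. (if s = r then a else 0) * s)" using assms by (simp add: if_distrib[of "\<lambda>c. c * _"] cong: if_cong)
  then show ?thesis using assms unfolding generated_ideal_def by (auto intro!: exI[of _ "\<lambda>s. if s = r then a else 0"])
qed

lemma ideal_binomial:
  assumes "represents J R rs" "r \<in> set rs" "a \<in> poly_ring l"
  shows "a * binomial_of J r \<in> generated_ideal l R"
proof -
  have "finite R" using assms by (simp add: represents_def)
  moreover have "a * binomial_of J r = (- a) * (- binomial_of J r)" by simp
  ultimately show ?thesis using assms ideal_gen[of R] poly_ring_uminus[OF assms(3)] unfolding represents_def by metis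
qed

text \<open>If \<open>F\<close> does not distinguish the two monomials of a relation after
  multiplication by any monomial, the two halves of every multiple of the binomial cancel.\<close>

lemma psi_ideal_0:
  fixes F :: "(nat \<Rightarrow>\<^sub>0 nat) \<Rightarrow> 'k::field_char_0 \<Rightarrow> 'b::ab_group_add"
  assumes F: "\<And>m. F m 0 = 0" "\<And>m a b. F m (a + b) = F m a + F m b"
    and ab: "\<And>m c r. r \<in> set rs \<Longrightarrow> F (m + mon (fst r) (\<lambda>_. 1)) c = F (m + mon J (snd r)) c"
    and R: "represents J R rs" and f: "f \<in> generated_ideal l R"
  shows "psi F f = 0"
proof -
  obtain q where q: "f = (\<Sum>r\<in>R. q r * r)" using f unfolding generated_ideal_def by blast
  have "psi F (q p * p) = 0" if "p \<in> R" for p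
  proof -
    obtain r where r: "r \<in> set rs" "p = binomial_of J r \<or> p = - binomial_of J r"
      using R \<open>p \<in> R\<close> unfolding represents_def by blast
    have *: "psi F (a * binomial_of J r) = 0" for a
      unfolding binomial_of_def by (rule psi_mult_binomial[of F, OF F ab[OF r(1)]])
    have "q p * p = q p * binomial_of J r \<or> q p * p = (- q p) * binomial_of J r" using r(2) by auto
    then show ?thesis using * by metis
  qed
  then show ?thesis unfolding q by (simp add: psi_sum[of F, OF F])
qed

lemma lookup_monomial_hom:
  fixes f :: "'k::field_char_0 mpoly"
  shows "lookup (monomial_hom g f) e = (\<Sum>m\<in>{m\<in>keys f. phi g m = e}. lookup f m)"
proof -
  show ?thesis
    unfolding monomial_hom_psi psi_def lookup_sum' lookup_single when_def by (simp add: sum.inter_filter)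
qed

lemma keys_monomial_hom: "keys (monomial_hom g f) \<subseteq> phi g ` keys f"
proof
  fix e assume "e \<in> keys (monomial_hom g f)"
  then have "{m\<in>keys f. phi g m = e} \<noteq> {}"
    unfolding in_keys_iff lookup_monomial_hom by (metis sum.empty)
  then show "e \<in> phi g ` keys f" by blast
qed

lemma monomial_hom_kernel_binomial:
  fixes R :: "'k::field_char_0 mpoly set"
  assumes rel: "\<And>r. r \<in> set rs \<Longrightarrow> comb J g (rvec r) = 0" and J: "finite J" "triangular J rs"
    and R: "represents J R rs" and f: "f \<in> generated_ideal l R"
  shows "monomial_hom g f = 0"
  unfolding monomial_hom_psi
proof (rule psi_ideal_0[OF _ _ _ R f])
  fix m :: "nat \<Rightarrow>\<^sub>0 nat" and c :: 'k and r assume r: "r \<in> set rs"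
  have L: "fst r \<subseteq> J" using triangular_mem[OF J(2) r] by simp
  then have fL: "finite (fst r)" using J(1) finite_subset by blast
  have "phi g (mon (fst r) (\<lambda>_. 1)) - phi g (mon J (snd r)) = comb J g (rvec r)"
    using phi_superset[OF J(1), of "mon (fst r) (\<lambda>_. 1)" g] phi_superset[OF J(1) keys_mon[OF J(1)], of g "snd r"]
      keys_mon[OF fL, of "\<lambda>_. 1"] L lookup_mon_rvec[OF J r]
    by (simp add: comb_diff[symmetric])
  then have "phi g (mon (fst r) (\<lambda>_. 1)) = phi g (mon J (snd r))" using rel[OF r] by simp
  then show "single (phi g (m + mon (fst r) (\<lambda>_. 1))) c = single (phi g (m + mon J (snd r))) c"
    by (simp add: phi_add)
qed (auto simp: single_add)

lemma monoid_hull_comb: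
  assumes "finite J"
  shows "(\<lambda>T. 0 \<in> T \<and> (\<forall>x\<in>T. \<forall>y\<in>T. x + y \<in> T)) hull (g ` J) = {comb J g f |f. (\<forall>j. f j \<in> \<nat>) \<and> (\<forall>j. j \<notin> J \<longrightarrow> f j = 0)}" (is "?H = ?C")
proof (rule hull_unique)
  show "g ` J \<subseteq> ?C"
  proof
    fix x assume "x \<in> g ` J"
    then obtain j where j: "j \<in> J" "x = g j" by blast
    then show "x \<in> ?C" using comb_unit[OF assms j(1), of g]
      by (intro CollectI exI[of _ "\<lambda>i. if i = j then 1 else 0"]) auto
  qed
  show "0 \<in> ?C \<and> (\<forall>x\<in>?C. \<forall>y\<in>?C. x + y \<in> ?C)"
  proof (intro conjI ballI)
    show "0 \<in> ?C" by (intro CollectI exI[of _ "\<lambda>_. 0"]) auto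
    fix x y assume "x \<in> ?C" "y \<in> ?C"
    then obtain f h where "x = comb J g f" "y = comb J g h" "\<forall>j. f j \<in> \<nat>" "\<forall>j. h j \<in> \<nat>" "\<forall>j. j \<notin> J \<longrightarrow> f j = 0" "\<forall>j. j \<notin> J \<longrightarrow> h j = 0"
      by blast
    then show "x + y \<in> ?C" by (intro CollectI exI[of _ "\<lambda>j. f j + h j"]) (auto simp: comb_add)
  qed
  fix T assume T: "g ` J \<subseteq> T" "0 \<in> T \<and> (\<forall>x\<in>T. \<forall>y\<in>T. x + y \<in> T)"
  have mult: "real k *\<^sub>R x \<in> T" if "x \<in> T" for k x
    by (induction k) (use T(2) that in \<open>auto simp: scaleR_add_left\<close>)
  have sum: "sum h A \<in> T" if "\<And>a. a \<in> A \<Longrightarrow> h a \<in> T" for h and A :: "nat set"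
    using that by (induction A rule: infinite_finite_induct) (use T(2) in auto)
  show "?C \<subseteq> T"
  proof
    fix x assume "x \<in> ?C"
    then obtain f where f: "\<forall>j. f j \<in> \<nat>" and x: "x = comb J g f" by blast
    show "x \<in> T" unfolding x comb_def
    proof (rule sum)
      fix j assume "j \<in> J"
      obtain k where "f j = real k" using f by (meson Nats_cases)
      then show "f j *\<^sub>R g j \<in> T" using mult[of "g j" k] T(1) \<open>j \<in> J\<close> by auto
    qed
  qed
qed

lemma nat_exponent:
  assumes "\<And>j. f j \<in> \<nat>" "finite J" "\<And>j. j \<notin> J \<Longrightarrow> f j = 0"
  shows "\<exists>m. keys m \<subseteq> J \<and> (\<forall>j. real (lookup m j) = f j) \<and> phi g m = comb J g f"
proof -
  let ?m = "mon J (\<lambda>j. nat \<lfloor>f j\<rfloor>)"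
  have f: "real (nat \<lfloor>f j\<rfloor>) = f j" for j using assms(1)[of j] by (auto elim: Nats_cases)
  have "real (lookup ?m j) = f j" for j using f assms by (simp add: lookup_mon)
  then show ?thesis using keys_mon[OF assms(2)] phi_superset[OF assms(2) keys_mon[OF assms(2)], of g]
    by (intro exI[of _ ?m] conjI) simp_all
qed

text \<open>Replacing the \<open>k\<close>-th power of a leading monomial by the \<open>k\<close>-th
  power of its tail changes a term by a multiple of the relation. The induction runs over sublists,
  while the ideal stays that of the full list.\<close>

lemma ideal_normal_form:
  fixes R :: "'k::field_char_0 mpoly set"
  assumes tri: "triangular {1..l} rs" and R: "represents {1..l} R rs"
    and u: "keys u \<subseteq> {1..l}"
  shows "\<exists>v. keys v \<subseteq> {1..l} \<and> normal rs (\<lambda>j. real (lookup v j)) \<and>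
    in_span rs (\<lambda>j. real (lookup u j) - real (lookup v j)) \<and>
    (\<forall>c. single u c - single v c \<in> generated_ideal l R)"
proof -
  have "\<exists>v. keys v \<subseteq> {1..l} \<and> normal rs' (\<lambda>j. real (lookup v j)) \<and>
    in_span rs' (\<lambda>j. real (lookup u j) - real (lookup v j)) \<and>
    (\<forall>c. single u c - single v c \<in> generated_ideal l R)"
    if "triangular {1..l} rs'" "set rs' \<subseteq> set rs" "keys u \<subseteq> {1..l}" for rs'
    using that
  proof (induction rs' arbitrary: u)
    case Nil
    then show ?case by (intro exI[of _ u]) (auto simp: normal_def)
  next
    case (Cons r rs')
    have L: "fst r \<subseteq> {1..l}" "fst r \<noteq> {}" using Cons.prems(1) by auto
    then have fL: "finite (fst r)" using finite_subset by blast
    define a where "a = mon (fst r) (\<lambda>_. 1)"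
    define b where "b = mon {1..l} (snd r)"
    define k where "k = Min (lookup u ` fst r)"
    have "k \<in> lookup u ` fst r" unfolding k_def using fL L by (intro Min_in) auto
    then obtain j0 where j0: "j0 \<in> fst r" "lookup u j0 = k" by auto
    have kle: "k \<le> lookup u j" if "j \<in> fst r" for j unfolding k_def using fL that by (intro Min_le) auto
    define u' where "u' = mon {1..l} (\<lambda>j. if j \<in> fst r then lookup u j - k else lookup u j)"
    define ka where "ka = mon (fst r) (\<lambda>_. k)"
    define kb where "kb = mon {1..l} (\<lambda>j. k * snd r j)"
    have u_eq: "u = u' + ka"
      using Cons.prems(3) L kle
      by (intro poly_mapping_eqI) (auto simp: lookup_add u'_def ka_def lookup_mon fL in_keys_iff subset_iff)
    have ka: "single ka 1 = (single a 1 :: 'k mpoly) ^ k"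
    proof -
      have "(single a 1 :: 'k mpoly) ^ i = single (mon (fst r) (\<lambda>_. i)) 1" for i
        by (induction i) (auto simp: a_def mon_def mult_single single_add[symmetric] sum.distrib[symmetric])
      then show ?thesis by (simp add: ka_def)
    qed
    have kb: "single kb 1 = (single b 1 :: 'k mpoly) ^ k"
    proof -
      have "(single b 1 :: 'k mpoly) ^ i = single (mon {1..l} (\<lambda>j. i * snd r j)) 1" for i
        by (induction i) (auto simp: b_def mon_def mult_single single_add[symmetric] sum.distrib[symmetric])
      then show ?thesis by (simp add: kb_def)
    qed
    define w where "w = u' + kb"
    have wk: "keys w \<subseteq> {1..l}"
      unfolding w_def using keys_add[of u' kb] keys_mon[of "{1..l}"] by (auto simp: u'_def kb_def)
    have lw: "real (lookup u j) - real k * rvec r j = real (lookup w j)" for j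
    proof -
      have "fst r \<inter> {j. snd r j \<noteq> 0} = {}" using Cons.prems(1) by auto
      then have "lookup w j = (if j \<in> fst r then lookup u j - k else lookup u j + k * snd r j)"
        using Cons.prems(1,3) L by (auto simp: w_def lookup_add u'_def kb_def lookup_mon in_keys_iff subset_iff)
      then show ?thesis using kle[of j] Cons.prems(1) by (auto simp: rvec_def of_nat_diff)
    qed
    have uw: "single u c - single w c \<in> generated_ideal l R" for c
    proof -
      let ?X = "single a 1 :: 'k mpoly" and ?Y = "single b 1 :: 'k mpoly"
      have "single u c - single w c = single u' c * (?X ^ k - ?Y ^ k)"
        by (simp add: ka[symmetric] kb[symmetric] u_eq w_def right_diff_distrib mult_single)
      also have "\<dots> = (single u' c * (\<Sum>i<k. ?Y ^ (k - Suc i) * ?X ^ i)) * (?X - ?Y)"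
        by (simp only: power_diff_sumr2 mult.assoc mult.commute mult.left_commute)
      also have "?X - ?Y = binomial_of {1..l} r" by (simp add: binomial_of_def a_def b_def)
      also have "(single u' c * (\<Sum>i<k. ?Y ^ (k - Suc i) * ?X ^ i)) * binomial_of {1..l} r \<in> generated_ideal l R"
        using keys_mon[of "{1..l}"] subset_trans[OF keys_mon[OF fL] L(1)] Cons.prems(2)
        by (intro ideal_binomial[OF R] poly_ring_mult poly_ring_sum poly_ring_power poly_ring_single)
           (simp_all add: u'_def a_def b_def)
      finally show ?thesis .
    qed
    have "triangular {1..l} rs'" "set rs' \<subseteq> set rs" using Cons.prems by auto
    from Cons.IH[OF this wk] obtain v where v: "keys v \<subseteq> {1..l}" "normal rs' (\<lambda>j. real (lookup v j))"
      "in_span rs' (\<lambda>j. real (lookup w j) - real (lookup v j))"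
      "\<And>c. single w c - single v c \<in> generated_ideal l R" by blast
    have "lookup v j0 = 0"
      using in_span_lead[OF Cons.prems(1) v(3) j0(1)] lw[of j0] j0 rvec_lead[OF Cons.prems(1) j0(1)] by simp
    then have "normal (r # rs') (\<lambda>j. real (lookup v j))" using v(2) j0(1) by (auto simp: normal_def)
    moreover have "in_span (r # rs') (\<lambda>j. real (lookup u j) - real (lookup v j))"
      using v(3) unfolding lw[symmetric] by (auto simp: algebra_simps intro!: exI[of _ "real k"])
    moreover have "single u c - single v c \<in> generated_ideal l R" for c
    proof -
      have "single u c - single v c =
        (single u c - single w c) + (single w c - single v c)"
        by (simp add: algebra_simps)
      then show ?thesis using ideal_add[OF uw v(4)] by metis
    qed
    ultimately show ?case using v(1) by blast
  qed
  from this[OF tri order_refl u] show ?thesis .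
qed

text \<open>Modulo the ideal every polynomial is a combination of normal monomials, and distinct
  normal monomials go to distinct semigroup elements, so nothing else lies in the kernel. Minimality
  of the generators follows from their irreducibility.\<close>

lemma presents_if:
  fixes R :: "'k::field_char_0 mpoly set"
  assumes tri: "triangular {1..l} rs" and R: "represents {1..l} R rs"
    and rel: "\<And>r. r \<in> set rs \<Longrightarrow> comb {1..l} g (rvec r) = 0"
    and ker: "\<And>f. (\<And>j. j \<notin> {1..l} \<Longrightarrow> f j = 0) \<Longrightarrow> comb {1..l} g f = 0 \<Longrightarrow> in_span rs f"
    and S: "cone_semigroup n P = {comb {1..l} g f |f. (\<forall>j. f j \<in> \<nat>) \<and> (\<forall>j. j \<notin> {1..l} \<longrightarrow> f j = 0)}"
    and irr: "\<And>j x y. j \<in> {1..l} \<Longrightarrow> x \<in> cone_semigroup n P \<Longrightarrow> y \<in> cone_semigroup n P \<Longrightarrow> x + y = g j \<Longrightarrow> x = 0 \<or> y = 0"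
    and inj: "inj_on g {1..l}" and nz: "\<And>j. j \<in> {1..l} \<Longrightarrow> g j \<noteq> 0"
  shows "presents n P l R g"
proof -
  let ?J = "{1..l}" and ?S = "cone_semigroup n P"
  have gen: "generates_monoid (g ` ?J) ?S" unfolding generates_monoid_def S by (rule monoid_hull_comb) simp
  have "g ` ?J \<subseteq> H" if H: "generates_monoid H ?S" for H
  proof (rule ccontr)
    assume "\<not> g ` ?J \<subseteq> H"
    then obtain j where j: "j \<in> ?J" "g j \<notin> H" by blast
    have HS: "H \<subseteq> ?S"
      using hull_subset[of H "\<lambda>T. 0 \<in> T \<and> (\<forall>x\<in>T. \<forall>y\<in>T. x + y \<in> T)"] H unfolding generates_monoid_def by simp
    have S0: "0 \<in> ?S \<and> (\<forall>x\<in>?S. \<forall>y\<in>?S. x + y \<in> ?S)"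
    proof (intro conjI ballI)
      show "0 \<in> ?S" unfolding S by (intro CollectI exI[of _ "\<lambda>_. 0"]) auto
      fix x y assume "x \<in> ?S" "y \<in> ?S"
      then obtain f h where "x = comb {1..l} g f" "y = comb {1..l} g h" "\<forall>j. f j \<in> \<nat>" "\<forall>j. h j \<in> \<nat>"
        "\<forall>j. j \<notin> {1..l} \<longrightarrow> f j = 0" "\<forall>j. j \<notin> {1..l} \<longrightarrow> h j = 0" unfolding S by blast
      then show "x + y \<in> ?S" unfolding S by (intro CollectI exI[of _ "\<lambda>j. f j + h j"]) (auto simp: comb_add)
    qed
    \<comment> \<open>Removing a nonzero irreducible element from the semigroup leaves a submonoid,
      so every generating set contains that element.\<close>
    have "(\<lambda>T. 0 \<in> T \<and> (\<forall>x\<in>T. \<forall>y\<in>T. x + y \<in> T)) hull H \<subseteq> ?S - {g j}"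
    proof (rule hull_minimal)
      show "H \<subseteq> ?S - {g j}" using HS j by blast
      show "0 \<in> ?S - {g j} \<and> (\<forall>x\<in>?S - {g j}. \<forall>y\<in>?S - {g j}. x + y \<in> ?S - {g j})"
      proof (intro conjI ballI)
        show "0 \<in> ?S - {g j}" using S0 nz[OF j(1)] by (metis DiffI singletonD)
        fix x y assume xy: "x \<in> ?S - {g j}" "y \<in> ?S - {g j}"
        then have "x + y \<noteq> g j" using irr[OF j(1), of x y] by auto
        then show "x + y \<in> ?S - {g j}" using S0 xy by blast
      qed
    qed
    moreover have "g j \<in> ?S" unfolding S using comb_unit[OF _ j(1), of g] j(1)
      by (intro CollectI exI[of _ "\<lambda>i. if i = j then 1 else 0"]) auto
    ultimately show False using H unfolding generates_monoid_def by blast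
  qed
  then have mgs: "minimal_generating_set (g ` ?J) ?S" using gen by (simp add: minimal_generating_set_def)
  have phiS: "phi g m \<in> ?S" if "keys m \<subseteq> ?J" for m
    using that unfolding S phi_superset[OF finite_atLeastAtMost that]
    by (intro CollectI exI[of _ "\<lambda>j. real (lookup m j)"]) (auto simp: in_keys_iff)
  have img: "monomial_hom g ` (poly_ring l :: 'k mpoly set) = semigroup_algebra n P"
  proof (intro equalityI subsetI)
    fix f assume "f \<in> monomial_hom g ` (poly_ring l :: 'k mpoly set)"
    then obtain h where "h \<in> poly_ring l" "f = monomial_hom g h" by blast
    then show "f \<in> semigroup_algebra n P" using keys_monomial_hom[of g h] phiS
      unfolding semigroup_algebra_def poly_ring_def by blast
  next
    fix f :: "vec \<times> real \<Rightarrow>\<^sub>0 'k" assume f: "f \<in> semigroup_algebra n P"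
    have "\<forall>p\<in>keys f. \<exists>m. keys m \<subseteq> ?J \<and> phi g m = p"
    proof
      fix p assume "p \<in> keys f"
      then have "p \<in> ?S" using f by (auto simp: semigroup_algebra_def)
      then obtain u where "p = comb ?J g u" "\<forall>j. u j \<in> \<nat>" "\<forall>j. j \<notin> ?J \<longrightarrow> u j = 0" unfolding S by blast
      then show "\<exists>m. keys m \<subseteq> ?J \<and> phi g m = p" using nat_exponent[of u ?J g] by auto
    qed
    from bchoice[OF this] obtain e where e: "\<And>p. p \<in> keys f \<Longrightarrow> keys (e p) \<subseteq> ?J"
      "\<And>p. p \<in> keys f \<Longrightarrow> phi g (e p) = p" by blast
    let ?h = "\<Sum>p\<in>keys f. single (e p) (lookup f p)"
    have "monomial_hom g ?h = (\<Sum>p\<in>keys f. single p (lookup f p))"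
      unfolding monomial_hom_psi by (subst psi_sum) (auto simp: single_add psi_single e)
    also have "\<dots> = f" by (rule sum_monomials)
    finally have "f = monomial_hom g ?h" by simp
    moreover have "?h \<in> poly_ring l" by (intro poly_ring_sum poly_ring_single e(1))
    ultimately show "f \<in> monomial_hom g ` (poly_ring l :: 'k mpoly set)" by (rule image_eqI)
  qed
  have kern: "{f \<in> poly_ring l :: 'k mpoly set. monomial_hom g f = 0} = generated_ideal l R"
  proof (intro equalityI subsetI)
    fix f assume f: "f \<in> generated_ideal l R"
    have "binomial_of ?J r \<in> (poly_ring l :: 'k mpoly set)" if r: "r \<in> set rs" for r
    proof -
      have "fst r \<subseteq> ?J" using triangular_mem[OF tri r] by simp
      moreover then have "finite (fst r)" using finite_subset by blast
      ultimately show ?thesis unfolding binomial_of_def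
        using keys_mon[of "fst r" "\<lambda>_. 1"] keys_mon[of ?J "snd r"] by (intro poly_ring_diff poly_ring_single) auto
    qed
    then have "p \<in> poly_ring l" if "p \<in> R" for p
      using R \<open>p \<in> R\<close> unfolding represents_def by (metis poly_ring_uminus)
    then have "f \<in> poly_ring l" using f unfolding generated_ideal_def by (auto intro!: poly_ring_sum poly_ring_mult)
    moreover have "monomial_hom g f = 0" by (rule monomial_hom_kernel_binomial[OF rel _ tri R f]) auto
    ultimately show "f \<in> {f \<in> poly_ring l. monomial_hom g f = 0}" by simp
  next
    fix f :: "'k mpoly" assume "f \<in> {f \<in> poly_ring l. monomial_hom g f = 0}"
    then have f: "f \<in> poly_ring l" "monomial_hom g f = 0" by auto
    have "\<forall>m\<in>keys f. \<exists>v. keys v \<subseteq> ?J \<and> normal rs (\<lambda>j. real (lookup v j)) \<and>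
      (\<forall>c. single m c - single v c \<in> generated_ideal l R)"
      using ideal_normal_form[OF tri R] f(1) unfolding poly_ring_def by blast
    from bchoice[OF this] obtain nu where nu: "\<And>m. m \<in> keys f \<Longrightarrow> keys (nu m) \<subseteq> ?J"
      "\<And>m. m \<in> keys f \<Longrightarrow> normal rs (\<lambda>j. real (lookup (nu m) j))"
      "\<And>m c. m \<in> keys f \<Longrightarrow> single m c - single (nu m) c \<in> generated_ideal l R" by blast
    define h where "h = (\<Sum>m\<in>keys f. single (nu m) (lookup f m))"
    have fh: "f - h \<in> generated_ideal l R"
    proof -
      have "f - h = (\<Sum>m\<in>keys f. single m (lookup f m) - single (nu m) (lookup f m))"
        unfolding sum_subtractf h_def sum_monomials ..
      then show ?thesis using nu(3) by (auto intro!: ideal_sum)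
    qed
    have "monomial_hom g (f - h) = 0" by (rule monomial_hom_kernel_binomial[OF rel _ tri R fh]) auto
    then have h0: "monomial_hom g h = 0"
      using f(2) unfolding monomial_hom_psi by (subst (asm) psi_diff) (auto simp: single_add)
    have hk: "\<exists>m\<in>keys f. v = nu m" if "v \<in> keys h" for v
    proof -
      have "keys h \<subseteq> (\<Union>m\<in>keys f. keys (single (nu m) (lookup f m)))"
        unfolding h_def by (rule keys_sum)
      then show ?thesis using that by (auto split: if_splits)
    qed
    have "h = 0"
    proof (rule poly_mapping_eqI)
      fix v
      show "lookup h v = lookup 0 v"
      proof (cases "v \<in> keys h")
        case True
        \<comment> \<open>Consequently the coefficient of \<open>monomial_hom g h\<close> at
          \<open>phi g v\<close> is the single coefficient of \<open>h\<close> at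
          \<open>v\<close>.\<close>
        have "{m\<in>keys h. phi g m = phi g v} = {v}"
        proof -
          have "m = v" if m: "m \<in> keys h" "phi g m = phi g v" for m
          proof -
            have k: "keys m \<subseteq> ?J" "keys v \<subseteq> ?J" "normal rs (\<lambda>j. real (lookup m j))" "normal rs (\<lambda>j. real (lookup v j))"
              using hk[OF m(1)] hk[OF True] nu by auto
            have "comb ?J g (\<lambda>j. real (lookup m j) - real (lookup v j)) = 0"
              using m(2) phi_superset[OF _ k(1)] phi_superset[OF _ k(2)] by (simp add: comb_diff)
            then have "in_span rs (\<lambda>j. real (lookup m j) - real (lookup v j))"
            proof (intro ker)
              fix j assume "j \<notin> ?J"
              then have "lookup m j = 0" "lookup v j = 0" using k(1,2) by (meson in_keys_iff subsetD)+
              then show "real (lookup m j) - real (lookup v j) = 0" by simp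
            qed
            from normal_form_unique[OF tri k(3,4) this] have "(\<lambda>j. real (lookup m j)) = (\<lambda>j. real (lookup v j))" by simp
            then show ?thesis by (intro poly_mapping_eqI) (metis of_nat_eq_iff)
          qed
          then show ?thesis using True by blast
        qed
        then show ?thesis using lookup_monomial_hom[of g h "phi g v"] h0 by simp
      qed (simp add: in_keys_iff)
    qed
    then show "f \<in> generated_ideal l R" using fh by simp
  qed
  show ?thesis unfolding presents_def using mgs inj img kern by (auto intro!: exI[of _ "g ` ?J"] simp: bij_betw_def)
qed

text \<open>For the last conclusion, the binomial of \<open>u\<close> and \<open>v\<close> lies in
  the ideal. The sum of coefficients over the exponents congruent to \<open>u\<close> modulo the
  relations vanishes on the ideal, so \<open>v\<close> must be congruent to \<open>u\<close>
  too.\<close>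

lemma presentsD:
  fixes R :: "'k::field_char_0 mpoly set"
  assumes pr: "presents n P l R g" and tri: "triangular {1..l} rs" and R: "represents {1..l} R rs"
  shows "minimal_generating_set (g ` {1..l}) (cone_semigroup n P)" "inj_on g {1..l}"
    "\<And>r. r \<in> set rs \<Longrightarrow> comb {1..l} g (rvec r) = 0"
    "\<And>u v. (\<And>j. u j \<in> \<nat>) \<Longrightarrow> (\<And>j. v j \<in> \<nat>) \<Longrightarrow> (\<And>j. j \<notin> {1..l} \<Longrightarrow> u j = 0) \<Longrightarrow> (\<And>j. j \<notin> {1..l} \<Longrightarrow> v j = 0) \<Longrightarrow>
      comb {1..l} g u = comb {1..l} g v \<Longrightarrow> in_span rs (\<lambda>j. u j - v j)"
proof -
  obtain G where G: "minimal_generating_set G (cone_semigroup n P)" "bij_betw g {1..l} G" using pr by (auto simp: presents_def)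
  then show "minimal_generating_set (g ` {1..l}) (cone_semigroup n P)" "inj_on g {1..l}" by (auto simp: bij_betw_def)
  have kern: "{f \<in> poly_ring l :: 'k mpoly set. monomial_hom g f = 0} = generated_ideal l R" using pr by (simp add: presents_def)
  show "comb {1..l} g (rvec r) = 0" if r: "r \<in> set rs" for r
  proof -
    have L: "fst r \<subseteq> {1..l}" using triangular_mem[OF tri r] by simp
    then have fL: "finite (fst r)" using finite_subset by blast
    let ?a = "mon (fst r) (\<lambda>_. 1)" and ?b = "mon {1..l} (snd r)"
    have "1 * binomial_of {1..l} r \<in> generated_ideal l R" by (rule ideal_binomial[OF R r]) simp
    then have "monomial_hom g (binomial_of {1..l} r :: 'k mpoly) = 0" using kern by auto
    then have "single (phi g ?a) (1::'k) - single (phi g ?b) 1 = 0"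
      unfolding monomial_hom_psi binomial_of_def by (subst (asm) psi_diff) (auto simp: single_add psi_single)
    then have "lookup (single (phi g ?a) (1::'k)) (phi g ?b) = lookup (single (phi g ?b) (1::'k)) (phi g ?b)" by simp
    then have "phi g ?a = phi g ?b" by (auto simp: lookup_single when_def split: if_splits)
    moreover have "phi g ?a - phi g ?b = comb {1..l} g (rvec r)"
      using phi_superset[of "{1..l}" ?a g] phi_superset[of "{1..l}" ?b g] keys_mon[of "{1..l}" "snd r"]
        keys_mon[OF fL, of "\<lambda>_. 1"] L lookup_mon_rvec[OF _ tri r]
      by (simp add: comb_diff[symmetric])
    ultimately show ?thesis by simp
  qed
  fix u v :: "nat \<Rightarrow> real"
  assume uv: "\<And>j. u j \<in> \<nat>" "\<And>j. v j \<in> \<nat>" "\<And>j. j \<notin> {1..l} \<Longrightarrow> u j = 0" "\<And>j. j \<notin> {1..l} \<Longrightarrow> v j = 0" "comb {1..l} g u = comb {1..l} g v"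
  obtain a where a: "keys a \<subseteq> {1..l}" "\<And>j. real (lookup a j) = u j" "phi g a = comb {1..l} g u"
    using nat_exponent[of u "{1..l}" g] uv by auto
  obtain b where b: "keys b \<subseteq> {1..l}" "\<And>j. real (lookup b j) = v j" "phi g b = comb {1..l} g v"
    using nat_exponent[of v "{1..l}" g] uv by auto
  let ?f = "single a 1 - single b 1 :: 'k mpoly"
  have "monomial_hom g ?f = 0"
    unfolding monomial_hom_psi using a(3) b(3) uv(5) by (subst psi_diff) (auto simp: single_add psi_single)
  moreover have "?f \<in> poly_ring l" using a b by (intro poly_ring_diff poly_ring_single)
  ultimately have I: "?f \<in> generated_ideal l R" using kern by blast
  define C where "C = (\<lambda>m. in_span rs (\<lambda>j. u j - real (lookup m j)))"
  let ?F = "\<lambda>m c. if C m then c else 0 :: 'k"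
  have "psi ?F ?f = 0"
  proof (rule psi_ideal_0[OF _ _ _ R I])
    fix m :: "nat \<Rightarrow>\<^sub>0 nat" and c :: 'k and r assume r: "r \<in> set rs"
    let ?x = "m + mon (fst r) (\<lambda>_. 1)" and ?y = "m + mon {1..l} (snd r)"
    have d: "(\<lambda>j. u j - real (lookup ?y j)) = (\<lambda>j. (u j - real (lookup ?x j)) + rvec r j)"
      using lookup_mon_rvec[OF _ tri r] by (auto simp: lookup_add algebra_simps)
    have "C ?x \<longleftrightarrow> C ?y"
    proof
      assume "C ?x" then show "C ?y" unfolding C_def d by (rule in_span_add[OF _ in_span_rvec[OF r]])
    next
      assume "C ?y" then show "C ?x" using in_span_diff[OF _ in_span_rvec[OF r]] unfolding C_def d by fastforce
    qed
    then show "?F ?x c = ?F ?y c" by simp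
  qed auto
  moreover have "psi ?F ?f = ?F a 1 - ?F b 1" by (subst psi_diff) (auto simp: psi_single)
  moreover have "C a" unfolding C_def a(2) by (rule in_span_0) simp
  ultimately have "C b" by (auto split: if_splits)
  then show "in_span rs (\<lambda>j. u j - v j)" by (simp add: C_def b(2))
qed

section \<open>Counting normal forms\<close>

text \<open>Exponent vectors of the monomials of degree \<open>k\<close> in the variables
  \<open>J\<close>.\<close>

definition comps :: "'a set \<Rightarrow> nat \<Rightarrow> ('a \<Rightarrow> nat) set" where
  "comps J k = {u. (\<forall>x. x \<notin> J \<longrightarrow> u x = 0) \<and> sum u J = k}"

lemma finite_comps: assumes "finite J" shows "finite (comps J k)"
proof -
  have "comps J k \<subseteq> {u. \<forall>x. (x \<in> J \<longrightarrow> u x \<in> {..k}) \<and> (x \<notin> J \<longrightarrow> u x = 0)}"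
    using member_le_sum[of _ J] assms by (fastforce simp: comps_def)
  then show ?thesis using finite_set_of_finite_funs[OF assms, of "{..k}" 0] by (rule finite_subset) simp
qed

lemma card_comps_insert:
  assumes "finite J" "x \<notin> J"
  shows "card (comps (insert x J) k) = card (comps J k) + (if k = 0 then 0 else card (comps (insert x J) (k - 1)))"
proof -
  let ?A = "{u \<in> comps (insert x J) k. u x = 0}" and ?B = "{u \<in> comps (insert x J) k. u x > 0}"
  have "card (comps (insert x J) k) = card (?A \<union> ?B)" by (rule arg_cong[of _ _ card]) auto
  also have "card (?A \<union> ?B) = card ?A + card ?B"
    using finite_comps[of "insert x J" k] assms by (intro card_Un_disjoint) auto
  also have "?A = comps J k" using assms by (auto simp: comps_def) (metis)
  also have "card ?B = (if k = 0 then 0 else card (comps (insert x J) (k - 1)))"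
  proof (cases "k = 0")
    case True
    then have "?B = {}" using assms by (auto simp: comps_def)
    then show ?thesis using True by (metis card.empty)
  next
    case False
    have "bij_betw (\<lambda>u. u(x := Suc (u x))) (comps (insert x J) (k - 1)) ?B"
    proof (rule bij_betw_byWitness[where f' = "\<lambda>u. u(x := u x - 1)"])
      have s: "sum (u(x := c)) J = sum u J" for u :: "'a \<Rightarrow> nat" and c using assms by (intro sum.cong) auto
      show "(\<lambda>u. u(x := Suc (u x))) ` comps (insert x J) (k - 1) \<subseteq> ?B"
        using False assms s by (auto simp: comps_def)
      show "(\<lambda>u. u(x := u x - 1)) ` ?B \<subseteq> comps (insert x J) (k - 1)"
        using False assms s by (auto simp: comps_def)
    qed auto
    then show ?thesis using False by (simp add: bij_betw_same_card)
  qed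
  finally show ?thesis .
qed

lemma one_minus_X_mult_nth: "((1 - fps_X) * F) $ k = F $ k - (if k = 0 then 0 else F $ (k - 1) :: 'a::comm_ring_1)"
  by (simp add: left_diff_distrib)

text \<open>The Hilbert series of a polynomial ring: a new variable contributes one factor, since
  exponents with \<open>u x > 0\<close> come from degree \<open>k - 1\<close>.\<close>

lemma comps_fps:
  assumes "finite J"
  shows "(1 - fps_X) ^ card J * Abs_fps (\<lambda>k. int (card (comps J k))) = 1"
  using assms
proof (induction J rule: finite_induct)
  case empty
  have "comps ({} :: 'a set) k = (if k = 0 then {\<lambda>_. 0} else {})" for k by (auto simp: comps_def)
  then show ?case by (intro fps_ext) auto
next
  case (insert x J)
  let ?F = "\<lambda>J. Abs_fps (\<lambda>k. int (card (comps J k)))"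
  have "(1 - fps_X) * ?F (insert x J) = ?F J"
  proof (rule fps_ext)
    fix k
    show "((1 - fps_X) * ?F (insert x J)) $ k = ?F J $ k"
      unfolding one_minus_X_mult_nth using card_comps_insert[OF insert.hyps, of k] by simp
  qed
  moreover have "(1 - fps_X) ^ card (insert x J) * ?F (insert x J) = (1 - fps_X) ^ card J * ((1 - fps_X) * ?F (insert x J))"
    using insert.hyps by (simp add: mult_ac)
  ultimately show ?case using insert by simp
qed

lemma card_comps_cong:
  assumes "finite J" "finite K" "card J = card K"
  shows "card (comps J k) = card (comps K k)"
proof -
  let ?F = "Abs_fps (\<lambda>k. int (card (comps J k)))" and ?G = "Abs_fps (\<lambda>k. int (card (comps K k)))"
  have nz: "(1 - fps_X :: int fps) ^ card J \<noteq> 0" using comps_fps[OF assms(1)] by auto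
  have "(1 - fps_X) ^ card J * ?F = (1 - fps_X) ^ card J * ?G"
    using comps_fps[OF assms(1)] comps_fps[OF assms(2)] assms(3) by simp
  then have "?F = ?G" using nz by simp
  then have "?F $ k = ?G $ k" by simp
  then show ?thesis by simp
qed

definition nforms :: "nat set \<Rightarrow> nat set list \<Rightarrow> nat \<Rightarrow> (nat \<Rightarrow> nat) set" where
  "nforms J Ls k = {u \<in> comps J k. \<forall>L\<in>set Ls. \<exists>j\<in>L. u j = 0}"

text \<open>Exponents divisible by the lead \<open>L\<close> are shifts by \<open>card L\<close> of
  exponents normal for the other leads, whose conditions are untouched by disjointness. Each lead
  thus contributes a factor, as in a complete intersection.\<close>

lemma nforms_fps:
  assumes "finite J" "\<And>L. L \<in> set Ls \<Longrightarrow> L \<subseteq> J" "sorted_wrt (\<lambda>A B. A \<inter> B = {}) Ls"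
  shows "(1 - fps_X) ^ card J * Abs_fps (\<lambda>k. int (card (nforms J Ls k))) = prod_list (map (\<lambda>L. 1 - fps_X ^ card L) Ls)"
  using assms(2,3)
proof (induction Ls)
  case Nil
  then show ?case using comps_fps[OF assms(1)] by (simp add: nforms_def)
next
  case (Cons L Ls)
  have LJ: "L \<subseteq> J" using Cons by simp
  then have fL: "finite L" using assms(1) finite_subset by blast
  have dis: "L \<inter> M = {}" if "M \<in> set Ls" for M using Cons.prems(2) that by simp
  have fin: "finite (nforms J Ls k)" for Ls k using finite_comps[OF assms(1)] by (simp add: nforms_def)
  let ?F = "\<lambda>Ls. Abs_fps (\<lambda>k. int (card (nforms J Ls k)))"
  have "card (nforms J Ls k) = card (nforms J (L # Ls) k) + (if k < card L then 0 else card (nforms J Ls (k - card L)))" for k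
  proof -
    let ?A = "nforms J (L # Ls) k" and ?B = "{u \<in> nforms J Ls k. \<forall>j\<in>L. u j > 0}"
    have "card (nforms J Ls k) = card (?A \<union> ?B)" by (rule arg_cong[of _ _ card]) (auto simp: nforms_def)
    also have "card (?A \<union> ?B) = card ?A + card ?B"
    proof (rule card_Un_disjoint[OF fin])
      show "finite ?B" using fin by simp
      show "?A \<inter> ?B = {}" by (auto simp: nforms_def)
    qed
    also have "card ?B = (if k < card L then 0 else card (nforms J Ls (k - card L)))"
    proof (cases "k < card L")
      case True
      have "?B = {}"
      proof (rule ccontr)
        assume "?B \<noteq> {}"
        then obtain u where u: "u \<in> comps J k" "\<forall>j\<in>L. u j > 0" by (auto simp: nforms_def)
        have "card L = (\<Sum>j\<in>L. 1)" by simp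
        also have "\<dots> \<le> (\<Sum>j\<in>L. u j)" using u(2) by (intro sum_mono) (auto simp: Suc_leI)
        also have "\<dots> \<le> (\<Sum>j\<in>J. u j)" using LJ assms(1) by (intro sum_mono2) auto
        finally show False using u(1) True by (simp add: comps_def)
      qed
      then show ?thesis using True by (metis card.empty)
    next
      case False
      define f where "f = (\<lambda>(u :: nat \<Rightarrow> nat) j. if j \<in> L then Suc (u j) else u j)"
      define f' where "f' = (\<lambda>(u :: nat \<Rightarrow> nat) j. if j \<in> L then u j - 1 else u j)"
      have sumf: "sum (f u) J = sum u J + card L" for u
      proof -
        have "sum (f u) J = (\<Sum>j\<in>J. u j + (if j \<in> L then 1 else 0))" by (intro sum.cong) (auto simp: f_def)
        then show ?thesis using LJ assms(1) by (simp add: sum.distrib sum.inter_restrict[symmetric] inf.absorb2)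
      qed
      have ff': "f (f' u) = u" if "\<forall>j\<in>L. u j > 0" for u using that by (auto simp: f_def f'_def)
      have keep: "(\<exists>j\<in>M. f u j = 0) \<longleftrightarrow> (\<exists>j\<in>M. u j = 0)" "(\<exists>j\<in>M. f' u j = 0) \<longleftrightarrow> (\<exists>j\<in>M. u j = 0)" if "M \<in> set Ls" for M u
        using dis[OF that] by (auto simp: f_def f'_def disjoint_iff)
      have "bij_betw f (nforms J Ls (k - card L)) ?B"
      proof (rule bij_betw_byWitness[where f' = f'])
        show "\<forall>u\<in>nforms J Ls (k - card L). f' (f u) = u" by (auto simp: f_def f'_def)
        show "\<forall>u\<in>?B. f (f' u) = u" using ff' by auto
        show "f ` nforms J Ls (k - card L) \<subseteq> ?B"
        proof
          fix v assume "v \<in> f ` nforms J Ls (k - card L)"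
          then obtain u where u: "u \<in> nforms J Ls (k - card L)" "v = f u" by blast
          have "\<forall>x. x \<notin> J \<longrightarrow> f u x = 0" using u(1) LJ by (auto simp: f_def nforms_def comps_def)
          moreover have "sum (f u) J = k" using u(1) False sumf[of u] by (simp add: nforms_def comps_def)
          moreover have "\<forall>M\<in>set Ls. \<exists>j\<in>M. f u j = 0" using u(1) keep(1)[of _ u] by (simp add: nforms_def)
          moreover have "\<forall>j\<in>L. f u j > 0" by (simp add: f_def)
          ultimately show "v \<in> ?B" unfolding u(2) nforms_def comps_def by blast
        qed
        show "f' ` ?B \<subseteq> nforms J Ls (k - card L)"
        proof
          fix v assume "v \<in> f' ` ?B"
          then obtain u where u: "u \<in> nforms J Ls k" "\<forall>j\<in>L. u j > 0" "v = f' u" by blast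
          have "\<forall>x. x \<notin> J \<longrightarrow> f' u x = 0" using u(1) LJ by (auto simp: f'_def nforms_def comps_def)
          moreover have "sum (f' u) J + card L = k" using sumf[of "f' u"] ff'[OF u(2)] u(1) by (simp add: nforms_def comps_def)
          ultimately show "v \<in> nforms J Ls (k - card L)" using u(1,3) keep(2)[of _ u] by (auto simp: nforms_def comps_def)
        qed
      qed
      then show ?thesis using False by (simp add: bij_betw_same_card)
    qed
    finally show ?thesis .
  qed
  then have "?F (L # Ls) = (1 - fps_X ^ card L) * ?F Ls"
    by (intro fps_ext) (simp add: left_diff_distrib fps_X_power_mult_nth)
  moreover have "(1 - fps_X) ^ card J * ?F Ls = prod_list (map (\<lambda>L. 1 - fps_X ^ card L) Ls)" using Cons by simp
  ultimately show ?case by (simp add: mult.left_commute)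
qed

section \<open>Lattice points of the cone by degree\<close>

definition slice :: "nat \<Rightarrow> vec set \<Rightarrow> nat \<Rightarrow> (vec \<times> real) set" where
  "slice n P k = {p \<in> cone_semigroup n P. snd p = real k}"

lemma card_slice: "card (dilate k P \<inter> lattice n) = card (slice n P k)"
proof -
  have "bij_betw (\<lambda>x. (x, real k)) (dilate k P \<inter> lattice n) (slice n P k)"
    by (rule bij_betw_byWitness[where f' = fst]) (auto simp: slice_def cone_semigroup_def cone_over_def dilate_def)
  then show ?thesis by (rule bij_betw_same_card)
qed

lemma hstar_slice: "hstar n P = (1 - fps_X) ^ (n + 1) * Abs_fps (\<lambda>k. int (card (slice n P k)))"
  by (simp add: hstar_def card_slice)

lemma finite_lattice_bounded: "finite {x \<in> lattice n. \<forall>i<n. \<bar>lookup x i\<bar> \<le> M}"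
proof -
  obtain N :: nat where N: "M \<le> real N" using real_arch_simple by blast
  let ?T = "{f. \<forall>i. (i \<in> {..<n} \<longrightarrow> f i \<in> {-int N..int N}) \<and> (i \<notin> {..<n} \<longrightarrow> f i = 0)}"
  have fT: "finite ?T" by (rule finite_set_of_finite_funs) auto
  let ?h = "\<lambda>x :: vec. \<lambda>i. \<lfloor>lookup x i\<rfloor>"
  have inj: "inj_on ?h {x \<in> lattice n. \<forall>i<n. \<bar>lookup x i\<bar> \<le> M}"
  proof (rule inj_onI)
    fix x y assume a: "x \<in> {x \<in> lattice n. \<forall>i<n. \<bar>lookup x i\<bar> \<le> M}" "y \<in> {x \<in> lattice n. \<forall>i<n. \<bar>lookup x i\<bar> \<le> M}" "?h x = ?h y"
    show "x = y"
    proof (rule poly_mapping_eqI)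
      fix i
      have "lookup x i \<in> \<int>" "lookup y i \<in> \<int>" using a by (auto simp: lattice_iff)
      then have "lookup x i = of_int (?h x i)" "lookup y i = of_int (?h y i)" by (auto elim: Ints_cases)
      then show "lookup x i = lookup y i" using a(3) by metis
    qed
  qed
  have "?h ` {x \<in> lattice n. \<forall>i<n. \<bar>lookup x i\<bar> \<le> M} \<subseteq> ?T"
  proof clarify
    fix x :: vec and i assume x: "x \<in> lattice n" "\<forall>i<n. \<bar>lookup x i\<bar> \<le> M"
    have Z: "lookup x i = of_int \<lfloor>lookup x i\<rfloor>" using x(1) by (auto simp: lattice_iff elim: Ints_cases)
    show "(i \<in> {..<n} \<longrightarrow> \<lfloor>lookup x i\<rfloor> \<in> {- int N..int N}) \<and> (i \<notin> {..<n} \<longrightarrow> \<lfloor>lookup x i\<rfloor> = 0)"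
    proof (intro conjI impI)
      assume "i \<in> {..<n}"
      then have "\<bar>lookup x i\<bar> \<le> real N" using x(2) N by fastforce
      then have "\<bar>\<lfloor>lookup x i\<rfloor>\<bar> \<le> int N" using Z by linarith
      then show "\<lfloor>lookup x i\<rfloor> \<in> {- int N..int N}" by auto
    next
      assume "i \<notin> {..<n}"
      then show "\<lfloor>lookup x i\<rfloor> = 0" using x(1) by (auto simp: lattice_iff rspace_iff)
    qed
  qed
  then show ?thesis using inj_on_finite[OF inj _ fT] by blast
qed

lemma finite_slice:
  assumes "lattice_polytope n P" shows "finite (slice n P k)"
proof -
  obtain W where W: "finite W" "P = convex hull W" using assms by (auto simp: lattice_polytope_def)
  have "compact P" unfolding W(2) by (rule finite_imp_compact_convex_hull[OF W(1)])
  then obtain B where B: "\<And>x. x \<in> P \<Longrightarrow> norm x \<le> B" using compact_imp_bounded bounded_iff by metis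
  let ?X = "{x \<in> lattice n. \<forall>i<n. \<bar>lookup x i\<bar> \<le> real k * B}"
  have "slice n P k \<subseteq> (\<lambda>x. (x, real k)) ` ?X"
  proof
    fix p assume "p \<in> slice n P k"
    then obtain x where x: "x \<in> P" "p = (real k *\<^sub>R x, real k)" "real k *\<^sub>R x \<in> lattice n"
      by (auto simp: slice_def cone_semigroup_def cone_over_def)
    have "\<bar>lookup (real k *\<^sub>R x) i\<bar> \<le> real k * B" for i
      using abs_lookup_le_norm[of x i] B[OF x(1)] by (simp add: abs_mult mult_left_mono)
    then show "p \<in> (\<lambda>x. (x, real k)) ` ?X" using x by auto
  qed
  then show ?thesis using finite_lattice_bounded finite_subset by blast
qed

section \<open>Lexicographic triangulations and box points\<close>

definition lexpos :: "(nat \<Rightarrow> real) \<Rightarrow> bool" where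
  "lexpos f \<longleftrightarrow> (\<exists>j. f j > 0 \<and> (\<forall>i<j. f i = 0))"

lemma lexpos_total: assumes "f j \<noteq> 0" shows "lexpos f \<or> lexpos (\<lambda>j. - f j)"
proof -
  obtain k where k: "f k \<noteq> 0" "\<forall>i<k. f i = 0" using assms exists_least_iff[of "\<lambda>j. f j \<noteq> 0"] by blast
  show ?thesis
  proof (cases "f k > 0")
    case True
    then show ?thesis using k(2) unfolding lexpos_def by (intro disjI1 exI[of _ k] conjI)
  next
    case False
    then have "- f k > 0" using k(1) by simp
    then show ?thesis using k(2) unfolding lexpos_def by (intro disjI2 exI[of _ k] conjI) auto
  qed
qed

lemma lexpos_asym: "lexpos f \<Longrightarrow> \<not> lexpos (\<lambda>j. - f j)"
  unfolding lexpos_def by (metis linorder_neqE_nat neg_0_equal_iff_equal neg_less_0_iff_less not_less_iff_gr_or_eq)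

lemma lexpos_add: assumes "lexpos f" "lexpos g" shows "lexpos (\<lambda>j. f j + g j)"
proof -
  obtain a b where ab: "f a > 0" "\<forall>i<a. f i = 0" "g b > 0" "\<forall>i<b. g i = 0" using assms by (auto simp: lexpos_def)
  have "f (min a b) + g (min a b) > 0" using ab by (cases a b rule: linorder_cases) (auto simp: min_def)
  then show ?thesis unfolding lexpos_def using ab by (intro exI[of _ "min a b"]) auto
qed

lemma lexpos_scale: assumes "lexpos f" "c > 0" shows "lexpos (\<lambda>j. c * f j)"
proof -
  obtain j where "f j > 0" "\<forall>i<j. f i = 0" using assms by (auto simp: lexpos_def)
  then show ?thesis unfolding lexpos_def using assms by (intro exI[of _ j]) auto
qed

text \<open>A factor \<open>x\<close> does not change the sign to the right of 0; once the constant
  term is nonzero, continuity decides.\<close>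

lemma poly_sign_right:
  fixes q :: "real poly" assumes "q \<noteq> 0"
  shows "(\<exists>e>0. \<forall>x. 0 < x \<and> x < e \<longrightarrow> poly q x > 0) \<or> (\<exists>e>0. \<forall>x. 0 < x \<and> x < e \<longrightarrow> poly q x < 0)"
  using assms
proof (induction q)
  case (pCons a q)
  show ?case
  proof (cases "a = 0")
    case True
    then have "q \<noteq> 0" using pCons.hyps by simp
    with pCons.IH show ?thesis using True by (auto simp: mult_pos_neg)
  next
    case False
    have "isCont (\<lambda>x. poly (pCons a q) x) 0" by simp
    then have "\<exists>d>0. \<forall>x. \<bar>x - 0\<bar> < d \<longrightarrow> \<bar>poly (pCons a q) x - poly (pCons a q) 0\<bar> < \<bar>a\<bar>"
      using False unfolding continuous_at_eps_delta dist_real_def by (metis zero_less_abs_iff)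
    then obtain d where d: "d > 0" "\<And>x. \<bar>x\<bar> < d \<Longrightarrow> \<bar>poly (pCons a q) x - a\<bar> < \<bar>a\<bar>" by auto
    show ?thesis
    proof (cases "a > 0")
      case True
      then show ?thesis using d by (intro disjI1 exI[of _ d]) (fastforce simp: abs_less_iff)
    next
      case False
      then show ?thesis using d by (intro disjI2 exI[of _ d]) (fastforce simp: abs_less_iff)
    qed
  qed
qed simp

section \<open>Bases and lexicographic minima in a configuration of degree-one vectors\<close>

locale configuration =
  fixes n :: nat and J :: "nat set" and g :: "nat \<Rightarrow> vec \<times> real"
  assumes fin: "finite J" and deg1: "\<And>j. j \<in> J \<Longrightarrow> snd (g j) = 1" and gL: "\<And>j. j \<in> J \<Longrightarrow> g j \<in> Lam n"
    and spans: "\<And>p. p \<in> VV n \<Longrightarrow> \<exists>f. (\<forall>j. j \<notin> J \<longrightarrow> f j = 0) \<and> comb J g f = p"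
begin

definition supp :: "(nat \<Rightarrow> real) \<Rightarrow> nat set \<Rightarrow> bool" where "supp f B \<longleftrightarrow> (\<forall>j. j \<notin> B \<longrightarrow> f j = 0)"
definition indep :: "nat set \<Rightarrow> bool" where
  "indep B \<longleftrightarrow> (\<forall>f. supp f B \<longrightarrow> comb J g f = 0 \<longrightarrow> f = (\<lambda>_. 0))"
definition basis :: "nat set \<Rightarrow> bool" where
  "basis B \<longleftrightarrow> B \<subseteq> J \<and> indep B \<and> (\<forall>p\<in>VV n. \<exists>f. supp f B \<and> comb J g f = p)"
definition co :: "nat set \<Rightarrow> vec \<times> real \<Rightarrow> nat \<Rightarrow> real" where
  "co B p = (THE f. supp f B \<and> comb J g f = p)"
definition cone :: "(vec \<times> real) set" where "cone = {comb J g f |f. \<forall>j. f j \<ge> 0}"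

lemma gV: "comb J g f \<in> VV n"
  unfolding comb_def by (intro VV_sum VV_scale Lam_VV gL)

lemma indep_unique: "indep B \<Longrightarrow> supp f B \<Longrightarrow> supp h B \<Longrightarrow> comb J g f = comb J g h \<Longrightarrow> f = h"
proof -
  assume "indep B" "supp f B" "supp h B" "comb J g f = comb J g h"
  then have "(\<lambda>j. f j - h j) = (\<lambda>_. 0)" unfolding indep_def by (auto simp: supp_def comb_diff)
  then show "f = h" by (metis eq_iff_diff_eq_0 ext)
qed

lemma co_unique: "basis B \<Longrightarrow> supp f B \<Longrightarrow> comb J g f = p \<Longrightarrow> co B p = f"
  unfolding co_def by (rule the_equality) (auto intro: indep_unique simp: basis_def)

lemma co: assumes "basis B" "p \<in> VV n" shows co_supp: "supp (co B p) B" and co_comb: "comb J g (co B p) = p"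
proof -
  obtain f where "supp f B" "comb J g f = p" using assms by (auto simp: basis_def)
  then show "supp (co B p) B" "comb J g (co B p) = p" using co_unique[OF assms(1)] by auto
qed

lemma co_add: assumes "basis B" "p \<in> VV n" "q \<in> VV n" shows "co B (p + q) j = co B p j + co B q j"
proof -
  have "co B (p + q) = (\<lambda>j. co B p j + co B q j)"
    using co_supp[OF assms(1,2)] co_supp[OF assms(1,3)] co_comb[OF assms(1,2)] co_comb[OF assms(1,3)]
    by (intro co_unique[OF assms(1)]) (auto simp: supp_def comb_add)
  then show ?thesis by simp
qed

lemma co_scale: assumes "basis B" "p \<in> VV n" shows "co B (c *\<^sub>R p) j = c * co B p j"
proof -
  have "co B (c *\<^sub>R p) = (\<lambda>j. c * co B p j)"
    using co_supp[OF assms] co_comb[OF assms] by (intro co_unique[OF assms(1)]) (auto simp: supp_def comb_scale)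
  then show ?thesis by simp
qed

lemma co_diff: assumes "basis B" "p \<in> VV n" "q \<in> VV n" shows "co B (p - q) j = co B p j - co B q j"
  using co_add[OF assms(1,2), of "(-1) *\<^sub>R q" j] co_scale[OF assms(1,3), of "-1" j] VV_scale[OF assms(3), of "-1"] by simp

lemma co_comb_supp: "basis B \<Longrightarrow> supp f B \<Longrightarrow> co B (comb J g f) = f"
  by (rule co_unique) auto

lemma indep_subset_finite: "B \<subseteq> J \<Longrightarrow> finite B" using fin finite_subset by blast

lemma extend_basis:
  assumes "T \<subseteq> J" "indep T" shows "\<exists>B. T \<subseteq> B \<and> basis B"
proof -
  let ?M = "{B. T \<subseteq> B \<and> B \<subseteq> J \<and> indep B}"
  have "finite ?M" by (rule finite_subset[of _ "Pow J"]) (use fin in auto)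
  moreover have "?M \<noteq> {}" using assms by auto
  ultimately have "\<exists>B\<in>?M. \<forall>B'\<in>?M. B \<subseteq> B' \<longrightarrow> B = B'" by (rule finite_has_maximal)
  then obtain B where B: "B \<in> ?M" "\<forall>B'\<in>?M. B \<subseteq> B' \<longrightarrow> B = B'" by (rule bexE)
  have g_in: "\<exists>f. supp f B \<and> comb J g f = g j" if j: "j \<in> J" for j
  proof (cases "j \<in> B")
    case True
    then show ?thesis using comb_unit[OF fin j, of g] by (intro exI[of _ "\<lambda>i. if i = j then 1 else 0"]) (auto simp: supp_def)
  next
    case False
    then have "\<not> indep (insert j B)" using B j by blast
    then obtain f where f: "supp f (insert j B)" "comb J g f = 0" "f \<noteq> (\<lambda>_. 0)" by (auto simp: indep_def)
    have fj: "f j \<noteq> 0"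
    proof
      assume "f j = 0"
      then have "supp f B" using f(1) by (auto simp: supp_def)
      then show False using B(1) f(2,3) by (auto simp: indep_def)
    qed
    let ?h = "\<lambda>i. (if i = j then 1 else 0) - (1 / f j) * f i"
    have "comb J g ?h = g j" by (simp only: comb_diff comb_scale comb_unit[OF fin j] f(2)) simp
    moreover have "supp ?h B" using f(1) fj by (auto simp: supp_def)
    ultimately show ?thesis by blast
  qed
  have "\<forall>j\<in>J. \<exists>f. supp f B \<and> comb J g f = g j" using g_in by blast
  from bchoice[OF this] obtain F where F: "\<And>j. j \<in> J \<Longrightarrow> supp (F j) B" "\<And>j. j \<in> J \<Longrightarrow> comb J g (F j) = g j" by blast
  have "\<exists>f. supp f B \<and> comb J g f = p" if "p \<in> VV n" for p
  proof -
    obtain f where f: "comb J g f = p" using spans[OF \<open>p \<in> VV n\<close>] by blast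
    let ?h = "\<lambda>i. \<Sum>j\<in>J. f j * F j i"
    have "comb J g ?h = (\<Sum>j\<in>J. f j *\<^sub>R comb J g (F j))" by (simp only: comb_sum comb_scale)
    also have "\<dots> = p" using f F(2) by (simp add: comb_def[of J g f])
    finally show ?thesis using F(1) by (intro exI[of _ ?h]) (auto simp: supp_def intro!: sum.neutral)
  qed
  then show ?thesis using B(1) by (intro exI[of _ B]) (auto simp: basis_def)
qed

lemma basis_subset: assumes "basis B" "basis B'" "B \<subseteq> B'" shows "B = B'"
proof (rule ccontr)
  assume "B \<noteq> B'"
  then obtain j where j: "j \<in> B'" "j \<notin> B" using assms by blast
  then have jJ: "j \<in> J" using assms by (auto simp: basis_def)
  have V: "g j \<in> VV n" using gL[OF jJ] by (rule Lam_VV)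
  let ?u = "\<lambda>i. if i = j then 1 else 0 :: real"
  have "co B (g j) = ?u"
    using co_supp[OF assms(1) V] co_comb[OF assms(1) V] assms(2,3) j comb_unit[OF fin jJ, of g]
    by (intro indep_unique[of B']) (auto simp: basis_def supp_def)
  then have "co B (g j) j = 1" by simp
  then show False using co_supp[OF assms(1) V] j(2) by (simp add: supp_def)
qed

text \<open>Caratheodory's reduction with a prescribed direction: a dependency of the support is
  taken lexicographically positive, and the largest admissible multiple of it is subtracted. The
  coefficients decrease lexicographically while the support shrinks.\<close>

lemma reduce_to_indep:
  assumes "supp f J" "\<And>j. f j \<ge> 0"
  shows "\<exists>h. supp h J \<and> (\<forall>j. h j \<ge> 0) \<and> comb J g h = comb J g f \<and> indep {j. h j \<noteq> 0} \<and>
    (h = f \<or> lexpos (\<lambda>j. f j - h j))"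
  using assms
proof (induction "card {j. f j \<noteq> 0}" arbitrary: f rule: less_induct)
  case less
  show ?case
  proof (cases "indep {j. f j \<noteq> 0}")
    case True
    then show ?thesis using less.prems by blast
  next
    case False
    then obtain r0 where r0: "supp r0 {j. f j \<noteq> 0}" "comb J g r0 = 0" "r0 \<noteq> (\<lambda>_. 0)" by (auto simp: indep_def)
    then obtain j1 where "r0 j1 \<noteq> 0" by blast
    define r where "r = (if lexpos r0 then r0 else (\<lambda>j. - r0 j))"
    have r: "supp r {j. f j \<noteq> 0}" "comb J g r = 0" "lexpos r"
      using r0 lexpos_total[of r0 j1] \<open>r0 j1 \<noteq> 0\<close> comb_scale[of J g "-1" r0] by (auto simp: r_def supp_def)
    have fsub: "{j. f j \<noteq> 0} \<subseteq> J" using less.prems by (auto simp: supp_def)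
    define K where "K = {j\<in>J. r j > 0}"
    have finK: "finite K" using fin by (simp add: K_def)
    obtain i where i: "r i > 0" using r(3) by (auto simp: lexpos_def)
    then have "f i \<noteq> 0" using r(1) by (auto simp: supp_def)
    then have iK: "i \<in> K" using i fsub by (auto simp: K_def)
    define d where "d = Min ((\<lambda>j. f j / r j) ` K)"
    have "d \<in> (\<lambda>j. f j / r j) ` K" unfolding d_def using finK iK by (intro Min_in) auto
    then obtain k where k: "k \<in> K" "d = f k / r k" by blast
    have fk: "f k > 0" "r k > 0" using k(1) r(1) less.prems(2)[of k] by (auto simp: K_def supp_def less_le)
    have d0: "d > 0" using fk k(2) by simp
    have dle: "d * r j \<le> f j" for j
    proof (cases "r j > 0")
      case True
      then have "f j \<noteq> 0" using r(1) by (auto simp: supp_def)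
      then have "j \<in> K" using True fsub by (auto simp: K_def)
      then have "d \<le> f j / r j" unfolding d_def using finK by (intro Min_le) auto
      then show ?thesis using True by (simp add: pos_le_divide_eq)
    next
      case False
      then have "d * r j \<le> 0" using d0 by (simp add: mult_nonneg_nonpos)
      then show ?thesis using less.prems(2)[of j] by simp
    qed
    define f' where "f' = (\<lambda>j. f j - d * r j)"
    have f'0: "f' j = 0" if "f j = 0" for j using r(1) that by (auto simp: f'_def supp_def)
    have f'k: "f' k = 0" using fk k(2) by (simp add: f'_def)
    have "{j. f' j \<noteq> 0} \<subset> {j. f j \<noteq> 0}"
    proof (rule psubsetI)
      show "{j. f' j \<noteq> 0} \<subseteq> {j. f j \<noteq> 0}" using f'0 by blast
      have "k \<notin> {j. f' j \<noteq> 0}" "k \<in> {j. f j \<noteq> 0}" using f'k fk by simp_all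
      then show "{j. f' j \<noteq> 0} \<noteq> {j. f j \<noteq> 0}" by metis
    qed
    moreover have "finite {j. f j \<noteq> 0}" using fsub fin finite_subset by blast
    ultimately have "card {j. f' j \<noteq> 0} < card {j. f j \<noteq> 0}" by (rule psubset_card_mono[rotated])
    moreover have "supp f' J" using less.prems(1) f'0 by (auto simp: supp_def)
    moreover have "f' j \<ge> 0" for j using dle[of j] by (simp add: f'_def)
    ultimately obtain h where h: "supp h J" "\<forall>j. h j \<ge> 0" "comb J g h = comb J g f'" "indep {j. h j \<noteq> 0}"
      "h = f' \<or> lexpos (\<lambda>j. f' j - h j)" using less.hyps[of f'] by blast
    have c: "comb J g f' = comb J g f" using r(2) by (simp add: f'_def comb_diff comb_scale)
    have "lexpos (\<lambda>j. f j - f' j)" using lexpos_scale[OF r(3) d0] by (simp add: f'_def)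
    then have "lexpos (\<lambda>j. f j - h j)" using h(5) lexpos_add[of "\<lambda>j. f j - f' j" "\<lambda>j. f' j - h j"] by auto
    then show ?thesis using h c by auto
  qed
qed

text \<open>Nonnegative representations with independent support are determined by their support, so
  there are finitely many; every other representation lies lexicographically above one of
  them.\<close>

lemma lexmin_exists:
  assumes "supp f J" "\<And>j. f j \<ge> 0"
  shows "\<exists>h. supp h J \<and> (\<forall>j. h j \<ge> 0) \<and> comb J g h = comb J g f \<and> indep {j. h j \<noteq> 0} \<and>
    (\<forall>k. supp k J \<longrightarrow> (\<forall>j. k j \<ge> 0) \<longrightarrow> comb J g k = comb J g f \<longrightarrow> k = h \<or> lexpos (\<lambda>j. k j - h j))"
proof -
  define M where "M = {h. supp h J \<and> (\<forall>j. h j \<ge> 0) \<and> comb J g h = comb J g f \<and> indep {j. h j \<noteq> 0}}"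
  have "inj_on (\<lambda>h. {j. h j \<noteq> 0}) M"
  proof (rule inj_onI)
    fix x y assume xy: "x \<in> M" "y \<in> M" "{j. x j \<noteq> 0} = {j. y j \<noteq> 0}"
    show "x = y" by (rule indep_unique[of "{j. x j \<noteq> 0}"]) (use xy in \<open>auto simp: M_def supp_def\<close>)
  qed
  moreover have "(\<lambda>h. {j. h j \<noteq> 0}) ` M \<subseteq> Pow J" by (auto simp: M_def supp_def)
  ultimately have finM: "finite M" using inj_on_finite[of _ M "Pow J"] fin by simp
  have "M \<noteq> {}" using reduce_to_indep[OF assms] by (auto simp: M_def)
  have "\<exists>h\<in>N. \<forall>k\<in>N. k = h \<or> lexpos (\<lambda>j. k j - h j)" if "finite N" "N \<noteq> {}" for N :: "(nat \<Rightarrow> real) set"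
    using that
  proof (induction N rule: finite_ne_induct)
    case (insert x N)
    then obtain h where h: "h \<in> N" "\<forall>k\<in>N. k = h \<or> lexpos (\<lambda>j. k j - h j)" by blast
    show ?case
    proof (cases "x = h \<or> lexpos (\<lambda>j. x j - h j)")
      case True
      then show ?thesis using h by blast
    next
      case False
      then obtain i where "x i - h i \<noteq> 0" by fastforce
      then have lx: "lexpos (\<lambda>j. h j - x j)" using lexpos_total[of "\<lambda>j. x j - h j" i] False by simp
      have "lexpos (\<lambda>j. k j - x j)" if "k \<in> N" for k
        using h(2) that lx lexpos_add[of "\<lambda>j. k j - h j" "\<lambda>j. h j - x j"] by auto
      then show ?thesis by (intro bexI[of _ x]) auto
    qed
  qed auto
  from this[OF finM \<open>M \<noteq> {}\<close>] obtain h where h: "h \<in> M" "\<forall>k\<in>M. k = h \<or> lexpos (\<lambda>j. k j - h j)" by blast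
  have "k = h \<or> lexpos (\<lambda>j. k j - h j)" if k: "supp k J" "\<forall>j. k j \<ge> 0" "comb J g k = comb J g f" for k
  proof -
    obtain k' where k': "supp k' J" "\<forall>j. k' j \<ge> 0" "comb J g k' = comb J g k" "indep {j. k' j \<noteq> 0}"
      "k' = k \<or> lexpos (\<lambda>j. k j - k' j)" using reduce_to_indep[of k] k by blast
    then have "k' \<in> M" using k by (simp add: M_def)
    then have "k' = h \<or> lexpos (\<lambda>j. k' j - h j)" using h by blast
    then show ?thesis using k'(5) lexpos_add[of "\<lambda>j. k j - k' j" "\<lambda>j. k' j - h j"] by auto
  qed
  then show ?thesis using h(1) by (intro exI[of _ h]) (auto simp: M_def)
qed

text \<open>The maximal cones of the triangulation selected by lexicographic minimality of coefficients.\<close>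

definition good :: "nat set \<Rightarrow> bool" where
  "good B \<longleftrightarrow> basis B \<and> (\<forall>r. supp r J \<longrightarrow> comb J g r = 0 \<longrightarrow> (\<forall>j\<in>J - B. r j \<ge> 0) \<longrightarrow> r = (\<lambda>_. 0) \<or> lexpos r)"

text \<open>A relation that is nonnegative off \<open>B\<close> can be added to \<open>h\<close>
  with a small positive factor without losing nonnegativity, so minimality of \<open>h\<close> makes
  it zero or lexicographically positive.\<close>

lemma good_if_lexmin:
  assumes B: "basis B" and h: "supp h B" "\<And>j. j \<in> B \<Longrightarrow> h j > 0"
    and min: "\<And>k. supp k J \<Longrightarrow> (\<forall>j. k j \<ge> 0) \<Longrightarrow> comb J g k = comb J g h \<Longrightarrow> k = h \<or> lexpos (\<lambda>j. k j - h j)"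
  shows "good B"
  unfolding good_def
proof (intro conjI B allI impI)
  fix r assume r: "supp r J" "comb J g r = 0" "\<forall>j\<in>J - B. r j \<ge> 0"
  have BJ: "B \<subseteq> J" "finite B" using B indep_subset_finite by (auto simp: basis_def)
  have "\<exists>d>0. \<forall>j\<in>C. h j + d * r j \<ge> 0" if "finite C" "C \<subseteq> B" for C
    using that
  proof (induction C rule: finite_induct)
    case empty then show ?case by (auto intro: exI[of _ 1])
  next
    case (insert x C)
    then obtain d where d: "d > 0" "\<forall>j\<in>C. h j + d * r j \<ge> 0" by auto
    define e where "e = min d (h x / (\<bar>r x\<bar> + 1))"
    have hx: "h x > 0" using insert h(2) by simp
    have e: "e > 0" "e \<le> d" using d hx by (auto simp: e_def)
    have "e \<le> h x / (\<bar>r x\<bar> + 1)" by (simp add: e_def)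
    then have "e * (\<bar>r x\<bar> + 1) \<le> h x" by (simp add: pos_le_divide_eq)
    then have "e * \<bar>r x\<bar> \<le> h x" using e by (simp add: distrib_left)
    moreover have "- (e * \<bar>r x\<bar>) \<le> e * r x"
    proof -
      have "e * (- \<bar>r x\<bar>) \<le> e * r x" using e by (intro mult_left_mono) auto
      then show ?thesis by simp
    qed
    ultimately have "h x + e * r x \<ge> 0" by linarith
    moreover have "h j + e * r j \<ge> 0" if "j \<in> C" for j
    proof (cases "r j \<ge> 0")
      case True
      then have "e * r j \<ge> 0" using e by simp
      moreover have "h j > 0" using h(2)[of j] insert.prems \<open>j \<in> C\<close> by blast
      ultimately show ?thesis by linarith
    next
      case False
      then have "d * r j \<le> e * r j" using e by (intro mult_right_mono_neg) auto
      then show ?thesis using d(2) that by fastforce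
    qed
    ultimately show ?case using e by auto
  qed
  from this[OF BJ(2) subset_refl] obtain d where d: "d > 0" "\<forall>j\<in>B. h j + d * r j \<ge> 0" by blast
  let ?k = "\<lambda>j. h j + d * r j"
  have "?k j \<ge> 0" for j
  proof (cases "j \<in> B")
    case False
    then have "h j = 0" using h(1) by (simp add: supp_def)
    moreover have "r j \<ge> 0" using r(1,3) False by (cases "j \<in> J") (auto simp: supp_def)
    ultimately show ?thesis using d by simp
  qed (use d in auto)
  moreover have "supp ?k J" using h(1) r(1) BJ by (auto simp: supp_def)
  moreover have "comb J g ?k = comb J g h" by (simp add: comb_add comb_scale r(2))
  ultimately have "?k = h \<or> lexpos (\<lambda>j. ?k j - h j)" using min by blast
  then show "r = (\<lambda>_. 0) \<or> lexpos r"
  proof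
    assume "?k = h"
    then have "d * r j = 0" for j by (metis add_cancel_left_right)
    then show ?thesis using d by auto
  next
    assume "lexpos (\<lambda>j. ?k j - h j)"
    then have "lexpos (\<lambda>j. d * r j)" by simp
    then show ?thesis using lexpos_scale[of "\<lambda>j. d * r j" "1 / d"] d by simp
  qed
qed

text \<open>The difference of the two representations is a relation nonnegative off
  \<open>B'\<close>, and its negative is nonnegative off \<open>B\<close>. Both cannot be
  lexicographically positive, so the representations agree.\<close>

lemma good_unique:
  assumes B: "good B" "good B'" and f: "supp f B" "\<And>j. j \<in> B \<Longrightarrow> f j > 0" and h: "supp h B'" "\<And>j. h j \<ge> 0"
    and eq: "comb J g f = comb J g h"
  shows "B = B'"
proof -
  have BJ: "B \<subseteq> J" "B' \<subseteq> J" using B by (auto simp: good_def basis_def)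
  have f0: "f j \<ge> 0" for j using f by (cases "j \<in> B") (auto simp: supp_def less_imp_le)
  have out: "f j = 0" "h j = 0" if "j \<notin> J" for j using that f(1) h(1) BJ by (auto simp: supp_def)
  let ?r = "\<lambda>j. f j - h j" and ?r' = "\<lambda>j. - (f j - h j)"
  have "supp ?r J" "comb J g ?r = 0" "\<forall>j\<in>J - B'. ?r j \<ge> 0" using f h f0 out eq by (auto simp: supp_def comb_diff)
  then have 1: "?r = (\<lambda>_. 0) \<or> lexpos ?r" using B(2) unfolding good_def by blast
  have "supp ?r' J" "\<forall>j\<in>J - B. ?r' j \<ge> 0" using f h out by (auto simp: supp_def)
  moreover have "comb J g ?r' = 0" using eq comb_scale[of J g "-1" ?r] by (simp add: comb_diff)
  ultimately have 2: "?r' = (\<lambda>_. 0) \<or> lexpos ?r'" using B(1) unfolding good_def by blast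
  have "?r = (\<lambda>_. 0)"
  proof (rule ccontr)
    assume nz: "?r \<noteq> (\<lambda>_. 0)"
    then obtain x where "f x - h x \<noteq> 0" by blast
    then have "?r' \<noteq> (\<lambda>_. 0)" by (metis neg_equal_0_iff_equal)
    then show False using 1 2 nz lexpos_asym by blast
  qed
  then have "f j = h j" for j by (metis eq_iff_diff_eq_0)
  then have "B \<subseteq> B'" using f h by (metis less_irrefl subsetI supp_def)
  then show ?thesis using basis_subset B by (auto simp: good_def)
qed

text \<open>A curve leaving 0 into the cone. The distinct powers of \<open>x\<close> make every
  coordinate in every basis a nonzero polynomial, so for small positive \<open>x\<close> the curve
  avoids all walls.\<close>

definition pert :: "real \<Rightarrow> vec \<times> real" where "pert x = comb J g (\<lambda>j. x ^ Suc j)"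

definition pertpoly :: "nat set \<Rightarrow> nat \<Rightarrow> real poly" where
  "pertpoly B v = (\<Sum>i\<in>J. monom (co B (g i) v) (Suc i))"

lemma co_pert: assumes "basis B" shows "co B (pert x) v = poly (pertpoly B v) x"
proof -
  have "co B (\<Sum>i\<in>I. c i *\<^sub>R g i) v = (\<Sum>i\<in>I. c i * co B (g i) v)" if "finite I" "I \<subseteq> J" for c I
    using that
  proof (induction I rule: finite_induct)
    case empty
    have "co B 0 = (\<lambda>_. 0)" using co_comb_supp[OF assms, of "\<lambda>_. 0"] by (simp add: supp_def)
    then show ?case by simp
  next
    case (insert i I)
    have "(\<Sum>i\<in>I. c i *\<^sub>R g i) \<in> VV n" using insert by (intro VV_sum VV_scale Lam_VV gL) auto
    moreover have "g i \<in> VV n" using insert by (intro Lam_VV gL) auto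
    ultimately show ?case using insert co_add[OF assms VV_scale] co_scale[OF assms] by simp
  qed
  from this[OF fin order_refl] show ?thesis
    by (simp add: pert_def comb_def pertpoly_def poly_sum poly_monom mult.commute)
qed

lemma pertpoly_coeff: assumes "basis B" "v \<in> B" shows "coeff (pertpoly B v) (Suc v) = 1" "coeff (pertpoly B v) 0 = 0"
proof -
  have vJ: "v \<in> J" using assms by (auto simp: basis_def)
  have "co B (g v) = (\<lambda>i. if i = v then 1 else 0)"
    using assms comb_unit[OF fin vJ, of g] by (intro co_unique) (auto simp: supp_def)
  then show "coeff (pertpoly B v) (Suc v) = 1" using vJ fin by (simp add: pertpoly_def coeff_sum)
  show "coeff (pertpoly B v) 0 = 0" by (simp add: pertpoly_def coeff_sum)
qed

text \<open>Tells on which side of the wall of \<open>v\<close> the displaced points lie; exactly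
  these walls are closed in the half-open cone \<open>cell 1 B\<close>.\<close>

definition upper :: "nat set \<Rightarrow> nat \<Rightarrow> bool" where
  "upper B v \<longleftrightarrow> (\<exists>e>0. \<forall>x. 0 < x \<and> x < e \<longrightarrow> poly (pertpoly B v) x > 0)"

lemma sign_eventually:
  assumes "basis B" "v \<in> B" "s \<noteq> 0"
  shows "(\<exists>e>0. \<forall>x. 0 < x \<and> x < e \<longrightarrow> b + s * poly (pertpoly B v) x > 0) \<or> (\<exists>e>0. \<forall>x. 0 < x \<and> x < e \<longrightarrow> b + s * poly (pertpoly B v) x < 0)"
proof -
  have "coeff ([:b:] + smult s (pertpoly B v)) (Suc v) \<noteq> 0" using pertpoly_coeff[OF assms(1,2)] assms(3) by simp
  then have "[:b:] + smult s (pertpoly B v) \<noteq> 0" by (metis coeff_0)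
  from poly_sign_right[OF this] show ?thesis by simp
qed

text \<open>The constant term of \<open>pertpoly\<close> is 0, so \<open>b\<close> decides unless it
  vanishes; then the sign of the perturbation does.\<close>

lemma eventually_pos_iff:
  assumes "basis B" "v \<in> B" "s = 1 \<or> s = -1"
  shows "(\<exists>e>0. \<forall>x. 0 < x \<and> x < e \<longrightarrow> b + s * poly (pertpoly B v) x > 0) \<longleftrightarrow> b > 0 \<or> (b = 0 \<and> (upper B v \<longleftrightarrow> s = 1))"
    (is "?E \<longleftrightarrow> _")
proof -
  have cont: "isCont (\<lambda>x. b + s * poly (pertpoly B v) x) 0" by simp
  have at0: "b + s * poly (pertpoly B v) 0 = b" using pertpoly_coeff(2)[OF assms(1,2)] by (simp add: poly_0_coeff_0)
  have pm: "\<exists>x. 0 < x \<and> x < e \<and> x < e'" if "e > 0" "e' > 0" for e e' :: real using that by (intro exI[of _ "min e e' / 2"]) auto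
  consider "b > 0" | "b < 0" | "b = 0" by linarith
  then show ?thesis
  proof cases
    case 1
    obtain d where d: "d > 0" "\<And>x. \<bar>x\<bar> < d \<Longrightarrow> \<bar>b + s * poly (pertpoly B v) x - b\<bar> < b"
      using cont 1 at0 unfolding continuous_at_eps_delta dist_real_def by (metis diff_zero)
    have ?E by (intro exI[of _ d] conjI d(1) allI impI) (use d(2) in \<open>fastforce simp: abs_less_iff\<close>)
    then show ?thesis using 1 by simp
  next
    case 2
    obtain d where d: "d > 0" "\<And>x. \<bar>x\<bar> < d \<Longrightarrow> \<bar>b + s * poly (pertpoly B v) x - b\<bar> < - b"
      using cont 2 at0 unfolding continuous_at_eps_delta dist_real_def by (metis diff_zero neg_0_less_iff_less)
    have "\<not> ?E"
    proof
      assume ?E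
      then obtain e where e: "e > 0" "\<And>x. 0 < x \<and> x < e \<Longrightarrow> b + s * poly (pertpoly B v) x > 0" by blast
      obtain x where "0 < x" "x < e" "x < d" using pm[OF e(1) d(1)] by blast
      then show False using e(2)[of x] d(2)[of x] by (simp add: abs_less_iff)
    qed
    then show ?thesis using 2 by simp
  next
    case 3
    show ?thesis
    proof (cases "s = 1")
      case True
      then show ?thesis using 3 by (simp add: upper_def)
    next
      case False
      then have s: "s = -1" using assms(3) by simp
      have "(\<exists>e>0. \<forall>x. 0 < x \<and> x < e \<longrightarrow> 0 + 1 * poly (pertpoly B v) x > 0) \<or> (\<exists>e>0. \<forall>x. 0 < x \<and> x < e \<longrightarrow> 0 + 1 * poly (pertpoly B v) x < 0)"
        by (rule sign_eventually[OF assms(1,2)]) simp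
      moreover have "\<not> ((\<exists>e>0. \<forall>x. 0 < x \<and> x < e \<longrightarrow> poly (pertpoly B v) x > 0) \<and> (\<exists>e>0. \<forall>x. 0 < x \<and> x < e \<longrightarrow> poly (pertpoly B v) x < 0))"
        using pm by (metis less_asym)
      ultimately show ?thesis using 3 s by (auto simp: upper_def)
    qed
  qed
qed

text \<open>The half-open simplicial cone of points that enter its interior when displaced by
  \<open>s\<close> times the perturbation. The choice \<open>s = 1\<close> partitions the whole
  cone; \<open>s = -1\<close> reverses the closed walls and suits interior points.\<close>

definition cell :: "real \<Rightarrow> nat set \<Rightarrow> (vec \<times> real) set" where
  "cell s B = {p \<in> VV n. \<forall>v\<in>B. co B p v > 0 \<or> (co B p v = 0 \<and> (upper B v \<longleftrightarrow> s = 1))}"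

lemma pertV: "pert x \<in> VV n" unfolding pert_def by (rule gV)

lemma cell_iff:
  assumes "basis B" "s = 1 \<or> s = -1" "p \<in> VV n"
  shows "p \<in> cell s B \<longleftrightarrow> (\<exists>e>0. \<forall>x. 0 < x \<and> x < e \<longrightarrow> (\<forall>v\<in>B. co B (p + s *\<^sub>R pert x) v > 0))"
proof -
  have finB: "finite B" using assms indep_subset_finite by (auto simp: basis_def)
  have c: "co B (p + s *\<^sub>R pert x) v = co B p v + s * poly (pertpoly B v) x" for x v
    using assms pertV by (simp add: co_add VV_scale co_scale co_pert)
  have "p \<in> cell s B \<longleftrightarrow> (\<forall>v\<in>B. \<exists>e>0. \<forall>x. 0 < x \<and> x < e \<longrightarrow> co B p v + s * poly (pertpoly B v) x > 0)"
    unfolding cell_def using assms(3) eventually_pos_iff[OF assms(1) _ assms(2)] by simp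
  also have "\<dots> \<longleftrightarrow> (\<exists>e>0. \<forall>x. 0 < x \<and> x < e \<longrightarrow> (\<forall>v\<in>B. co B p v + s * poly (pertpoly B v) x > 0))"
  proof
    assume a: "\<forall>v\<in>B. \<exists>e>0. \<forall>x. 0 < x \<and> x < e \<longrightarrow> co B p v + s * poly (pertpoly B v) x > 0"
    from bchoice[OF a] obtain e where e: "\<forall>v\<in>B. e v > 0 \<and> (\<forall>x. 0 < x \<and> x < e v \<longrightarrow> co B p v + s * poly (pertpoly B v) x > 0)"
      by (rule exE)
    define e0 where "e0 = Min (insert 1 (e ` B))"
    have "e0 > 0" unfolding e0_def using finB e by (subst Min_gr_iff) auto
    moreover have "e0 \<le> e v" if "v \<in> B" for v unfolding e0_def using finB that by (intro Min_le) auto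
    ultimately show "\<exists>e>0. \<forall>x. 0 < x \<and> x < e \<longrightarrow> (\<forall>v\<in>B. co B p v + s * poly (pertpoly B v) x > 0)"
      using e by (intro exI[of _ e0]) force
  qed blast
  finally show ?thesis by (simp add: c)
qed

text \<open>For \<open>x\<close> below all sign changes of the finitely many coordinates, the
  displaced point lies on no wall. The lexicographically least representation at one such
  \<open>x0\<close> selects a basis, and its coordinates stay positive for all smaller
  \<open>x > 0\<close>.\<close>

lemma cell_exists:
  assumes s: "s = 1 \<or> s = -1" and p: "p \<in> VV n"
    and c: "e1 > 0" "\<And>x. 0 < x \<Longrightarrow> x < e1 \<Longrightarrow> p + s *\<^sub>R pert x \<in> cone"
  shows "\<exists>B. good B \<and> p \<in> cell s B"
proof -
  have s0: "s \<noteq> 0" using s by auto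
  let ?pq = "\<lambda>x. p + s *\<^sub>R pert x"
  let ?I = "{(B, v). basis B \<and> v \<in> B}"
  have "finite ?I" by (rule finite_subset[of _ "Pow J \<times> J"]) (use fin in \<open>auto simp: basis_def\<close>)
  define Q where "Q = (\<lambda>(B, v) x. co B p v + s * poly (pertpoly B v) x)"
  have Qc: "Q (B, v) x = co B (?pq x) v" if "basis B" for B v x
    using that p pertV by (simp add: Q_def co_add VV_scale co_scale co_pert)
  have "\<forall>i\<in>?I. \<exists>e>0. (\<forall>x. 0 < x \<and> x < e \<longrightarrow> Q i x > 0) \<or> (\<forall>x. 0 < x \<and> x < e \<longrightarrow> Q i x < 0)"
  proof
    fix i assume "i \<in> ?I"
    then obtain B v where i: "i = (B, v)" "basis B" "v \<in> B" by blast
    from sign_eventually[OF i(2,3) s0, of "co B p v"]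
    show "\<exists>e>0. (\<forall>x. 0 < x \<and> x < e \<longrightarrow> Q i x > 0) \<or> (\<forall>x. 0 < x \<and> x < e \<longrightarrow> Q i x < 0)"
      unfolding i(1) Q_def by auto
  qed
  from bchoice[OF this] obtain e where e': "\<forall>i\<in>?I. e i > 0 \<and> ((\<forall>x. 0 < x \<and> x < e i \<longrightarrow> Q i x > 0) \<or> (\<forall>x. 0 < x \<and> x < e i \<longrightarrow> Q i x < 0))"
    by (rule exE)
  have e: "\<And>i. i \<in> ?I \<Longrightarrow> e i > 0"
    "\<And>i. i \<in> ?I \<Longrightarrow> (\<forall>x. 0 < x \<and> x < e i \<longrightarrow> Q i x > 0) \<or> (\<forall>x. 0 < x \<and> x < e i \<longrightarrow> Q i x < 0)" using bspec[OF e'] by blast+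
  define e0 where "e0 = Min (insert e1 (e ` ?I))"
  have e0: "e0 > 0" unfolding e0_def using \<open>finite ?I\<close> e(1) c(1) by (subst Min_gr_iff) auto
  have e0le: "e0 \<le> e i" if "i \<in> ?I" for i unfolding e0_def using \<open>finite ?I\<close> that by (intro Min_le) auto
  have e0c: "e0 \<le> e1" unfolding e0_def using \<open>finite ?I\<close> by (intro Min_le) auto
  define x0 where "x0 = e0 / 2"
  have x0: "0 < x0" "x0 < e0" using e0 by (auto simp: x0_def)
  have "?pq x0 \<in> cone" using c(2) x0 e0c by simp
  then obtain f where f: "?pq x0 = comb J g f" "\<And>j. f j \<ge> 0" by (auto simp: cone_def)
  let ?f = "\<lambda>j. if j \<in> J then f j else 0"
  have "supp ?f J" "\<And>j. ?f j \<ge> 0" using f by (auto simp: supp_def)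
  from lexmin_exists[OF this] obtain h where h: "supp h J" "\<forall>j. h j \<ge> 0" "comb J g h = ?pq x0" "indep {j. h j \<noteq> 0}"
    "\<forall>k. supp k J \<longrightarrow> (\<forall>j. k j \<ge> 0) \<longrightarrow> comb J g k = ?pq x0 \<longrightarrow> k = h \<or> lexpos (\<lambda>j. k j - h j)"
    unfolding comb_restrict f(1) by blast
  have "{j. h j \<noteq> 0} \<subseteq> J" using h(1) by (auto simp: supp_def)
  then obtain B where B: "{j. h j \<noteq> 0} \<subseteq> B" "basis B" using extend_basis h(4) by blast
  have hB: "supp h B" using B(1) by (auto simp: supp_def)
  have coh: "co B (?pq x0) = h" by (rule co_unique[OF B(2) hB h(3)])
  have Qpos: "Q (B, v) x > 0" if v: "v \<in> B" and x: "0 < x" "x < e0" for v x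
  proof -
    have i: "(B, v) \<in> ?I" using B v by simp
    have "Q (B, v) x0 \<ge> 0" using Qc[OF B(2), of v x0] coh h(2) by simp
    then show ?thesis using e(2)[OF i] e0le[OF i] x x0 by (metis less_le_trans not_less)
  qed
  have "h j > 0" if "j \<in> B" for j using Qpos[OF that x0] Qc[OF B(2)] coh by metis
  then have "good B" using good_if_lexmin[OF B(2) hB] h(3,5) by metis
  moreover have "p \<in> cell s B" unfolding cell_iff[OF B(2) s p]
    using e0 Qpos Qc[OF B(2)] by (intro exI[of _ e0]) auto
  ultimately show ?thesis by blast
qed

lemma cell_unique:
  assumes "good B" "good B'" "s = 1 \<or> s = -1" "p \<in> cell s B" "p \<in> cell s B'"
  shows "B = B'"
proof -
  have b: "basis B" "basis B'" using assms by (auto simp: good_def)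
  have p: "p \<in> VV n" using assms by (simp add: cell_def)
  obtain e e' where e: "e > 0" "\<And>x. 0 < x \<and> x < e \<Longrightarrow> \<forall>v\<in>B. co B (p + s *\<^sub>R pert x) v > 0"
    "e' > 0" "\<And>x. 0 < x \<and> x < e' \<Longrightarrow> \<forall>v\<in>B'. co B' (p + s *\<^sub>R pert x) v > 0"
    using assms(4,5) unfolding cell_iff[OF b(1) assms(3) p] cell_iff[OF b(2) assms(3) p] by blast
  define x where "x = min e e' / 2"
  have x: "0 < x \<and> x < e" "0 < x \<and> x < e'" using e by (auto simp: x_def)
  have V: "p + s *\<^sub>R pert x \<in> VV n" using p pertV by (intro VV_add VV_scale)
  show ?thesis
  proof (rule good_unique[OF assms(1,2)])
    show "supp (co B (p + s *\<^sub>R pert x)) B" "supp (co B' (p + s *\<^sub>R pert x)) B'" using co_supp b V by auto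
    show "comb J g (co B (p + s *\<^sub>R pert x)) = comb J g (co B' (p + s *\<^sub>R pert x))" using co_comb b V by metis
    show "0 < co B (p + s *\<^sub>R pert x) j" if "j \<in> B" for j using e(2)[OF x(1)] that by blast
    show "0 \<le> co B' (p + s *\<^sub>R pert x) j" for j
      using e(4)[OF x(2)] co_supp[OF b(2) V] by (cases "j \<in> B'") (auto simp: supp_def less_imp_le)
  qed
qed

lemma cell_nonneg: "basis B \<Longrightarrow> p \<in> cell s B \<Longrightarrow> co B p j \<ge> 0"
  using co_supp[of B p] by (cases "j \<in> B") (auto simp: cell_def supp_def less_imp_le)

lemma cell_cone: assumes "basis B" "p \<in> cell s B" shows "p \<in> cone"
proof -
  have "comb J g (co B p) = p" using co_comb[OF assms(1)] assms(2) by (simp add: cell_def)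
  then show ?thesis using cell_nonneg[OF assms] unfolding cone_def by (intro CollectI exI[of _ "co B p"]) simp
qed

lemma cone_cell_exists: assumes "p \<in> cone" shows "\<exists>B. good B \<and> p \<in> cell 1 B"
proof -
  obtain f where f: "p = comb J g f" "\<And>j. f j \<ge> 0" using assms by (auto simp: cone_def)
  have "p + 1 *\<^sub>R pert x \<in> cone" if "0 < x" for x
  proof -
    have "p + 1 *\<^sub>R pert x = comb J g (\<lambda>j. f j + x ^ Suc j)" by (simp add: f pert_def comb_add)
    moreover have "f j + x ^ Suc j \<ge> 0" for j using f(2)[of j] zero_le_power[of x "Suc j"] that by simp
    ultimately show ?thesis unfolding cone_def by blast
  qed
  moreover have "p \<in> VV n" unfolding f by (rule gV)
  ultimately show ?thesis using cell_exists[of 1 p 1] by simp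
qed

end

lemma binomial_convolution_nth:
  "(Abs_fps a * Abs_fps b :: int fps) $ k = (\<Sum>j\<le>k. a j * b (k - j))"
  by (simp add: fps_mult_nth atMost_atLeast0)

section \<open>Dimension counts in the ambient space\<close>

lemma VV_standard_basis:
  "\<exists>S0. finite S0 \<and> card S0 = n + 1 \<and> independent S0 \<and> VV n \<subseteq> span S0 \<and> S0 \<subseteq> VV n"
proof -
  let ?e = "\<lambda>i. (single i 1 :: vec, 0 :: real)"
  define S0 where "S0 = insert (0, 1) (?e ` {..<n})"
  have inj: "inj_on ?e {..<n}" by (rule inj_onI) (metis fst_conv lookup_single_eq lookup_single_not_eq zero_neq_one)
  have cS: "card S0 = n + 1" unfolding S0_def using inj by (subst card_insert_disjoint) (auto simp: card_image)
  have finS: "finite S0" by (simp add: S0_def)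
  have SV: "S0 \<subseteq> VV n" unfolding S0_def using unit_in_Lam Lam_VV by blast
  have Vspan: "VV n \<subseteq> span S0"
  proof
    fix p assume "p \<in> VV n"
    then have "p = (\<Sum>i<n. lookup (fst p) i *\<^sub>R ?e i) + snd p *\<^sub>R (0, 1)" by (rule VV_decomp)
    also have "\<dots> \<in> span S0" by (intro span_add span_sum span_scale span_base) (auto simp: S0_def)
    finally show "p \<in> span S0" .
  qed
  have "independent S0"
  proof -
    have "u v = 0" if u: "(\<Sum>v\<in>S0. u v *\<^sub>R v) = 0" and v: "v \<in> S0" for u v
    proof -
      have s: "(\<Sum>v\<in>S0. u v *\<^sub>R v) = u (0, 1) *\<^sub>R (0, 1) + (\<Sum>i<n. u (?e i) *\<^sub>R ?e i)"
        unfolding S0_def using inj by (subst sum.insert) (auto simp: sum.reindex simp del: scaleR_Pair)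
      have "u (0, 1) = 0" using arg_cong[OF u[unfolded s], of snd] by (simp add: snd_sum)
      moreover have "u (?e i) = 0" if "i < n" for i
      proof -
        have "lookup (fst (u (0, 1) *\<^sub>R (0, 1) + (\<Sum>i<n. u (?e i) *\<^sub>R ?e i))) i = u (?e i)"
          using that by (simp add: fst_sum lookup_add lookup_sum' lookup_single when_def if_distrib cong: if_cong)
        then show ?thesis unfolding u[unfolded s] by simp
      qed
      ultimately show ?thesis using v by (auto simp: S0_def)
    qed
    then show ?thesis unfolding dependent_finite[OF finS] by blast
  qed
  then show ?thesis using cS finS SV Vspan by blast
qed

lemma card_spanning_VV: assumes "finite X" "VV n \<subseteq> span X" shows "n + 1 \<le> card X"
proof -
  obtain S0 where S0: "card S0 = n + 1" "independent S0" "S0 \<subseteq> VV n" using VV_standard_basis by blast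
  then show ?thesis using independent_span_bound[OF assms(1), of S0] assms(2) by auto
qed

lemma independent_spanning_VV:
  assumes "finite X" "VV n \<subseteq> span X" "card X \<le> n + 1" shows "independent X"
proof (rule ccontr)
  assume "\<not> independent X"
  then obtain a where a: "a \<in> X" "a \<in> span (X - {a})" by (auto simp: dependent_def)
  then have "span (X - {a}) = span X" using span_redundant[of a "X - {a}"] by (simp add: insert_absorb)
  then have "n + 1 \<le> card (X - {a})" using assms by (intro card_spanning_VV) auto
  then show False using a assms card_Diff1_less[of X a] by simp
qed

context configuration
begin

lemma basis_fin: "basis B \<Longrightarrow> finite B" and basis_J: "basis B \<Longrightarrow> B \<subseteq> J"
  using indep_subset_finite by (auto simp: basis_def)

lemma basis_family:
  assumes b: "basis B"
  shows "inj_on g B" "independent (g ` B)" "VV n \<subseteq> span (g ` B)" "g ` B \<subseteq> VV n"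
proof -
  show inj: "inj_on g B"
  proof (rule inj_onI)
    fix i j assume ij: "i \<in> B" "j \<in> B" "g i = g j"
    have J: "i \<in> J" "j \<in> J" using ij basis_J[OF b] by auto
    have "(\<lambda>k. if k = i then 1 else 0 :: real) = (\<lambda>k. if k = j then 1 else 0)"
      using b ij comb_unit[OF fin J(1), of g] comb_unit[OF fin J(2), of g]
      by (intro indep_unique[of B]) (auto simp: basis_def supp_def)
    then have "(if i = i then 1 else 0 :: real) = (if i = j then 1 else 0)" by (rule fun_cong)
    then show "i = j" by (simp split: if_splits)
  qed
  have zero: "u v = 0" if u: "(\<Sum>v\<in>g ` B. u v *\<^sub>R v) = 0" and v: "v \<in> g ` B" for u v
  proof -
    have "(\<Sum>j\<in>B. u (g j) *\<^sub>R g j) = 0" using u inj by (simp add: sum.reindex)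
    moreover have "comb J g (\<lambda>j. if j \<in> B then u (g j) else 0) = (\<Sum>j\<in>B. u (g j) *\<^sub>R g j)"
      unfolding comb_def using fin basis_J[OF b]
      by (intro sum.mono_neutral_cong_right) auto
    ultimately have "(\<lambda>j. if j \<in> B then u (g j) else 0) = (\<lambda>_. 0)"
      using b by (auto simp: basis_def indep_def supp_def)
    then show ?thesis using v by (metis (mono_tags, lifting) imageE)
  qed
  show "independent (g ` B)"
    unfolding dependent_finite[OF finite_imageI[OF basis_fin[OF b]]] using zero by blast
  show "VV n \<subseteq> span (g ` B)"
  proof
    fix x assume V: "x \<in> VV n"
    have "x = (\<Sum>j\<in>J. co B x j *\<^sub>R g j)" using co_comb[OF b V] by (simp add: comb_def)
    also have "\<dots> = (\<Sum>j\<in>B. co B x j *\<^sub>R g j)"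
      using co_supp[OF b V] basis_J[OF b] fin by (intro sum.mono_neutral_right) (auto simp: supp_def)
    also have "\<dots> \<in> span (g ` B)" by (intro span_sum span_scale span_base) auto
    finally show "x \<in> span (g ` B)" .
  qed
  show "g ` B \<subseteq> VV n" using basis_J[OF b] Lam_VV[OF gL] by blast
qed

lemma card_basis: assumes b: "basis B" shows "card B = n + 1"
proof -
  obtain S0 where S0: "finite S0" "card S0 = n + 1" "independent S0" "VV n \<subseteq> span S0" using VV_standard_basis by blast
  have "n + 1 \<le> card (g ` B)" by (rule card_spanning_VV) (use basis_family(3)[OF b] basis_fin[OF b] in auto)
  moreover have "card (g ` B) \<le> card S0"
    using independent_span_bound[OF S0(1) basis_family(2)[OF b]] S0(4) basis_family(4)[OF b] by auto
  ultimately show ?thesis using S0(2) card_image[OF basis_family(1)[OF b]] by simp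
qed

text \<open>Lattice points of the half-open fundamental parallelepiped, with the closed sides chosen
  to match \<open>cell 1 B\<close>.\<close>

definition boxed :: "nat set \<Rightarrow> vec \<times> real \<Rightarrow> bool" where
  "boxed B p \<longleftrightarrow> p \<in> Lam n \<and> (\<forall>v\<in>B. if upper B v then 0 \<le> co B p v \<and> co B p v < 1 else 0 < co B p v \<and> co B p v \<le> 1)"

lemma boxed_cell: assumes "basis B" "boxed B p" shows "p \<in> cell 1 B"
proof -
  have "co B p v > 0 \<or> (co B p v = 0 \<and> (upper B v \<longleftrightarrow> (1::real) = 1))" if "v \<in> B" for v
    using assms(2) that unfolding boxed_def by (cases "upper B v") (auto simp: less_le)
  then show ?thesis using assms by (auto simp: cell_def boxed_def Lam_VV)
qed

definition nc :: "(nat \<Rightarrow> nat) \<Rightarrow> vec \<times> real" where "nc u = comb J g (\<lambda>j. real (u j))"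

lemma nc_Lam: "nc u \<in> Lam n" unfolding nc_def comb_def by (intro Lam_sum Lam_scale gL) auto

lemma snd_nc: assumes "B \<subseteq> J" "\<And>j. j \<notin> B \<Longrightarrow> u j = 0" shows "snd (nc u) = real (sum u B)"
proof -
  have "snd (nc u) = (\<Sum>j\<in>J. real (u j))" unfolding nc_def comb_def snd_sum by (intro sum.cong) (auto simp: deg1)
  also have "\<dots> = (\<Sum>j\<in>B. real (u j))" using assms fin by (intro sum.mono_neutral_right) auto
  finally show ?thesis by simp
qed

lemma co_nc: "basis B \<Longrightarrow> (\<And>j. j \<notin> B \<Longrightarrow> u j = 0) \<Longrightarrow> co B (nc u) j = real (u j)"
  unfolding nc_def by (subst co_comb_supp) (auto simp: supp_def)

lemma cell_decomp:
  assumes B: "basis B" and p: "p \<in> Lam n" "p \<in> cell 1 B"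
  shows "\<exists>b u. boxed B b \<and> (\<forall>j. j \<notin> B \<longrightarrow> u j = 0) \<and> p = b + nc u"
proof -
  have pV: "p \<in> VV n" using p by (simp add: Lam_VV)
  \<comment> \<open>At an open wall the ceiling minus one replaces the floor, leaving a remainder in
    \<open>(0, 1]\<close> instead of \<open>[0, 1)\<close>.\<close>
  define u where "u = (\<lambda>j. if j \<in> B then nat (if upper B j then \<lfloor>co B p j\<rfloor> else \<lceil>co B p j\<rceil> - 1) else 0)"
  have u0: "u j = 0" if "j \<notin> B" for j using that by (simp add: u_def)
  define b where "b = p - nc u"
  have bL: "b \<in> Lam n" unfolding b_def by (intro Lam_diff p nc_Lam)
  have cb: "co B b j = co B p j - real (u j)" for j
    unfolding b_def using co_diff[OF B pV Lam_VV[OF nc_Lam]] co_nc[OF B u0] by simp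
  have "boxed B b"
    unfolding boxed_def
  proof (intro conjI bL ballI)
    fix v assume v: "v \<in> B"
    have c: "co B p v > 0 \<or> (co B p v = 0 \<and> upper B v)" using p(2) v by (auto simp: cell_def)
    show "if upper B v then 0 \<le> co B b v \<and> co B b v < 1 else 0 < co B b v \<and> co B b v \<le> 1"
    proof (cases "upper B v")
      case True
      then have "real (u v) = of_int \<lfloor>co B p v\<rfloor>" using v c by (auto simp: u_def)
      then show ?thesis using True cb[of v] by (simp) linarith
    next
      case False
      then have "co B p v > 0" using c by simp
      then have "\<lceil>co B p v\<rceil> \<ge> 1" by linarith
      then have "real (u v) = of_int \<lceil>co B p v\<rceil> - 1" using v False by (simp add: u_def)
      then show ?thesis using False cb[of v] by (simp) linarith
    qed
  qed
  then show ?thesis using u0 by (intro exI[of _ b] exI[of _ u]) (auto simp: b_def)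
qed

lemma cell_decomp_unique:
  assumes B: "basis B" and b: "boxed B b" "boxed B b'" and u: "\<forall>j. j \<notin> B \<longrightarrow> u j = 0" "\<forall>j. j \<notin> B \<longrightarrow> u' j = 0"
    and eq: "b + nc u = b' + nc u'"
  shows "b = b' \<and> u = u'"
proof -
  have V: "b \<in> VV n" "b' \<in> VV n" using b by (auto simp: boxed_def Lam_VV)
  have "u j = u' j" for j
  proof (cases "j \<in> B")
    case True
    have "co B b j + real (u j) = co B b' j + real (u' j)"
      using arg_cong[OF eq, of "\<lambda>p. co B p j"] co_add[OF B V(1) Lam_VV[OF nc_Lam]] co_add[OF B V(2) Lam_VV[OF nc_Lam]]
        co_nc[OF B, of u] co_nc[OF B, of u'] u by simp
    moreover have "\<bar>co B b j - co B b' j\<bar> < 1" using b True by (auto simp: boxed_def split: if_splits dest!: bspec[of _ _ j])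
    ultimately have "\<bar>real (u' j) - real (u j)\<bar> < 1" by linarith
    then show ?thesis by linarith
  qed (use u in auto)
  then have "u = u'" by blast
  then show ?thesis using eq by simp
qed

lemma boxed_add_cell:
  assumes "basis B" "boxed B b" "\<forall>j. j \<notin> B \<longrightarrow> u j = 0"
  shows "b + nc u \<in> cell 1 B" "b + nc u \<in> Lam n"
proof -
  have bL: "b \<in> Lam n" using assms by (simp add: boxed_def)
  show "b + nc u \<in> Lam n" by (intro Lam_add bL nc_Lam)
  then have V: "b + nc u \<in> VV n" by (rule Lam_VV)
  have "co B (b + nc u) v = co B b v + real (u v)" for v
    using co_add[OF assms(1) Lam_VV[OF bL] Lam_VV[OF nc_Lam]] co_nc[OF assms(1), of u] assms(3) by simp
  then show "b + nc u \<in> cell 1 B" using boxed_cell[OF assms(1,2)] V by (force simp: cell_def)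
qed

lemma boxed_snd_nonneg: assumes "basis B" "boxed B b" shows "snd b \<ge> 0" "snd b \<in> \<int>"
proof -
  have "b \<in> cone" using cell_cone[OF assms(1) boxed_cell[OF assms]] .
  then obtain f where "b = comb J g f" "\<forall>j. f j \<ge> 0" by (auto simp: cone_def)
  then show "snd b \<ge> 0" by (auto simp: comb_def snd_sum deg1 intro!: sum_nonneg)
  show "snd b \<in> \<int>" using assms(2) by (auto simp: boxed_def Lam_def)
qed

text \<open>Every lattice point of the cone is uniquely a box point of one half-open cone plus a
  natural combination of the generators of that cone. All these cones have \<open>n + 1\<close>
  generators, so a common factor splits off and \<open>hstar\<close> is left counting box points by
  degree.\<close>

lemma box_count:
  assumes cone: "cone_over P = cone" and lp: "lattice_polytope n P"
  shows "fps_nth (hstar n P) j = int (card {(B, b). good B \<and> boxed B b \<and> snd b = real j})"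
proof -
  obtain B0 where B0: "basis B0" using extend_basis[of "{}"] by (auto simp: indep_def supp_def)
  define N where "N = (\<lambda>j. {(B, b). good B \<and> boxed B b \<and> snd b = real j})"
  have S: "slice n P k = {p \<in> Lam n. p \<in> cone \<and> snd p = real k}" for k
    by (auto simp: slice_def cone_semigroup_def cone Lam_def)
  have gb: "good B \<Longrightarrow> basis B" for B by (simp add: good_def)
  have cB: "card B = card B0" if "good B" for B using card_basis gb[OF that] B0 by simp
  have finN: "finite (N j)" for j
  proof (rule finite_subset)
    show "N j \<subseteq> Pow J \<times> slice n P j"
      unfolding N_def S using basis_J gb boxed_cell cell_cone by (fastforce simp: boxed_def)
    show "finite (Pow J \<times> slice n P j)" using fin finite_slice[OF lp] by simp
  qed
  define c where "c = (\<lambda>k. int (card (comps B0 k)))"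
  have cc: "int (card (comps B k)) = c k" if "good B" for B k
    unfolding c_def using card_comps_cong[of B B0 k] basis_fin gb[OF that] B0 cB[OF that] by simp
  have main: "int (card (slice n P k)) = (\<Sum>j\<le>k. int (card (N j)) * c (k - j))" for k
  proof -
    let ?X = "SIGMA j:{..k}. N j"
    let ?Y = "SIGMA x:?X. comps (fst (snd x)) (k - fst x)"
    have finX: "finite ?X" using finN by simp
    have "bij_betw (\<lambda>((j, B, b), u). b + nc u) ?Y (slice n P k)"
    proof (rule bij_betw_imageI)
      show "inj_on (\<lambda>((j, B, b), u). b + nc u) ?Y"
      proof (rule inj_onI)
        fix x y assume xy: "x \<in> ?Y" "y \<in> ?Y" "(\<lambda>((j, B, b), u). b + nc u) x = (\<lambda>((j, B, b), u). b + nc u) y"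
        obtain j B b u where x: "x = ((j, B, b), u)" by (metis prod.exhaust)
        obtain j' B' b' u' where y: "y = ((j', B', b'), u')" by (metis prod.exhaust)
        have X: "good B" "boxed B b" "snd b = real j" "\<forall>i. i \<notin> B \<longrightarrow> u i = 0" using xy(1) by (auto simp: x N_def comps_def)
        have Y: "good B'" "boxed B' b'" "snd b' = real j'" "\<forall>i. i \<notin> B' \<longrightarrow> u' i = 0" using xy(2) by (auto simp: y N_def comps_def)
        have e: "b + nc u = b' + nc u'" using xy(3) by (simp add: x y)
        have "B = B'"
          using cell_unique[OF X(1) Y(1), of 1 "b + nc u"] boxed_add_cell(1)[OF gb[OF X(1)] X(2,4)] boxed_add_cell(1)[OF gb[OF Y(1)] Y(2,4)] e by simp
        then have "b = b' \<and> u = u'" using cell_decomp_unique[OF gb[OF X(1)] X(2) _ X(4) _ e] Y by simp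
        then show "x = y" using X(3) Y(3) \<open>B = B'\<close> by (simp add: x y)
      qed
      show "(\<lambda>((j, B, b), u). b + nc u) ` ?Y = slice n P k"
      proof (intro equalityI subsetI)
        fix p assume "p \<in> (\<lambda>((j, B, b), u). b + nc u) ` ?Y"
        then obtain j B b u where x: "((j, B, b), u) \<in> ?Y" "p = b + nc u" by auto
        then have X: "good B" "boxed B b" "snd b = real j" "\<forall>i. i \<notin> B \<longrightarrow> u i = 0" "sum u B = k - j" "j \<le> k"
          by (auto simp: N_def comps_def)
        have "snd p = real j + real (k - j)" using snd_nc[OF basis_J[OF gb[OF X(1)]], of u] X by (simp add: x(2))
        then have "snd p = real k" using X(6) by simp
        then show "p \<in> slice n P k" unfolding S x(2)
          using boxed_add_cell[OF gb[OF X(1)] X(2,4)] cell_cone[OF gb[OF X(1)]] by blast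
      next
        fix p assume "p \<in> slice n P k"
        then have p: "p \<in> Lam n" "p \<in> cone" "snd p = real k" by (auto simp: S)
        obtain B where B: "good B" "p \<in> cell 1 B" using cone_cell_exists[OF p(2)] by blast
        obtain b u where bu: "boxed B b" "\<forall>j. j \<notin> B \<longrightarrow> u j = 0" "p = b + nc u" using cell_decomp[OF gb[OF B(1)] p(1) B(2)] by blast
        obtain j :: nat where j: "snd b = real j" using boxed_snd_nonneg[OF gb[OF B(1)] bu(1)]
          by (metis Ints_cases of_int_0_le_iff of_int_of_nat_eq zero_le_imp_eq_int)
        have "real j + real (sum u B) = real k" using snd_nc[OF basis_J[OF gb[OF B(1)]], of u] bu j p(3) by simp
        then have "j \<le> k" "sum u B = k - j" by linarith+
        then have "((j, B, b), u) \<in> ?Y" using B(1) bu j by (auto simp: N_def comps_def)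
        then show "p \<in> (\<lambda>((j, B, b), u). b + nc u) ` ?Y" by (rule rev_image_eqI) (simp add: bu(3))
      qed
    qed
    then have "card (slice n P k) = card ?Y" by (simp add: bij_betw_same_card)
    also have "\<dots> = (\<Sum>x\<in>?X. card (comps (fst (snd x)) (k - fst x)))"
    proof (rule card_SigmaI[OF finX], rule ballI)
      fix x assume "x \<in> ?X"
      then have "good (fst (snd x))" by (auto simp: N_def)
      then show "finite (comps (fst (snd x)) (k - fst x))" using finite_comps basis_fin gb by blast
    qed
    finally have "int (card (slice n P k)) = (\<Sum>x\<in>?X. int (card (comps (fst (snd x)) (k - fst x))))" by simp
    also have "\<dots> = (\<Sum>(j, y)\<in>?X. c (k - j))"
      by (rule sum.cong[OF refl]) (use cc in \<open>auto simp: N_def\<close>)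
    also have "\<dots> = (\<Sum>j\<le>k. \<Sum>y\<in>N j. c (k - j))" using finN by (subst sum.Sigma[symmetric]) auto
    finally show ?thesis by simp
  qed
  have "Abs_fps (\<lambda>k. int (card (slice n P k))) = Abs_fps (\<lambda>j. int (card (N j))) * Abs_fps c"
    by (rule fps_ext) (simp only: binomial_convolution_nth main fps_nth_Abs_fps)
  then have "hstar n P = Abs_fps (\<lambda>j. int (card (N j))) * ((1 - fps_X) ^ (n + 1) * Abs_fps c)"
    unfolding hstar_slice by (simp only: mult_ac)
  also have "(1 - fps_X) ^ (n + 1) * Abs_fps c = 1"
    using comps_fps[OF basis_fin[OF B0]] unfolding c_def card_basis[OF B0] .
  finally show ?thesis by (simp add: N_def)
qed

section \<open>Consequences of a bound on the degree of \<open>hstar\<close>\<close>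

context
  fixes P d
  assumes cone: "cone_over P = cone" and lp: "lattice_polytope n P"
    and hd: "\<And>j. j > d \<Longrightarrow> fps_nth (hstar n P) j = 0"
begin

lemma box_degree: assumes "good B" "boxed B b" shows "snd b \<le> real d"
proof (rule ccontr)
  assume a: "\<not> snd b \<le> real d"
  have bs: "basis B" using assms by (simp add: good_def)
  obtain j :: nat where j: "snd b = real j" using boxed_snd_nonneg[OF bs assms(2)]
    by (metis Ints_cases of_int_0_le_iff of_int_of_nat_eq zero_le_imp_eq_int)
  let ?N = "{(B, b). good B \<and> boxed B b \<and> snd b = real j}"
  have "finite ?N"
  proof (rule finite_subset)
    have S: "slice n P j = {p \<in> Lam n. p \<in> cone \<and> snd p = real j}"
      by (auto simp: slice_def cone_semigroup_def cone Lam_def)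
    have gb: "good B \<Longrightarrow> basis B" for B by (simp add: good_def)
    show "?N \<subseteq> Pow J \<times> slice n P j"
      unfolding S using basis_J gb boxed_cell cell_cone by (fastforce simp: boxed_def)
    show "finite (Pow J \<times> slice n P j)" using fin finite_slice[OF lp] by simp
  qed
  moreover have "card ?N = 0" using hd[of j] box_count[OF cone lp, of j] a j by simp
  ultimately have "?N = {}" by simp
  then show False using assms j by blast
qed

lemma semigroup_decomp:
  assumes "p \<in> cone_semigroup n P"
  shows "\<exists>b u. b \<in> cone_semigroup n P \<and> snd b \<le> real d \<and> p = b + nc u"
proof -
  have p: "p \<in> Lam n" "p \<in> cone" using assms by (auto simp: cone_semigroup_def cone Lam_def)
  obtain B where B: "good B" "p \<in> cell 1 B" using cone_cell_exists[OF p(2)] by blast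
  have bs: "basis B" using B by (simp add: good_def)
  obtain b u where bu: "boxed B b" "p = b + nc u" using cell_decomp[OF bs p(1) B(2)] by blast
  have "b \<in> cone_semigroup n P" using cell_cone[OF bs boxed_cell[OF bs bu(1)]] bu(1)
    by (auto simp: cone_semigroup_def cone boxed_def Lam_def)
  then show ?thesis using bu box_degree[OF B(1) bu(1)] by blast
qed

text \<open>Reflection in the box: subtracting \<open>w\<close>, up to generators, from the sum of
  \<open>B\<close> turns each remainder into one minus it and exchanges open and closed sides. The
  result is a box point, whose degree is at most \<open>d\<close>.\<close>

lemma interior_degree:
  assumes w: "w \<in> Lam n" and c: "e > 0" "\<And>x. 0 < x \<Longrightarrow> x < e \<Longrightarrow> w - pert x \<in> cone"
  shows "snd w \<ge> real (n + 1) - real d"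
proof -
  have "w + (-1) *\<^sub>R pert x \<in> cone" if "0 < x" "x < e" for x using c(2)[OF that] by simp
  then obtain B where B: "good B" "w \<in> cell (-1) B" using cell_exists[of "-1" w e] Lam_VV[OF w] c(1) by auto
  have bs: "basis B" using B by (simp add: good_def)
  have cB: "card B = n + 1" by (rule card_basis[OF bs])
  define u where "u = (\<lambda>j. if j \<in> B then nat (if upper B j then \<lceil>co B w j\<rceil> - 1 else \<lfloor>co B w j\<rfloor>) else 0)"
  have u0: "u j = 0" if "j \<notin> B" for j using that by (simp add: u_def)
  define one where "one = (\<lambda>j. if j \<in> B then 1 else 0 :: nat)"
  have o0: "one j = 0" if "j \<notin> B" for j using that by (simp add: one_def)
  define b where "b = nc one - (w - nc u)"
  have bL: "b \<in> Lam n" unfolding b_def by (intro Lam_diff w nc_Lam)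
  have "co B b j = co B (nc one) j - (co B w j - co B (nc u) j)" for j
    unfolding b_def using co_diff[OF bs Lam_VV[OF nc_Lam] VV_diff[OF Lam_VV[OF w] Lam_VV[OF nc_Lam]]]
      co_diff[OF bs Lam_VV[OF w] Lam_VV[OF nc_Lam]] by simp
  then have cb: "co B b j = real (one j) - co B w j + real (u j)" for j
    using co_nc[OF bs u0] co_nc[OF bs o0] by simp
  have "boxed B b"
    unfolding boxed_def
  proof (intro conjI bL ballI)
    fix v assume v: "v \<in> B"
    have c: "co B w v > 0 \<or> (co B w v = 0 \<and> \<not> upper B v)" using B(2) v by (auto simp: cell_def)
    show "if upper B v then 0 \<le> co B b v \<and> co B b v < 1 else 0 < co B b v \<and> co B b v \<le> 1"
    proof (cases "upper B v")
      case True
      then have "co B w v > 0" using c by simp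
      then have "\<lceil>co B w v\<rceil> \<ge> 1" by linarith
      then have "real (u v) = of_int \<lceil>co B w v\<rceil> - 1" using v True by (simp add: u_def)
      then show ?thesis using True cb[of v] v by (simp add: one_def) linarith
    next
      case False
      then have "real (u v) = of_int \<lfloor>co B w v\<rfloor>" using v c by (auto simp: u_def)
      then show ?thesis using False cb[of v] v by (simp add: one_def) linarith
    qed
  qed
  then have "snd b \<le> real d" using box_degree[OF B(1)] by simp
  moreover have "snd b = real (sum one B) - (snd w - real (sum u B))"
    unfolding b_def using snd_nc[OF basis_J[OF bs] o0] snd_nc[OF basis_J[OF bs] u0] by simp
  moreover have "sum one B = n + 1" using cB by (simp add: one_def)
  moreover have "real (sum u B) \<ge> 0" by (rule of_nat_0_le_iff)
  ultimately show ?thesis by linarith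
qed

text \<open>Gorenstein duality in degree two: if \<open>z\<close> is indecomposable, then \<open>\<Sum>B - z\<close> is the generator \<open>w\<close> of the
  interior, and \<open>w + z = \<Sum>B\<close> forces every coordinate functional of \<open>B\<close> to be a facet functional up to scaling.\<close>

lemma indecomposable_degree_two:
  assumes d: "d = 2" and U: "finite U" "U \<subseteq> Lam n" "cone_over P = {p \<in> VV n. \<forall>u\<in>U. 0 \<le> ev n u p}"
    and w: "w \<in> Lam n" "\<And>u. u \<in> U \<Longrightarrow> ev n u w = 1"
    and z: "z \<in> Lam n" "z \<in> cone" "snd z = 2" "\<And>j. j \<in> J \<Longrightarrow> z - g j \<notin> cone"
  shows "card (g ` J) \<le> n + 1"
proof -
  have inC: "p \<in> cone \<longleftrightarrow> p \<in> VV n \<and> (\<forall>u\<in>U. 0 \<le> ev n u p)" for p using U(3) cone by auto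
  have gC: "g j \<in> cone" if "j \<in> J" for j
    unfolding cone_def using comb_unit[OF fin that, of g] by (intro CollectI exI[of _ "\<lambda>i. if i = j then 1 else 0"]) auto
  have evg: "0 \<le> ev n u (g j)" if "u \<in> U" "j \<in> J" for u j using gC[OF that(2)] that(1) inC by blast
  have evc: "ev n u (comb J g f) = (\<Sum>j\<in>J. f j * ev n u (g j))" for u f by (simp add: comb_def ev_sum ev_scale)
  have wdeg: "snd w \<ge> real n - 1"
  proof -
    \<comment> \<open>\<open>M\<close> bounds all functionals on the perturbation, so for small
      \<open>x\<close> every functional stays nonnegative on \<open>w - pert x\<close>, its value at
      \<open>w\<close> being 1.\<close>
    define M where "M = (\<Sum>u\<in>U. \<Sum>j\<in>J. \<bar>ev n u (g j)\<bar>) + 1"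
    have M: "M > 0" unfolding M_def by (intro add_nonneg_pos sum_nonneg) auto
    define e where "e = min 1 (1 / M)"
    have "w - pert x \<in> cone" if x: "0 < x" "x < e" for x
    proof -
      have x1: "x \<le> 1" "x * M \<le> 1" using x M by (auto simp: e_def pos_less_divide_eq less_imp_le)
      have "ev n u (pert x) \<le> 1" if u: "u \<in> U" for u
      proof -
        have "ev n u (pert x) \<le> (\<Sum>j\<in>J. x * \<bar>ev n u (g j)\<bar>)"
          unfolding pert_def evc
        proof (rule sum_mono)
          fix j assume "j \<in> J"
          have "x ^ Suc j \<le> x" using x x1 power_le_one[of x j] by (simp add: mult_left_le)
          then show "x ^ Suc j * ev n u (g j) \<le> x * \<bar>ev n u (g j)\<bar>"
            using x evg[OF u \<open>j \<in> J\<close>] by (intro mult_mono) auto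
        qed
        also have "\<dots> = x * (\<Sum>j\<in>J. \<bar>ev n u (g j)\<bar>)" by (simp add: sum_distrib_left)
        also have "\<dots> \<le> x * M"
        proof (rule mult_left_mono)
          show "(\<Sum>j\<in>J. \<bar>ev n u (g j)\<bar>) \<le> M" unfolding M_def
            using member_le_sum[OF u, of "\<lambda>u. \<Sum>j\<in>J. \<bar>ev n u (g j)\<bar>"] U(1) by (simp add: sum_nonneg)
        qed (use x in simp)
        finally show ?thesis using x1 by simp
      qed
      then show ?thesis unfolding inC using w VV_diff[OF Lam_VV[OF w(1)] pertV] by (auto simp: ev_diff)
    qed
    moreover have "e > 0" using M by (simp add: e_def)
    ultimately show ?thesis using interior_degree[OF w(1), of e] d by auto
  qed
  obtain B where B: "good B" "z \<in> cell 1 B" using cone_cell_exists[OF z(2)] by blast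
  have bs: "basis B" using B by (simp add: good_def)
  have BJ: "B \<subseteq> J" "finite B" using basis_J basis_fin bs by auto
  define la where "la = co B z"
  have la0: "la j \<ge> 0" for j unfolding la_def by (rule cell_nonneg[OF bs B(2)])
  have laS: "supp la B" "comb J g la = z" using co_supp[OF bs] co_comb[OF bs] Lam_VV[OF z(1)] by (auto simp: la_def)
  have la1: "la v < 1" if v: "v \<in> B" for v
  proof (rule ccontr)
    assume "\<not> la v < 1"
    have "z - g v = comb J g (\<lambda>j. la j - (if j = v then 1 else 0))"
      using comb_unit[OF fin, of v g] v BJ laS(2) by (auto simp: comb_diff)
    moreover have "la j - (if j = v then 1 else 0) \<ge> 0" for j using la0[of j] \<open>\<not> la v < 1\<close> by auto
    ultimately have "z - g v \<in> cone" unfolding cone_def by blast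
    then show False using z(4) v BJ by blast
  qed
  have evB: "ev n u (comb J g f) = (\<Sum>j\<in>B. f j * ev n u (g j))" if "supp f B" for u f
    unfolding evc using that BJ fin by (intro sum.mono_neutral_right) (auto simp: supp_def)
  define s where "s = nc (\<lambda>j. if j \<in> B then 1 else 0)"
  have s_comb: "s = comb J g (\<lambda>j. if j \<in> B then 1 else 0)" unfolding s_def nc_def by (rule comb_cong) auto
  have evs: "ev n u s = (\<Sum>j\<in>B. ev n u (g j))" for u unfolding s_comb by (subst evB) (auto simp: supp_def)
  have sdeg: "snd s = real n + 1"
    unfolding s_def by (subst snd_nc[OF BJ(1)]) (auto simp: card_basis[OF bs])
  \<comment> \<open>The coordinates of \<open>s - z\<close> lie in \<open>(0, 1]\<close>, so each
    functional is positive on it, hence at least 1. Thus \<open>W - w\<close> is in the cone; by the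
    bound on the degree of \<open>w\<close> its own degree is at most 0, and so
    \<open>W = w\<close>.\<close>
  define W where "W = s - z"
  have WL: "W \<in> Lam n" unfolding W_def s_def by (intro Lam_diff nc_Lam z)
  have evz: "ev n u z = (\<Sum>j\<in>B. la j * ev n u (g j))" for u using evB[OF laS(1)] laS(2) by simp
  have evW: "ev n u W \<ge> 1" if u: "u \<in> U" for u
  proof -
    have e: "ev n u W = (\<Sum>j\<in>B. (1 - la j) * ev n u (g j))"
      unfolding W_def ev_diff evs evz by (simp add: left_diff_distrib sum_subtractf)
    have pos: "0 \<le> (1 - la j) * ev n u (g j)" if "j \<in> B" for j
    proof (rule mult_nonneg_nonneg)
      show "0 \<le> 1 - la j" using la1[OF that] by simp
      show "0 \<le> ev n u (g j)" using evg[OF u] that BJ by blast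
    qed
    have "ev n u W \<noteq> 0"
    proof
      assume "ev n u W = 0"
      then have "\<forall>j\<in>B. (1 - la j) * ev n u (g j) = 0" using e pos BJ by (simp add: sum_nonneg_eq_0_iff)
      then have "\<forall>j\<in>B. ev n u (g j) = 0" using la1 by fastforce
      then have "ev n u (comb J g (co B w)) = 0" using evB[OF co_supp[OF bs Lam_VV[OF w(1)]]] by simp
      then show False using w(2)[OF u] co_comb[OF bs Lam_VV[OF w(1)]] by simp
    qed
    moreover have "ev n u W \<ge> 0" unfolding e by (rule sum_nonneg) (rule pos)
    moreover have "ev n u W \<in> \<int>" using U u WL by (auto intro!: ev_Ints)
    ultimately show ?thesis by (auto elim!: Ints_cases)
  qed
  have "W - w \<in> cone" unfolding inC using evW w VV_diff[OF Lam_VV[OF WL] Lam_VV[OF w(1)]] by (auto simp: ev_diff)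
  then obtain f where f: "W - w = comb J g f" "\<forall>j. f j \<ge> 0" by (auto simp: cone_def)
  have "snd (W - w) = (\<Sum>j\<in>J. f j)" unfolding f comb_def snd_sum by (intro sum.cong) (auto simp: deg1)
  moreover have "snd (W - w) \<le> 0" using wdeg sdeg z(3) by (simp add: W_def)
  ultimately have "(\<Sum>j\<in>J. f j) = 0" using f(2) sum_nonneg[of J f] by force
  then have "\<forall>j\<in>J. f j = 0" using f(2) fin by (simp add: sum_nonneg_eq_0_iff)
  then have "W - w = 0" unfolding f comb_def by simp
  then have sz: "s = z + w" by (simp add: W_def algebra_simps)
  have ex: "\<exists>u\<in>U. ev n u z < ev n u (g j)" if j: "j \<in> J" for j
  proof (rule ccontr)
    assume "\<not> ?thesis"
    then have "z - g j \<in> cone" unfolding inC using Lam_VV[OF z(1)] Lam_VV[OF gL[OF j]] by (force simp: ev_diff intro!: VV_diff)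
    then show False using z(4) j by blast
  qed
  have evZ: "ev n u (g j) \<in> \<int>" if "u \<in> U" "j \<in> J" for u j using U that gL by (auto intro!: ev_Ints)
  \<comment> \<open>Some functional is larger at \<open>g v\<close> than at \<open>z\<close>, by at
    least 1. On \<open>s = z + w\<close> its value is only one more than at \<open>z\<close>, so
    nothing remains for the other elements of \<open>B\<close>.\<close>
  have coord: "\<exists>u\<in>U. (\<forall>j\<in>B. j \<noteq> v \<longrightarrow> ev n u (g j) = 0) \<and> ev n u (g v) = ev n u z + 1" if v: "v \<in> B" for v
  proof -
    obtain u where u: "u \<in> U" "ev n u z < ev n u (g v)" using ex v BJ by blast
    have zZ: "ev n u z \<in> \<int>" "ev n u z \<ge> 0" using U u z inC by (auto intro!: ev_Ints)
    have tot: "ev n u z + 1 = ev n u (g v) + (\<Sum>j\<in>B - {v}. ev n u (g j))"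
      using arg_cong[OF sz, of "ev n u"] w(2)[OF u(1)] evs[of u] v BJ by (simp add: ev_add sum.remove)
    have rest: "(\<Sum>j\<in>B - {v}. ev n u (g j)) \<ge> 0" using evg[OF u(1)] BJ by (intro sum_nonneg) auto
    have "ev n u (g v) \<ge> ev n u z + 1"
    proof -
      have "ev n u (g v) \<in> \<int>" using evZ[OF u(1)] v BJ by blast
      then show ?thesis using u(2) zZ(1) by (auto elim!: Ints_cases)
    qed
    then have "(\<Sum>j\<in>B - {v}. ev n u (g j)) = 0" "ev n u (g v) = ev n u z + 1" using tot rest by linarith+
    moreover then have "\<forall>j\<in>B - {v}. ev n u (g j) = 0" using evg[OF u(1)] BJ by (subst (asm) sum_nonneg_eq_0_iff) auto
    ultimately show ?thesis using u(1) by blast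
  qed
  have "g i \<in> g ` B" if i: "i \<in> J" for i
  proof -
    define mu where "mu = co B (g i)"
    have muS: "supp mu B" "comb J g mu = g i" using co_supp[OF bs] co_comb[OF bs] Lam_VV[OF gL[OF i]] by (auto simp: mu_def)
    have evi: "ev n u (g i) = (\<Sum>j\<in>B. mu j * ev n u (g j))" for u using evB[OF muS(1)] muS(2) by simp
    have musum: "(\<Sum>j\<in>B. mu j) = 1"
    proof -
      have "1 = snd (comb J g mu)" using muS deg1[OF i] by simp
      also have "\<dots> = (\<Sum>j\<in>J. mu j)" unfolding comb_def snd_sum by (intro sum.cong) (auto simp: deg1)
      also have "\<dots> = (\<Sum>j\<in>B. mu j)" using muS BJ fin by (intro sum.mono_neutral_right) (auto simp: supp_def)
      finally show ?thesis by simp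
    qed
    have single: "(\<Sum>j\<in>B. c j * ev n u (g j)) = c v * ev n u (g v)" if "v \<in> B" "\<forall>j\<in>B. j \<noteq> v \<longrightarrow> ev n u (g j) = 0" for c :: "nat \<Rightarrow> real" and u v
      using that BJ by (simp add: sum.remove[of B v])
    have mu0: "mu v \<ge> 0" if v: "v \<in> B" for v
    proof -
      obtain u where u: "u \<in> U" "\<forall>j\<in>B. j \<noteq> v \<longrightarrow> ev n u (g j) = 0" "ev n u (g v) = ev n u z + 1" using coord[OF v] by blast
      have "ev n u z \<ge> 0" using u z inC by auto
      moreover have "mu v * ev n u (g v) \<ge> 0" using evi[of u] single[OF v u(2)] evg[OF u(1) i] by simp
      ultimately show ?thesis using u(3) by (simp add: zero_le_mult_iff)
    qed
    \<comment> \<open>A functional larger at \<open>g i\<close> than at \<open>z\<close> forces some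
      coordinate \<open>mu v\<close> above \<open>la v\<close>. The functional isolating
      \<open>v\<close> then gives \<open>mu v \<ge> 1\<close> by integrality, and as the coordinates
      are nonnegative with sum 1, \<open>g i = g v\<close>.\<close>
    obtain u where u: "u \<in> U" "ev n u z < ev n u (g i)" using ex[OF i] by blast
    have "\<exists>v\<in>B. la v < mu v"
    proof (rule ccontr)
      assume "\<not> ?thesis"
      then have "(\<Sum>j\<in>B. mu j * ev n u (g j)) \<le> (\<Sum>j\<in>B. la j * ev n u (g j))"
        using evg[OF u(1)] BJ by (intro sum_mono mult_right_mono) auto
      then show False using u(2) evz evi by simp
    qed
    then obtain v where v: "v \<in> B" "la v < mu v" by blast
    obtain u where u: "u \<in> U" "\<forall>j\<in>B. j \<noteq> v \<longrightarrow> ev n u (g j) = 0" "ev n u (g v) = ev n u z + 1" using coord[OF v(1)] by blast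
    have c: "ev n u (g v) > 0" using u z inC by fastforce
    have "ev n u z < ev n u (g i)" unfolding evz evi single[OF v(1) u(2)] using v(2) c by simp
    then have "ev n u (g i) \<ge> ev n u z + 1"
      using evZ[OF u(1) i] U u z by (auto elim!: Ints_cases dest!: ev_Ints[of u n z, rotated])
    then have "mu v * ev n u (g v) \<ge> 1 * ev n u (g v)" using evi[of u] single[OF v(1) u(2)] u(3) by simp
    then have "mu v \<ge> 1" using c by simp
    moreover have "(\<Sum>j\<in>B. mu j) = mu v + (\<Sum>j\<in>B - {v}. mu j)" using v(1) BJ by (simp add: sum.remove)
    moreover have "(\<Sum>j\<in>B - {v}. mu j) \<ge> 0" using mu0 by (intro sum_nonneg) auto
    ultimately have m1: "mu v = 1" "(\<Sum>j\<in>B - {v}. mu j) = 0" using musum by linarith+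
    then have "\<forall>j\<in>B - {v}. mu j = 0" using mu0 BJ by (subst (asm) sum_nonneg_eq_0_iff) auto
    then have "mu = (\<lambda>j. if j = v then 1 else 0)" using m1(1) muS(1) by (auto simp: supp_def fun_eq_iff)
    then show ?thesis using muS(2) comb_unit[OF fin, of v g] v(1) BJ by auto
  qed
  then have "g ` J \<subseteq> g ` B" by blast
  then have "card (g ` J) \<le> card (g ` B)" using BJ by (intro card_mono) auto
  then show ?thesis using card_basis[OF bs] card_image_le[OF BJ(2), of g] by simp
qed

end
end

lemma eliminate_leads:
  assumes "triangular J rs" "\<And>r. r \<in> set rs \<Longrightarrow> z r \<in> fst r"
  shows "\<exists>h. in_span rs (\<lambda>j. f j - h j) \<and> (\<forall>r\<in>set rs. h (z r) = 0)"
  using assms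
proof (induction rs arbitrary: f)
  case (Cons r rs)
  have zr: "z r \<in> fst r" using Cons.prems by simp
  let ?w = "\<lambda>j. f j - f (z r) * rvec r j"
  have "\<exists>h. in_span rs (\<lambda>j. ?w j - h j) \<and> (\<forall>r\<in>set rs. h (z r) = 0)" using Cons by simp
  then obtain h where h: "in_span rs (\<lambda>j. ?w j - h j)" "\<forall>r\<in>set rs. h (z r) = 0" by blast
  have "?w (z r) - h (z r) = 0" by (rule in_span_lead[OF Cons.prems(1) h(1) zr])
  then have "h (z r) = 0" using rvec_lead[OF Cons.prems(1) zr] by simp
  moreover have "in_span (r # rs) (\<lambda>j. f j - h j)" using h(1) by (auto simp: algebra_simps intro!: exI[of _ "f (z r)"])
  ultimately show ?case using h(2) by auto
qed auto

lemma card_lead_choice: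
  "triangular J rs \<Longrightarrow> (\<And>r. r \<in> set rs \<Longrightarrow> z r \<in> fst r) \<Longrightarrow> card (z ` set rs) = length rs"
proof (induction rs)
  case (Cons r rs)
  have "z r \<notin> z ` set rs"
  proof
    assume "z r \<in> z ` set rs"
    then obtain s where s: "s \<in> set rs" "z r = z s" by blast
    have "fst s \<inter> fst r = {}" using Cons.prems(1) s(1) by simp
    moreover have "z r \<in> fst r" "z s \<in> fst s" using Cons.prems(2) s(1) by auto
    ultimately show False using s(2) by auto
  qed
  then show ?case using Cons by simp
qed simp

text \<open>By a dimension count, as many relations as the codimension already generate all linear relations.\<close>

lemma premodel_of_generators:
  assumes J: "finite J" "triangular J rs" and g: "\<And>j. j \<in> J \<Longrightarrow> g j \<in> Lam n \<and> snd (g j) = real (d j) \<and> d j \<ge> 1"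
    and rel: "\<And>r. r \<in> set rs \<Longrightarrow> comb J g (rvec r) = 0" and card: "card J = n + 1 + length rs"
    and gen: "\<And>p. p \<in> Lam n \<Longrightarrow> \<exists>f. (\<forall>j. f j \<in> \<int>) \<and> comb J g f = p"
  shows "premodel n J rs d g"
proof -
  have "\<forall>r\<in>set rs. \<exists>j. j \<in> fst r" using triangular_mem[OF J(2)] by blast
  from bchoice[OF this] obtain z where z: "\<And>r. r \<in> set rs \<Longrightarrow> z r \<in> fst r" by blast
  \<comment> \<open>Dropping one leading variable per relation leaves \<open>n + 1\<close>
    generators that still span, hence a basis; a relation reduced to \<open>K\<close> must
    vanish.\<close>
  define K where "K = J - z ` set rs"
  have zJ: "z ` set rs \<subseteq> J" using z triangular_mem[OF J(2)] by blast
  have finK: "finite K" using J by (simp add: K_def)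
  have cK: "card K = n + 1" unfolding K_def using card_lead_choice[OF J(2) z] zJ J(1) card by (simp add: card_Diff_subset finite_subset)
  have elim: "\<exists>h. in_span rs (\<lambda>j. f j - h j) \<and> (\<forall>j. j \<notin> K \<longrightarrow> h j = 0) \<and> comb J g h = comb J g f"
    if f: "\<And>j. j \<notin> J \<Longrightarrow> f j = 0" for f
  proof -
    obtain h where h: "in_span rs (\<lambda>j. f j - h j)" "\<forall>r\<in>set rs. h (z r) = 0"
      using eliminate_leads[OF J(2) z, where f = f] by blast
    have "h j = 0" if "j \<notin> K" for j
      using that h(2) in_span_outside[OF J(2) h(1), of j] f[of j] by (auto simp: K_def)
    moreover have "comb J g (\<lambda>j. f j - h j) = 0" by (rule comb_in_span[OF rel h(1)])
    ultimately show ?thesis using h(1) by (auto simp: comb_diff)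
  qed
  have combK: "comb J g h = (\<Sum>j\<in>K. h j *\<^sub>R g j)" if "\<forall>j. j \<notin> K \<longrightarrow> h j = 0" for h
    unfolding comb_def using that J(1) by (intro sum.mono_neutral_right) (auto simp: K_def)
  have "VV n \<subseteq> span (g ` K)"
  proof
    fix p assume p: "p \<in> VV n"
    have L: "q \<in> span (g ` K)" if "q \<in> Lam n" for q
    proof -
      obtain f where f: "comb J g f = q" using gen[OF \<open>q \<in> Lam n\<close>] by blast
      obtain h where h: "\<forall>j. j \<notin> K \<longrightarrow> h j = 0" "comb J g h = comb J g (\<lambda>j. if j \<in> J then f j else 0)"
        using elim[of "\<lambda>j. if j \<in> J then f j else 0"] by auto
      then have "q = (\<Sum>j\<in>K. h j *\<^sub>R g j)" using combK f by (simp add: comb_restrict)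
      also have "\<dots> \<in> span (g ` K)" by (intro span_sum span_scale span_base) auto
      finally show ?thesis .
    qed
    have "(\<Sum>i<n. lookup (fst p) i *\<^sub>R (single i 1, 0)) + snd p *\<^sub>R (0, 1) \<in> span (g ` K)"
      by (intro span_add span_sum span_scale L unit_in_Lam) auto
    then show "p \<in> span (g ` K)" using VV_decomp[OF p] by metis
  qed
  then have ind: "independent (g ` K)" and "n + 1 \<le> card (g ` K)"
    using independent_spanning_VV[of "g ` K" n] card_spanning_VV[of "g ` K" n] finK cK card_image_le[OF finK, of g] by auto
  then have inj: "inj_on g K" using cK finK card_image_le[OF finK, of g] by (intro eq_card_imp_inj_on) auto
  have "in_span rs f" if f: "\<forall>j. j \<notin> J \<longrightarrow> f j = 0" "comb J g f = 0" for f
  proof -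
    obtain h where h: "in_span rs (\<lambda>j. f j - h j)" "\<forall>j. j \<notin> K \<longrightarrow> h j = 0" "comb J g h = 0" using elim[of f] f by auto
    have "(\<Sum>v\<in>g ` K. h (inv_into K g v) *\<^sub>R v) = (\<Sum>j\<in>K. h j *\<^sub>R g j)" using inj by (simp add: sum.reindex)
    then have "(\<Sum>v\<in>g ` K. h (inv_into K g v) *\<^sub>R v) = 0" using combK[OF h(2)] h(3) by simp
    moreover have nd: "\<forall>v\<in>g ` K. u v = 0" if "(\<Sum>v\<in>g ` K. u v *\<^sub>R v) = 0" for u
      using ind that unfolding dependent_finite[OF finite_imageI[OF finK]] by blast
    ultimately have "\<forall>v\<in>g ` K. h (inv_into K g v) = 0" by (intro nd)
    then have "h j = 0" for j using h(2) inj by (cases "j \<in> K") auto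
    then show ?thesis using h(1) by simp
  qed
  then show ?thesis unfolding premodel_def using J g rel gen by blast
qed

section \<open>Lattice polytopes as configurations\<close>

lemma hull_lift:
  assumes P: "P = convex hull (fst ` g ` J)" and J: "finite J" "J \<noteq> {}" and g: "\<And>j. j \<in> J \<Longrightarrow> snd (g j) = 1"
  shows "cone_over P = {comb J g f |f. \<forall>j. f j \<ge> 0}"
proof -
  have cP: "convex P" and Pne: "P \<noteq> {}" using J by (auto simp: P)
  let ?K = "{comb J g f |f. \<forall>j. f j \<ge> 0}"
  have gc: "g j \<in> cone_over P" if "j \<in> J" for j
  proof -
    have "fst (g j) \<in> P" unfolding P using that by (intro hull_inc) auto
    then show ?thesis unfolding cone_over_def using g[OF that]
      by (intro CollectI exI[of _ "1::real"] exI[of _ "fst (g j)"] conjI) (auto simp: prod_eq_iff)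
  qed
  have "convex {x. (x, 1) \<in> ?K}"
  proof (rule convexI)
    fix x y :: vec and u v :: real
    assume xy: "x \<in> {x. (x, 1) \<in> ?K}" "y \<in> {x. (x, 1) \<in> ?K}" and uv: "0 \<le> u" "0 \<le> v" "u + v = 1"
    obtain f f' where a: "(x, 1) = comb J g f" "\<forall>j. 0 \<le> f j" "(y, 1) = comb J g f'" "\<forall>j. 0 \<le> f' j" using xy by blast
    have "(u *\<^sub>R x + v *\<^sub>R y, 1) = u *\<^sub>R (x, 1::real) + v *\<^sub>R (y, 1::real)" using uv by simp
    also have "\<dots> = comb J g (\<lambda>j. u * f j + v * f' j)" by (simp only: a comb_add comb_scale)
    finally show "u *\<^sub>R x + v *\<^sub>R y \<in> {x. (x, 1) \<in> ?K}" using a uv by auto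
  qed
  moreover have "fst ` g ` J \<subseteq> {x. (x, 1) \<in> ?K}"
  proof
    fix x assume "x \<in> fst ` g ` J"
    then obtain j where j: "j \<in> J" and x: "x = fst (g j)" by blast
    then have "(x, 1) = comb J g (\<lambda>i. if i = j then 1 else 0)"
      using comb_unit[OF J(1) j] g[OF j] by (simp add: prod_eq_iff)
    then show "x \<in> {x. (x, 1) \<in> ?K}" by (intro CollectI exI conjI) auto
  qed
  ultimately have PK: "P \<subseteq> {x. (x, 1) \<in> ?K}" unfolding P by (rule hull_minimal[rotated])
  show ?thesis
  proof (intro equalityI subsetI)
    fix p assume "p \<in> cone_over P"
    then obtain x t where x: "x \<in> P" "t \<ge> 0" "p = (t *\<^sub>R x, t)" by (auto simp: cone_over_def)
    then obtain f where f: "(x, 1) = comb J g f" "\<forall>j. f j \<ge> 0" using PK by blast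
    have "p = t *\<^sub>R (x, 1)" by (simp add: x)
    also have "\<dots> = comb J g (\<lambda>j. t * f j)" by (simp only: f comb_scale)
    finally show "p \<in> ?K" using f x by auto
  next
    fix p assume "p \<in> ?K"
    then show "p \<in> cone_over P"
      unfolding comb_def by (auto intro!: cone_over_sum cP Pne cone_over_scale gc)
  qed
qed

text \<open>\<open>P\<close> is the hull of lattice points, so its lattice points at height one
  already generate the cone, and full dimension makes them span.\<close>

lemma lattice_configuration:
  assumes full: "full_lattice_polytope n P" and g: "bij_betw g J (slice n P 1)" and J: "finite J"
  shows "P = convex hull (fst ` g ` J)" "configuration n J g" "cone_over P = configuration.cone J g" "J \<noteq> {}"
proof -
  obtain W where W: "finite W" "W \<subseteq> lattice n" "P = convex hull W" and aff: "affine hull P = rspace n"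
    using full by (auto simp: full_lattice_polytope_def lattice_polytope_def)
  have gJ: "g ` J = slice n P 1" using g by (simp add: bij_betw_def)
  have sl: "slice n P 1 = {p \<in> Lam n. fst p \<in> P \<and> snd p = 1}"
  proof (intro equalityI subsetI)
    fix p assume "p \<in> slice n P 1"
    then show "p \<in> {p \<in> Lam n. fst p \<in> P \<and> snd p = 1}" by (auto simp: slice_def cone_semigroup_def cone_over_def Lam_def)
  next
    fix p assume p: "p \<in> {p \<in> Lam n. fst p \<in> P \<and> snd p = 1}"
    then have "p \<in> cone_over P" unfolding cone_over_def
      by (intro CollectI exI[of _ "1::real"] exI[of _ "fst p"] conjI) (auto simp: prod_eq_iff)
    then show "p \<in> slice n P 1" using p by (auto simp: slice_def cone_semigroup_def Lam_def)
  qed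
  have fg: "fst ` g ` J = P \<inter> lattice n" unfolding gJ sl by (force simp: Lam_def)
  show P: "P = convex hull (fst ` g ` J)"
  proof
    have "W \<subseteq> convex hull W" by (rule hull_subset)
    then have "W \<subseteq> P \<inter> lattice n" using W by blast
    then show "P \<subseteq> convex hull (fst ` g ` J)" unfolding fg using W(3) hull_mono by metis
    have "convex P" by (simp add: W)
    then show "convex hull (fst ` g ` J) \<subseteq> P" unfolding fg by (intro hull_minimal) auto
  qed
  have "P \<noteq> {}" using aff rspace_0[of n] by (metis affine_hull_empty empty_iff)
  then show Jne: "J \<noteq> {}" using P by auto
  have g1: "\<And>j. j \<in> J \<Longrightarrow> snd (g j) = 1" and gL: "\<And>j. j \<in> J \<Longrightarrow> g j \<in> Lam n" using gJ sl by auto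
  have comb1: "comb J g (\<lambda>j. c * f j) = c *\<^sub>R comb J g f" for c f by (rule comb_scale)
  have "affine {x. \<exists>f. (x, 1) = comb J g f}"
    unfolding affine_def
  proof (intro ballI allI impI)
    fix x y :: vec and u v :: real
    assume xy: "x \<in> {x. \<exists>f. (x, 1) = comb J g f}" "y \<in> {x. \<exists>f. (x, 1) = comb J g f}" and uv: "u + v = 1"
    obtain f f' where a: "(x, 1) = comb J g f" "(y, 1) = comb J g f'" using xy by blast
    have "(u *\<^sub>R x + v *\<^sub>R y, 1) = u *\<^sub>R (x, 1::real) + v *\<^sub>R (y, 1::real)" using uv by simp
    also have "\<dots> = comb J g (\<lambda>j. u * f j + v * f' j)" by (simp only: a comb_add comb_scale)
    finally show "u *\<^sub>R x + v *\<^sub>R y \<in> {x. \<exists>f. (x, 1) = comb J g f}" by blast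
  qed
  moreover have "P \<subseteq> {x. \<exists>f. (x, 1) = comb J g f}"
  proof
    fix x assume "x \<in> P"
    then have "(1 *\<^sub>R x, 1) \<in> cone_over P" unfolding cone_over_def
      by (intro CollectI exI[of _ "1::real"] exI[of _ x] conjI) auto
    then show "x \<in> {x. \<exists>f. (x, 1) = comb J g f}" using hull_lift[OF P J Jne g1] by auto
  qed
  ultimately have rs: "rspace n \<subseteq> {x. \<exists>f. (x, 1) = comb J g f}" unfolding aff[symmetric] by (intro hull_minimal)
  show conf: "configuration n J g"
  proof
    fix p assume "p \<in> VV n"
    then have "fst p \<in> rspace n" by (auto simp: VV_def mem_Times_iff)
    then obtain f where f: "(fst p, 1) = comb J g f" using rs by blast
    obtain f0 where f0: "(0, 1) = comb J g f0" using rs rspace_0[of n] by blast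
    have "p = (fst p, 1) + (snd p - 1) *\<^sub>R (0, 1)" by (simp add: prod_eq_iff)
    also have "\<dots> = comb J g (\<lambda>j. f j + (snd p - 1) * f0 j)" by (simp only: f f0 comb_add comb_scale)
    finally have "comb J g (\<lambda>j. f j + (snd p - 1) * f0 j) = p" by simp
    then show "\<exists>f. (\<forall>j. j \<notin> J \<longrightarrow> f j = 0) \<and> comb J g f = p"
      by (intro exI[of _ "\<lambda>j. if j \<in> J then f j + (snd p - 1) * f0 j else 0"]) (simp add: comb_restrict)
  qed (use J g1 gL in auto)
  show "cone_over P = configuration.cone J g"
    unfolding configuration.cone_def[OF conf] by (rule hull_lift[OF P J Jne g1])
qed

text \<open>Adding a large multiple of \<open>\<Sum>J\<close> moves every lattice point into the semigroup.\<close>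

lemma (in configuration) lattice_generated:
  assumes S: "\<And>p. p \<in> Lam n \<Longrightarrow> p \<in> cone \<Longrightarrow> \<exists>f. (\<forall>j. f j \<in> \<int>) \<and> p = comb K h f" and hJ: "J \<subseteq> K" "\<And>j. j \<in> J \<Longrightarrow> h j = g j"
    and K: "finite K" and p: "p \<in> Lam n"
  shows "\<exists>f. (\<forall>j. f j \<in> \<int>) \<and> comb K h f = p"
proof -
  obtain f where f: "comb J g f = p" using spans[OF Lam_VV[OF p]] by blast
  define N where "N = (\<Sum>j\<in>J. \<bar>f j\<bar>)"
  have "\<bar>f j\<bar> \<le> N" if "j \<in> J" for j unfolding N_def using fin that by (intro member_le_sum) auto
  moreover obtain M :: nat where M: "N \<le> real M" using real_arch_simple by blast
  ultimately have ge: "f j + real M \<ge> 0" if "j \<in> J" for j using that by fastforce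
  define s where "s = nc (\<lambda>_. M)"
  have "p + s = comb J g (\<lambda>j. f j + real M)" by (simp add: s_def nc_def comb_add f)
  also have "\<dots> = comb J g (\<lambda>j. if j \<in> J then f j + real M else 0)" by (simp add: comb_restrict)
  finally have "p + s \<in> cone" unfolding cone_def using ge by force
  moreover have "p + s \<in> Lam n" unfolding s_def by (intro Lam_add p nc_Lam)
  ultimately obtain h' where h': "\<forall>j. h' j \<in> \<int>" "p + s = comb K h h'" using S by blast
  have "s = comb K h (\<lambda>j. if j \<in> J then real M else 0)"
    unfolding s_def nc_def comb_def using hJ K by (intro sum.mono_neutral_cong_left) auto
  then have "comb K h (\<lambda>j. h' j - (if j \<in> J then real M else 0)) = p" using h'(2) by (simp add: comb_diff algebra_simps)
  then show ?thesis using h'(1) by (intro exI[of _ "\<lambda>j. h' j - (if j \<in> J then real M else 0)"]) auto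
qed

section \<open>The relations of the list\<close>

text \<open>Orientation and order are chosen to make each list triangular: a relation whose tail
  contains a leading variable of the other one comes first.\<close>

fun label_rels :: "label \<Rightarrow> rel list" where
  "label_rels Delta1 = [({1,2,3}, (\<lambda>_. 0)(4 := 3))]"
| "label_rels Delta2 = [({3,4}, (\<lambda>_. 0)(5 := 2)), ({1,2}, (\<lambda>_. 0)(5 := 2))]"
| "label_rels Delta3 = [({3,4}, (\<lambda>_. 0)(1 := 1, 5 := 1)), ({1,2}, (\<lambda>_. 0)(5 := 2))]"
| "label_rels Delta4 = [({3,4}, (\<lambda>_. 0)(1 := 2)), ({1,2}, (\<lambda>_. 0)(5 := 2))]"
| "label_rels P1 = [({1,2,3,4}, (\<lambda>_. 0)(5 := 2))]"
| "label_rels P2 = [({1,2,3}, (\<lambda>_. 0)(4 := 1, 5 := 2))]"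
| "label_rels P3 = [({4,5}, (\<lambda>_. 0)(6 := 2)), ({1,2}, (\<lambda>_. 0)(3 := 2))]"
| "label_rels P4 = [({5,6}, (\<lambda>_. 0)(1 := 1, 4 := 1)), ({1,2}, (\<lambda>_. 0)(3 := 2))]"
| "label_rels P5 = [({5,6}, (\<lambda>_. 0)(3 := 1, 4 := 1)), ({1,2}, (\<lambda>_. 0)(3 := 2))]"
| "label_rels P6 = [({3,4}, (\<lambda>_. 0)(1 := 1, 2 := 1)), ({1,5}, (\<lambda>_. 0)(2 := 1, 6 := 1))]"
| "label_rels P7 = [({3,4}, (\<lambda>_. 0)(1 := 1, 2 := 1)), ({5,6}, (\<lambda>_. 0)(1 := 1, 2 := 1))]"
| "label_rels Q1 = [({1,2,3}, (\<lambda>_. 0)(4 := 1, 5 := 1, 6 := 1))]"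
| "label_rels Q2 = [({5,6}, (\<lambda>_. 0)(7 := 1, 1 := 1)), ({1,2}, (\<lambda>_. 0)(3 := 1, 4 := 1))]"
| "label_rels Q3 = [({5,6}, (\<lambda>_. 0)(7 := 2)), ({1,2}, (\<lambda>_. 0)(3 := 1, 4 := 1))]"
| "label_rels R1 = [({5,6}, (\<lambda>_. 0)(7 := 1, 8 := 1)), ({1,2}, (\<lambda>_. 0)(3 := 1, 4 := 1))]"

definition label_deg :: "label \<Rightarrow> nat \<Rightarrow> nat" where "label_deg i j = (if i = P1 \<and> j = 5 then 2 else 1)"

abbreviation (input) vars :: "label \<Rightarrow> nat set" where "vars i \<equiv> {1..num_vars i}"

abbreviation (input) label_model :: "nat \<Rightarrow> label \<Rightarrow> (nat \<Rightarrow> vec \<times> real) \<Rightarrow> vec set \<Rightarrow> bool" where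
  "label_model n i \<equiv> model n (vars i) (label_rels i) (label_deg i)"

lemma label_triangular: "triangular (vars i) (label_rels i)"
  by (cases i) (auto split: if_splits)

lemma label_length: "num_vars i = label_dim i + 1 + length (label_rels i)"
  by (cases i) auto

lemma label_leads: "r \<in> set (label_rels i) \<Longrightarrow> card (fst r) \<ge> 2"
  by (cases i) auto

lemma label_leads_not_singleton: "r \<in> set (label_rels i) \<Longrightarrow> \<exists>j\<in>fst r. j \<noteq> 1"
  using label_leads[of r i] card_mono[of "{1::nat}" "fst r"] by fastforce

lemma label_leads_proper: "(vars i) - leads (label_rels i) \<noteq> {}"
proof -
  have "\<exists>j. j \<in> vars i - leads (label_rels i)"
    by (cases i) (auto simp: leads_def intro: exI[of _ 4] exI[of _ 5] exI[of _ 3] exI[of _ 2])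
  then show ?thesis by blast
qed

lemma Icc_numeral_sum: "sum f {1..4::nat} = f 1 + f 2 + f 3 + f 4" "sum f {1..5::nat} = f 1 + f 2 + f 3 + f 4 + f 5"
  "sum f {1..6::nat} = f 1 + f 2 + f 3 + f 4 + f 5 + f 6" "sum f {1..7::nat} = f 1 + f 2 + f 3 + f 4 + f 5 + f 6 + f 7"
  "sum f {1..8::nat} = f 1 + f 2 + f 3 + f 4 + f 5 + f 6 + f 7 + f 8"
  by (simp_all add: eval_nat_numeral)

lemma label_homogeneous: "\<forall>r\<in>set (label_rels i). (\<Sum>j\<in>(vars i). rvec r j * real (label_deg i j)) = 0"
  by (cases i) (simp_all add: Icc_numeral_sum[unfolded One_nat_def] rvec_def label_deg_def)

lemma label_single_power: "label_deg i j = 1 \<or> single_power (label_rels i) (label_deg i) j"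
  by (cases "i = P1 \<and> j = 5") (auto simp: single_power_def label_deg_def fun_eq_iff intro!: exI[of _ 2])

lemma label_represents: "represents (vars i) (relations i :: 'k::field_char_0 mpoly set) (label_rels i)"
  by (cases i) (simp_all add: represents_def binomial_of_def mon_def Icc_numeral_sum[unfolded One_nat_def]
    var_def mult_single power2_eq_square power3_eq_cube single_add[symmetric] add_ac numeral_2_eq_2 numeral_3_eq_3)

section \<open>Exponent vectors of degree at most three\<close>

lemma comps_0: "finite J \<Longrightarrow> comps J 0 = {\<lambda>_. 0}"
  by (auto simp: comps_def fun_eq_iff)

lemma comps_Suc:
  assumes "u \<in> comps J (Suc k)" "finite J"
  shows "\<exists>x\<in>J. \<exists>v\<in>comps J k. u = (\<lambda>j. v j + (if j = x then 1 else 0))"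
proof -
  have "sum u J \<noteq> 0" using assms by (simp add: comps_def)
  then obtain x where x: "x \<in> J" "u x \<noteq> 0" by (meson sum.neutral)
  let ?v = "\<lambda>j. u j - (if j = x then 1 else 0)"
  have u: "u = (\<lambda>j. ?v j + (if j = x then 1 else 0))" using x by (auto simp: fun_eq_iff)
  have "sum ?v (J - {x}) = sum u (J - {x})" by (intro sum.cong) auto
  then have "sum u J = sum ?v J + 1" using x assms(2) by (simp add: sum.remove[of J x])
  then have "?v \<in> comps J k" using assms(1) x by (auto simp: comps_def)
  then show ?thesis using u x(1) by (intro bexI[of _ x] bexI[of _ ?v])
qed

text \<open>Exponent vector of the product of two variables; it serves as an unordered pair that may
  be a square.\<close>

definition pr :: "nat \<Rightarrow> nat \<Rightarrow> nat \<Rightarrow> nat" where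
  "pr x y j = (if j = x then 1 else 0) + (if j = y then 1 else 0)"

lemma pr_sym: "pr x y = pr y x" by (simp add: pr_def fun_eq_iff)

lemma pr_eq_iff: "pr x y = pr z w \<longleftrightarrow> (x = z \<and> y = w) \<or> (x = w \<and> y = z)"
proof
  assume eq: "pr x y = pr z w"
  have c: "y = w" if "pr x y = pr x w" for x w
    using fun_cong[OF that, of y] by (simp add: pr_def split: if_splits)
  have "x = z \<or> x = w" using fun_cong[OF eq, of x] by (simp add: pr_def split: if_splits)
  then show "(x = z \<and> y = w) \<or> (x = w \<and> y = z)" using c eq by (metis pr_sym)
next
  show "(x = z \<and> y = w) \<or> (x = w \<and> y = z) \<Longrightarrow> pr x y = pr z w" by (auto simp: pr_def fun_eq_iff)
qed

lemma comps_1: "finite J \<Longrightarrow> u \<in> comps J 1 \<Longrightarrow> \<exists>x\<in>J. u = (\<lambda>j. if j = x then 1 else 0)"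
  using comps_Suc[of u J 0] comps_0[of J] by auto

lemma comps_2: assumes "finite J" "u \<in> comps J 2" shows "\<exists>x\<in>J. \<exists>y\<in>J. u = pr x y"
proof -
  obtain x v where x: "x \<in> J" "v \<in> comps J 1" "u = (\<lambda>j. v j + (if j = x then 1 else 0))"
    using comps_Suc[of u J 1] assms by (auto simp: numeral_2_eq_2)
  obtain y where "y \<in> J" "v = (\<lambda>j. if j = y then 1 else 0)" using comps_1[OF assms(1) x(2)] by blast
  then have "u = pr y x" using x by (auto simp: pr_def fun_eq_iff)
  then show ?thesis using x(1) \<open>y \<in> J\<close> by blast
qed

lemma comps_3: assumes "finite J" "u \<in> comps J 3"
  shows "\<exists>x\<in>J. \<exists>y\<in>J. \<exists>z\<in>J. u = (\<lambda>j. pr x y j + (if j = z then 1 else 0))"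
  using comps_Suc[of u J 2] comps_2[OF assms(1)] assms by (fastforce simp: numeral_3_eq_3)

lemma pr_comps: "finite J \<Longrightarrow> x \<in> J \<Longrightarrow> y \<in> J \<Longrightarrow> pr x y \<in> comps J 2"
  by (auto simp: comps_def pr_def sum.distrib)

lemma card_comps_1: assumes "finite J" shows "card (comps J 1) = card J"
proof -
  have "bij_betw (\<lambda>x j. if j = x then 1 else 0 :: nat) J (comps J 1)"
  proof (rule bij_betw_imageI)
    show "inj_on (\<lambda>x j. if j = x then 1 else 0 :: nat) J"
      by (rule inj_onI) (metis zero_neq_one)
    show "(\<lambda>x j. if j = x then 1 else 0 :: nat) ` J = comps J 1"
      using comps_1[OF assms] assms by (auto simp: comps_def)
  qed
  then show ?thesis by (simp add: bij_betw_same_card)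
qed

text \<open>Two elements are lost in the image. Dropping one point of a coincidence twice makes
  \<open>f\<close> injective, and the two coincidences found either share a fibre or account for all
  others.\<close>

lemma two_collisions:
  assumes M: "finite M" "card (f ` M) + 2 = card M"
  shows "(\<exists>p\<in>M. \<exists>q\<in>M. \<exists>r\<in>M. p \<noteq> q \<and> p \<noteq> r \<and> q \<noteq> r \<and> f p = f q \<and> f p = f r) \<or>
    (\<exists>p1\<in>M. \<exists>p2\<in>M. \<exists>p3\<in>M. \<exists>p4\<in>M. p1 \<noteq> p2 \<and> p3 \<noteq> p4 \<and> f p1 = f p2 \<and> f p3 = f p4 \<and> f p1 \<noteq> f p3 \<and>
       (\<forall>s\<in>M. \<forall>t\<in>M. f s = f t \<longrightarrow> s \<noteq> t \<longrightarrow> s \<in> {p1, p2, p3, p4}))"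
proof -
  have "\<not> inj_on f M" using M card_image[of f M] by auto
  then obtain p1 p2 where p: "p1 \<in> M" "p2 \<in> M" "p1 \<noteq> p2" "f p1 = f p2" by (auto simp: inj_on_def)
  have "f ` (M - {p2}) = f ` M" using p by (auto simp: image_iff) (metis DiffI singletonD)
  then have c: "card (f ` (M - {p2})) + 1 = card (M - {p2})" using M p by simp
  then have "\<not> inj_on f (M - {p2})" using card_image[of f "M - {p2}"] by auto
  then obtain p3 p4 where q: "p3 \<in> M - {p2}" "p4 \<in> M - {p2}" "p3 \<noteq> p4" "f p3 = f p4" by (auto simp: inj_on_def)
  have "f ` (M - {p2} - {p4}) = f ` (M - {p2})"
  proof (intro equalityI subsetI)
    fix y assume "y \<in> f ` (M - {p2})"
    then obtain x where x: "x \<in> M - {p2}" "y = f x" by blast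
    show "y \<in> f ` (M - {p2} - {p4})"
    proof (cases "x = p4")
      case True
      then have "y = f p3" using x q by simp
      then show ?thesis using q by (intro image_eqI[of _ _ p3]) auto
    next
      case False
      then show ?thesis using x by (intro image_eqI[of _ _ x]) auto
    qed
  qed auto
  then have "card (f ` (M - {p2} - {p4})) = card (M - {p2} - {p4})" using c M(1) q by simp
  then have inj: "inj_on f (M - {p2} - {p4})" using M(1) by (intro eq_card_imp_inj_on) auto
  show ?thesis
  proof (cases "f p1 = f p3")
    case True
    then have "\<exists>p\<in>M. \<exists>q\<in>M. \<exists>r\<in>M. p \<noteq> q \<and> p \<noteq> r \<and> q \<noteq> r \<and> f p = f q \<and> f p = f r"
      using p q True by (metis Diff_iff singletonI)
    then show ?thesis by blast
  next
    case False
    have "s \<in> {p1, p2, p3, p4}" if st: "s \<in> M" "t \<in> M" "f s = f t" "s \<noteq> t" for s t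
    proof (rule ccontr)
      assume n: "s \<notin> {p1, p2, p3, p4}"
      then have sM: "s \<in> M - {p2} - {p4}" using st by auto
      have "t \<in> {p2, p4}" using inj_onD[OF inj st(3) sM] st by blast
      then have "f s = f p1 \<or> f s = f p3" using st p q by auto
      moreover have "p1 \<in> M - {p2} - {p4}" "p3 \<in> M - {p2} - {p4}" using p q False by auto
      ultimately have "s = p1 \<or> s = p3" using inj_onD[OF inj _ sM] by metis
      then show False using n by blast
    qed
    then show ?thesis using p q False by (intro disjI2) blast
  qed
qed

section \<open>Classification\<close>

text \<open>The enumeration \<open>g\<close> of the degree-one points is a parameter, so that
  results can be reused after the variables have been renumbered to match a label.\<close>

locale small_polytope =
  fixes n :: nat and P :: "vec set" and a :: nat and J :: "nat set" and g :: "nat \<Rightarrow> vec \<times> real"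
  assumes small: "small_degree_two_polytope n P a" and g_bij: "bij_betw g J (slice n P 1)" and fin_J: "finite J"
begin

lemma hst: "hstar n P = fps_of_poly [:1, int a, 1:]" and a012: "a \<in> {0, 1, 2}" and gor: "gorenstein n P"
  and not_pyramid: "\<not> gorenstein_pyramid n P"
  using small by (auto simp: small_degree_two_polytope_def)

lemma full: "full_lattice_polytope n P"
  using gor by (auto simp: gorenstein_def gorenstein_of_index_def)

lemma lp: "lattice_polytope n P" using full by (simp add: full_lattice_polytope_def)

lemmas conf = lattice_configuration[OF full g_bij fin_J]

sublocale configuration n "J" g by (rule conf(2))

lemma h_nth: "fps_nth (hstar n P) 0 = 1" "fps_nth (hstar n P) 1 = int a" "fps_nth (hstar n P) 2 = 1"
  "j > 2 \<Longrightarrow> fps_nth (hstar n P) j = 0"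
  unfolding hst by (auto simp: coeff_pCons numeral_2_eq_2 split: nat.splits)

text \<open>For a single point all slices have one element and \<open>hstar\<close> is 1, without a
  term of degree two.\<close>

lemma n1: "n \<ge> 1"
proof (rule ccontr)
  assume "\<not> n \<ge> 1"
  then have n0: "n = 0" by simp
  have r0: "rspace 0 = {0}" by (auto simp: rspace_iff poly_mapping_eqI)
  have "P \<subseteq> {0}" using lattice_polytope_rspace[OF lp] n0 r0 by simp
  moreover have "P \<noteq> {}" using conf(1,4) by auto
  ultimately have P: "P = {0}" by blast
  have "dilate k P \<inter> lattice n = {0}" for k using lattice_0[of 0] by (auto simp: P dilate_def n0)
  then have "hstar n P = (1 - fps_X) * Abs_fps (\<lambda>k. 1)" by (simp add: hstar_def n0)
  then have "fps_nth (hstar n P) 2 = 0" by (simp add: one_minus_X_mult_nth)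
  then show False using h_nth by simp
qed

text \<open>For \<open>m = a\<close> this compares the cone with the polynomial ring on its
  degree-one generators; the factor in front measures the deviation.\<close>

lemma slice_series:
  assumes "finite K" "card K = n + 1 + m"
  shows "Abs_fps (\<lambda>k. int (card (slice n P k))) = fps_of_poly [:1, int a, 1:] * (1 - fps_X) ^ m * Abs_fps (\<lambda>k. int (card (comps K k)))"
proof -
  let ?H = "Abs_fps (\<lambda>k. int (card (slice n P k)))" and ?F = "Abs_fps (\<lambda>k. int (card (comps K k)))" and ?h = "fps_of_poly [:1, int a, 1:]"
  have nz: "(1 - fps_X :: int fps) ^ (n + 1) \<noteq> 0"
    using comps_fps[OF assms(1)] by (auto simp: assms(2) power_add)
  have F: "(1 - fps_X) ^ (n + 1) * ((1 - fps_X) ^ m * ?F) = 1"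
    using comps_fps[OF assms(1)] unfolding assms(2) power_add by (simp only: mult_ac)
  have "(1 - fps_X) ^ (n + 1) * ?H = ?h" using hst hstar_slice by metis
  also have "\<dots> = ?h * ((1 - fps_X) ^ (n + 1) * ((1 - fps_X) ^ m * ?F))" by (simp only: F mult_1_right)
  also have "\<dots> = (1 - fps_X) ^ (n + 1) * (?h * (1 - fps_X) ^ m * ?F)" by (simp only: mult_ac)
  finally show ?thesis using nz by simp
qed

lemma h_poly: "fps_of_poly [:1, int a, 1:] = 1 + of_nat a * fps_X + fps_X ^ 2"
  by (simp add: fps_of_poly_pCons algebra_simps power2_eq_square fps_of_nat[symmetric])

lemma card_J: "card J = n + 1 + a"
proof -
  have "int (card (slice n P 1)) = fps_nth (fps_of_poly [:1, int a, 1:] * Abs_fps (\<lambda>k. int (card (comps {..<n + 1} k)))) 1"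
    using slice_series[of "{..<n + 1}" 0] by (metis (no_types, lifting) add_0_right card_lessThan finite_lessThan fps_nth_Abs_fps mult_1_right power_0)
  also have "\<dots> = int (n + 1) + int a"
    using card_comps_1[of "{..<n + 1}"] comps_0[of "{..<n + 1}"] by (simp add: fps_mult_nth coeff_pCons)
  finally show ?thesis using bij_betw_same_card[OF g_bij] by simp
qed

lemma functionals:
  "\<exists>U w. finite U \<and> U \<subseteq> Lam n \<and> w \<in> Lam n \<and> (\<forall>u\<in>U. ev n u w = 1) \<and> cone_over P = {p \<in> VV n. \<forall>u\<in>U. 0 \<le> ev n u p}"
  by (rule gorenstein_functionals[OF gor n1])

lemma semigroup_iff: "p \<in> cone_semigroup n P \<longleftrightarrow> p \<in> Lam n \<and> p \<in> cone"
  using conf(3) by (auto simp: cone_semigroup_def Lam_def)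

lemma slice_iff: "p \<in> slice n P k \<longleftrightarrow> p \<in> Lam n \<and> p \<in> cone \<and> snd p = real k"
  by (auto simp: slice_def semigroup_iff)

lemma g_image: "g ` J = slice n P 1" and g_inj: "inj_on g J"
  using g_bij by (auto simp: bij_betw_def)

lemma degree_one: assumes "t \<in> Lam n" "t \<in> cone" "snd t = 1" shows "\<exists>i\<in>J. g i = t"
proof -
  have "t \<in> slice n P 1" using assms by (simp add: slice_iff)
  then show ?thesis using g_image by (metis imageE)
qed

lemma cone_comb: "(\<And>j. f j \<ge> 0) \<Longrightarrow> comb J g f \<in> cone"
  unfolding cone_def by blast

lemma cone_scale: assumes "p \<in> cone" "c \<ge> 0" shows "c *\<^sub>R p \<in> cone"
proof -
  obtain f where f: "p = comb J g f" "\<forall>j. f j \<ge> 0" using assms by (auto simp: cone_def)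
  then have "c *\<^sub>R p = comb J g (\<lambda>j. c * f j)" by (simp add: comb_scale)
  then show ?thesis using f assms by (auto intro!: cone_comb)
qed

lemma g_cone: assumes "j \<in> J" shows "g j \<in> cone"
  using cone_comb[of "\<lambda>i. if i = j then 1 else 0"] unfolding comb_unit[OF fin_J assms] by simp

lemma cone_add: assumes "p \<in> cone" "q \<in> cone" shows "p + q \<in> cone"
proof -
  obtain f h where "p = comb J g f" "\<forall>j. f j \<ge> 0" "q = comb J g h" "\<forall>j. h j \<ge> 0" using assms by (auto simp: cone_def)
  then have "p + q = comb J g (\<lambda>j. f j + h j)" "\<forall>j. f j + h j \<ge> 0" by (simp_all add: comb_add)
  then show ?thesis by (auto intro!: cone_comb)
qed

text \<open>Half of a sum of two generators lies in the cone and has degree one. This excludes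
  relations between squares that would require a missing lattice point.\<close>

lemma midpoint:
  assumes "t \<in> Lam n" "x \<in> J" "y \<in> J" "2 *\<^sub>R t = g x + g y"
  shows "\<exists>i\<in>J. g i = t"
proof (rule degree_one[OF assms(1)])
  have t: "t = (1/2) *\<^sub>R (g x + g y)" using assms(4)[symmetric] by simp
  show "t \<in> cone" unfolding t by (intro cone_scale cone_add g_cone assms) simp
  show "snd t = 1" unfolding t using assms(2,3) by (simp add: deg1)
qed

lemma decomposition: "p \<in> cone_semigroup n P \<Longrightarrow> \<exists>b u. b \<in> cone_semigroup n P \<and> snd b \<le> 2 \<and> p = b + nc u"
  using semigroup_decomp[OF conf(3) lp, of 2 p] h_nth(4) by (metis of_nat_numeral)

lemma indecomposable: assumes "z \<in> Lam n" "z \<in> cone" "snd z = 2" "\<And>j. j \<in> J \<Longrightarrow> z - g j \<notin> cone" shows "a = 0"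
proof -
  obtain U w where U: "finite U" "U \<subseteq> Lam n" "w \<in> Lam n" "\<And>u. u \<in> U \<Longrightarrow> ev n u w = 1"
    "cone_over P = {p \<in> VV n. \<forall>u\<in>U. 0 \<le> ev n u p}" using functionals by blast
  have "card (g ` J) \<le> n + 1"
    by (rule indecomposable_degree_two[OF conf(3) lp h_nth(4) refl U(1,2,5,3,4) assms])
  then show ?thesis using card_image[OF g_inj] card_J by simp
qed

lemma cone_snd: "p \<in> cone \<Longrightarrow> snd p \<ge> 0" "p \<in> cone \<Longrightarrow> snd p = 0 \<Longrightarrow> p = 0"
proof -
  assume "p \<in> cone"
  then obtain f where f: "p = comb J g f" "\<forall>j. f j \<ge> 0" by (auto simp: cone_def)
  have s: "snd p = (\<Sum>j\<in>J. f j)" unfolding f comb_def snd_sum by (intro sum.cong) (auto simp: deg1)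
  then show "snd p \<ge> 0" using f by (simp add: sum_nonneg)
  assume "snd p = 0"
  then have "\<forall>j\<in>J. f j = 0" using s f fin_J by (simp add: sum_nonneg_eq_0_iff)
  then show "p = 0" unfolding f comb_def by simp
qed

lemma nc_add: "nc u + nc v = nc (\<lambda>j. u j + v j)" by (simp add: nc_def comb_add)

lemma nc_unit: "j \<in> J \<Longrightarrow> nc (\<lambda>i. if i = j then 1 else 0) = g j"
proof -
  assume j: "j \<in> J"
  have "nc (\<lambda>i. if i = j then 1 else 0) = comb J g (\<lambda>i. if i = j then 1 else 0)" unfolding nc_def by (rule comb_cong) auto
  then show ?thesis using comb_unit[OF fin_J j, of g] by simp
qed

lemma nc_pr: "x \<in> J \<Longrightarrow> y \<in> J \<Longrightarrow> nc (pr x y) = g x + g y"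
  using nc_add[of "\<lambda>i. if i = x then 1 else 0" "\<lambda>i. if i = y then 1 else 0"] by (simp add: nc_unit pr_def[abs_def])

lemma low_degree:
  assumes "q \<in> cone_semigroup n P" "snd q \<le> 1" shows "\<exists>u. q = nc u"
proof -
  have q: "q \<in> Lam n" "q \<in> cone" using assms(1) semigroup_iff by auto
  have "snd q \<in> \<int>" using q by (auto simp: Lam_def)
  then obtain z :: int where z: "snd q = of_int z" by (auto elim: Ints_cases)
  then have "z = 0 \<or> z = 1" using cone_snd(1)[OF q(2)] assms(2) by auto
  then consider "snd q = 0" | "snd q = 1" using z by auto
  then show ?thesis
  proof cases
    case 1
    then have "q = nc (\<lambda>_. 0)" using cone_snd(2)[OF q(2)] by (simp add: nc_def comb_def)
    then show ?thesis by blast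
  next
    case 2
    then obtain i where "i \<in> J" "g i = q" using degree_one q by blast
    then show ?thesis using nc_unit by metis
  qed
qed

text \<open>Box points have degree at most two; one of degree two splits off a generator, because an
  indecomposable one would force \<open>a = 0\<close>.\<close>

lemma generated_degree_one:
  assumes "a \<noteq> 0" "p \<in> cone_semigroup n P"
  shows "\<exists>u. (\<forall>j. j \<notin> J \<longrightarrow> u j = 0) \<and> p = nc u"
proof -
  obtain b v where b: "b \<in> cone_semigroup n P" "snd b \<le> 2" "p = b + nc v" using decomposition[OF assms(2)] by blast
  have bL: "b \<in> Lam n" "b \<in> cone" using b semigroup_iff by auto
  note low = low_degree[unfolded semigroup_iff]
  have "\<exists>u. b = nc u"
  proof (cases "snd b = 2")
    case True
    then obtain j where j: "j \<in> J" "b - g j \<in> cone" using indecomposable[OF bL] assms(1) by blast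
    have "\<exists>u. b - g j = nc u" using low[of "b - g j"] bL gL[OF j(1)] j True deg1[OF j(1)] by (auto intro: Lam_diff)
    then obtain u where "b - g j = nc u" by blast
    then have "b = nc u + nc (\<lambda>i. if i = j then 1 else 0)" using nc_unit[OF j(1)] by (simp add: algebra_simps)
    then show ?thesis unfolding nc_add by blast
  next
    case False
    have "snd b \<in> \<int>" using bL by (auto simp: Lam_def)
    then have "snd b \<le> 1" using b(2) False by (auto elim!: Ints_cases)
    then show ?thesis using low bL by blast
  qed
  then obtain u where "b = nc u" by blast
  then have "p = nc (\<lambda>j. u j + v j)" using b(3) nc_add by simp
  also have "\<dots> = nc (\<lambda>j. if j \<in> J then u j + v j else 0)" unfolding nc_def by (rule comb_cong) auto
  finally show ?thesis by (intro exI[of _ "\<lambda>j. if j \<in> J then u j + v j else 0"]) auto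
qed

lemma nc_semigroup: "nc u \<in> cone_semigroup n P"
  unfolding semigroup_iff using nc_Lam by (auto simp: nc_def intro: cone_comb)

lemma nc_slice: assumes "a \<noteq> 0" shows "nc ` comps J k = slice n P k"
proof (intro equalityI subsetI)
  fix p assume "p \<in> nc ` comps J k"
  then obtain u where u: "u \<in> comps J k" "p = nc u" by blast
  have "snd p = real k" using snd_nc[of "J" u] u by (auto simp: comps_def)
  then show "p \<in> slice n P k" using nc_semigroup u(2) by (simp add: slice_def)
next
  fix p assume p: "p \<in> slice n P k"
  then obtain u where u: "\<forall>j. j \<notin> J \<longrightarrow> u j = 0" "p = nc u" using generated_degree_one[OF assms, of p] by (auto simp: slice_def)
  have "real (sum u J) = real k" using snd_nc[of "J" u] u p by (simp add: slice_def)
  then have "sum u J = k" by linarith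
  then show "p \<in> nc ` comps J k" using u by (auto simp: comps_def)
qed

text \<open>The relations of a label, satisfied by some of the degree one generators, exhaust all relations;
  a generator not occurring in them would be the apex of a pyramid.\<close>

lemma classify:
  assumes i: "i \<noteq> P1" and xs: "distinct xs" "set xs \<subseteq> J" "length xs = num_vars i"
    and a: "a \<noteq> 0" "length (label_rels i) = a"
    and rel: "\<And>r. r \<in> set (label_rels i) \<Longrightarrow> comb (vars i) (\<lambda>j. g (xs ! (j - 1))) (rvec r) = 0"
  shows "label_dim i = n" "\<exists>h. label_model n i h P"
proof -
  define l where "l = card J"
  define L where "L = {1..l}"
  \<comment> \<open>The variables of the label come first, so that any others are numbered above
    \<open>num_vars i\<close>.\<close>
  define ys where "ys = xs @ sorted_list_of_set (J - set xs)"
  have ys: "distinct ys" "set ys = J" using xs fin_J by (auto simp: ys_def)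
  have len: "length ys = l" using distinct_card[OF ys(1)] ys(2) by (simp add: l_def)
  define h where "h = (\<lambda>j. g (ys ! (j - 1)))"
  have le: "num_vars i \<le> l" using len xs(3) by (simp add: ys_def)
  have himg: "h ` L = g ` J"
  proof -
    have "(\<lambda>j. ys ! (j - 1)) ` L = set ys"
    proof (intro equalityI subsetI)
      fix y assume "y \<in> set ys"
      then obtain k where "k < l" "y = ys ! k" using len by (auto simp: in_set_conv_nth)
      then show "y \<in> (\<lambda>j. ys ! (j - 1)) ` L" by (intro image_eqI[of _ _ "Suc k"]) (auto simp: L_def)
    qed (use len in \<open>auto simp: L_def\<close>)
    then show ?thesis unfolding h_def image_image[symmetric] using ys by (metis image_image)
  qed
  have L: "finite L" "card L = card J" by (simp_all add: L_def l_def)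
  have hbij: "bij_betw h L (slice n P 1)"
    using himg g_image card_image[OF g_inj] L by (auto simp: bij_betw_def intro!: eq_card_imp_inj_on)
  interpret h: small_polytope n P a L h using small hbij L(1) by (rule small_polytope.intro)
  have rel': "comb L h (rvec r) = 0" if r: "r \<in> set (label_rels i)" for r
  proof -
    have "comb L h (rvec r) = comb (vars i) h (rvec r)"
      unfolding comb_def using le rvec_outside[OF label_triangular r] by (intro sum.mono_neutral_right) (auto simp: L_def)
    also have "\<dots> = comb (vars i) (\<lambda>j. g (xs ! (j - 1))) (rvec r)"
      unfolding comb_def using xs(3) by (intro sum.cong) (auto simp: h_def ys_def nth_append)
    finally show ?thesis using rel[OF r] by simp
  qed
  have tri: "triangular L (label_rels i)" by (rule triangular_mono[OF label_triangular]) (use le in \<open>auto simp: L_def\<close>)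
  have pm: "premodel n L (label_rels i) (\<lambda>_. 1) h"
  proof (rule premodel_of_generators)
    show "triangular L (label_rels i)" by (rule tri)
    show "h j \<in> Lam n \<and> snd (h j) = real 1 \<and> (1::nat) \<ge> 1" if "j \<in> L" for j using h.gL[OF that] h.deg1[OF that] by simp
    show "card L = n + 1 + length (label_rels i)" using h.card_J a by simp
    fix p assume "p \<in> Lam n"
    show "\<exists>f. (\<forall>j. f j \<in> \<int>) \<and> comb L h f = p"
    proof (rule h.lattice_generated[OF _ subset_refl refl _ \<open>p \<in> Lam n\<close>])
      fix q assume "q \<in> Lam n" "q \<in> h.cone"
      then obtain u where "q = h.nc u" using h.generated_degree_one[OF a(1)] h.semigroup_iff by blast
      then show "\<exists>f. (\<forall>j. f j \<in> \<int>) \<and> q = comb L h f" unfolding h.nc_def by (intro exI[of _ "\<lambda>j. real (u j)"]) auto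
    qed (rule L(1))
  qed (use rel' L(1) in auto)
  have proper: "L - leads (label_rels i) \<noteq> {}" using label_leads_proper[of i] le by (fastforce simp: L_def)
  have m: "model n L (label_rels i) (\<lambda>_. 1) h P"
    unfolding model_def using pm proper h.conf(1,3) h.g_cone by simp
  have "l = num_vars i"
  proof (rule ccontr)
    assume "l \<noteq> num_vars i"
    then have lt: "num_vars i < l" using le by simp
    obtain m' where m': "n = Suc m'" using n1 by (cases n) auto
    define K where "K = {1..l - 1}"
    have K: "L = insert l K" "l \<notin> K" using lt by (auto simp: K_def L_def)
    have subK: "(vars i) \<subseteq> K" using lt by (auto simp: K_def)
    have "gorenstein_pyramid (Suc m') P"
    proof (rule free_variable_pyramid[where J = K and l = l and d = "\<lambda>_. 1" and o' = 1])
      show "model (Suc m') (insert l K) (label_rels i) (\<lambda>_. 1) h P" using m K m' by simp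
      show "triangular K (label_rels i)" by (rule triangular_mono[OF label_triangular subK])
      have "num_vars i \<ge> 1" by (cases i) auto
      then show "1 \<in> K" using subK by auto
      show "\<exists>j\<in>fst r. j \<noteq> 1" if "r \<in> set (label_rels i)" for r using label_leads_not_singleton[OF that] .
      show "card K = m' + 1 + length (label_rels i)" using h.card_J[unfolded L_def] a m' by (simp add: K_def)
      show "K - leads (label_rels i) \<noteq> {}" using label_leads_proper[of i] subK by fastforce
    qed (use K in \<open>auto simp: K_def\<close>)
    then show False using not_pyramid m' by simp
  qed
  then show "label_dim i = n" using label_length[of i] card_J a by (simp add: l_def)
  have "label_deg i = (\<lambda>_. 1)" using i by (auto simp: label_deg_def fun_eq_iff)
  then show "\<exists>h. label_model n i h P"
    using m \<open>l = num_vars i\<close> by (auto simp: L_def)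
qed

end

lemma scaleR_3: "3 *\<^sub>R (v :: 'a::real_vector) = v + v + v"
  using scaleR_add_left[of 2 1 v] by (simp add: scaleR_2)

definition label_holds :: "label \<Rightarrow> (nat \<Rightarrow> vec \<times> real) \<Rightarrow> bool" where
  "label_holds i G \<longleftrightarrow> (\<forall>r\<in>set (label_rels i). comb (vars i) G (rvec r) = 0)"

lemma comb_rvec_eq_0_iff:
  assumes "finite J" "fst r \<subseteq> J"
  shows "comb J G (rvec r) = 0 \<longleftrightarrow> sum G (fst r) = comb J G (\<lambda>j. real (snd r j))"
proof -
  have "comb J G (rvec r) = comb J G (\<lambda>j. if j \<in> fst r then 1 else 0) - comb J G (\<lambda>j. real (snd r j))"
    unfolding rvec_def by (simp add: comb_diff)
  also have "comb J G (\<lambda>j. if j \<in> fst r then 1 else 0) = sum G (fst r)"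
    unfolding comb_def using assms by (intro sum.mono_neutral_cong_right) auto
  finally show ?thesis by simp
qed

lemma label_holds_sums:
  "label_holds i G \<longleftrightarrow> (\<forall>r\<in>set (label_rels i). sum G (fst r) = comb (vars i) G (\<lambda>j. real (snd r j)))"
proof -
  have "fst r \<subseteq> (vars i)" if "r \<in> set (label_rels i)" for r
    using that by (cases i) auto
  then show ?thesis unfolding label_holds_def by (intro ball_cong refl comb_rvec_eq_0_iff) auto
qed

lemma label_holds_iff:
  "label_holds Delta1 G \<longleftrightarrow> G 1 + G 2 + G 3 = G 4 + G 4 + G 4"
  "label_holds Delta2 G \<longleftrightarrow> G 1 + G 2 = G 5 + G 5 \<and> G 3 + G 4 = G 5 + G 5"
  "label_holds Delta3 G \<longleftrightarrow> G 1 + G 2 = G 5 + G 5 \<and> G 3 + G 4 = G 1 + G 5"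
  "label_holds Delta4 G \<longleftrightarrow> G 1 + G 2 = G 5 + G 5 \<and> G 3 + G 4 = G 1 + G 1"
  "label_holds P1 G \<longleftrightarrow> G 1 + G 2 + G 3 + G 4 = G 5 + G 5"
  "label_holds P2 G \<longleftrightarrow> G 1 + G 2 + G 3 = G 4 + (G 5 + G 5)"
  "label_holds P3 G \<longleftrightarrow> G 1 + G 2 = G 3 + G 3 \<and> G 4 + G 5 = G 6 + G 6"
  "label_holds P4 G \<longleftrightarrow> G 1 + G 2 = G 3 + G 3 \<and> G 5 + G 6 = G 1 + G 4"
  "label_holds P5 G \<longleftrightarrow> G 1 + G 2 = G 3 + G 3 \<and> G 5 + G 6 = G 3 + G 4"
  "label_holds P6 G \<longleftrightarrow> G 1 + G 5 = G 2 + G 6 \<and> G 3 + G 4 = G 1 + G 2"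
  "label_holds P7 G \<longleftrightarrow> G 5 + G 6 = G 1 + G 2 \<and> G 3 + G 4 = G 1 + G 2"
  "label_holds Q1 G \<longleftrightarrow> G 1 + G 2 + G 3 = G 4 + G 5 + G 6"
  "label_holds Q2 G \<longleftrightarrow> G 1 + G 2 = G 3 + G 4 \<and> G 5 + G 6 = G 1 + G 7"
  "label_holds Q3 G \<longleftrightarrow> G 1 + G 2 = G 3 + G 4 \<and> G 5 + G 6 = G 7 + G 7"
  "label_holds R1 G \<longleftrightarrow> G 1 + G 2 = G 3 + G 4 \<and> G 5 + G 6 = G 7 + G 8"
  by (simp_all add: label_holds_sums comb_def Icc_numeral_sum[unfolded One_nat_def] scaleR_2 scaleR_3 add.assoc conj_commute)

context small_polytope
begin

abbreviation classified :: bool where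
  "classified \<equiv> \<exists>i h. label_dim i = n \<and> label_model n i h P"

lemma classify_label:
  assumes "i \<noteq> P1" "a = length (label_rels i)" "length xs = num_vars i" "distinct xs" "set xs \<subseteq> J"
    "label_holds i (\<lambda>j. g (xs ! (j - 1)))"
  shows classified
proof -
  have a: "a \<noteq> 0" using assms(2) by (cases i) auto
  show ?thesis using classify[OF assms(1,4,5,3) a assms(2)[symmetric]] assms(6) unfolding label_holds_def by blast
qed

lemma nc_inj_le: assumes "a \<noteq> 0" "card (slice n P k) = card (comps J k)" shows "inj_on nc (comps J k)"
  using assms nc_slice[of k] finite_comps[OF fin_J] by (intro eq_card_imp_inj_on) auto

text \<open>The factor in front of the free Hilbert series is \<open>1 - t^3\<close> for
  \<open>a = 1\<close>, \<open>(1 - t^2)^2\<close> for \<open>a = 2\<close> and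
  \<open>1 + t^2\<close> for \<open>a = 0\<close>. Its low coefficients count the coincidences or
  the extra point.\<close>

lemma slice_cards:
  "a = 1 \<Longrightarrow> card (slice n P 2) = card (comps J 2) \<and> card (slice n P 3) + 1 = card (comps J 3)"
  "a = 2 \<Longrightarrow> card (slice n P 2) + 2 = card (comps J 2)"
  "a = 0 \<Longrightarrow> card (slice n P 2) = card (comps J 2) + 1"
proof -
  let ?F = "Abs_fps (\<lambda>k. int (card (comps J k)))"
  have H: "int (card (slice n P k)) = fps_nth (fps_of_poly [:1, int a, 1:] * (1 - fps_X) ^ a * ?F) k" for k
    using slice_series[OF fin_J card_J] by (metis fps_nth_Abs_fps)
  have c0: "card (comps J 0) = 1" using comps_0[OF fin_J] by simp
  have X: "fps_nth (fps_X ^ m * ?F) k = (if k < m then 0 else int (card (comps J (k - m))))" for m k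
    by (simp add: fps_X_power_mult_nth)
  show "card (slice n P 2) = card (comps J 2) \<and> card (slice n P 3) + 1 = card (comps J 3)" if "a = 1"
  proof -
    have e: "fps_of_poly [:1, int a, 1:] * (1 - fps_X) ^ a * ?F = ?F - fps_X ^ 3 * ?F"
      unfolding h_poly unfolding that by (simp add: algebra_simps eval_nat_numeral)
    show ?thesis using H[of 2] H[of 3] unfolding e by (simp add: X c0)
  qed
  show "card (slice n P 2) + 2 = card (comps J 2)" if "a = 2"
  proof -
    have e: "fps_of_poly [:1, int a, 1:] * (1 - fps_X) ^ a * ?F = ?F - fps_X ^ 2 * ?F - fps_X ^ 2 * ?F + fps_X ^ 4 * ?F"
      unfolding h_poly unfolding that by (simp add: algebra_simps eval_nat_numeral)
    show ?thesis using H[of 2] unfolding e by (simp add: X c0)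
  qed
  show "card (slice n P 2) = card (comps J 2) + 1" if "a = 0"
  proof -
    have e: "fps_of_poly [:1, int a, 1:] * (1 - fps_X) ^ a * ?F = ?F + fps_X ^ 2 * ?F"
      unfolding h_poly unfolding that by (simp add: algebra_simps)
    show ?thesis using H[of 2] unfolding e by (simp add: X c0)
  qed
qed

lemma g_eq_iff: "x \<in> J \<Longrightarrow> y \<in> J \<Longrightarrow> g x = g y \<longleftrightarrow> x = y"
  using g_inj by (auto simp: inj_on_def)

lemma half: assumes "2 *\<^sub>R g x = 2 *\<^sub>R g y" "x \<in> J" "y \<in> J" shows "x = y"
  using assms g_eq_iff by simp

section \<open>The case \<open>a = 1\<close>: one cubic relation\<close>

definition cubic :: "nat \<Rightarrow> nat \<Rightarrow> nat \<Rightarrow> nat \<Rightarrow> nat \<Rightarrow> nat \<Rightarrow> bool" where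
  "cubic x y z u v w \<longleftrightarrow> {x, y, z, u, v, w} \<subseteq> J \<and> {x, y, z} \<inter> {u, v, w} = {} \<and> g x + g y + g z = g u + g v + g w"

lemma classify_cubic_double:
  assumes "a = 1" "cubic x y z u v v" "distinct [x, y, z]" shows classified
proof (cases "u = v")
  case True
  show ?thesis by (rule classify_label[of Delta1 "[x, y, z, v]"]) (use assms True in \<open>auto simp: label_holds_iff cubic_def add_ac\<close>)
next
  case False
  show ?thesis by (rule classify_label[of P2 "[x, y, z, u, v]"]) (use assms False in \<open>auto simp: label_holds_iff cubic_def add_ac\<close>)
qed

lemma classify_cubic_distinct:
  assumes a: "a = 1" and c: "cubic x y z u v w" and d: "distinct [x, y, z]" shows classified
proof -
  consider "distinct [u, v, w]" | "u = v" | "v = w" | "u = w" by auto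
  then show ?thesis
  proof cases
    case 1
    show ?thesis by (rule classify_label[of Q1 "[x, y, z, u, v, w]"]) (use assms 1 in \<open>auto simp: label_holds_iff cubic_def add_ac\<close>)
  next
    case 2
    have "cubic x y z w u u" using c 2 by (auto simp: cubic_def add_ac)
    then show ?thesis using classify_cubic_double a d by blast
  next
    case 3
    then show ?thesis using classify_cubic_double a d c by blast
  next
    case 4
    have "cubic x y z v w w" using c 4 by (auto simp: cubic_def add_ac)
    then show ?thesis using classify_cubic_double a d by blast
  qed
qed

text \<open>For \<open>a = 1\<close> there are as many points of degree two as unordered pairs of
  generators.\<close>

lemma quadric_unique:
  assumes "a = 1" "{x, y, z, w} \<subseteq> J" "g x + g y = g z + g w" shows "pr x y = pr z w"
proof -
  have "inj_on nc (comps J 2)" by (rule nc_inj_le) (use assms slice_cards in auto)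
  moreover have "nc (pr x y) = nc (pr z w)" "pr x y \<in> comps J 2" "pr z w \<in> comps J 2"
    using assms fin_J by (auto simp: nc_pr pr_comps)
  ultimately show ?thesis by (rule inj_onD)
qed

text \<open>Written multiplicatively, \<open>x^2 y = z^2 w\<close> makes
  \<open>(x y / z)^2 = y w\<close>. So \<open>x y / z\<close> is a generator whose square equals
  \<open>y w\<close>, a quadratic relation because \<open>y\<close> and \<open>w\<close>
  differ.\<close>

lemma cubic_repeated:
  assumes a: "a = 1" and c: "cubic x x y z z w" shows False
proof -
  have J: "x \<in> J" "y \<in> J" "z \<in> J" "w \<in> J" using c by (auto simp: cubic_def)
  define t where "t = g x + g y - g z"
  have "g x + g x + g y = g z + g z + g w" using c by (simp add: cubic_def)
  then have t2: "2 *\<^sub>R t = g y + g w" by (simp add: t_def scaleR_2 algebra_simps)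
  have "t \<in> Lam n" unfolding t_def using J gL by (auto intro: Lam_add Lam_diff)
  then obtain i where i: "i \<in> J" "g i = t" using midpoint[OF _ J(2,4) t2] by blast
  then have "g i + g i = g y + g w" using t2 by (simp add: scaleR_2)
  then have "pr i i = pr y w" using quadric_unique[OF a] i J by blast
  then show False using c by (auto simp: pr_eq_iff cubic_def)
qed

text \<open>The point missing in degree three yields two cubic monomials with equal image. A common
  variable would cancel to a quadratic relation, and repeated variables in both monomials are
  impossible by \<open>cubic_repeated\<close>.\<close>

lemma classify_one: assumes a: "a = 1" shows classified
proof -
  have "\<not> inj_on nc (comps J 3)"
    using slice_cards(1)[OF a] nc_slice[of 3] a card_image[of nc "comps J 3"] by auto
  then obtain p q where pq: "p \<in> comps J 3" "q \<in> comps J 3" "p \<noteq> q" "nc p = nc q" by (auto simp: inj_on_def)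
  obtain x y z where p: "x \<in> J" "y \<in> J" "z \<in> J" "p = (\<lambda>j. pr x y j + (if j = z then 1 else 0))" using comps_3[OF fin_J pq(1)] by blast
  obtain u v w where q: "u \<in> J" "v \<in> J" "w \<in> J" "q = (\<lambda>j. pr u v j + (if j = w then 1 else 0))" using comps_3[OF fin_J pq(2)] by blast
  have eq: "g x + g y + g z = g u + g v + g w"
    using pq(4) unfolding p(4) q(4) nc_add[symmetric] using p q by (simp add: nc_pr nc_unit)
  have ne: False if "s \<in> J" "t \<in> J" "s' \<in> J" "t' \<in> J" "c \<in> J" "g s + g t = g s' + g t'"
    "p = (\<lambda>j. pr s t j + (if j = c then 1 else 0))" "q = (\<lambda>j. pr s' t' j + (if j = c then 1 else 0))" for s t s' t' c
    using quadric_unique[OF a, of s t s' t'] that pq(3) by simp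
  have cyc: "(\<lambda>j. pr s t j + (if j = c then 1 else 0)) = (\<lambda>j. pr t c j + (if j = s then 1 else 0))" for s t c
    by (simp add: pr_def fun_eq_iff)
  note P = p(4) p(4)[unfolded cyc] p(4)[unfolded cyc[of x] cyc[of y]] and Q = q(4) q(4)[unfolded cyc] q(4)[unfolded cyc[of u] cyc[of v]]
  have disj: "{x, y, z} \<inter> {u, v, w} = {}"
  proof (rule ccontr)
    assume "\<not> ?thesis"
    then consider "x = u" | "x = v" | "x = w" | "y = u" | "y = v" | "y = w" | "z = u" | "z = v" | "z = w" by auto
    then show False
      by cases (use eq p(1-3) q(1-3) ne[of y z v w x] ne[of y z w u x] ne[of y z u v x] ne[of z x v w y] ne[of z x w u y]
         ne[of z x u v y] ne[of x y v w z] ne[of x y w u z] ne[of x y u v z] p(4) q(4) in \<open>simp add: algebra_simps pr_def fun_eq_iff; fail\<close>)+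
  qed
  have c: "cubic x y z u v w" using p q eq disj by (auto simp: cubic_def)
  show ?thesis
  proof (cases "distinct [x, y, z]")
    case True
    then show ?thesis using classify_cubic_distinct[OF a c] by blast
  next
    case nd: False
    show ?thesis
    proof (cases "distinct [u, v, w]")
      case True
      have "cubic u v w x y z" using c by (auto simp: cubic_def)
      then show ?thesis using classify_cubic_distinct[OF a] True by blast
    next
      case False
      obtain s t where s: "cubic s s t u v w"
      proof -
        consider "x = y" | "y = z" | "x = z" using nd by auto
        then show thesis by cases (use c that[of x z] that[of y x] that[of x y] in \<open>auto simp: cubic_def add_ac\<close>)
      qed
      obtain s' t' where "cubic s s t s' s' t'"
      proof -
        consider "u = v" | "v = w" | "u = w" using False by auto
        then show thesis by cases (use s that[of u w] that[of v u] that[of u v] in \<open>auto simp: cubic_def add_ac\<close>)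
      qed
      then show ?thesis using cubic_repeated[OF a] by blast
    qed
  qed
qed

end

section \<open>The case \<open>a = 2\<close>: two quadratic relations\<close>

context small_polytope
begin

text \<open>In multiplicative notation \<open>p q = r s\<close> and \<open>t u = v w\<close>. The
  last clause records that no further pair of generators takes part in a coincidence, which is used
  to refute extra relations.\<close>

definition two_quadrics :: "nat \<Rightarrow> nat \<Rightarrow> nat \<Rightarrow> nat \<Rightarrow> nat \<Rightarrow> nat \<Rightarrow> nat \<Rightarrow> nat \<Rightarrow> bool" where
  "two_quadrics p q r s t u v w \<longleftrightarrow> {p, q, r, s, t, u, v, w} \<subseteq> J \<and> {p, q} \<inter> {r, s} = {} \<and> {t, u} \<inter> {v, w} = {} \<and>
     g p + g q = g r + g s \<and> g t + g u = g v + g w \<and> g p + g q \<noteq> g t + g u \<and>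
     (\<forall>x\<in>J. \<forall>y\<in>J. \<forall>x'\<in>J. \<forall>y'\<in>J. g x + g y = g x' + g y' \<longrightarrow> pr x y \<noteq> pr x' y' \<longrightarrow>
        pr x y \<in> {pr p q, pr r s, pr t u, pr v w})"

lemma quadrics_sums: "x \<in> J \<Longrightarrow> y \<in> J \<Longrightarrow> pr x y = pr x' y' \<Longrightarrow> g x + g y = g x' + g y'"
  by (auto simp: pr_eq_iff add.commute)

lemma two_quadricsD:
  assumes "two_quadrics p q r s t u v w"
  shows "p \<in> J" "q \<in> J" "r \<in> J" "s \<in> J" "t \<in> J" "u \<in> J" "v \<in> J" "w \<in> J"
    "p \<noteq> r" "p \<noteq> s" "q \<noteq> r" "q \<noteq> s" "t \<noteq> v" "t \<noteq> w" "u \<noteq> v" "u \<noteq> w"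
  using assms by (auto simp: two_quadrics_def)

lemma two_quadrics_eqs:
  assumes "two_quadrics p q r s t u v w"
  shows "g p + g q = g r + g s" "g t + g u = g v + g w" "g p + g q \<noteq> g t + g u"
  using assms by (auto simp: two_quadrics_def)

lemma two_quadrics_collision:
  assumes "two_quadrics p q r s t u v w" "x \<in> J" "y \<in> J" "x' \<in> J" "y' \<in> J" "g x + g y = g x' + g y'" "pr x y \<noteq> pr x' y'"
  shows "pr x y \<in> {pr p q, pr r s, pr t u, pr v w}"
  using assms unfolding two_quadrics_def by blast

lemma two_quadricsI:
  assumes "{p, q, r, s, t, u, v, w} \<subseteq> J" "{p, q} \<inter> {r, s} = {}" "{t, u} \<inter> {v, w} = {}"
     "g p + g q = g r + g s" "g t + g u = g v + g w" "g p + g q \<noteq> g t + g u"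
     "\<And>x y x' y'. x \<in> J \<Longrightarrow> y \<in> J \<Longrightarrow> x' \<in> J \<Longrightarrow> y' \<in> J \<Longrightarrow> g x + g y = g x' + g y' \<Longrightarrow> pr x y \<noteq> pr x' y' \<Longrightarrow>
        pr x y \<in> {pr p q, pr r s, pr t u, pr v w}"
  shows "two_quadrics p q r s t u v w"
  unfolding two_quadrics_def by (intro conjI ballI impI assms)

text \<open>Symmetries: exchange of the relations, of the sides of a relation, and of the factors of
  a side.\<close>

lemma two_quadrics_swap:
  assumes t: "two_quadrics p q r s t u v w"
  shows "two_quadrics t u v w p q r s" "two_quadrics q p r s t u v w" "two_quadrics r s p q t u v w"
    "two_quadrics p q r s u t v w" "two_quadrics p q r s v w t u"
proof -
  note D = two_quadricsD[OF t] and E = two_quadrics_eqs[OF t] and C = two_quadrics_collision[OF t]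
  show "two_quadrics t u v w p q r s"
    by (rule two_quadricsI; (drule (5) C)?; ((use D in \<open>auto simp: pr_sym; fail\<close>) | (use E in \<open>simp add: add.commute; fail | metis add.commute\<close>)))
  show "two_quadrics q p r s t u v w"
    by (rule two_quadricsI; (drule (5) C)?; ((use D in \<open>auto simp: pr_sym; fail\<close>) | (use E in \<open>simp add: add.commute; fail | metis add.commute\<close>)))
  show "two_quadrics r s p q t u v w"
    by (rule two_quadricsI; (drule (5) C)?; ((use D in \<open>auto simp: pr_sym; fail\<close>) | (use E in \<open>simp add: add.commute; fail | metis add.commute\<close>)))
  show "two_quadrics p q r s u t v w"
    by (rule two_quadricsI; (drule (5) C)?; ((use D in \<open>auto simp: pr_sym; fail\<close>) | (use E in \<open>simp add: add.commute; fail | metis add.commute\<close>)))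
  show "two_quadrics p q r s v w t u"
    by (rule two_quadricsI; (drule (5) C)?; ((use D in \<open>auto simp: pr_sym; fail\<close>) | (use E in \<open>simp add: add.commute; fail | metis add.commute\<close>)))
qed

lemma two_quadrics_swap_right: "two_quadrics p q r s t u v w \<Longrightarrow> two_quadrics p q s r t u v w"
  "two_quadrics p q r s t u v w \<Longrightarrow> two_quadrics p q r s t u w v"
  by (blast intro: two_quadrics_swap)+

lemma two_quadrics_sum_neq:
  assumes "two_quadrics p q r s t u v w"
  shows "pr p q \<noteq> pr t u" "pr p q \<noteq> pr v w" "pr r s \<noteq> pr t u" "pr r s \<noteq> pr v w"
  using two_quadricsD[OF assms] two_quadrics_eqs[OF assms] quadrics_sums by metis+

lemma two_quadrics_collision':
  assumes "two_quadrics p q r s t u v w" "x \<in> J" "y \<in> J" "x' \<in> J" "y' \<in> J" "g x + g y = g x' + g y'"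
    "x \<noteq> x'" "x \<noteq> y'"
  shows "pr x y = pr p q \<or> pr x y = pr r s \<or> pr x y = pr t u \<or> pr x y = pr v w"
  using two_quadrics_collision[OF assms(1-6)] assms(7,8) by (auto simp: pr_eq_iff)

lemma two_quadrics_not_both_squares: "two_quadrics p q r s t u v w \<Longrightarrow> p = q \<Longrightarrow> r = s \<Longrightarrow> False"
  using half[of p r] by (auto simp: two_quadrics_def scaleR_2)

text \<open>From \<open>p q = r s\<close> and \<open>p u = r w\<close> follows
  \<open>q w = u s\<close>, a further coincidence.\<close>

lemma no_opposite_overlap: assumes t: "two_quadrics p q r s p u r w" shows False
proof -
  note D = two_quadricsD[OF t] and E = two_quadrics_eqs[OF t]
  have "g q + g w = (g p + g q) + (g r + g w) - (g p + g r)" by simp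
  also have "\<dots> = (g r + g s) + (g p + g u) - (g p + g r)" using E by simp
  also have "\<dots> = g u + g s" by simp
  finally have "g q + g w = g u + g s" .
  moreover have "q \<noteq> u" "q \<noteq> s" using D two_quadrics_sum_neq[OF t] by auto
  ultimately have "pr q w = pr p q \<or> pr q w = pr r s \<or> pr q w = pr p u \<or> pr q w = pr r w"
    using two_quadrics_collision'[OF t, of q w u s] D by blast
  then show False using D two_quadrics_sum_neq[OF t] by (auto simp: pr_eq_iff)
qed

text \<open>A lattice point whose square is \<open>x y\<close> is a generator by normality, so the
  pair of \<open>x\<close> and \<open>y\<close> would take part in a coincidence.\<close>

lemma no_half:
  assumes t: "two_quadrics p q r s t u v w" and x: "x \<in> J" "y \<in> J" "x \<noteq> y" and h: "h \<in> Lam n" "2 *\<^sub>R h = g x + g y"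
    and n: "pr x y \<notin> {pr p q, pr r s, pr t u, pr v w}"
  shows False
proof -
  obtain i where i: "i \<in> J" "g i = h" using midpoint[OF h(1) x(1,2) h(2)] by blast
  then have e: "g x + g y = g i + g i" using h by (simp add: scaleR_2)
  have "x \<noteq> i" using e x i g_eq_iff[of y i] by auto
  then show False using two_quadrics_collision'[OF t x(1,2) i(1,1) e] n by auto
qed

text \<open>The side \<open>p q\<close> of one relation meets the side \<open>p u\<close> of the
  other, and the label depends on which further variables coincide. Patterns that match no label
  either equate two squares or require a lattice point that is half of a sum of two
  generators.\<close>

lemma classify_one_sided:
  assumes a: "a = 2" and t: "two_quadrics p q r s p u v w" and d: "{r, s} \<inter> {p, u, v, w} = {}"
  shows classified
proof -
  note D = two_quadricsD[OF t] two_quadrics_sum_neq[OF t]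
  have L: "g x \<in> Lam n" if "x \<in> J" for x using gL that .
  have qu: "q \<noteq> u" using D by auto
  note e1 = two_quadrics_eqs(1)[OF t] and e2 = two_quadrics_eqs(2)[OF t]
  consider (i) "p = q" | (ii) "p \<noteq> q" "u = p" "q \<notin> {v, w}" | (iii) "p \<noteq> q" "u = p" "q \<in> {v, w}"
    | (iv) "p \<noteq> q" "u \<noteq> p" "q \<in> {v, w}" | (v) "p \<noteq> q" "u \<noteq> p" "q \<notin> {v, w}" by blast
  then show ?thesis
  proof cases
    case i
    have rs: "r \<noteq> s" using two_quadrics_not_both_squares[OF t] i by auto
    show ?thesis
    proof (cases "v = w")
      case True
      show ?thesis by (rule classify_label[of Delta4 "[p, u, r, s, v]"]) (use e1 e2 i True D a d rs qu in \<open>auto simp: label_holds_iff add_ac\<close>)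
    next
      case False
      show ?thesis by (rule classify_label[of P5 "[r, s, p, u, v, w]"]) (use e1 e2 i D a d rs False qu in \<open>auto simp: label_holds_iff add_ac\<close>)
    qed
  next
    case ii
    have vw: "v \<noteq> w" using two_quadrics_not_both_squares[OF two_quadrics_swap(1)[OF t]] ii by auto
    show ?thesis
    proof (cases "r = s")
      case True
      show ?thesis by (rule classify_label[of Delta4 "[p, q, v, w, r]"]) (use e1 e2 ii True D a d vw qu in \<open>auto simp: label_holds_iff add_ac\<close>)
    next
      case False
      show ?thesis by (rule classify_label[of P5 "[v, w, p, q, r, s]"]) (use e1 e2 ii D a d vw False qu in \<open>auto simp: label_holds_iff add_ac\<close>)
    qed
  next
    case iii
    obtain k where k: "k \<in> {v, w}" "g p + g p = g q + g k" "pr v w = pr q k"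
    proof (cases "q = v")
      case True
      then show thesis using that[of w] e2 iii by simp
    next
      case False
      then show thesis using that[of v] e2 iii by (simp add: pr_sym add.commute)
    qed
    have kJ: "k \<in> J" "k \<noteq> p" "k \<noteq> r" "k \<noteq> s" using k D d by auto
    have qk: "q \<noteq> k" using k(2) half[of p q] D iii by (auto simp: scaleR_2)
    have rs: "r \<noteq> s"
    proof
      assume rs: "r = s"
      \<comment> \<open>Multiplicatively \<open>r^2 = p q\<close> and \<open>p^2 = q k\<close>, so
        \<open>(p r / q)^2 = p k\<close>.\<close>
      let ?t = "g p + g r - g q"
      have t2: "2 *\<^sub>R ?t = g p + g k" using e1 k(2) rs by (simp add: scaleR_2 algebra_simps)
      show False
      proof (rule no_half[OF t _ _ _ _ t2])
        show "pr p k \<notin> {pr p q, pr r s, pr p u, pr v w}" unfolding k(3) using kJ(2) qk rs D(9) iii(1,2) by (auto simp: pr_eq_iff)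
      qed (use D kJ L in \<open>auto intro: Lam_add Lam_diff\<close>)
    qed
    show ?thesis by (rule classify_label[of Delta3 "[q, k, r, s, p]"]) (use e1 k(2) D a iii d rs kJ qk in \<open>auto simp: label_holds_iff add_ac\<close>)
  next
    case iv
    obtain k where k: "k \<in> {v, w}" "g p + g u = g q + g k" "pr v w = pr q k"
    proof (cases "q = v")
      case True
      then show thesis using that[of w] e2 iv by simp
    next
      case False
      then show thesis using that[of v] e2 iv by (simp add: pr_sym add.commute)
    qed
    have kJ: "k \<in> J" "k \<noteq> p" "k \<noteq> r" "k \<noteq> s" "k \<noteq> u" using k D d by auto
    show ?thesis
    proof (cases "q = k")
      case True
      have rs: "r \<noteq> s"
      proof
        assume rs: "r = s"
        \<comment> \<open>Multiplicatively \<open>r^2 = p q\<close> and \<open>q^2 = p u\<close>, so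
          \<open>(q r / p)^2 = q u\<close>.\<close>
        let ?t = "g q + g r - g p"
        have t2: "2 *\<^sub>R ?t = g q + g u" using e1 k(2) rs True by (simp add: scaleR_2 algebra_simps)
        show False
        proof (rule no_half[OF t _ _ _ _ t2])
          show "pr q u \<notin> {pr p q, pr r s, pr p u, pr v w}" unfolding k(3) using True rs D(11) iv(1,2) qu by (auto simp: pr_eq_iff)
        qed (use D qu L in \<open>auto intro: Lam_add Lam_diff\<close>)
      qed
      show ?thesis by (rule classify_label[of Delta3 "[p, u, r, s, q]"]) (use e1 k(2) True D a iv d rs kJ qu in \<open>auto simp: label_holds_iff add_ac\<close>)
    next
      case False
      have rs: "r \<noteq> s"
      proof
        assume rs: "r = s"
        \<comment> \<open>Multiplicatively \<open>r^2 = p q\<close> and \<open>p u = q k\<close>, so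
          \<open>(k r / p)^2 = k u\<close>.\<close>
        let ?t = "g k + g r - g p"
        have "2 *\<^sub>R ?t = (g r + g r) + (g k + g k) - (g p + g p)" by (simp add: scaleR_2 algebra_simps)
        also have "\<dots> = (g p + g q) + (g k + g k) - (g p + g p)" using e1 rs by simp
        also have "\<dots> = (g q + g k) + g k - g p" by (simp add: algebra_simps)
        also have "\<dots> = g k + g u" unfolding k(2)[symmetric] by (simp add: algebra_simps)
        finally have t2: "2 *\<^sub>R ?t = g k + g u" .
        show False
        proof (rule no_half[OF t _ _ _ _ t2])
          show "pr k u \<notin> {pr p q, pr r s, pr p u, pr v w}" unfolding k(3) using kJ False rs qu by (auto simp: pr_eq_iff)
        qed (use D kJ L in \<open>auto intro: Lam_add Lam_diff\<close>)
      qed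
      show ?thesis by (rule classify_label[of P6 "[p, q, r, s, u, k]"]) (use e1 k(2) D a iv d rs kJ False qu in \<open>auto simp: label_holds_iff add_ac\<close>)
    qed
  next
    case v
    consider "r \<noteq> s" "v \<noteq> w" | "r = s" "v \<noteq> w" | "r \<noteq> s" "v = w" | "r = s" "v = w" by blast
    then show ?thesis
    proof cases
      case 1
      show ?thesis by (rule classify_label[of Q2 "[p, q, r, s, v, w, u]"]) (use e1 e2 D a v d 1 qu in \<open>auto simp: label_holds_iff add_ac\<close>)
    next
      case 2
      show ?thesis by (rule classify_label[of P4 "[p, q, r, u, v, w]"]) (use e1 e2 2 D a v d qu in \<open>auto simp: label_holds_iff add_ac\<close>)
    next
      case 3
      show ?thesis by (rule classify_label[of P4 "[p, u, v, q, r, s]"]) (use e1 e2 3 D a v d qu in \<open>auto simp: label_holds_iff add_ac\<close>)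
    next
      case 4
      \<comment> \<open>Multiplicatively \<open>r^2 = p q\<close> and \<open>v^2 = p u\<close>, so
        \<open>(r v / p)^2 = q u\<close>.\<close>
      let ?t = "g r + g v - g p"
      have "2 *\<^sub>R ?t = (g r + g r) + (g v + g v) - (g p + g p)" by (simp add: scaleR_2 algebra_simps)
      also have "\<dots> = (g p + g q) + (g p + g u) - (g p + g p)" using e1 e2 4 by simp
      also have "\<dots> = g q + g u" by (simp add: algebra_simps)
      finally have t2: "2 *\<^sub>R ?t = g q + g u" .
      have False
      proof (rule no_half[OF t _ _ _ _ t2])
        show "pr q u \<notin> {pr p q, pr r s, pr p u, pr v w}" using 4 D(11) v qu by (auto simp: pr_eq_iff)
      qed (use D L qu in \<open>auto intro: Lam_add Lam_diff\<close>)
      then show ?thesis ..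
    qed
  qed
qed

text \<open>By \<open>no_opposite_overlap\<close>, two sides and the sides opposite to them cannot
  both share variables. Hence in one of the two relations all shared variables lie on a single
  side.\<close>

lemma classify_overlap: assumes a: "a = 2" and t: "two_quadrics p q r s p u v w" shows classified
proof -
  note S = two_quadrics_swap two_quadrics_swap_right
  have opp: False if o: "two_quadrics p' q' r' s' t' u' v' w'" "t' \<in> {p', q'}" "v' \<in> {r', s'}" for p' q' r' s' t' u' v' w'
  proof -
    obtain q'' where "two_quadrics t' q'' r' s' t' u' v' w'" using o S(2) by (metis insertE singletonD)
    then obtain s'' where "two_quadrics t' q'' v' s'' t' u' v' w'" using o(3) S(6) by (metis insertE singletonD)
    then show False by (rule no_opposite_overlap)
  qed
  have o1: "{r, s} \<inter> {v, w} = {}" using opp[OF t] opp[OF S(7)[OF t]] by auto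
  note D = two_quadricsD[OF t]
  show ?thesis
  proof (cases "u \<in> {r, s}")
    case False
    then show ?thesis using classify_one_sided[OF a t] o1 D by auto
  next
    case True
    have "{p, q} \<inter> {v, w} = {}"
      using opp[OF S(4)[OF S(3)[OF t]]] opp[OF S(7)[OF S(4)[OF S(3)[OF t]]]] True by auto
    then show ?thesis using classify_one_sided[OF a S(1)[OF t]] o1 by auto
  qed
qed

lemma classify_no_overlap:
  assumes a: "a = 2" and t: "two_quadrics p q r s t u v w" and d: "{p, q, r, s} \<inter> {t, u, v, w} = {}" and pq: "p \<noteq> q" "t \<noteq> u"
  shows classified
proof -
  note D = two_quadricsD[OF t]
  consider "r \<noteq> s" "v \<noteq> w" | "r = s" "v \<noteq> w" | "r \<noteq> s" "v = w" | "r = s" "v = w" by blast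
  then show ?thesis
  proof cases
    case 1
    show ?thesis by (rule classify_label[of R1 "[p, q, r, s, t, u, v, w]"]) (use two_quadrics_eqs(1,2)[OF t] D a d 1 pq in \<open>auto simp: label_holds_iff add_ac\<close>)
  next
    case 2
    show ?thesis by (rule classify_label[of Q3 "[t, u, v, w, p, q, r]"]) (use two_quadrics_eqs(1,2)[OF t] 2 D a d pq in \<open>auto simp: label_holds_iff add_ac\<close>)
  next
    case 3
    show ?thesis by (rule classify_label[of Q3 "[p, q, r, s, t, u, v]"]) (use two_quadrics_eqs(1,2)[OF t] 3 D a d pq in \<open>auto simp: label_holds_iff add_ac\<close>)
  next
    case 4
    show ?thesis by (rule classify_label[of P3 "[p, q, r, t, u, v]"]) (use two_quadrics_eqs(1,2)[OF t] 4 D a d pq in \<open>auto simp: label_holds_iff add_ac\<close>)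
  qed
qed

lemma classify_two_quadrics: assumes a: "a = 2" and t: "two_quadrics p q r s t u v w" shows classified
proof -
  note S = two_quadrics_swap two_quadrics_swap_right
  show ?thesis
  proof (cases "{p, q, r, s} \<inter> {t, u, v, w} = {}")
    case True
    have A: "\<exists>p' q' r' s'. two_quadrics p' q' r' s' t' u' v' w' \<and> p' \<noteq> q' \<and> {p', q', r', s'} = {p, q, r, s}"
      if "two_quadrics p q r s t' u' v' w'" for t' u' v' w'
    proof (cases "p = q")
      case False
      then show ?thesis using that by blast
    next
      case True
      then have "r \<noteq> s" using two_quadrics_not_both_squares[OF that] by auto
      then show ?thesis using S(3)[OF that] by blast
    qed
    have "\<exists>t' u' v' w'. two_quadrics p q r s t' u' v' w' \<and> t' \<noteq> u' \<and> {t', u', v', w'} = {t, u, v, w}"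
    proof (cases "t = u")
      case False
      then show ?thesis using t by blast
    next
      case True
      then have "v \<noteq> w" using two_quadrics_not_both_squares[OF S(1)[OF t]] by auto
      then show ?thesis using S(5)[OF t] by blast
    qed
    then obtain t' u' v' w' where 1: "two_quadrics p q r s t' u' v' w'" "t' \<noteq> u'" "{t', u', v', w'} = {t, u, v, w}" by blast
    obtain p' q' r' s' where 2: "two_quadrics p' q' r' s' t' u' v' w'" "p' \<noteq> q'" "{p', q', r', s'} = {p, q, r, s}" using A[OF 1(1)] by blast
    show ?thesis by (rule classify_no_overlap[OF a 2(1) _ 2(2) 1(2)]) (simp add: 1(3) 2(3) True)
  next
    case False
    then obtain x where x: "x \<in> {p, q, r, s}" "x \<in> {t, u, v, w}" by blast
    obtain q' r' s' where 1: "two_quadrics x q' r' s' t u v w" using x(1) t S(2,3) by (metis insertE singletonD)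
    obtain u' v' w' where "two_quadrics x q' r' s' x u' v' w'" using x(2) 1 S(4,5) by (metis insertE singletonD)
    then show ?thesis by (rule classify_overlap[OF a])
  qed
qed

text \<open>A common variable cancels and leaves two equal generators.\<close>

lemma fibre_disjoint:
  assumes "{x, y, z, w} \<subseteq> J" "g x + g y = g z + g w" "pr x y \<noteq> pr z w" shows "{x, y} \<inter> {z, w} = {}"
proof (rule ccontr)
  assume "\<not> ?thesis"
  then have "x = z \<or> x = w \<or> y = z \<or> y = w" by auto
  moreover have "x = z \<Longrightarrow> g y = g w" "x = w \<Longrightarrow> g y = g z" "y = z \<Longrightarrow> g x = g w" "y = w \<Longrightarrow> g x = g z"
    using assms(2) by (metis add.commute add_left_cancel)+
  ultimately have "(x = z \<and> y = w) \<or> (x = w \<and> y = z)" using assms(1) g_eq_iff by (metis insert_subset)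
  then show False using assms(3) by (auto simp: pr_eq_iff)
qed

text \<open>Three pairs have the same product. At most one of them is a square, as distinct
  generators have distinct doubles; this leaves \<open>Delta2\<close> and \<open>P7\<close>.\<close>

lemma classify_triple:
  assumes a: "a = 2" and J: "{p, q, r, s, t, u} \<subseteq> J" and e: "g p + g q = g r + g s" "g p + g q = g t + g u"
    and n: "pr p q \<noteq> pr r s" "pr p q \<noteq> pr t u" "pr r s \<noteq> pr t u"
  shows classified
proof -
  have e3: "g r + g s = g t + g u" using e by simp
  have D: "{p, q} \<inter> {r, s} = {}" "{p, q} \<inter> {t, u} = {}" "{r, s} \<inter> {t, u} = {}"
    using fibre_disjoint[OF _ e(1) n(1)] fibre_disjoint[OF _ e(2) n(2)] fibre_disjoint[OF _ e3 n(3)] J by simp_all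
  have sq: "\<not> (p = q \<and> r = s)" "\<not> (p = q \<and> t = u)" "\<not> (r = s \<and> t = u)"
    using half[of p r] half[of p t] half[of r t] J e e3 D by (auto simp: scaleR_2)
  have square: classified
    if J: "{p, q, r, s, t} \<subseteq> J" and e: "g p + g q = g t + g t" "g r + g s = g t + g t"
      and d: "distinct [p, q, r, s, t]" for p q r s t
  by (rule classify_label[of Delta2 "[p, q, r, s, t]"]) (use e J d a in \<open>auto simp: label_holds_iff add_ac\<close>)
  consider "p = q" | "r = s" | "t = u" | "p \<noteq> q" "r \<noteq> s" "t \<noteq> u" by blast
  then show ?thesis
  proof cases
    case 1
    show ?thesis by (rule square[of r s t u p]) (use J e D sq 1 in auto)
  next
    case 2
    show ?thesis by (rule square[of p q t u r]) (use J e D sq 2 in auto)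
  next
    case 3
    show ?thesis by (rule square[of p q r s t]) (use J e D sq 3 in auto)
  next
    case 4
    show ?thesis by (rule classify_label[of P7 "[p, q, r, s, t, u]"]) (use e J D a 4 in \<open>auto simp: label_holds_iff add_ac\<close>)
  qed
qed

lemma classify_two: assumes a: "a = 2" shows classified
proof -
  let ?M = "comps J 2"
  have pair: "\<exists>x\<in>J. \<exists>y\<in>J. u = pr x y" if "u \<in> ?M" for u using comps_2[OF fin_J that] .
  have c: "card (nc ` ?M) + 2 = card ?M" using slice_cards(2)[OF a] nc_slice[of 2] a by simp
  show ?thesis
  proof (rule disjE[OF two_collisions[OF finite_comps[OF fin_J] c]])
    assume "\<exists>p\<in>?M. \<exists>q\<in>?M. \<exists>r\<in>?M. p \<noteq> q \<and> p \<noteq> r \<and> q \<noteq> r \<and> nc p = nc q \<and> nc p = nc r"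
    then obtain P Q R where M: "P \<in> ?M" "Q \<in> ?M" "R \<in> ?M" "P \<noteq> Q" "P \<noteq> R" "Q \<noteq> R" "nc P = nc Q" "nc P = nc R" by blast
    obtain p q r s t u where E: "P = pr p q" "Q = pr r s" "R = pr t u" "p \<in> J" "q \<in> J" "r \<in> J" "s \<in> J" "t \<in> J" "u \<in> J"
      using pair[OF M(1)] pair[OF M(2)] pair[OF M(3)] by blast
    show ?thesis by (rule classify_triple[OF a, of p q r s t u]) (use M E in \<open>auto simp: nc_pr\<close>)
  next
    assume "\<exists>p1\<in>?M. \<exists>p2\<in>?M. \<exists>p3\<in>?M. \<exists>p4\<in>?M. p1 \<noteq> p2 \<and> p3 \<noteq> p4 \<and> nc p1 = nc p2 \<and> nc p3 = nc p4 \<and> nc p1 \<noteq> nc p3 \<and>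
       (\<forall>s\<in>?M. \<forall>t\<in>?M. nc s = nc t \<longrightarrow> s \<noteq> t \<longrightarrow> s \<in> {p1, p2, p3, p4})"
    then obtain P Q R T where M: "P \<in> ?M" "Q \<in> ?M" "R \<in> ?M" "T \<in> ?M" "P \<noteq> Q" "R \<noteq> T" "nc P = nc Q" "nc R = nc T" "nc P \<noteq> nc R"
       and all: "\<And>s t. s \<in> ?M \<Longrightarrow> t \<in> ?M \<Longrightarrow> nc s = nc t \<Longrightarrow> s \<noteq> t \<Longrightarrow> s \<in> {P, Q, R, T}" by blast
    obtain p q r s t u v w where E: "P = pr p q" "Q = pr r s" "R = pr t u" "T = pr v w"
      and J: "p \<in> J" "q \<in> J" "r \<in> J" "s \<in> J" "t \<in> J" "u \<in> J" "v \<in> J" "w \<in> J"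
      using pair[OF M(1)] pair[OF M(2)] pair[OF M(3)] pair[OF M(4)] by blast
    have e: "g p + g q = g r + g s" "g t + g u = g v + g w" "g p + g q \<noteq> g t + g u" using M E J by (auto simp: nc_pr)
    have "{p, q} \<inter> {r, s} = {}" "{t, u} \<inter> {v, w} = {}" using fibre_disjoint J e M E by auto
    moreover have "pr x y \<in> {pr p q, pr r s, pr t u, pr v w}"
      if "x \<in> J" "y \<in> J" "x' \<in> J" "y' \<in> J" "g x + g y = g x' + g y'" "pr x y \<noteq> pr x' y'" for x y x' y'
      using all[of "pr x y" "pr x' y'"] that fin_J by (simp add: nc_pr pr_comps E)
    ultimately have "two_quadrics p q r s t u v w" using J e by (intro two_quadricsI) auto
    then show ?thesis by (rule classify_two_quadrics[OF a])
  qed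
qed

end

section \<open>The case \<open>a = 0\<close>: an extra generator of degree two\<close>

context small_polytope
begin

lemma nc_restrict: "nc u = nc (\<lambda>j. if j \<in> J then u j else 0)"
  unfolding nc_def by (rule comb_cong) auto

lemma nc_comps: assumes "snd (nc u) = real k" shows "nc u \<in> nc ` comps J k"
proof -
  let ?u = "\<lambda>j. if j \<in> J then u j else 0"
  have "real (sum ?u J) = real k" using snd_nc[of J ?u] assms nc_restrict[of u] by simp
  then have "?u \<in> comps J k" by (simp only: of_nat_eq_iff) (simp add: comps_def)
  then show ?thesis using nc_restrict[of u] by blast
qed

text \<open>The degree-one generators form a basis, so the one extra point \<open>b\<close> of
  degree two has unique coordinates, all less than 1. Since \<open>b + b\<close> is generated
  without \<open>b\<close>, these coordinates are 0 or 1/2, and degree two leaves exactly four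
  halves.\<close>

lemma extra_generator:
  assumes a0: "a = 0"
  obtains L b where "L \<subseteq> J" "card L = 4" "b \<in> cone_semigroup n P" "snd b = 2" "b + b = sum g L"
    "\<And>p. p \<in> cone_semigroup n P \<Longrightarrow> \<exists>u. p = nc u \<or> p = b + nc u"
proof -
  obtain B where B: "basis B" using extend_basis[of "{}"] by (auto simp: indep_def supp_def)
  have "B = J" using B card_basis[OF B] card_J a0 fin_J by (intro card_subset_eq) (auto simp: basis_def)
  then have ind: "indep J" using B by (simp add: basis_def)
  have inj: "inj_on nc (comps J 2)"
  proof (rule inj_onI)
    fix u v assume uv: "u \<in> comps J 2" "v \<in> comps J 2" "nc u = nc v"
    have "(\<lambda>j. real (u j)) = (\<lambda>j. real (v j))"
      by (rule indep_unique[OF ind]) (use uv in \<open>auto simp: supp_def comps_def nc_def\<close>)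
    then show "u = v" by (auto simp: fun_eq_iff)
  qed
  have sub: "nc ` comps J 2 \<subseteq> slice n P 2"
  proof
    fix p assume "p \<in> nc ` comps J 2"
    then obtain u where u: "u \<in> comps J 2" "p = nc u" by blast
    then show "p \<in> slice n P 2" using snd_nc[of J u] nc_semigroup by (simp add: slice_def comps_def)
  qed
  have "card (slice n P 2 - nc ` comps J 2) = 1"
    using slice_cards(3)[OF a0] card_image[OF inj] sub finite_comps[OF fin_J] by (subst card_Diff_subset) auto
  then obtain b where b: "slice n P 2 - nc ` comps J 2 = {b}" by (auto simp: card_1_singleton_iff)
  then have bS: "b \<in> cone_semigroup n P" "snd b = 2" and bn: "b \<notin> nc ` comps J 2" by (auto simp: slice_def)
  have bL: "b \<in> Lam n" "b \<in> cone" using bS semigroup_iff by auto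
  have gen: "\<exists>u. p = nc u \<or> p = b + nc u" if p: "p \<in> cone_semigroup n P" for p
  proof -
    obtain c v where c: "c \<in> cone_semigroup n P" "snd c \<le> 2" "p = c + nc v" using decomposition[OF p] by blast
    have "snd c \<in> \<int>" using c(1) semigroup_iff by (auto simp: Lam_def)
    then obtain z :: int where z: "snd c = of_int z" by (auto elim: Ints_cases)
    then have "snd c \<le> 1 \<or> snd c = 2" using c(2) by (cases "z \<le> 1") auto
    then have "c = b \<or> (\<exists>u. c = nc u)"
    proof
      assume "snd c = 2"
      then have "c \<in> slice n P 2" using c by (simp add: slice_def)
      then show ?thesis using b by blast
    qed (use low_degree c in blast)
    then show ?thesis using c(3) nc_add by metis
  qed
  obtain f0 where f0: "b = comb J g f0" "\<forall>j. f0 j \<ge> 0" using bL(2) by (auto simp: cone_def)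
  define f where "f = (\<lambda>j. if j \<in> J then f0 j else 0)"
  have f: "b = comb J g f" "\<And>j. f j \<ge> 0" "supp f J"
    using f0 by (auto simp: f_def supp_def intro: comb_cong)
  \<comment> \<open>A coordinate of at least 1 would allow a generator to be subtracted, making
    \<open>b\<close> a sum of two generators.\<close>
  have f1: "f j < 1" for j
  proof (rule ccontr)
    assume ge: "\<not> f j < 1"
    then have j: "j \<in> J" by (auto simp: f_def split: if_splits)
    have "b - g j = comb J g (\<lambda>i. f i - (if i = j then 1 else 0))" unfolding comb_diff comb_unit[OF fin_J j] f(1) ..
    moreover have "f i - (if i = j then 1 else 0) \<ge> 0" for i using ge f(2) by simp
    ultimately have "b - g j \<in> cone" using cone_comb by simp
    then obtain i where i: "i \<in> J" "g i = b - g j"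
      using degree_one[of "b - g j"] bL gL[OF j] deg1[OF j] bS(2) by (auto intro: Lam_diff)
    then have "b = nc (pr i j)" using j by (simp add: nc_pr)
    then show False using bn pr_comps[OF fin_J i(1) j] by blast
  qed
  have "b + b \<in> cone_semigroup n P" using bL semigroup_iff by (auto intro: Lam_add cone_add)
  then obtain u0 where "b + b = nc u0 \<or> b + b = b + nc u0" using gen by blast
  moreover have "b \<noteq> nc u0" using nc_comps[of u0 2] bn bS(2) by auto
  ultimately have u0: "b + b = nc u0" by auto
  define u where "u = (\<lambda>j. if j \<in> J then u0 j else 0)"
  have u: "b + b = nc u" using u0 nc_restrict[of u0] by (simp add: u_def)
  have "comb J g (\<lambda>j. f j + f j) = comb J g (\<lambda>j. real (u j))"
    using u unfolding comb_add f(1)[symmetric] nc_def .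
  then have "(\<lambda>j. f j + f j) = (\<lambda>j. real (u j))"
    by (intro indep_unique[OF ind]) (use f(3) in \<open>auto simp: supp_def u_def\<close>)
  then have uf: "real (u j) = f j + f j" for j by (metis)
  have u01: "u j = 0 \<or> u j = 1" for j using uf[of j] f1[of j] by linarith
  then have u0: "u j = 0" if "u j \<noteq> 1" for j using that by metis
  define L where "L = {j\<in>J. u j = 1}"
  have "snd (nc u) = real (sum u J)" by (rule snd_nc) (auto simp: u_def)
  then have "sum u J = 4" using u bS(2) by (metis add_numeral_special(2) numeral_Bit0 of_nat_eq_iff of_nat_numeral snd_add numeral_plus_numeral)
  moreover have "sum u J = sum u L" unfolding L_def using fin_J u0 by (intro sum.mono_neutral_right) auto
  ultimately have "card L = 4" by (simp add: L_def)
  moreover have "b + b = sum g L"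
  proof -
    have "nc u = (\<Sum>j\<in>L. real (u j) *\<^sub>R g j)" unfolding nc_def comb_def L_def using fin_J u0 by (intro sum.mono_neutral_right) auto
    also have "\<dots> = sum g L" by (intro sum.cong) (auto simp: L_def)
    finally show ?thesis using u by simp
  qed
  moreover have "L \<subseteq> J" by (auto simp: L_def)
  ultimately show thesis by (intro that[of L b] bS gen)
qed

text \<open>The generators are renumbered to fit \<open>P1\<close>: the four in \<open>L\<close>
  become variables 1 to 4, the extra point becomes variable 5, and the others follow. If
  \<open>n > 3\<close>, the last of these is a free variable.\<close>

lemma classify_zero: assumes a0: "a = 0" shows classified
proof -
  obtain L b where L: "L \<subseteq> J" "card L = 4" and b: "b \<in> cone_semigroup n P" "snd b = 2" "b + b = sum g L"
    and gen: "\<And>p. p \<in> cone_semigroup n P \<Longrightarrow> \<exists>u. p = nc u \<or> p = b + nc u"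
    by (rule extra_generator[OF a0]) (rule that)
  have finL: "finite L" using L fin_J finite_subset by blast
  define ys where "ys = sorted_list_of_set L @ sorted_list_of_set (J - L)"
  have ys: "distinct ys" "set ys = J" using L fin_J finL by (auto simp: ys_def)
  have len: "length ys = n + 1" using distinct_card[OF ys(1)] ys(2) card_J a0 by simp
  have n3: "n + 1 \<ge> 4" using card_mono[OF fin_J L(1)] L(2) card_J a0 by simp
  define K where "K = {1..n + 2}"
  define J' where "J' = K - {5}"
  have KJ: "K = insert 5 J'" "5 \<notin> J'" "finite J'" "finite K" using n3 by (auto simp: J'_def K_def)
  define idx where "idx = (\<lambda>k. ys ! (if k \<le> 4 then k - 1 else k - 2))"
  define pos where "pos = (\<lambda>k::nat. if k \<le> 4 then k - 1 else k - 2)"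
  have "bij_betw pos J' {..<length ys}"
    unfolding len by (rule bij_betw_byWitness[where f' = "\<lambda>k. if k < 4 then k + 1 else k + 2"])
      (use n3 in \<open>auto simp: pos_def J'_def K_def\<close>)
  then have "bij_betw ((!) ys \<circ> pos) J' J" by (rule bij_betw_trans) (use ys bij_betw_nth in blast)
  then have idx: "bij_betw idx J' J" unfolding idx_def pos_def comp_def .
  define h where "h = (\<lambda>k. if k = 5 then b else g (idx k))"
  have hg: "h k = g (idx k)" if "k \<in> J'" for k using that KJ by (auto simp: h_def)
  have hbij: "bij_betw h J' (slice n P 1)"
    using bij_betw_trans[OF idx g_bij] hg by (simp add: comp_def cong: bij_betw_cong)
  interpret h: small_polytope n P a J' h using small hbij KJ(3) by (rule small_polytope.intro)
  have reindex: "comb J g f = comb J' h (\<lambda>k. f (idx k))" for f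
    unfolding comb_def by (subst sum.reindex_bij_betw[OF idx, symmetric]) (simp add: hg)
  have combK: "comb K h f = f 5 *\<^sub>R b + comb J' h f" for f
    unfolding comb_def KJ(1) using KJ(2,3) by (simp add: h_def)
  have sumL: "h 1 + h 2 + h 3 + h 4 = b + b"
  proof -
    have l4: "length (sorted_list_of_set L) = 4" using L(2) by simp
    have "sum g L = sum_list (map g (sorted_list_of_set L))" using finL by (simp add: sum_list_distinct_conv_sum_set)
    also have "\<dots> = (\<Sum>k<4. g (sorted_list_of_set L ! k))" using l4 by (simp add: sum_list_sum_nth atLeast0LessThan)
    also have "\<dots> = h 1 + h 2 + h 3 + h 4" using l4 by (simp add: eval_nat_numeral h_def idx_def ys_def nth_append)
    finally show ?thesis using b(3) by simp
  qed
  have tri: "triangular K (label_rels P1)" by (rule triangular_mono[OF label_triangular]) (use n3 in \<open>auto simp: K_def\<close>)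
  have rel: "comb K h (rvec r) = 0" if r: "r \<in> set (label_rels P1)" for r
  proof -
    have "label_holds P1 h" using sumL by (simp add: label_holds_iff h_def)
    then have "comb (vars P1) h (rvec r) = 0" using r by (simp only: label_holds_def)
    moreover have "comb K h (rvec r) = comb (vars P1) h (rvec r)"
      unfolding comb_def using n3 rvec_outside[OF label_triangular r] by (intro sum.mono_neutral_right) (auto simp: K_def)
    ultimately show ?thesis by simp
  qed
  have bL: "b \<in> Lam n" "b \<in> h.cone" using b h.semigroup_iff by auto
  have pm: "premodel n K (label_rels P1) (label_deg P1) h"
  proof (rule premodel_of_generators)
    show "h j \<in> Lam n \<and> snd (h j) = real (label_deg P1 j) \<and> label_deg P1 j \<ge> 1" if "j \<in> K" for j
    proof (cases "j = 5")
      case True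
      then show ?thesis using bL b by (simp add: h_def label_deg_def)
    next
      case False
      then have "j \<in> J'" using that by (simp add: J'_def)
      then show ?thesis using h.gL h.deg1 False by (simp add: label_deg_def)
    qed
    show "card K = n + 1 + length (label_rels P1)" by (simp add: K_def)
    fix p assume p: "p \<in> Lam n"
    show "\<exists>f. (\<forall>j. f j \<in> \<int>) \<and> comb K h f = p"
    proof (rule h.lattice_generated[OF _ _ refl _ p])
      fix q assume "q \<in> Lam n" "q \<in> h.cone"
      then obtain u where "q = nc u \<or> q = b + nc u" using gen h.semigroup_iff by blast
      then have "q = comb K h (\<lambda>k. if k = 5 then 0 else real (u (idx k))) \<or> q = comb K h (\<lambda>k. if k = 5 then 1 else real (u (idx k)))"
      proof -
        have "comb J' h (\<lambda>k. if k = 5 then c else real (u (idx k))) = nc u" for c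
          unfolding nc_def reindex by (rule comb_cong) (use KJ(2) in auto)
        then show ?thesis using \<open>q = nc u \<or> q = b + nc u\<close> unfolding combK by auto
      qed
      then obtain c :: real where c: "c = 0 \<or> c = 1" "q = comb K h (\<lambda>k. if k = 5 then c else real (u (idx k)))" by blast
      then show "\<exists>f. (\<forall>j. f j \<in> \<int>) \<and> q = comb K h f"
        by (intro exI[of _ "\<lambda>k. if k = 5 then c else real (u (idx k))"]) auto
    qed (use KJ in auto)
  qed (use rel tri KJ in auto)
  have proper: "K - leads (label_rels P1) \<noteq> {}"
  proof -
    have "5 \<in> K - leads (label_rels P1)" using n3 by (simp add: leads_def K_def)
    then show ?thesis by blast
  qed
  have J'_deg: "{j\<in>K. label_deg P1 j = 1} = J'" by (auto simp: J'_def label_deg_def)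
  have m: "model n K (label_rels P1) (label_deg P1) h P"
    unfolding model_def J'_deg
  proof (intro conjI ballI)
    fix j assume "j \<in> K"
    then show "h j \<in> cone_over P" using h.g_cone[of j] bL h.conf(3) by (cases "j = 5") (auto simp: J'_def h_def)
  qed (use pm proper h.conf(1) in auto)
  have "n = 3"
  proof (rule ccontr)
    assume "n \<noteq> 3"
    then have n4: "n \<ge> 4" using n3 by simp
    then obtain m' where m': "n = Suc m'" by (cases n) auto
    let ?K = "{1..n + 1}"
    have K: "K = insert (n + 2) ?K" by (auto simp: K_def)
    have sub5: "(vars P1) \<subseteq> ?K" using n4 by auto
    have "gorenstein_pyramid (Suc m') P"
    proof (rule free_variable_pyramid[where J = ?K and l = "n + 2" and d = "label_deg P1" and o' = 1])
      show "model (Suc m') (insert (n + 2) ?K) (label_rels P1) (label_deg P1) h P" using m K m' by simp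
      show "triangular ?K (label_rels P1)" by (rule triangular_mono[OF label_triangular sub5])
      show "\<exists>j\<in>fst r. j \<noteq> 1" if "r \<in> set (label_rels P1)" for r using that by auto
      show "label_deg P1 j = 1 \<or> single_power (label_rels P1) (label_deg P1) j" for j by (rule label_single_power)
      show "?K - leads (label_rels P1) \<noteq> {}" using label_leads_proper[of P1] sub5 by fastforce
    qed (use m' n4 in \<open>auto simp: label_deg_def\<close>)
    then show False using not_pyramid m' by simp
  qed
  then have "K = (vars P1)" "label_dim P1 = n" by (simp_all add: K_def)
  then show ?thesis using m by (intro exI[of _ P1] exI[of _ h]) simp
qed

theorem classification: "\<exists>i h. label_dim i = n \<and> label_model n i h P"
  using a012 classify_zero classify_one classify_two by blast

end

section \<open>Presentations of the models of the list\<close>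

lemma normal_comps:
  assumes "finite J" "u \<in> comps J k" "\<And>r. r \<in> set rs \<Longrightarrow> fst r \<subseteq> J \<and> k < card (fst r)"
  shows "normal rs (\<lambda>j. real (u j))"
  unfolding normal_def
proof
  fix r assume r: "r \<in> set rs"
  show "\<exists>j\<in>fst r. real (u j) = 0"
  proof (rule ccontr)
    assume "\<not> ?thesis"
    then have "1 \<le> u j" if "j \<in> fst r" for j using that by (cases "u j") auto
    then have "card (fst r) \<le> sum u (fst r)" using sum_mono[of "fst r" "\<lambda>_. 1" u] by simp
    also have "\<dots> \<le> sum u J" using assms(1,3) r by (intro sum_mono2) auto
    finally show False using assms(2,3) r by (fastforce simp: comps_def)
  qed
qed

lemma label_lead_subset: "r \<in> set (label_rels i) \<Longrightarrow> fst r \<subseteq> (vars i)"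
  by (cases i) auto

lemma label_lead_weight: "r \<in> set (label_rels i) \<Longrightarrow> label_deg i j < sum (label_deg i) (fst r)"
  by (cases i) (auto simp: label_deg_def)

text \<open>Every leading monomial has larger degree than any generator. Hence each representation
  of a generator is already in normal form, so it is unique, and the generators are distinct and
  irreducible.\<close>

lemma label_model_presents:
  assumes m: "label_model n i g P"
  shows "presents n P (num_vars i) (relations i :: 'k::field_char_0 mpoly set) g"
proof -
  let ?J = "vars i" and ?rs = "label_rels i" and ?d = "label_deg i"
  have pm: "premodel n ?J ?rs ?d g" using m by (simp add: model_def)
  note S = model_semigroup[OF m]
  have unique: "u = v" if "normal ?rs (\<lambda>j. real (u j))" "normal ?rs (\<lambda>j. real (v j))"
    "\<And>j. j \<notin> ?J \<Longrightarrow> u j = 0" "\<And>j. j \<notin> ?J \<Longrightarrow> v j = 0"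
    "comb ?J g (\<lambda>j. real (u j)) = comb ?J g (\<lambda>j. real (v j))" for u v :: "nat \<Rightarrow> nat"
  proof -
    have "(\<lambda>j. real (u j)) = (\<lambda>j. real (v j))"
      by (rule normal_form_unique[OF label_triangular that(1,2)])
        (use that(3-5) pm_comb_eq_iff[OF pm, of "\<lambda>j. real (u j)" "\<lambda>j. real (v j)"] in auto)
    then show ?thesis by (simp add: fun_eq_iff)
  qed
  let ?e = "\<lambda>x j. if j = x then 1 else 0 :: nat"
  have ecomb: "comb ?J g (\<lambda>j. real (?e x j)) = g x" if "x \<in> ?J" for x
    using comb_unit[of ?J x g] that by (simp add: if_distrib[of real] cong: if_cong)
  have weight: "normal ?rs (\<lambda>j. real (u j))" if w: "(\<Sum>j\<in>?J. u j * ?d j) \<le> ?d x" for u :: "nat \<Rightarrow> nat" and x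
    unfolding normal_def
  proof
    fix r assume r: "r \<in> set ?rs"
    show "\<exists>j\<in>fst r. real (u j) = 0"
    proof (rule ccontr)
      assume "\<not> ?thesis"
      then have "1 \<le> u j" if "j \<in> fst r" for j using that by (cases "u j") auto
      then have "sum ?d (fst r) \<le> (\<Sum>j\<in>fst r. u j * ?d j)" by (intro sum_mono) (metis mult_le_mono1 mult_1)
      also have "\<dots> \<le> (\<Sum>j\<in>?J. u j * ?d j)" using label_lead_subset[OF r] by (intro sum_mono2) auto
      finally show False using w label_lead_weight[OF r, of x] by simp
    qed
  qed
  have enormal: "normal ?rs (\<lambda>j. real (?e x j))" if "x \<in> ?J" for x
    by (rule weight[of _ x]) (use that in \<open>simp add: if_distrib[of "\<lambda>c. c * _"] cong: if_cong\<close>)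
  show ?thesis
  proof (rule presents_if[OF label_triangular label_represents])
    show "comb ?J g (rvec r) = 0" if "r \<in> set ?rs" for r by (rule pm_rel[OF pm that])
    show "in_span ?rs f" if "\<And>j. j \<notin> ?J \<Longrightarrow> f j = 0" "comb ?J g f = 0" for f by (rule pm_ker[OF pm that])
    show "cone_semigroup n P = {comb ?J g f |f. (\<forall>j. f j \<in> \<nat>) \<and> (\<forall>j. j \<notin> ?J \<longrightarrow> f j = 0)}" by (rule S)
    show "inj_on g ?J"
    proof (rule inj_onI)
      fix x y assume xy: "x \<in> ?J" "y \<in> ?J" "g x = g y"
      have "?e x = ?e y" by (rule unique) (use xy enormal ecomb in auto)
      from fun_cong[OF this, of x] show "x = y" by (simp split: if_splits)
    qed
    show "g j \<noteq> 0" if "j \<in> ?J" for j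
      using pm_deg[OF pm that] pm_pos[OF pm that] by auto
    fix j x y assume j: "j \<in> ?J" and x: "x \<in> cone_semigroup n P" and y: "y \<in> cone_semigroup n P" and xy: "x + y = g j"
    have nat: "\<exists>u :: nat \<Rightarrow> nat. (\<forall>j. j \<notin> ?J \<longrightarrow> u j = 0) \<and> p = comb ?J g (\<lambda>j. real (u j))" if p: "p \<in> cone_semigroup n P" for p
    proof -
      obtain f where f: "p = comb ?J g f" "\<forall>j. f j \<in> \<nat>" "\<forall>j. j \<notin> ?J \<longrightarrow> f j = 0" using p unfolding S by blast
      have "\<forall>j. \<exists>k. f j = real k" using f(2) by (auto elim: Nats_cases)
      then obtain u :: "nat \<Rightarrow> nat" where "\<forall>j. f j = real (u j)" by (rule choice[elim_format]) blast
      then show ?thesis using f by (intro exI[of _ u]) (auto simp: fun_eq_iff cong: comb_cong)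
    qed
    obtain u where u: "\<forall>j. j \<notin> ?J \<longrightarrow> u j = 0" "x = comb ?J g (\<lambda>j. real (u j))" using nat[OF x] by blast
    obtain v where v: "\<forall>j. j \<notin> ?J \<longrightarrow> v j = 0" "y = comb ?J g (\<lambda>j. real (v j))" using nat[OF y] by blast
    let ?w = "\<lambda>j. u j + v j"
    have w: "comb ?J g (\<lambda>j. real (?w j)) = g j" using xy u v by (simp add: comb_add)
    have "snd (g j) = (\<Sum>k\<in>?J. real (?w k) * real (?d k))"
      unfolding w[symmetric] using snd_comb[of ?J g ?d "\<lambda>j. real (?w j)"] pm_deg[OF pm] by simp
    then have "real (\<Sum>k\<in>?J. ?w k * ?d k) = real (?d j)" using pm_deg[OF pm j] by simp
    then have "(\<Sum>k\<in>?J. ?w k * ?d k) \<le> ?d j" by linarith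
    then have "?w = ?e j" by (intro unique[OF weight enormal[OF j]]) (use u v w j ecomb in auto)
    then have sum: "u k + v k = ?e j k" for k by metis
    have "u k = 0" if "k \<noteq> j" for k using sum[of k] that by simp
    moreover have "v k = 0" if "k \<noteq> j" for k using sum[of k] that by simp
    moreover have "u j = 0 \<or> v j = 0" using sum[of j] by auto
    ultimately have "u = (\<lambda>_. 0) \<or> v = (\<lambda>_. 0)" by (metis ext)
    then show "x = 0 \<or> y = 0" using u v by (auto simp: comb_def)
  qed
qed

section \<open>Uniqueness of the label\<close>

text \<open>What a presentation by the relations of \<open>i\<close> says about coincidences between
  generators, without reference to a polytope or a field.\<close>

definition faithful :: "label \<Rightarrow> (nat \<Rightarrow> vec \<times> real) \<Rightarrow> bool" where
  "faithful i G \<longleftrightarrow> inj_on G (vars i) \<and> label_holds i G \<and>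
     (\<forall>u v :: nat \<Rightarrow> nat. (\<forall>j. j \<notin> vars i \<longrightarrow> u j = 0) \<longrightarrow> (\<forall>j. j \<notin> vars i \<longrightarrow> v j = 0) \<longrightarrow>
        normal (label_rels i) (\<lambda>j. real (u j)) \<longrightarrow> normal (label_rels i) (\<lambda>j. real (v j)) \<longrightarrow>
        comb (vars i) G (\<lambda>j. real (u j)) = comb (vars i) G (\<lambda>j. real (v j)) \<longrightarrow> u = v)"

lemma faithful_normal_unique:
  fixes u v :: "nat \<Rightarrow> nat"
  assumes "faithful i G" "normal (label_rels i) (\<lambda>j. real (u j))" "normal (label_rels i) (\<lambda>j. real (v j))"
    "\<forall>j. j \<notin> vars i \<longrightarrow> u j = 0" "\<forall>j. j \<notin> vars i \<longrightarrow> v j = 0"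
    "comb (vars i) G (\<lambda>j. real (u j)) = comb (vars i) G (\<lambda>j. real (v j))"
  shows "u = v"
  using assms unfolding faithful_def by blast

lemma presents_faithful:
  assumes p: "presents n P (num_vars i) (relations i :: 'k::field_char_0 mpoly set) g"
  shows "faithful i g" "minimal_generating_set (g ` (vars i)) (cone_semigroup n P)"
proof -
  note D = presentsD[OF p label_triangular label_represents]
  show "minimal_generating_set (g ` (vars i)) (cone_semigroup n P)" by (rule D(1))
  have "u = v" if "\<forall>j. j \<notin> vars i \<longrightarrow> u j = 0" "\<forall>j. j \<notin> vars i \<longrightarrow> v j = 0"
    "normal (label_rels i) (\<lambda>j. real (u j))" "normal (label_rels i) (\<lambda>j. real (v j))"
    "comb (vars i) g (\<lambda>j. real (u j)) = comb (vars i) g (\<lambda>j. real (v j))" for u v :: "nat \<Rightarrow> nat"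
  proof -
    have "in_span (label_rels i) (\<lambda>j. real (u j) - real (v j))" by (rule D(4)) (use that in auto)
    then have "(\<lambda>j. real (u j)) = (\<lambda>j. real (v j))" by (intro normal_form_unique[OF label_triangular that(3,4)]) auto
    then show ?thesis by (simp add: fun_eq_iff)
  qed
  then show "faithful i g" unfolding faithful_def label_holds_def using D(2,3) by blast
qed

section \<open>Quadratic coincidences as finite lists\<close>

fun quads :: "label \<Rightarrow> (nat \<times> nat \<times> nat \<times> nat) list" where
  "quads Delta2 = [(3,4,5,5), (1,2,5,5)]"
| "quads Delta3 = [(3,4,1,5), (1,2,5,5)]"
| "quads Delta4 = [(3,4,1,1), (1,2,5,5)]"
| "quads P3 = [(4,5,6,6), (1,2,3,3)]"
| "quads P4 = [(5,6,1,4), (1,2,3,3)]"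
| "quads P5 = [(5,6,3,4), (1,2,3,3)]"
| "quads P6 = [(3,4,1,2), (1,5,2,6)]"
| "quads P7 = [(3,4,1,2), (5,6,1,2)]"
| "quads Q2 = [(5,6,7,1), (1,2,3,4)]"
| "quads Q3 = [(5,6,7,7), (1,2,3,4)]"
| "quads R1 = [(5,6,7,8), (1,2,3,4)]"
| "quads _ = []"

lemma label_rels_quads: "length (label_rels i) = 2 \<Longrightarrow> label_rels i = map (\<lambda>(a, b, c, d). ({a, b}, pr c d)) (quads i)"
  by (cases i) (auto simp: fun_eq_iff pr_def)

lemma quads_range: "(a, b, c, d) \<in> set (quads i) \<Longrightarrow> {a, b, c, d} \<subseteq> (vars i) \<and> a \<noteq> b"
  by (cases i) auto

text \<open>Tails contain no leading monomial, so one reduction step is enough for a product of two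
  variables.\<close>

lemma quads_normal:
  assumes m: "(a, b, c, d) \<in> set (quads i)" "(a', b', c', d') \<in> set (quads i)"
  shows "pr c d a' = 0 \<or> pr c d b' = 0"
proof -
  have X: "\<forall>(a, b, c, d)\<in>set (quads i). \<forall>(a', b', c', d')\<in>set (quads i). pr c d a' = 0 \<or> pr c d b' = 0"
    by (cases i) (simp_all add: pr_def)
  show ?thesis using bspec[OF bspec[OF X m(1), unfolded prod.case] m(2)] by simp
qed

lemma quads_holds: "label_holds i G \<Longrightarrow> (a, b, c, d) \<in> set (quads i) \<Longrightarrow> G a + G b = G c + G d"
  by (cases i) (auto simp: label_holds_iff add.commute)

definition reduct :: "label \<Rightarrow> (nat \<Rightarrow> nat) \<Rightarrow> (nat \<Rightarrow> nat) \<Rightarrow> bool" where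
  "reduct i p q \<longleftrightarrow> p = q \<or> (\<exists>(a, b, c, d)\<in>set (quads i). p = pr a b \<and> q = pr c d)"

definition collide :: "label \<Rightarrow> (nat \<Rightarrow> nat) \<Rightarrow> (nat \<Rightarrow> nat) \<Rightarrow> bool" where
  "collide i p p' \<longleftrightarrow> (\<exists>q. reduct i p q \<and> reduct i p' q)"

lemma comb_pr: assumes "x \<in> {1..l}" "y \<in> {1..l}" shows "comb {1..l} G (\<lambda>j. real (pr x y j)) = G x + G y"
proof -
  have "comb {1..l} G (\<lambda>j. real (pr x y j)) = comb {1..l} G (\<lambda>j. (if j = x then 1 else 0) + (if j = y then 1 else 0))"
    by (rule comb_cong) (auto simp: pr_def)
  then show ?thesis using assms by (simp add: comb_add comb_unit)
qed

text \<open>Both products reduce in at most one step to normal forms, which separate points; a lead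
  with more than two variables cannot apply to a product of two.\<close>

lemma collision_iff:
  assumes f: "faithful i G" and x: "x \<in> vars i" "y \<in> vars i" "z \<in> vars i" "w \<in> vars i"
  shows "G x + G y = G z + G w \<longleftrightarrow> collide i (pr x y) (pr z w)"
proof
  let ?J = "vars i" and ?rs = "label_rels i" and ?c = "\<lambda>u. comb (vars i) G (\<lambda>j. real (u j))"
  have red: "\<exists>q. reduct i (pr x y) q \<and> normal ?rs (\<lambda>j. real (q j)) \<and> ?c q = G x + G y \<and> (\<forall>j. j \<notin> ?J \<longrightarrow> q j = 0)"
    if xy: "x \<in> ?J" "y \<in> ?J" for x y
  proof (cases "normal ?rs (\<lambda>j. real (pr x y j))")
    case True
    then show ?thesis using comb_pr[OF xy] xy by (intro exI[of _ "pr x y"]) (auto simp: reduct_def pr_def)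
  next
    case False
    then obtain r where r: "r \<in> set ?rs" "\<forall>j\<in>fst r. pr x y j \<noteq> 0" by (auto simp: normal_def)
    have two: "length ?rs = 2"
    proof (rule ccontr)
      assume n: "length ?rs \<noteq> 2"
      have "2 < card (fst r)" using r(1) n by (cases i) auto
      moreover have "fst r \<subseteq> {x, y}" using r(2) by (auto simp: pr_def split: if_splits)
      ultimately show False using card_mono[of "{x, y}" "fst r"] card_insert_le_m1[of 2 "{y}" x] by (simp add: card_insert_if split: if_splits)
    qed
    then obtain a b c d where q: "(a, b, c, d) \<in> set (quads i)" "r = ({a, b}, pr c d)" using r(1) label_rels_quads[OF two] by auto
    note ran = quads_range[OF q(1)]
    have "a \<in> {x, y}" "b \<in> {x, y}" using r(2) q(2) by (auto simp: pr_def split: if_splits)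
    then have e: "pr x y = pr a b" using ran by (auto simp: pr_eq_iff)
    have "G x + G y = G a + G b" using comb_pr[OF xy, of G] comb_pr[of a "num_vars i" b G] ran e by simp
    also have "\<dots> = ?c (pr c d)" using quads_holds[OF _ q(1)] f comb_pr[of c "num_vars i" d G] ran by (simp add: faithful_def)
    finally have "?c (pr c d) = G x + G y" by simp
    moreover have "normal ?rs (\<lambda>j. real (pr c d j))"
      unfolding label_rels_quads[OF two] normal_def using quads_normal[OF q(1)] by auto
    moreover have "reduct i (pr x y) (pr c d)" using q(1) e by (auto simp: reduct_def)
    moreover have "pr c d j = 0" if "j \<notin> ?J" for j using that ran by (auto simp: pr_def)
    ultimately show ?thesis by blast
  qed
  obtain q where q: "reduct i (pr x y) q" "normal ?rs (\<lambda>j. real (q j))" "?c q = G x + G y" "\<forall>j. j \<notin> ?J \<longrightarrow> q j = 0" using red[OF x(1,2)] by blast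
  obtain q' where q': "reduct i (pr z w) q'" "normal ?rs (\<lambda>j. real (q' j))" "?c q' = G z + G w" "\<forall>j. j \<notin> ?J \<longrightarrow> q' j = 0" using red[OF x(3,4)] by blast
  show "collide i (pr x y) (pr z w)" if "G x + G y = G z + G w"
  proof -
    have "?c q = ?c q'" using q(3) q'(3) that by simp
    then have "q = q'" by (rule faithful_normal_unique[OF f q(2) q'(2) q(4) q'(4)])
    then show ?thesis using q(1) q'(1) by (auto simp: collide_def)
  qed
  have val: "?c q = G x + G y" if "reduct i (pr x y) q" "x \<in> ?J" "y \<in> ?J" for q x y
    using that(1) unfolding reduct_def
  proof
    assume "pr x y = q"
    then show ?thesis using comb_pr[OF that(2,3)] by auto
  next
    assume "\<exists>(a, b, c, d)\<in>set (quads i). pr x y = pr a b \<and> q = pr c d"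
    then obtain a b c d where q: "(a, b, c, d) \<in> set (quads i)" "pr x y = pr a b" "q = pr c d" by blast
    show ?thesis using comb_pr[OF that(2,3), of G] comb_pr[of a "num_vars i" b G] comb_pr[of c "num_vars i" d G]
      quads_range[OF q(1)] quads_holds[OF _ q(1), of G] f q by (simp add: faithful_def)
  qed
  show "G x + G y = G z + G w" if "collide i (pr x y) (pr z w)"
    using that val[of x y] val[of z w] x unfolding collide_def by metis
qed

definition quadric :: "'a::ab_group_add \<Rightarrow> 'a \<Rightarrow> 'a \<Rightarrow> 'a \<Rightarrow> bool" where
  "quadric x y z w \<longleftrightarrow> x + y = z + w \<and> x \<noteq> z \<and> x \<noteq> w"

definition quadric_index :: "label \<Rightarrow> nat \<Rightarrow> nat \<Rightarrow> nat \<Rightarrow> nat \<Rightarrow> bool" where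
  "quadric_index i x y z w \<longleftrightarrow> collide i (pr x y) (pr z w) \<and> x \<noteq> z \<and> x \<noteq> w"

text \<open>The invariants take the coincidence relation as a parameter, so that they can be formed
  from the generators and computed from the indices.\<close>

definition squares :: "'a set \<Rightarrow> ('a \<Rightarrow> 'a \<Rightarrow> 'a \<Rightarrow> 'a \<Rightarrow> bool) \<Rightarrow> 'a set" where
  "squares A q = {x \<in> A. \<exists>y\<in>A. \<exists>z\<in>A. q x x y z}"

definition square_factor :: "'a set \<Rightarrow> ('a \<Rightarrow> 'a \<Rightarrow> 'a \<Rightarrow> 'a \<Rightarrow> bool) \<Rightarrow> bool" where
  "square_factor A q \<longleftrightarrow> (\<exists>x\<in>A. \<exists>y\<in>A. \<exists>z\<in>A. \<exists>w\<in>A. x \<in> squares A q \<and> y \<noteq> x \<and> q x y z w)"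

definition triple_fibre :: "'a set \<Rightarrow> ('a \<Rightarrow> 'a \<Rightarrow> 'a \<Rightarrow> 'a \<Rightarrow> bool) \<Rightarrow> bool" where
  "triple_fibre A q \<longleftrightarrow> (\<exists>x\<in>A. \<exists>y\<in>A. \<exists>z\<in>A. \<exists>w\<in>A. \<exists>z'\<in>A. \<exists>w'\<in>A. q x y z w \<and> q x y z' w' \<and> z \<noteq> z' \<and> z \<noteq> w')"

definition some_quadric :: "'a set \<Rightarrow> ('a \<Rightarrow> 'a \<Rightarrow> 'a \<Rightarrow> 'a \<Rightarrow> bool) \<Rightarrow> bool" where
  "some_quadric A q \<longleftrightarrow> (\<exists>x\<in>A. \<exists>y\<in>A. \<exists>z\<in>A. \<exists>w\<in>A. q x y z w)"

lemma faithful_invariants: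
  assumes f: "faithful i G"
  shows "card (G ` (vars i)) = num_vars i"
    "card (squares (G ` (vars i)) quadric) = card (squares (vars i) (quadric_index i))"
    "square_factor (G ` (vars i)) quadric \<longleftrightarrow> square_factor (vars i) (quadric_index i)"
    "triple_fibre (G ` (vars i)) quadric \<longleftrightarrow> triple_fibre (vars i) (quadric_index i)"
    "some_quadric (G ` (vars i)) quadric \<longleftrightarrow> some_quadric (vars i) (quadric_index i)"
proof -
  define J where "J = (vars i)"
  have inj: "inj_on G J" using f by (simp add: faithful_def J_def)
  have eq: "G x = G y \<longleftrightarrow> x = y" if "x \<in> J" "y \<in> J" for x y using inj that by (auto simp: inj_on_def)
  have q: "quadric (G x) (G y) (G z) (G w) \<longleftrightarrow> quadric_index i x y z w" if "x \<in> J" "y \<in> J" "z \<in> J" "w \<in> J" for x y z w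
    using collision_iff[OF f, of x y z w] that eq by (simp add: quadric_def quadric_index_def J_def)
  have sqm: "G x \<in> squares (G ` J) quadric \<longleftrightarrow> x \<in> squares J (quadric_index i)" if "x \<in> J" for x
    using that by (simp add: squares_def q cong: bex_cong)
  have sq: "squares (G ` J) quadric = G ` squares J (quadric_index i)"
  proof -
    have "x \<in> squares (G ` J) quadric \<longleftrightarrow> (\<exists>j\<in>J. x = G j \<and> G j \<in> squares (G ` J) quadric)" for x unfolding squares_def by blast
    moreover have "j \<in> squares J (quadric_index i) \<Longrightarrow> j \<in> J" for j by (simp add: squares_def)
    ultimately show ?thesis using sqm by blast
  qed
  have "inj_on G (squares J (quadric_index i))" by (rule inj_on_subset[OF inj]) (auto simp: squares_def)
  then show "card (squares (G ` (vars i)) quadric) = card (squares (vars i) (quadric_index i))"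
    using sq card_image unfolding J_def by metis
  show "card (G ` (vars i)) = num_vars i" using card_image[OF inj] by (simp add: J_def)
  have "square_factor (G ` J) quadric \<longleftrightarrow> square_factor J (quadric_index i)"
    by (simp add: square_factor_def q sqm eq cong: bex_cong)
  then show "square_factor (G ` (vars i)) quadric \<longleftrightarrow> square_factor (vars i) (quadric_index i)" by (simp only: J_def)
  have "triple_fibre (G ` J) quadric \<longleftrightarrow> triple_fibre J (quadric_index i)"
    by (simp add: triple_fibre_def q eq cong: bex_cong)
  then show "triple_fibre (G ` (vars i)) quadric \<longleftrightarrow> triple_fibre (vars i) (quadric_index i)" by (simp only: J_def)
  have "some_quadric (G ` J) quadric \<longleftrightarrow> some_quadric J (quadric_index i)"
    by (simp add: some_quadric_def q cong: bex_cong)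
  then show "some_quadric (G ` (vars i)) quadric \<longleftrightarrow> some_quadric (vars i) (quadric_index i)" by (simp only: J_def)
qed

text \<open>In \<open>Delta2\<close> and \<open>P7\<close> both relations have the same tail, so
  their two leads collide with each other as well.\<close>

definition collisions :: "label \<Rightarrow> (nat \<times> nat \<times> nat \<times> nat) list" where
  "collisions i = quads i @ (if i = Delta2 then [(1,2,3,4)] else if i = P7 then [(3,4,5,6)] else [])"

fun reorderings :: "nat \<times> nat \<times> nat \<times> nat \<Rightarrow> (nat \<times> nat \<times> nat \<times> nat) list" where
  "reorderings (a, b, c, d) = [(a,b,c,d), (b,a,c,d), (a,b,d,c), (b,a,d,c), (c,d,a,b), (d,c,a,b), (c,d,b,a), (d,c,b,a)]"

definition quadric_list :: "label \<Rightarrow> (nat \<times> nat \<times> nat \<times> nat) list" where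
  "quadric_list i = concat (map reorderings (collisions i))"

lemma in_reorderings_iff: "(x, y, z, w) \<in> set (reorderings (a, b, c, d)) \<longleftrightarrow>
  (pr x y = pr a b \<and> pr z w = pr c d) \<or> (pr x y = pr c d \<and> pr z w = pr a b)"
proof
  assume "(x, y, z, w) \<in> set (reorderings (a, b, c, d))"
  then show "(pr x y = pr a b \<and> pr z w = pr c d) \<or> (pr x y = pr c d \<and> pr z w = pr a b)"
    by (auto simp: pr_sym)
next
  assume "(pr x y = pr a b \<and> pr z w = pr c d) \<or> (pr x y = pr c d \<and> pr z w = pr a b)"
  then show "(x, y, z, w) \<in> set (reorderings (a, b, c, d))"
    unfolding pr_eq_iff by (elim disjE conjE) simp_all
qed

lemma in_quadric_list: "t \<in> set (quadric_list i) \<longleftrightarrow> (\<exists>a b c d. (a, b, c, d) \<in> set (collisions i) \<and> t \<in> set (reorderings (a, b, c, d)))"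
  unfolding quadric_list_def set_concat set_map UN_iff bex_simps(7) by (metis prod_cases4)

lemma collisions_range: "\<forall>(a, b, c, d)\<in>set (collisions i). {a, b, c, d} \<subseteq> (vars i) \<and> {a, b} \<inter> {c, d} = {}"
  by (cases i) (simp_all add: collisions_def)

lemma collisions_collide:
  assumes "(a, b, c, d) \<in> set (collisions i)" shows "collide i (pr a b) (pr c d)"
proof -
  have X: "\<forall>(a, b, c, d)\<in>set (collisions i). (a, b, c, d) \<in> set (quads i) \<or>
    (\<exists>(a', b', e, f)\<in>set (quads i). a' = a \<and> b' = b \<and> (c, d, e, f) \<in> set (quads i))"
    by (cases i) (simp_all add: collisions_def)
  have red: "reduct i (pr a b) (pr c d)" if "(a, b, c, d) \<in> set (quads i)" for a b c d
    using that unfolding reduct_def by blast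
  consider "(a, b, c, d) \<in> set (quads i)" | e f where "(a, b, e, f) \<in> set (quads i)" "(c, d, e, f) \<in> set (quads i)"
    using bspec[OF X assms] by auto
  then show ?thesis
  proof cases
    case 1
    have "reduct i (pr c d) (pr c d)" by (simp add: reduct_def)
    then show ?thesis using red[OF 1] unfolding collide_def by blast
  next
    case 2
    then show ?thesis using red unfolding collide_def by blast
  qed
qed

lemma collide_collisions:
  assumes "collide i p p'" "p \<noteq> p'"
  shows "\<exists>(a, b, c, d)\<in>set (collisions i). (p = pr a b \<and> p' = pr c d) \<or> (p = pr c d \<and> p' = pr a b)"
proof -
  have two: "\<forall>(a, b, c, d)\<in>set (quads i). \<forall>(a', b', c', d')\<in>set (quads i). pr c d = pr c' d' \<longrightarrow>
    pr a b = pr a' b' \<or> (a, b, a', b') \<in> set (collisions i) \<or> (a', b', a, b) \<in> set (collisions i)"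
    by (cases i) (simp_all add: collisions_def pr_eq_iff)
  have sub: "t \<in> set (quads i) \<Longrightarrow> t \<in> set (collisions i)" for t by (simp add: collisions_def)
  obtain q where q: "reduct i p q" "reduct i p' q" using assms(1) by (auto simp: collide_def)
  consider "q = p" "q = p'" | a b c d where "(a, b, c, d) \<in> set (quads i)" "p = pr a b" "q = pr c d" "q = p'"
    | a b c d where "(a, b, c, d) \<in> set (quads i)" "p' = pr a b" "q = pr c d" "q = p"
    | a b c d a' b' c' d' where "(a, b, c, d) \<in> set (quads i)" "p = pr a b" "q = pr c d"
        "(a', b', c', d') \<in> set (quads i)" "p' = pr a' b'" "q = pr c' d'"
    using q unfolding reduct_def by blast
  then show ?thesis
  proof cases
    case 1
    then show ?thesis using assms(2) by simp
  next
    case 2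
    then show ?thesis using sub by blast
  next
    case 3
    then show ?thesis using sub by blast
  next
    case 4
    have "(a, b, a', b') \<in> set (collisions i) \<or> (a', b', a, b) \<in> set (collisions i)"
      using two 4 assms(2) by fast
    then show ?thesis using 4 by blast
  qed
qed

text \<open>Turns the invariants into finite computations on lists.\<close>

lemma quadric_index_iff: "quadric_index i x y z w \<longleftrightarrow> (x, y, z, w) \<in> set (quadric_list i)"
proof
  assume q: "quadric_index i x y z w"
  then have "pr x y \<noteq> pr z w" by (auto simp: quadric_index_def pr_eq_iff)
  then obtain a b c d where "(a, b, c, d) \<in> set (collisions i)" "(pr x y = pr a b \<and> pr z w = pr c d) \<or> (pr x y = pr c d \<and> pr z w = pr a b)"
    using collide_collisions[of i "pr x y" "pr z w"] q unfolding quadric_index_def by blast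
  then show "(x, y, z, w) \<in> set (quadric_list i)"
    unfolding in_quadric_list using in_reorderings_iff by blast
next
  assume "(x, y, z, w) \<in> set (quadric_list i)"
  then obtain a b c d where c: "(a, b, c, d) \<in> set (collisions i)" "(x, y, z, w) \<in> set (reorderings (a, b, c, d))"
    unfolding in_quadric_list by blast
  have r: "a \<noteq> c" "a \<noteq> d" "b \<noteq> c" "b \<noteq> d" using collisions_range[of i] c(1) by fastforce+
  have "collide i (pr x y) (pr z w)"
    using c(2) collisions_collide[OF c(1)] unfolding in_reorderings_iff by (auto simp: collide_def)
  then show "quadric_index i x y z w" using c(2) r by (auto simp: quadric_index_def)
qed

lemma quadric_list_range: "(x, y, z, w) \<in> set (quadric_list i) \<Longrightarrow> x \<in> vars i \<and> y \<in> vars i \<and> z \<in> vars i \<and> w \<in> vars i"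
proof -
  assume "(x, y, z, w) \<in> set (quadric_list i)"
  then obtain a b c d where c: "(a, b, c, d) \<in> set (collisions i)" "(x, y, z, w) \<in> set (reorderings (a, b, c, d))"
    unfolding in_quadric_list by blast
  have "{a, b, c, d} \<subseteq> (vars i)" using collisions_range[of i] c(1) by fast
  then show ?thesis using c(2) by auto
qed

lemma squares_label: "squares (vars i) (quadric_index i) = {x. \<exists>z w. (x, x, z, w) \<in> set (quadric_list i)}"
  unfolding squares_def quadric_index_iff using quadric_list_range[of _ _ _ _ i] by blast

fun label_squares :: "label \<Rightarrow> nat set" where
  "label_squares Delta2 = {5}" | "label_squares Delta3 = {5}" | "label_squares Delta4 = {1, 5}"
| "label_squares P3 = {3, 6}" | "label_squares P4 = {3}" | "label_squares P5 = {3}" | "label_squares Q3 = {7}"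
| "label_squares _ = {}"

lemma squares_label_eq: "squares (vars i) (quadric_index i) = label_squares i"
proof -
  have L: "{x. \<exists>z w. (x, x, z, w) \<in> set L} = (\<lambda>(x, y, z, w). x) ` set (filter (\<lambda>(x, y, z, w). x = y) L)" for L :: "(nat \<times> nat \<times> nat \<times> nat) list"
    by force
  show ?thesis unfolding squares_label L
    by (cases i) (simp_all add: quadric_list_def collisions_def insert_commute)
qed

lemma square_factor_label:
  "square_factor (vars i) (quadric_index i) \<longleftrightarrow> (\<exists>(x, y, z, w)\<in>set (quadric_list i). x \<in> label_squares i \<and> y \<noteq> x)"
  unfolding square_factor_def squares_label_eq quadric_index_iff using quadric_list_range[of _ _ _ _ i] by fast

lemma square_factor_values:
  "square_factor (vars Delta3) (quadric_index Delta3)" "\<not> square_factor (vars Delta2) (quadric_index Delta2)"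
  "square_factor (vars P5) (quadric_index P5)" "\<not> square_factor (vars P4) (quadric_index P4)"
  unfolding square_factor_label by (simp_all add: quadric_list_def collisions_def)

lemma triple_fibre_label:
  "triple_fibre (vars i) (quadric_index i) \<longleftrightarrow>
     (\<exists>(x, y, z, w)\<in>set (quadric_list i). \<exists>(x', y', z', w')\<in>set (quadric_list i). x' = x \<and> y' = y \<and> z \<noteq> z' \<and> z \<noteq> w')"
proof
  assume "triple_fibre (vars i) (quadric_index i)"
  then obtain x y z w z' w' where m: "(x, y, z, w) \<in> set (quadric_list i)" "(x, y, z', w') \<in> set (quadric_list i)" "z \<noteq> z'" "z \<noteq> w'"
    unfolding triple_fibre_def quadric_index_iff by blast
  have "\<exists>(x', y', z', w')\<in>set (quadric_list i). x' = x \<and> y' = y \<and> z \<noteq> z' \<and> z \<noteq> w'"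
    by (rule bexI[of _ "(x, y, z', w')"]) (use m in simp_all)
  then show "\<exists>(x, y, z, w)\<in>set (quadric_list i). \<exists>(x', y', z', w')\<in>set (quadric_list i). x' = x \<and> y' = y \<and> z \<noteq> z' \<and> z \<noteq> w'"
    by (intro bexI[OF _ m(1)]) simp
next
  assume "\<exists>(x, y, z, w)\<in>set (quadric_list i). \<exists>(x', y', z', w')\<in>set (quadric_list i). x' = x \<and> y' = y \<and> z \<noteq> z' \<and> z \<noteq> w'"
  then obtain x y z w z' w' where "(x, y, z, w) \<in> set (quadric_list i)" "(x, y, z', w') \<in> set (quadric_list i)" "z \<noteq> z'" "z \<noteq> w'"
    by auto
  then show "triple_fibre (vars i) (quadric_index i)"
    unfolding triple_fibre_def quadric_index_iff using quadric_list_range[of _ _ _ _ i] by blast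
qed

lemma triple_fibre_values:
  "triple_fibre (vars P7) (quadric_index P7)" "\<not> triple_fibre (vars P6) (quadric_index P6)"
  unfolding triple_fibre_label by (simp_all add: quadric_list_def collisions_def)

lemma some_quadric_label:
  "some_quadric (vars i) (quadric_index i) \<longleftrightarrow> length (label_rels i) = 2"
proof -
  have "some_quadric (vars i) (quadric_index i) \<longleftrightarrow> (\<exists>x y z w. (x, y, z, w) \<in> set (quadric_list i))"
    unfolding some_quadric_def quadric_index_iff using quadric_list_range[of _ _ _ _ i] by blast
  also have "\<dots> \<longleftrightarrow> quadric_list i \<noteq> []"
    by (cases "quadric_list i") auto
  also have "\<dots> \<longleftrightarrow> length (label_rels i) = 2" by (cases i) (simp_all add: quadric_list_def collisions_def)
  finally show ?thesis .
qed

text \<open>Separates \<open>P1\<close> from \<open>P2\<close>, which both have five generators and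
  no quadratic coincidence.\<close>

definition cubic_relation :: "'a::ab_group_add set \<Rightarrow> bool" where
  "cubic_relation A \<longleftrightarrow> (\<exists>x\<in>A. \<exists>y\<in>A. \<exists>z\<in>A. \<exists>u\<in>A. \<exists>v\<in>A. \<exists>w\<in>A. x + y + z = u + v + w \<and> x \<notin> {u, v, w})"

lemma cubic_relation_P2: assumes "faithful P2 G" shows "cubic_relation (G ` (vars P2))"
proof -
  have e: "G 1 + G 2 + G 3 = G 4 + G 5 + G 5" and i: "inj_on G {1..5}" using assms by (auto simp: faithful_def label_holds_iff add.assoc)
  have n: "G 1 \<notin> {G 4, G 5}" using inj_onD[OF i, of 1 4] inj_onD[OF i, of 1 5] by auto
  show ?thesis unfolding cubic_relation_def
    by (rule bexI[of _ "G 1"], rule bexI[of _ "G 2"], rule bexI[of _ "G 3"],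
      rule bexI[of _ "G 4"], rule bexI[of _ "G 5"], rule bexI[of _ "G 5"]) (use e n in auto)
qed

text \<open>The only leading monomial of \<open>P1\<close> has four factors, so all products of
  three variables are normal and therefore pairwise different.\<close>

lemma not_cubic_relation_P1: assumes f: "faithful P1 G" shows "\<not> cubic_relation (G ` (vars P1))"
proof
  let ?J = "(vars P1)"
  let ?t = "\<lambda>x y z j. pr x y j + (if j = z then 1 else 0 :: nat)"
  assume "cubic_relation (G ` ?J)"
  then have "\<exists>x\<in>?J. \<exists>y\<in>?J. \<exists>z\<in>?J. \<exists>u\<in>?J. \<exists>v\<in>?J. \<exists>w\<in>?J.
    G x + G y + G z = G u + G v + G w \<and> G x \<notin> {G u, G v, G w}"
    unfolding cubic_relation_def bex_simps(7) .
  then obtain x y z u v w where J: "x \<in> ?J" "y \<in> ?J" "z \<in> ?J" "u \<in> ?J" "v \<in> ?J" "w \<in> ?J"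
    and e: "G x + G y + G z = G u + G v + G w" "G x \<notin> {G u, G v, G w}"
    by (elim bexE conjE) (rule that)
  have c: "comb ?J G (\<lambda>j. real (?t x y z j)) = G x + G y + G z" if "x \<in> ?J" "y \<in> ?J" "z \<in> ?J" for x y z
  proof -
    have "comb ?J G (\<lambda>j. real (?t x y z j)) = comb ?J G (\<lambda>j. real (pr x y j) + (if j = z then 1 else 0))"
      by (rule comb_cong) auto
    also have "\<dots> = comb ?J G (\<lambda>j. real (pr x y j)) + G z" using comb_unit[of ?J z G] that(3) by (simp only: comb_add finite_atLeastAtMost)
    also have "\<dots> = G x + G y + G z" using comb_pr[OF that(1,2)] by simp
    finally show ?thesis .
  qed
  have t3: "?t x y z \<in> comps ?J 3" if "x \<in> ?J" "y \<in> ?J" "z \<in> ?J" for x y z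
  proof -
    have "sum (?t x y z) ?J = sum (pr x y) ?J + 1" using that(3) by (simp add: sum.distrib)
    then show ?thesis using pr_comps[of ?J x y] that by (auto simp: comps_def)
  qed
  have n: "normal (label_rels P1) (\<lambda>j. real (?t x y z j))" if "x \<in> ?J" "y \<in> ?J" "z \<in> ?J" for x y z
    by (rule normal_comps[OF _ t3[OF that]]) auto
  have "?t x y z = ?t u v w"
  proof (rule faithful_normal_unique[OF f n[OF J(1-3)] n[OF J(4-6)]])
    show "comb ?J G (\<lambda>j. real (?t x y z j)) = comb ?J G (\<lambda>j. real (?t u v w j))"
      unfolding c[OF J(1-3)] c[OF J(4-6)] by (rule e(1))
  next
    show "\<forall>j. j \<notin> ?J \<longrightarrow> ?t x y z j = 0" using t3[OF J(1-3)] unfolding comps_def by blast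
    show "\<forall>j. j \<notin> ?J \<longrightarrow> ?t u v w j = 0" using t3[OF J(4-6)] unfolding comps_def by blast
  qed
  then have "?t x y z x = ?t u v w x" by metis
  then have "x = u \<or> x = v \<or> x = w" by (auto simp: pr_def split: if_splits)
  then show False using e(2) by auto
qed

text \<open>The numbers of generators and of squares and the type of the relations leave only four
  pairs of labels undecided.\<close>

lemma label_determined:
  assumes "num_vars i = num_vars i'" "card (label_squares i) = card (label_squares i')"
    "length (label_rels i) = 2 \<longleftrightarrow> length (label_rels i') = 2"
  shows "i = i' \<or> (i, i') \<in> {(Delta2, Delta3), (Delta3, Delta2), (P1, P2), (P2, P1), (P4, P5), (P5, P4), (P6, P7), (P7, P6)}"
proof -
  \<comment> \<open>The three invariants are packed into one number: hundreds for the variables,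
    tens for the squares, units for the type of the relations.\<close>
  define code where "code = (\<lambda>i. 100 * num_vars i + 10 * card (label_squares i) + (if length (label_rels i) = 2 then 1 else 0))"
  have code: "code Delta1 = 400" "code Delta2 = 511" "code Delta3 = 511" "code Delta4 = 521" "code P1 = 500" "code P2 = 500"
    "code P3 = 621" "code P4 = 611" "code P5 = 611" "code P6 = 601" "code P7 = 601" "code Q1 = 600" "code Q2 = 701"
    "code Q3 = 711" "code R1 = 801"
    by (simp_all add: code_def)
  have "code i = code i'" using assms by (simp add: code_def)
  then show ?thesis by (cases i; cases i'; simp add: code)
qed

text \<open>\<open>square_factor\<close> separates \<open>Delta2\<close> from \<open>Delta3\<close>
  and \<open>P4\<close> from \<open>P5\<close>, \<open>triple_fibre\<close> separates
  \<open>P6\<close> from \<open>P7\<close>, and \<open>cubic_relation\<close> separates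
  \<open>P1\<close> from \<open>P2\<close>.\<close>

lemma label_unique:
  assumes f: "faithful i G" and f': "faithful i' G'" and A: "G ` (vars i) = G' ` (vars i')"
  shows "i = i'"
proof -
  note F = faithful_invariants[OF f] and F' = faithful_invariants[OF f']
  have N: "num_vars i = num_vars i'" using F(1) F'(1) A by simp
  have sq: "card (label_squares i) = card (label_squares i')" using F(2) F'(2) A squares_label_eq by metis
  have sf: "square_factor (vars i) (quadric_index i) \<longleftrightarrow> square_factor (vars i') (quadric_index i')" using F(3) F'(3) A by metis
  have tf: "triple_fibre (vars i) (quadric_index i) \<longleftrightarrow> triple_fibre (vars i') (quadric_index i')" using F(4) F'(4) A by metis
  have qd: "length (label_rels i) = 2 \<longleftrightarrow> length (label_rels i') = 2" using F(5) F'(5) A some_quadric_label by metis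
  have "\<not> (i = P1 \<and> i' = P2)" "\<not> (i = P2 \<and> i' = P1)"
    using not_cubic_relation_P1 cubic_relation_P2 f f' A by metis+
  moreover have "\<not> (i = Delta2 \<and> i' = Delta3)" "\<not> (i = Delta3 \<and> i' = Delta2)" "\<not> (i = P4 \<and> i' = P5)" "\<not> (i = P5 \<and> i' = P4)"
    using sf square_factor_values by metis+
  moreover have "\<not> (i = P6 \<and> i' = P7)" "\<not> (i = P7 \<and> i' = P6)" using tf triple_fibre_values by metis+
  ultimately show ?thesis using label_determined[OF N sq qd] by auto
qed

section \<open>The fifteen examples\<close>

text \<open>Existence of normal forms gives surjectivity and uniqueness gives injectivity, so
  lattice points are counted by exponents.\<close>

lemma model_normal_bij:
  assumes m: "model n J rs d g P"
  shows "bij_betw (\<lambda>u. comb J g (\<lambda>j. real (u j)))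
    {u. (\<forall>j. j \<notin> J \<longrightarrow> u j = 0) \<and> normal rs (\<lambda>j. real (u j)) \<and> (\<Sum>j\<in>J. u j * d j) = k} (slice n P k)"
    (is "bij_betw ?c ?A _")
proof (rule bij_betw_imageI)
  have pm: "premodel n J rs d g" using m by (simp add: model_def)
  note fin = pm_fin[OF pm] and tri = pm_tri[OF pm] and S = model_semigroup[OF m]
  have deg: "snd (?c u) = real (\<Sum>j\<in>J. u j * d j)" for u
    using snd_comb[of J g d "\<lambda>j. real (u j)"] pm_deg[OF pm] by simp
  show "inj_on ?c ?A"
  proof (rule inj_onI)
    fix u v assume uv: "u \<in> ?A" "v \<in> ?A" "?c u = ?c v"
    have "(\<lambda>j. real (u j)) = (\<lambda>j. real (v j))"
      by (rule normal_form_unique[OF tri])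
        (use uv pm_comb_eq_iff[OF pm, of "\<lambda>j. real (u j)" "\<lambda>j. real (v j)"] in auto)
    then show "u = v" by (simp add: fun_eq_iff)
  qed
  show "?c ` ?A = slice n P k"
  proof (intro equalityI subsetI)
    fix p assume "p \<in> ?c ` ?A"
    then obtain u where u: "u \<in> ?A" "p = ?c u" by blast
    have "p \<in> cone_semigroup n P" unfolding S u(2)
      by (intro CollectI exI[of _ "\<lambda>j. real (u j)"]) (use u(1) in auto)
    then show "p \<in> slice n P k" using deg[of u] u by (simp add: slice_def del: of_nat_sum of_nat_mult)
  next
    fix p assume p: "p \<in> slice n P k"
    then obtain f where f: "p = comb J g f" "\<forall>j. f j \<in> \<nat>" "\<forall>j. j \<notin> J \<longrightarrow> f j = 0"
      unfolding slice_def S by blast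
    have "\<exists>v. in_span rs (\<lambda>j. f j - v j) \<and> (\<forall>j. v j \<in> \<nat>) \<and> normal rs v \<and> (\<forall>r\<in>set rs. \<forall>j\<in>fst r. 0 \<le> v j)"
    proof (rule normal_form_exists[OF _ _ fin tri])
      show "a - b \<in> \<nat>" if "a \<in> \<nat>" "b \<in> \<nat>" "b \<le> a" for a b :: real
        using that by (auto elim!: Nats_cases simp flip: of_nat_diff)
    qed (use f(2) in auto)
    then obtain v where v: "in_span rs (\<lambda>j. f j - v j)" "\<forall>j. v j \<in> \<nat>" "normal rs v" by blast
    have "\<forall>j. \<exists>k. v j = real k" using v(2) by (auto elim: Nats_cases)
    then obtain u :: "nat \<Rightarrow> nat" where u: "\<forall>j. v j = real (u j)" by (rule choice[elim_format]) blast
    have vu: "v = (\<lambda>j. real (u j))" using u by (simp add: fun_eq_iff)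
    have u0: "\<forall>j. j \<notin> J \<longrightarrow> u j = 0"
    proof (intro allI impI)
      fix j assume j: "j \<notin> J"
      have "f j - v j = 0" by (rule in_span_outside[OF tri v(1) j])
      then show "u j = 0" using f(3) j u by simp
    qed
    have "p = ?c u"
      using pm_comb_eq_iff[OF pm, of f v] f(1,3) u0 v(1) unfolding vu by simp
    then show "p \<in> ?c ` ?A" using u0 v(3) p deg[of u] unfolding vu slice_def
      by (intro image_eqI[of _ _ u]) (auto simp flip: of_nat_mult of_nat_sum)
  qed
qed

lemma normal_real_iff: "normal rs (\<lambda>j. real (u j)) \<longleftrightarrow> (\<forall>L\<in>set (map fst rs). \<exists>j\<in>L. u j = 0)"
  by (simp add: normal_def)

lemma label_disjoint: "sorted_wrt (\<lambda>A B. A \<inter> B = {}) (map fst (label_rels i))"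
  by (cases i) simp_all

text \<open>One lead of size three gives \<open>1 - t^3 = (1 - t) (1 + t + t^2)\<close>, two of size
  two give \<open>(1 - t^2)^2 = (1 - t)^2 (1 + 2t + t^2)\<close>.\<close>

lemma label_hstar:
  assumes m: "label_model n i g P" and dim: "label_dim i = n" and i: "i \<noteq> P1"
  shows "hstar n P = fps_of_poly [:1, int (length (label_rels i)), 1:]"
proof -
  let ?J = "vars i" and ?Ls = "map fst (label_rels i)" and ?q = "length (label_rels i)"
  let ?H = "Abs_fps (\<lambda>k. int (card (slice n P k)))"
  have d: "label_deg i = (\<lambda>_. 1)" using i by (auto simp: label_deg_def)
  have "card (slice n P k) = card (nforms ?J ?Ls k)" for k
  proof -
    have "{u. (\<forall>j. j \<notin> ?J \<longrightarrow> u j = 0) \<and> normal (label_rels i) (\<lambda>j. real (u j)) \<and> (\<Sum>j\<in>?J. u j * label_deg i j) = k} = nforms ?J ?Ls k"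
      unfolding nforms_def comps_def normal_real_iff d by auto
    then show ?thesis using bij_betw_same_card[OF model_normal_bij[OF m, of k]] by simp
  qed
  then have "(1 - fps_X) ^ num_vars i * ?H = (1 - fps_X) ^ card ?J * Abs_fps (\<lambda>k. int (card (nforms ?J ?Ls k)))" by simp
  also have "\<dots> = prod_list (map (\<lambda>L. 1 - fps_X ^ card L) ?Ls)"
    by (rule nforms_fps[OF finite_atLeastAtMost _ label_disjoint]) (use label_lead_subset in auto)
  also have "\<dots> = (1 - fps_X) ^ ?q * fps_of_poly [:1, int ?q, 1:]"
  proof -
    have p1: "fps_of_poly [:1, 1, 1:] = 1 + fps_X + (fps_X ^ 2 :: int fps)"
      by (simp add: fps_of_poly_pCons algebra_simps power2_eq_square)
    have p2: "fps_of_poly [:1, 2, 1:] = 1 + 2 * fps_X + (fps_X ^ 2 :: int fps)"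
      by (simp add: fps_of_poly_pCons algebra_simps power2_eq_square fps_numeral_fps_const)
    show ?thesis using i
      by (cases i) (simp_all add: p1 p2 algebra_simps power2_eq_square power3_eq_cube)
  qed
  finally have "(1 - fps_X) ^ ?q * ((1 - fps_X) ^ (n + 1) * ?H) = (1 - fps_X) ^ ?q * fps_of_poly [:1, int ?q, 1:]"
    unfolding label_length dim power_add by (simp only: mult_ac)
  moreover have "(1 - fps_X :: int fps) \<noteq> 0"
    by (metis diff_0_right diff_eq_eq fps_nonzeroI fps_sub_nth fps_one_nth fps_X_nth zero_neq_one One_nat_def)
  ultimately show ?thesis unfolding hstar_slice by simp
qed

text \<open>The variable of degree two is split off and contributes the denominator
  \<open>1 - t^2\<close>; the four others, with one lead of size four, contribute the numerator
  \<open>1 - t^4\<close>.\<close>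

lemma P1_hstar:
  assumes m: "label_model 3 P1 g P"
  shows "hstar 3 P = fps_of_poly [:1, 0, 1:]"
proof -
  let ?J = "{1..4::nat}"
  let ?H = "Abs_fps (\<lambda>k. int (card (slice 3 P k)))" and ?N = "Abs_fps (\<lambda>k. int (card (nforms ?J [?J] k)))"
  have lp: "lattice_polytope 3 P" by (rule model_lattice_polytope[OF m])
  define W where "W = (\<lambda>k. {u :: nat \<Rightarrow> nat. (\<forall>j. j \<notin> {1..5} \<longrightarrow> u j = 0) \<and> (u 1 = 0 \<or> u 2 = 0 \<or> u 3 = 0 \<or> u 4 = 0) \<and>
    u 1 + u 2 + u 3 + u 4 + 2 * u 5 = k})"
  have W: "u \<in> W k \<longleftrightarrow> (\<forall>j. j \<notin> {1..5} \<longrightarrow> u j = 0) \<and> (u 1 = 0 \<or> u 2 = 0 \<or> u 3 = 0 \<or> u 4 = 0) \<and>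
    u 1 + u 2 + u 3 + u 4 + 2 * u 5 = k" for u k
    by (simp add: W_def)
  have "{u. (\<forall>j. j \<notin> (vars P1) \<longrightarrow> u j = 0) \<and> normal (label_rels P1) (\<lambda>j. real (u j)) \<and>
      (\<Sum>j\<in>(vars P1). u j * label_deg P1 j) = k} = W k" for k
    by (auto simp: W_def normal_def Icc_numeral_sum[unfolded One_nat_def] label_deg_def)
  note bij = model_normal_bij[OF m, unfolded this]
  have card: "card (slice 3 P k) = card (W k)" for k
    using bij_betw_same_card[OF bij] by simp
  have finW: "finite (W k)" for k
    using bij_betw_finite[OF bij] finite_slice[OF lp] by blast
  have N: "u \<in> nforms ?J [?J] k \<longleftrightarrow> (\<forall>j. j \<notin> {1..4} \<longrightarrow> u j = 0) \<and> (u 1 = 0 \<or> u 2 = 0 \<or> u 3 = 0 \<or> u 4 = 0) \<and> u 1 + u 2 + u 3 + u 4 = k" for u k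
  proof -
    have "?J = {1, 2, 3, 4}" by auto
    then have "(\<exists>j\<in>?J. u j = 0) \<longleftrightarrow> u 1 = 0 \<or> u 2 = 0 \<or> u 3 = 0 \<or> u 4 = 0" by simp
    then show ?thesis by (auto simp: nforms_def comps_def Icc_numeral_sum[unfolded One_nat_def])
  qed
  have rec: "card (W k) = card (nforms ?J [?J] k) + (if k < 2 then 0 else card (W (k - 2)))" for k
  proof -
    let ?A = "{u \<in> W k. u 5 = 0}" and ?B = "{u \<in> W k. u 5 \<noteq> 0}"
    have "?A = nforms ?J [?J] k"
    proof (intro set_eqI)
      fix u :: "nat \<Rightarrow> nat"
      have "{1..5::nat} = insert 5 {1..4}" "5 \<notin> {1..4::nat}" by auto
      then have "(\<forall>j. j \<notin> {1..5} \<longrightarrow> u j = 0) \<and> u 5 = 0 \<longleftrightarrow> (\<forall>j. j \<notin> {1..4::nat} \<longrightarrow> u j = 0)" by (metis insert_iff)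
      then show "u \<in> ?A \<longleftrightarrow> u \<in> nforms ?J [?J] k" unfolding N by (auto simp: W simp del: atLeastAtMost_iff)
    qed
    moreover have "card ?B = (if k < 2 then 0 else card (W (k - 2)))"
    proof (cases "k < 2")
      case True
      then have "?B = {}" by (auto simp: W)
      then show ?thesis using True by (simp only: card.empty if_True)
    next
      case False
      have "bij_betw (\<lambda>u. u(5 := u 5 + 1)) (W (k - 2)) ?B"
        by (rule bij_betw_byWitness[where f' = "\<lambda>u. u(5 := u 5 - 1)"]) (use False in \<open>auto simp: W fun_eq_iff\<close>)
      then show ?thesis using bij_betw_same_card[of _ "W (k - 2)" ?B] False by auto
    qed
    moreover have "card (W k) = card ?A + card ?B"
    proof -
      have "W k = ?A \<union> ?B" by blast
      then have "card (W k) = card (?A \<union> ?B)" by (rule arg_cong)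
      also have "\<dots> = card ?A + card ?B"
        by (rule card_Un_disjoint) (use finW[of k] in \<open>auto intro: finite_subset[of _ "W k"]\<close>)
      finally show ?thesis .
    qed
    ultimately show ?thesis by simp
  qed
  have HN: "(1 - fps_X ^ 2) * ?H = ?N"
  proof (rule fps_ext)
    fix k
    have "fps_nth (fps_X ^ 2 * ?H) k = (if k < 2 then 0 else int (card (slice 3 P (k - 2))))" by (simp add: fps_X_power_mult_nth)
    then show "fps_nth ((1 - fps_X ^ 2) * ?H) k = fps_nth ?N k" using rec[of k] by (simp add: algebra_simps card)
  qed
  have nz: "(1 - fps_X ^ 2 :: int fps) \<noteq> 0"
    by (intro fps_nonzeroI[of _ 0]) simp
  have "(1 - fps_X ^ 2) * ((1 - fps_X) ^ 4 * ?H) = (1 - fps_X) ^ 4 * ?N" unfolding HN[symmetric] by (simp only: mult_ac)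
  also have "\<dots> = 1 - fps_X ^ 4" using nforms_fps[of ?J "[?J]"] by simp
  also have "\<dots> = (1 - fps_X ^ 2) * (1 + fps_X ^ 2)" by (simp add: algebra_simps flip: power_add)
  finally have "(1 - fps_X) ^ 4 * ?H = 1 + fps_X ^ 2" using nz by simp
  then show ?thesis unfolding hstar_slice by (simp add: fps_of_poly_pCons algebra_simps power2_eq_square)
qed

lemma label_occurs: "j \<in> vars i \<Longrightarrow> \<exists>r\<in>set (label_rels i). rvec r j \<noteq> 0"
proof -
  have "\<forall>j\<in>(vars i). \<exists>r\<in>set (label_rels i). j \<in> fst r \<or> snd r j \<noteq> 0"
    by (cases i) (auto simp: atLeastAtMost_iff)
  moreover have "snd r j = 0" if "r \<in> set (label_rels i)" "j \<in> fst r" for r j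
    using that by (cases i) auto
  ultimately show "j \<in> vars i \<Longrightarrow> \<exists>r\<in>set (label_rels i). rvec r j \<noteq> 0" by (fastforce simp: rvec_def)
qed

text \<open>The last coordinate \<open>lam\<close> is 0 or 1 on the degree-one generators, and 1
  only at the apex. A relation containing the apex variable would then have a single nonzero term;
  for \<open>P1\<close> the extra generator would have \<open>lam\<close> equal to 1/2.\<close>

lemma label_not_pyramid:
  assumes m: "label_model n i g P"
  shows "\<not> gorenstein_pyramid n P"
proof
  let ?J = "vars i" and ?rs = "label_rels i" and ?d = "label_deg i"
  assume "gorenstein_pyramid n P"
  then obtain m' P' where n: "n = Suc m'" and gor: "gorenstein m' P'" and iso: "lattice_iso n P n (pyramid m' P')"
    by (auto simp: gorenstein_pyramid_def)
  obtain h where h: "model n ?J ?rs ?d h (pyramid m' P')" using model_transport[OF m iso] by blast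
  have pm: "premodel n ?J ?rs ?d h" using h by (simp add: model_def)
  have full: "full_lattice_polytope m' P'" using gor by (auto simp: gorenstein_def gorenstein_of_index_def)
  then have lp: "lattice_polytope m' P'" by (simp add: full_lattice_polytope_def)
  have P'0: "lookup x m' = 0" if "x \<in> P'" for x using lattice_polytope_rspace[OF lp] that by (auto simp: rspace_iff)
  have "0 \<in> rspace m'" by (simp add: rspace_iff)
  moreover have "affine hull P' = rspace m'" using full by (simp add: full_lattice_polytope_def)
  ultimately have "P' \<noteq> {}" by (metis affine_hull_empty empty_iff)
  have hullP': "convex hull P' = P'" using lp by (auto simp: lattice_polytope_def)
  let ?e = "single m' 1 :: vec"
  define lam where "lam = (\<lambda>p :: vec \<times> real. lookup (fst p) m')"
  have pyr: "\<exists>u b. 0 \<le> u \<and> u \<le> 1 \<and> b \<in> P' \<and> x = u *\<^sub>R ?e + (1 - u) *\<^sub>R b \<and> lookup x m' = u" if x: "x \<in> pyramid m' P'" for x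
  proof -
    obtain u v b where u: "u \<ge> 0" "v \<ge> 0" "u + v = 1" "b \<in> P'" "x = u *\<^sub>R ?e + v *\<^sub>R b"
      using x unfolding pyramid_def convex_hull_insert[OF \<open>P' \<noteq> {}\<close>] hullP' by blast
    have "v = 1 - u" using u by simp
    then show ?thesis using u P'0[OF u(4)] by (intro exI[of _ u] exI[of _ b]) (simp add: lookup_add)
  qed
  have deg1: "h j = (fst (h j), 1) \<and> fst (h j) \<in> pyramid m' P'" if "j \<in> ?J" "?d j = 1" for j
  proof -
    have s: "snd (h j) = 1" using pm_deg[OF pm that(1)] that(2) by simp
    moreover have "h j \<in> cone_over (pyramid m' P')" using h that(1) unfolding model_def by blast
    ultimately show ?thesis by (auto simp: cone_over_def prod_eq_iff)
  qed
  have lamZ: "lam (h j) \<in> \<int>" if "j \<in> ?J" for j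
    using pm_Lam[OF pm that] by (auto simp: lam_def Lam_def lattice_def)
  have lam01: "lam (h j) = 0 \<or> h j = (?e, 1)" if j: "j \<in> ?J" "?d j = 1" for j
  proof -
    obtain u b where u: "0 \<le> u" "u \<le> 1" "b \<in> P'" "fst (h j) = u *\<^sub>R ?e + (1 - u) *\<^sub>R b" "lookup (fst (h j)) m' = u"
      using pyr[of "fst (h j)"] deg1[OF j] by blast
    obtain z :: int where z: "u = of_int z" using lamZ[OF j(1)] u(5) by (auto simp: lam_def elim: Ints_cases)
    then have "z = 0 \<or> z = 1" using u(1,2) by auto
    then show ?thesis
    proof
      assume "z = 1"
      then have "fst (h j) = ?e" using u(4) z by simp
      then show ?thesis using deg1[OF that] by simp
    qed (use u(5) z in \<open>simp add: lam_def\<close>)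
  qed
  \<comment> \<open>If the apex were not a generator, all degree-one generators and with them the
    pyramid would lie in the hyperplane where the last coordinate vanishes.\<close>
  have "\<exists>j\<in>?J. ?d j = 1 \<and> h j = (?e, 1)"
  proof (rule ccontr)
    assume no: "\<not> ?thesis"
    have "convex {x :: vec. lookup x m' = 0}" by (auto simp: convex_def lookup_add)
    moreover have "fst ` h ` {j\<in>?J. ?d j = 1} \<subseteq> {x. lookup x m' = 0}"
      using lam01 no by (auto simp: lam_def)
    ultimately have "convex hull (fst ` h ` {j\<in>?J. ?d j = 1}) \<subseteq> {x. lookup x m' = 0}"
      by (intro hull_minimal)
    moreover have "pyramid m' P' = convex hull (fst ` h ` {j\<in>?J. ?d j = 1})" using h unfolding model_def by blast
    ultimately have "pyramid m' P' \<subseteq> {x. lookup x m' = 0}" by simp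
    moreover have "?e \<in> pyramid m' P'" unfolding pyramid_def by (intro hull_inc) simp
    ultimately show False by auto
  qed
  then obtain j0 where j0: "j0 \<in> ?J" "?d j0 = 1" "h j0 = (?e, 1)" by blast
  have "inj_on h ?J" using presents_faithful(1)[OF label_model_presents[OF h, where 'k = real]] by (simp add: faithful_def)
  then have lam: "lam (h j) = (if j = j0 then 1 else 0)" if "j \<in> ?J" "?d j = 1" for j
  proof (cases "j = j0")
    case True
    then show ?thesis using j0(3) by (simp add: lam_def)
  next
    case False
    then have "h j \<noteq> (?e, 1)" using inj_onD[OF \<open>inj_on h ?J\<close> _ that(1) j0(1)] j0(3) by auto
    then show ?thesis using lam01[OF that] False by simp
  qed
  have rel: "(\<Sum>j\<in>?J. rvec r j * lam (h j)) = 0" if "r \<in> set ?rs" for r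
  proof -
    have "lam (comb ?J h (rvec r)) = (\<Sum>j\<in>?J. rvec r j * lam (h j))"
      unfolding lam_def comb_def by (simp add: fst_sum lookup_sum')
    then show ?thesis using pm_rel[OF pm that] by (simp add: lam_def)
  qed
  show False
  proof (cases "i = P1")
    case False
    then have d: "?d j = 1" for j by (simp add: label_deg_def)
    obtain r where r: "r \<in> set ?rs" "rvec r j0 \<noteq> 0" using label_occurs[OF j0(1)] by blast
    have "(\<Sum>j\<in>?J. rvec r j * lam (h j)) = (\<Sum>j\<in>?J. if j = j0 then rvec r j else 0)"
      by (intro sum.cong) (auto simp: lam d)
    then show False using rel[OF r(1)] r(2) j0(1) by simp
  next
    case True
    have "j0 \<noteq> 5" using j0(2) True by (auto simp: label_deg_def)
    moreover have "1 \<le> j0" "j0 \<le> 5" using j0(1) True by simp_all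
    ultimately have j: "j0 = 1 \<or> j0 = 2 \<or> j0 = 3 \<or> j0 = 4" by linarith
    have l: "lam (h 1) = (if j0 = 1 then 1 else 0)" "lam (h 2) = (if j0 = 2 then 1 else 0)" "lam (h 3) = (if j0 = 3 then 1 else 0)" "lam (h 4) = (if j0 = 4 then 1 else 0)"
      using lam True by (auto simp: label_deg_def)
    have "lam (h 1) + lam (h 2) + lam (h 3) + lam (h 4) = 2 * lam (h 5)"
      using rel True by (simp add: Icc_numeral_sum[unfolded One_nat_def] rvec_def)
    then have "2 * lam (h 5) = 1" using j unfolding l by auto
    moreover obtain z :: int where "lam (h 5) = of_int z" using lamZ[of 5] True by (auto elim: Ints_cases)
    ultimately have "of_int (2 * z) = (of_int 1 :: real)" by simp
    then show False unfolding of_int_eq_iff by presburger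
  qed
qed

lemma label_example: "\<exists>P a g. small_degree_two_polytope (label_dim i) P a \<and> label_model (label_dim i) i g P"
proof -
  let ?J = "vars i" and ?rs = "label_rels i" and ?d = "label_deg i"
  have one: "1 \<in> ?J" "?d 1 = 1" by (cases i; simp add: label_deg_def)+
  have "\<exists>g. premodel (label_dim i) ?J ?rs ?d g"
  proof (rule premodel_exists[where o' = 1])
    show "(\<Sum>j\<in>?J. rvec r j * real (?d j)) = 0" if "r \<in> set ?rs" for r using label_homogeneous that by blast
    show "\<exists>j\<in>fst r. j \<noteq> 1" if "r \<in> set ?rs" for r using label_leads_not_singleton[OF that] .
    show "card ?J = label_dim i + 1 + length ?rs" using label_length[of i] by simp
    show "?d j \<ge> 1" for j by (simp add: label_deg_def)
  qed (use one label_triangular in auto)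
  then obtain g where g: "premodel (label_dim i) ?J ?rs ?d g" by blast
  define P where "P = convex hull (fst ` g ` {j\<in>?J. ?d j = 1})"
  have m: "model (label_dim i) ?J ?rs ?d g P"
    unfolding P_def by (rule model_of_premodel[OF g label_leads_proper label_single_power]) (use one in blast)
  have "\<exists>a. a \<in> {0, 1, 2} \<and> hstar (label_dim i) P = fps_of_poly [:1, int a, 1:]"
  proof (cases "i = P1")
    case True
    then show ?thesis using P1_hstar[of g P] m by auto
  next
    case False
    have "length ?rs \<in> {1, 2}" by (cases i) auto
    then show ?thesis using label_hstar[OF m refl False] by (intro exI[of _ "length ?rs"]) auto
  qed
  then obtain a where a: "a \<in> {0, 1, 2}" "hstar (label_dim i) P = fps_of_poly [:1, int a, 1:]" by blast
  have "small_degree_two_polytope (label_dim i) P a"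
    unfolding small_degree_two_polytope_def has_hstar_degree_def
    using model_gorenstein(1)[OF m] label_not_pyramid[OF m] a by auto
  then show ?thesis using m by blast
qed

section \<open>Volume\<close>

definition vec_of :: "nat \<Rightarrow> (nat \<Rightarrow> real) \<Rightarrow> vec" where
  "vec_of n y = (\<Sum>i<n. single i (y i))"

lemma lookup_vec_of: "lookup (vec_of n y) i = (if i < n then y i else 0)"
  by (simp add: vec_of_def lookup_sum' lookup_single when_def)

lemma vec_of_rspace: "vec_of n y \<in> rspace n"
  by (simp add: rspace_iff lookup_vec_of)

definition affine_form :: "nat \<Rightarrow> vec \<times> real \<Rightarrow> (nat \<Rightarrow> real) \<Rightarrow> real" where
  "affine_form n u y = (\<Sum>i<n. lookup (fst u) i * y i) + snd u"

lemma affine_form_ev: "affine_form n u y = ev n u (vec_of n y, 1)"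
  by (simp add: affine_form_def ev_def pairing_def lookup_vec_of mult.commute)

abbreviation Leb :: "nat \<Rightarrow> (nat \<Rightarrow> real) measure" where
  "Leb n \<equiv> \<Pi>\<^sub>M i\<in>{..<n}. lborel"

lemma affine_form_measurable [measurable]: "affine_form n u \<in> borel_measurable (Leb n)"
  unfolding affine_form_def[abs_def] by measurable

interpretation lborel_prod: product_sigma_finite "\<lambda>_ :: nat. lborel :: real measure"
  by standard

text \<open>Fubini in the coordinate \<open>j\<close>: on each line in this direction the form
  vanishes at one point only.\<close>

lemma affine_form_null:
  assumes j: "j < n" "lookup (fst u) j \<noteq> 0"
  shows "AE y in Leb n. affine_form n u y \<noteq> 0"
proof -
  let ?I = "{..<n} - {j}" and ?c = "lookup (fst u)"
  let ?Z = "{y \<in> space (Leb n). affine_form n u y = 0}"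
  have I: "insert j ?I = {..<n}" "finite ?I" "j \<notin> ?I" using j by auto
  have "?Z = affine_form n u -` {0} \<inter> space (Leb n)" by auto
  then have Z: "?Z \<in> sets (Leb n)" using measurable_sets[OF affine_form_measurable, of "{0}"] by simp
  have "emeasure (Leb n) ?Z = (\<integral>\<^sup>+ y. indicator ?Z y \<partial>Leb n)" using Z by simp
  also have "\<dots> = (\<integral>\<^sup>+ x. (\<integral>\<^sup>+ t. indicator ?Z (x(j := t)) \<partial>lborel) \<partial>(\<Pi>\<^sub>M i\<in>?I. lborel))"
    using lborel_prod.product_nn_integral_insert[OF I(2,3), of "indicator ?Z"] Z unfolding I(1) by simp
  also have "\<dots> = (\<integral>\<^sup>+ x. 0 \<partial>(\<Pi>\<^sub>M i\<in>?I. (lborel :: real measure)))"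
  proof (rule nn_integral_cong)
    fix x assume x: "x \<in> space (\<Pi>\<^sub>M i\<in>?I. (lborel :: real measure))"
    define s where "s = (\<Sum>i\<in>?I. ?c i * x i) + snd u"
    have aff: "affine_form n u (x(j := t)) = ?c j * t + s" for t
    proof -
      have "(\<Sum>i<n. ?c i * (x(j := t)) i) = ?c j * t + (\<Sum>i\<in>?I. ?c i * (x(j := t)) i)"
        using j(1) by (subst sum.remove[of _ j]) auto
      also have "(\<Sum>i\<in>?I. ?c i * (x(j := t)) i) = (\<Sum>i\<in>?I. ?c i * x i)" by (rule sum.cong) auto
      finally show ?thesis by (simp add: affine_form_def s_def)
    qed
    have "(\<integral>\<^sup>+ t. indicator ?Z (x(j := t)) \<partial>lborel) \<le> (\<integral>\<^sup>+ t. indicator {- s / ?c j} t \<partial>lborel)"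
      by (rule nn_integral_mono) (use j(2) in \<open>auto simp: aff indicator_def field_simps eq_neg_iff_add_eq_0\<close>)
    also have "\<dots> = 0" by simp
    finally show "(\<integral>\<^sup>+ t. indicator ?Z (x(j := t)) \<partial>lborel) = 0" by simp
  qed
  finally have "emeasure (Leb n) ?Z = 0" by simp
  then have "AE y in Leb n. y \<notin> ?Z" using Z by (intro AE_not_in) (auto simp: null_sets_def)
  then show ?thesis by (rule AE_mp) (auto intro!: AE_I2)
qed

lemma floor_scaled_tendsto: "(\<lambda>k. of_int \<lfloor>real k * t\<rfloor> / real k) \<longlonglongrightarrow> t"
proof (rule LIMSEQ_I)
  fix e :: real assume e: "e > 0"
  obtain N :: nat where N: "N > 0" "1 / real N < e" using reals_Archimedean[OF e] by (metis inverse_eq_divide zero_less_Suc)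
  show "\<exists>N. \<forall>k\<ge>N. norm (of_int \<lfloor>real k * t\<rfloor> / real k - t) < e"
  proof (intro exI allI impI)
    fix k assume k: "k \<ge> N"
    then have k0: "real k > 0" using N by simp
    have "norm (of_int \<lfloor>real k * t\<rfloor> / real k - t) = \<bar>of_int \<lfloor>real k * t\<rfloor> - real k * t\<bar> / real k"
      using k0 by (simp add: field_simps abs_divide flip: abs_divide)
    also have "\<dots> \<le> 1 / real k" by (intro divide_right_mono) linarith+
    also have "\<dots> \<le> 1 / real N" using k N by (simp add: frac_le)
    finally show "norm (of_int \<lfloor>real k * t\<rfloor> / real k - t) < e" using N by simp
  qed
qed

text \<open>Induction on \<open>n\<close>: consecutive binomial coefficients have the ratio
  \<open>(Suc n + k) / Suc n\<close>.\<close>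

lemma binomial_growth: "(\<lambda>k. real ((n + k) choose n) / real k ^ n) \<longlonglongrightarrow> 1 / fact n"
proof (induction n)
  case 0
  then show ?case by simp
next
  case (Suc n)
  have "(\<lambda>k. 1 + real (Suc n) / real k) \<longlonglongrightarrow> 1 + 0" by (intro tendsto_add tendsto_const lim_const_over_n)
  moreover have "\<forall>\<^sub>F k in sequentially. 1 + real (Suc n) / real k = (real (Suc n) + real k) / real k"
    by (rule eventually_mono[OF eventually_gt_at_top[of 0]]) (simp add: field_simps)
  ultimately have ratio: "(\<lambda>k. (real (Suc n) + real k) / real k) \<longlonglongrightarrow> 1"
    using Lim_transform_eventually by fastforce
  have "(\<lambda>k. (real ((n + k) choose n) / real k ^ n) * ((real (Suc n) + real k) / real k) / real (Suc n)) \<longlonglongrightarrow> 1 / fact n * 1 / real (Suc n)"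
    by (intro tendsto_intros Suc ratio) simp
  moreover have "real ((Suc n + k) choose Suc n) / real k ^ Suc n =
      (real ((n + k) choose n) / real k ^ n) * ((real (Suc n) + real k) / real k) / real (Suc n)" for k
  proof -
    have "real (Suc n * (Suc (n + k) choose Suc n)) = real (Suc (n + k) * ((n + k) choose n))"
      using Suc_times_binomial_eq[of "n + k" n] by (simp only: mult.commute)
    then have "real (Suc (n + k) choose Suc n) = real ((n + k) choose n) * (real (Suc n) + real k) / real (Suc n)"
      by (simp add: field_simps del: binomial_Suc_Suc)
    then have C: "real ((Suc n + k) choose Suc n) = real ((n + k) choose n) * (real (Suc n) + real k) / real (Suc n)"
      by (simp only: add_Suc)
    show ?thesis unfolding C by (simp add: mult_ac del: of_nat_Suc)
  qed
  ultimately show ?case by (simp add: field_simps)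
qed

text \<open>The normalisation by \<open>(k + 2)^n\<close> is common to the shifts
  \<open>i = 0, 1, 2\<close> that come from the three coefficients of \<open>hstar\<close>.\<close>

lemma binomial_growth_shift: "(\<lambda>k. real ((n + (k + i)) choose n) / real (k + 2) ^ n) \<longlonglongrightarrow> 1 / fact n"
proof -
  have "(\<lambda>k. real ((n + (k + i)) choose n) / real (k + i) ^ n) \<longlonglongrightarrow> 1 / fact n"
    using LIMSEQ_ignore_initial_segment[OF binomial_growth[of n], of i] by simp
  moreover have "(\<lambda>k. ((real k + real i) / (real k + 2)) ^ n) \<longlonglongrightarrow> 1 ^ n"
  proof (rule tendsto_power)
    have "(\<lambda>k. 1 + (real i - 2) / real (k + 2)) \<longlonglongrightarrow> 1 + 0"
      by (intro tendsto_add tendsto_const LIMSEQ_ignore_initial_segment[OF lim_const_over_n])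
    moreover have "1 + (real i - 2) / real (k + 2) = (real k + real i) / (real k + 2)" for k by (simp add: field_simps)
    ultimately show "(\<lambda>k. (real k + real i) / (real k + 2)) \<longlonglongrightarrow> 1" by simp
  qed
  ultimately have l: "(\<lambda>k. real ((n + (k + i)) choose n) / real (k + i) ^ n * ((real k + real i) / (real k + 2)) ^ n) \<longlonglongrightarrow> 1 / fact n * 1 ^ n"
    by (rule tendsto_mult)
  have "eventually (\<lambda>k. real ((n + (k + i)) choose n) / real (k + i) ^ n * ((real k + real i) / (real k + 2)) ^ n =
      real ((n + (k + i)) choose n) / real (k + 2) ^ n) sequentially"
    by (rule eventually_mono[OF eventually_gt_at_top[of 0]]) (simp add: power_divide add.commute)
  then show ?thesis using Lim_transform_eventually[OF l] by simp
qed

lemma comps_card_binomial: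
  assumes "finite K" "card K = n + 1" shows "card (comps K k) = (n + k) choose n"
proof -
  have B: "(1 - fps_X) ^ (n + 1) * Abs_fps (\<lambda>k. int ((n + k) choose n)) = 1" for n
  proof (induction n)
    case 0
    show ?case by (rule fps_ext) (auto simp: one_minus_X_mult_nth)
  next
    case (Suc n)
    have "(1 - fps_X) * Abs_fps (\<lambda>k. int ((Suc n + k) choose Suc n)) = Abs_fps (\<lambda>k. int ((n + k) choose n))"
    proof (rule fps_ext)
      fix k
      show "fps_nth ((1 - fps_X) * Abs_fps (\<lambda>k. int ((Suc n + k) choose Suc n))) k = fps_nth (Abs_fps (\<lambda>k. int ((n + k) choose n))) k"
        by (cases k) (auto simp: one_minus_X_mult_nth)
    qed
    moreover have "(1 - fps_X :: int fps) ^ (Suc n + 1) = (1 - fps_X) ^ (n + 1) * (1 - fps_X)" by simp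
    ultimately show ?case using Suc by (simp only: mult.assoc)
  qed
  have "(1 - fps_X) ^ (n + 1) * Abs_fps (\<lambda>k. int (card (comps K k))) = (1 - fps_X) ^ (n + 1) * Abs_fps (\<lambda>k. int ((n + k) choose n))"
    using comps_fps[OF assms(1)] B[of n] assms(2) by simp
  moreover have "(1 - fps_X :: int fps) ^ (n + 1) \<noteq> 0" using B[of n] by auto
  ultimately have "Abs_fps (\<lambda>k. int (card (comps K k))) = Abs_fps (\<lambda>k. int ((n + k) choose n))" by simp
  then show ?thesis by (metis fps_nth_Abs_fps of_nat_eq_iff)
qed

context small_polytope
begin

text \<open>Each coefficient of \<open>hstar\<close> contributes a shifted binomial with the same
  leading behaviour, so the limit is the coefficient sum \<open>a + 2\<close> divided by
  \<open>n!\<close>.\<close>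

lemma slice_growth: "(\<lambda>k. real (card (slice n P k)) / real k ^ n) \<longlonglongrightarrow> (real a + 2) / fact n"
proof -
  let ?F = "Abs_fps (\<lambda>k. int (card (comps {..<n + 1} k)))" and ?b = "\<lambda>k. (n + k) choose n"
  have F: "card (comps {..<n + 1} k) = ?b k" for k by (rule comps_card_binomial) auto
  have "Abs_fps (\<lambda>k. int (card (slice n P k))) = fps_of_poly [:1, int a, 1:] * ?F"
    using slice_series[of "{..<n + 1}" 0] by simp
  also have "\<dots> = ?F + of_nat a * (fps_X ^ 1 * ?F) + fps_X ^ 2 * ?F" unfolding h_poly by (simp add: algebra_simps)
  finally have H: "Abs_fps (\<lambda>k. int (card (slice n P k))) = ?F + of_nat a * (fps_X ^ 1 * ?F) + fps_X ^ 2 * ?F" .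
  have "int (card (slice n P (k + 2))) = int (?b (k + 2)) + int a * int (?b (k + 1)) + int (?b k)" for k
  proof -
    have "int (card (slice n P (k + 2))) = fps_nth (?F + of_nat a * (fps_X ^ 1 * ?F) + fps_X ^ 2 * ?F) (k + 2)"
      unfolding H[symmetric] by simp
    also have "\<dots> = fps_nth ?F (k + 2) + int a * fps_nth (fps_X ^ 1 * ?F) (k + 2) + fps_nth (fps_X ^ 2 * ?F) (k + 2)"
      by (simp add: fps_of_nat[symmetric] fps_mult_left_const_nth)
    also have "\<dots> = int (?b (k + 2)) + int a * int (?b (k + 1)) + int (?b k)"
      unfolding fps_X_power_mult_nth by (simp add: F[simplified])
    finally show ?thesis .
  qed
  then have "real (card (slice n P (k + 2))) = real_of_int (int (?b (k + 2)) + int a * int (?b (k + 1)) + int (?b k))" for k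
    by (metis of_int_of_nat_eq)
  then have "real (card (slice n P (k + 2))) = real (?b (k + 2)) + real a * real (?b (k + 1)) + real (?b (k + 0))" for k
    by (simp only: of_int_add of_int_mult of_int_of_nat_eq add_0_right)
  then have "(\<lambda>k. real (card (slice n P (k + 2))) / real (k + 2) ^ n) =
     (\<lambda>k. real (?b (k + 2)) / real (k + 2) ^ n + real a * (real (?b (k + 1)) / real (k + 2) ^ n) + real (?b (k + 0)) / real (k + 2) ^ n)"
    by (simp add: add_divide_distrib)
  moreover have "\<dots> \<longlonglongrightarrow> 1 / fact n + real a * (1 / fact n) + 1 / fact n"
    by (intro tendsto_add tendsto_mult tendsto_const binomial_growth_shift)
  ultimately have "(\<lambda>k. real (card (slice n P (k + 2))) / real (k + 2) ^ n) \<longlonglongrightarrow> (real a + 2) / fact n"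
    by (simp add: add_divide_distrib algebra_simps)
  then show ?thesis by (rule LIMSEQ_offset)
qed

text \<open>The points whose coordinates, rounded down to multiples of \<open>1/k\<close>, give a
  point of \<open>P\<close> form a union of cubes of side \<open>1/k\<close>, one for each lattice
  point of the dilate. Dominated convergence compares this set with the polytope.\<close>

lemma volume: "normalized_volume n P = real (a + 2)"
proof -
  obtain U w where U: "finite U" "U \<subseteq> Lam n" "\<And>u. u \<in> U \<Longrightarrow> ev n u w = 1"
    and cone: "cone_over P = {p \<in> VV n. \<forall>u\<in>U. 0 \<le> ev n u p}" using functionals by blast
  let ?M = "Leb n"
  have space: "space ?M = PiE {..<n} (\<lambda>_. UNIV)" by (simp add: space_PiM)
  have Psub: "P \<subseteq> rspace n" by (rule lattice_polytope_rspace[OF lp])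
  have P_iff: "vec_of n y \<in> P \<longleftrightarrow> (\<forall>u\<in>U. 0 \<le> affine_form n u y)" for y
  proof -
    have "vec_of n y \<in> P \<longleftrightarrow> (vec_of n y, 1) \<in> cone_over P" by (auto simp: cone_over_def)
    then show ?thesis by (simp add: cone VV_def vec_of_rspace affine_form_ev)
  qed
  define K where "K = (\<lambda>x. restrict (lookup x) {..<n}) ` P"
  have K: "K = {y \<in> space ?M. \<forall>u\<in>U. 0 \<le> affine_form n u y}"
  proof (intro equalityI subsetI)
    fix y assume "y \<in> K"
    then obtain x where x: "x \<in> P" "y = restrict (lookup x) {..<n}" by (auto simp: K_def)
    have "vec_of n y = x" using x Psub by (intro poly_mapping_eqI) (auto simp: lookup_vec_of rspace_iff)
    then show "y \<in> {y \<in> space ?M. \<forall>u\<in>U. 0 \<le> affine_form n u y}" using x P_iff[of y] by (simp add: space)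
  next
    fix y assume y: "y \<in> {y \<in> space ?M. \<forall>u\<in>U. 0 \<le> affine_form n u y}"
    then have "vec_of n y \<in> P" using P_iff by blast
    moreover have "y = restrict (lookup (vec_of n y)) {..<n}"
    proof (rule ext)
      fix i
      show "y i = restrict (lookup (vec_of n y)) {..<n} i"
        using y PiE_arb[of y "{..<n}" "\<lambda>_. UNIV" i] by (cases "i < n") (simp_all add: lookup_vec_of space)
    qed
    ultimately show "y \<in> K" unfolding K_def by blast
  qed
  have Kset: "K \<in> sets ?M" unfolding K using U(1) by measurable
  define q where "q = (\<lambda>(k::nat) (y::nat \<Rightarrow> real). restrict (\<lambda>i. of_int \<lfloor>real k * y i\<rfloor> / real k) {..<n})"
  define A where "A = (\<lambda>k. {y \<in> space ?M. \<forall>u\<in>U. 0 \<le> affine_form n u (q k y)})"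
  have q_meas [measurable]: "q k \<in> measurable ?M ?M" for k unfolding q_def by measurable
  have Aset: "A k \<in> sets ?M" for k unfolding A_def using U(1) by measurable
  have bdd: "bounded P"
    using lp finite_imp_bounded_convex_hull unfolding lattice_polytope_def by blast
  then obtain B where B: "\<And>x. x \<in> P \<Longrightarrow> norm x \<le> B" unfolding bounded_iff by blast
  \<comment> \<open>Rounding moves a coordinate by at most 1, so all \<open>A k\<close> with
    \<open>k \<ge> 1\<close> stay in this cube, which gives an integrable bound.\<close>
  define box where "box = PiE {..<n} (\<lambda>_. {- B - 1..B + 1})"
  have boxset: "box \<in> sets ?M" unfolding box_def by (rule sets_PiM_I_finite) auto
  have boxfin: "emeasure ?M box < \<infinity>"
    unfolding box_def by (subst lborel_prod.emeasure_PiM) (auto simp: less_top[symmetric] power_eq_top_ennreal emeasure_lborel_Icc_eq)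
  have Abox: "A k \<subseteq> box" if k: "k \<ge> 1" for k
  proof
    fix y assume y: "y \<in> A k"
    have "vec_of n (q k y) \<in> P" using y P_iff by (simp add: A_def)
    then have "\<bar>q k y i\<bar> \<le> B" if "i < n" for i
      using B abs_lookup_le_norm[of "vec_of n (q k y)" i] that by (fastforce simp: lookup_vec_of)
    moreover have "\<bar>y i - q k y i\<bar> \<le> 1" if "i < n" for i
    proof -
      have "y i - q k y i = (real k * y i - of_int \<lfloor>real k * y i\<rfloor>) / real k" using k that by (simp add: q_def field_simps)
      also have "\<bar>\<dots>\<bar> \<le> 1 / real k" unfolding abs_divide by (intro frac_le) (use k in \<open>simp; linarith\<close>)+
      also have "\<dots> \<le> 1" using k by simp
      finally show ?thesis .
    qed
    ultimately have "- B - 1 \<le> y i \<and> y i \<le> B + 1" if "i < n" for i using that by (smt (verit))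
    then show "y \<in> box" using y by (auto simp: box_def A_def space PiE_iff)
  qed
  \<comment> \<open>Off the facet hyperplanes no inequality is an equality, so the rounded points
    eventually decide membership correctly. A functional with zero linear part is a nonzero
    constant, because its value at \<open>w\<close> is 1.\<close>
  have nonzero: "AE y in ?M. \<forall>u\<in>U. affine_form n u y \<noteq> 0"
  proof (rule AE_finite_allI[OF U(1)])
    fix u assume u: "u \<in> U"
    show "AE y in ?M. affine_form n u y \<noteq> 0"
    proof (cases "\<exists>j<n. lookup (fst u) j \<noteq> 0")
      case True
      then show ?thesis using affine_form_null by blast
    next
      case False
      then have c: "affine_form n u y = snd u" for y by (simp add: affine_form_def)
      have "ev n u w = snd u * snd w" using False by (simp add: ev_def pairing_def)
      then have "snd u \<noteq> 0" using U(3)[OF u] by auto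
      then show ?thesis by (simp add: c)
    qed
  qed
  have conv: "AE y in ?M. (\<lambda>k. indicator (A k) y :: real) \<longlonglongrightarrow> indicator K y"
    using nonzero
  proof (rule AE_mp, intro AE_I2 impI)
    fix y assume y: "y \<in> space ?M" and nz: "\<forall>u\<in>U. affine_form n u y \<noteq> 0"
    have lim: "(\<lambda>k. affine_form n u (q k y)) \<longlonglongrightarrow> affine_form n u y" for u
    proof -
      have "(\<lambda>k. (\<Sum>i<n. lookup (fst u) i * (of_int \<lfloor>real k * y i\<rfloor> / real k)) + snd u) \<longlonglongrightarrow> affine_form n u y"
        unfolding affine_form_def by (intro tendsto_add tendsto_sum tendsto_mult tendsto_const floor_scaled_tendsto)
      then show ?thesis by (simp add: affine_form_def q_def)
    qed
    show "(\<lambda>k. indicator (A k) y :: real) \<longlonglongrightarrow> indicator K y"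
    proof (cases "y \<in> K")
      case True
      have "\<forall>\<^sub>F k in sequentially. \<forall>u\<in>U. 0 < affine_form n u (q k y)"
      proof (rule eventually_ball_finite[OF U(1)], rule ballI)
        fix u assume "u \<in> U"
        then have "0 < affine_form n u y" using True nz by (auto simp: K less_le)
        then show "\<forall>\<^sub>F k in sequentially. 0 < affine_form n u (q k y)" by (rule order_tendstoD(1)[OF lim])
      qed
      then have "\<forall>\<^sub>F k in sequentially. indicator (A k) y = (indicator K y :: real)"
        by (rule eventually_mono) (use True y in \<open>auto simp: A_def indicator_def less_imp_le\<close>)
      then show ?thesis by (rule tendsto_eventually)
    next
      case False
      then obtain u where u: "u \<in> U" "affine_form n u y < 0" using y by (auto simp: K not_le)
      have "\<forall>\<^sub>F k in sequentially. affine_form n u (q k y) < 0" by (rule order_tendstoD(2)[OF lim u(2)])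
      then have "\<forall>\<^sub>F k in sequentially. indicator (A k) y = (indicator K y :: real)"
        by (rule eventually_mono) (use False u in \<open>force simp: A_def indicator_def\<close>)
      then show ?thesis by (rule tendsto_eventually)
    qed
  qed
  have "(\<lambda>k. \<integral>y. indicator (A (Suc k)) y \<partial>?M) \<longlonglongrightarrow> (\<integral>y. (indicator K y :: real) \<partial>?M)"
  proof (rule integral_dominated_convergence[where w = "indicator box"])
    show "integrable ?M (indicator box :: _ \<Rightarrow> real)" using boxset boxfin by simp
    show "AE y in ?M. (\<lambda>k. indicator (A (Suc k)) y :: real) \<longlonglongrightarrow> indicator K y"
      using conv by (rule AE_mp) (auto intro!: AE_I2 LIMSEQ_Suc)
    show "AE y in ?M. norm (indicator (A (Suc k)) y :: real) \<le> indicator box y" for k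
      using Abox[of "Suc k"] by (intro AE_I2) (auto simp: indicator_def)
  qed (use Aset Kset in auto)
  then have lim1: "(\<lambda>k. measure ?M (A (Suc k))) \<longlonglongrightarrow> measure ?M K"
    using Aset Kset sets.sets_into_space[OF Kset] sets.sets_into_space[OF Aset] by (simp add: Int_absorb2)
  have count: "measure ?M (A k) = real (card (slice n P k)) / real k ^ n" if k: "k \<ge> 1" for k
  proof -
    let ?T = "dilate k P \<inter> lattice n"
    define C where "C = (\<lambda>x :: vec. PiE {..<n} (\<lambda>i. {lookup x i / real k..<(lookup x i + 1) / real k}))"
    have k0: "real k > 0" using k by simp
    have "(\<lambda>x. (x, real k)) ` ?T \<subseteq> slice n P k"
      by (auto simp: slice_def cone_semigroup_def cone_over_def dilate_def)
    then have fin: "finite ?T"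
      by (rule finite_imageD[OF finite_subset[OF _ finite_slice[OF lp]]]) (simp add: inj_on_def)
    have dil: "x \<in> dilate k P \<longleftrightarrow> (1 / real k) *\<^sub>R x \<in> P" for x
      using k0 by (auto simp: dilate_def image_iff intro: bexI[of _ "(1 / real k) *\<^sub>R x"])
    have fl: "\<lfloor>real k * y i\<rfloor> = z \<longleftrightarrow> y i \<in> {of_int z / real k..<(of_int z + 1) / real k}" for y :: "nat \<Rightarrow> real" and i z
      using k0 by (simp add: floor_eq_iff field_simps)
    have C_iff: "y \<in> C x \<longleftrightarrow> y \<in> space ?M \<and> (\<forall>i<n. of_int \<lfloor>real k * y i\<rfloor> = lookup x i)" if x: "x \<in> lattice n" for x y
    proof -
      have "y i \<in> {lookup x i / real k..<(lookup x i + 1) / real k} \<longleftrightarrow> of_int \<lfloor>real k * y i\<rfloor> = lookup x i" for i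
      proof -
        obtain z :: int where z: "lookup x i = of_int z" using x by (auto simp: lattice_def elim: Ints_cases)
        show ?thesis unfolding z using fl[of y i z] by simp
      qed
      then show ?thesis unfolding C_def space PiE_iff by auto
    qed
    have AC: "A k = (\<Union>x\<in>?T. C x)"
    proof (intro equalityI subsetI)
      fix y assume y: "y \<in> A k"
      define x where "x = vec_of n (\<lambda>i. of_int \<lfloor>real k * y i\<rfloor>)"
      have xl: "x \<in> lattice n" by (simp add: x_def lattice_def vec_of_rspace lookup_vec_of)
      have "(1 / real k) *\<^sub>R x = vec_of n (q k y)" by (rule poly_mapping_eqI) (simp add: x_def lookup_vec_of q_def)
      then have "x \<in> dilate k P" using y P_iff dil by (simp add: A_def)
      moreover have "y \<in> C x" using C_iff[OF xl] y by (simp add: A_def x_def lookup_vec_of)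
      ultimately show "y \<in> (\<Union>x\<in>?T. C x)" using xl by blast
    next
      fix y assume "y \<in> (\<Union>x\<in>?T. C x)"
      then obtain x where x: "x \<in> dilate k P" "x \<in> lattice n" "y \<in> C x" by blast
      have "(1 / real k) *\<^sub>R x = vec_of n (q k y)"
        using C_iff[OF x(2)] x(2,3) by (intro poly_mapping_eqI) (auto simp: lookup_vec_of q_def lattice_def rspace_iff)
      then show "y \<in> A k" using x dil P_iff C_iff[OF x(2)] by (simp add: A_def)
    qed
    have em: "emeasure ?M (C x) = ennreal ((1 / real k) ^ n)" for x
    proof -
      have "emeasure ?M (C x) = (\<Prod>i<n. ennreal (1 / real k))"
        unfolding C_def using k0 by (subst lborel_prod.emeasure_PiM) (auto intro!: prod.cong simp: diff_divide_distrib[symmetric] divide_right_mono)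
      then show ?thesis by (simp add: ennreal_power)
    qed
    have "measure ?M (A k) = (\<Sum>x\<in>?T. measure ?M (C x))"
      unfolding AC
    proof (rule measure_finite_Union[OF fin])
      show "C ` ?T \<subseteq> sets ?M" unfolding C_def by (auto intro!: sets_PiM_I_finite)
      show "disjoint_family_on C ?T"
      proof (unfold disjoint_family_on_def, intro ballI impI equals0I)
        fix x x' y assume x: "x \<in> ?T" "x' \<in> ?T" "x \<noteq> x'" "y \<in> C x \<inter> C x'"
        have "x = x'" using x C_iff[of x y] C_iff[of x' y]
          by (intro poly_mapping_eqI) (metis IntD1 IntD2 lattice_rspace linorder_not_le rspace_iff subsetD)
        then show False using x by simp
      qed
    qed (simp add: em)
    also have "\<dots> = real (card ?T) * (1 / real k) ^ n" using k0 by (simp add: measure_def em)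
    also have "card ?T = card (slice n P k)" by (rule card_slice)
    finally show ?thesis by (simp add: power_divide add.commute)
  qed
  have "(\<lambda>k. measure ?M (A (Suc k))) \<longlonglongrightarrow> (real a + 2) / fact n"
    using LIMSEQ_Suc[OF slice_growth] by (simp add: count del: of_nat_Suc)
  then have "measure ?M K = (real a + 2) / fact n" by (rule LIMSEQ_unique[OF lim1])
  then show ?thesis by (simp add: normalized_volume_def K_def)
qed

end

section \<open>Labels and variable degrees of a given polytope\<close>

lemma minimal_generating_set_unique: "minimal_generating_set G S \<Longrightarrow> minimal_generating_set H S \<Longrightarrow> G = H"
  unfolding minimal_generating_set_def by blast

lemma small_polytope_exists:
  assumes "small_degree_two_polytope n P a"
  shows "\<exists>J g. small_polytope n P a J g"
proof -
  have "lattice_polytope n P"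
    using assms by (auto simp: small_degree_two_polytope_def gorenstein_def gorenstein_of_index_def full_lattice_polytope_def)
  then obtain g where "bij_betw g {1..card (slice n P 1)} (slice n P 1)"
    using ex_bij_betw_nat_finite_1[OF finite_slice] by blast
  then show ?thesis using assms small_polytope.intro finite_atLeastAtMost by blast
qed

lemma small_degree_two_model:
  assumes "small_degree_two_polytope n P a"
  shows "\<exists>i h. label_dim i = n \<and> label_model n i h P"
  using small_polytope_exists[OF assms] small_polytope.classification by blast

text \<open>The minimal generating set does not depend on the presentation, so \<open>i\<close> and
  \<open>i'\<close> describe the same set of generators and \<open>label_unique\<close>
  applies.\<close>

lemma presents_label:
  assumes m: "label_model n i h P"
    and p: "presents n P (num_vars i') (relations i' :: 'k::field_char_0 mpoly set) g"
  shows "i' = i" "j \<in> vars i \<Longrightarrow> snd (g j) = var_degree i j"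
proof -
  note F = presents_faithful[OF p] and F' = presents_faithful[OF label_model_presents[OF m, where 'k = 'k]]
  have img: "g ` (vars i') = h ` (vars i)" by (rule minimal_generating_set_unique[OF F(2) F'(2)])
  show i: "i' = i" by (rule label_unique[OF F(1) F'(1) img])
  have pm: "premodel n (vars i) (label_rels i) (label_deg i) h" using m by (simp add: model_def)
  have deg: "\<exists>k\<in>(vars i). g j = h k \<and> snd (g j) = real (label_deg i k)" if j: "j \<in> vars i" for j
  proof -
    have "g j \<in> h ` (vars i)" using img j i by blast
    then show ?thesis using pm_deg[OF pm] by (metis imageE)
  qed
  show "snd (g j) = var_degree i j" if j: "j \<in> vars i"
  proof (cases "i = P1")
    case False
    then show ?thesis using deg[OF j] by (auto simp: label_deg_def)
  next
    case True
    have inj: "inj_on g {1..5}" using F(1) i True by (simp add: faithful_def)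
    have d: "\<exists>k\<in>{1..5}. g x = h k \<and> snd (g x) = (if k = 5 then 2 else 1)" if "x \<in> {1..5}" for x
      using deg[of x] that True by (fastforce simp: label_deg_def)
    have one: "snd (g x) = 1" if x: "x \<in> {1..5}" "y \<in> {1..5}" "x \<noteq> y" "snd (g y) = 2" for x y
    proof (rule ccontr)
      assume n: "snd (g x) \<noteq> 1"
      obtain k where k: "g x = h k" "snd (g x) = (if k = 5 then 2 else 1)" using d[OF x(1)] by blast
      obtain k' where k': "g y = h k'" "snd (g y) = (if k' = 5 then 2 else 1)" using d[OF x(2)] by blast
      have "k = 5" "k' = 5" using k(2) k'(2) n x(4) by (auto split: if_splits)
      then have "g x = g y" using k k' by simp
      then show False using inj_onD[OF inj _ x(1,2)] x(3) by blast
    qed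
    have s12: "snd (g x) = 1 \<or> snd (g x) = 2" if "x \<in> {1..5}" for x using d[OF that] by (auto split: if_splits)
    \<comment> \<open>All five degrees are 1 or 2. If the fifth were 1, the left side would have
      degree at least four and the right side degree two; once it is 2, the other four must be
      1.\<close>
    have "g 1 + g 2 + g 3 + g 4 = g 5 + g 5" using F(1) i True by (simp add: faithful_def label_holds_iff add.assoc)
    then have e: "snd (g 1) + snd (g 2) + snd (g 3) + snd (g 4) = snd (g 5) + snd (g 5)" by (metis snd_add)
    have five: "snd (g 5) = 2"
    proof (rule ccontr)
      assume "snd (g 5) \<noteq> 2"
      then show False using s12[of 1] s12[of 2] s12[of 3] s12[of 4] s12[of 5] e by auto
    qed
    show ?thesis
    proof (cases "j = 5")
      case True
      then show ?thesis using five \<open>i = P1\<close> by simp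
    next
      case False
      then show ?thesis using one[of j 5] five j \<open>i = P1\<close> by simp
    qed
  qed
qed

text \<open>Apart from the volume, all clauses come from label models: every polytope in question
  has one, its label is unique, models of one label are isomorphic, isomorphisms transport models,
  and \<open>label_example\<close> realises each label.\<close>

theorem theorem2p10:
  shows "(\<forall>n P a. small_degree_two_polytope n P a \<longrightarrow>
            n \<le> 5 \<and>
            normalized_volume n P = real (a + 2) \<and>
            (\<exists>!i. \<exists>g. presents n P (num_vars i) (relations i :: 'k::field_char_0 mpoly set) g) \<and>
            (\<forall>i g. presents n P (num_vars i) (relations i :: 'k mpoly set) g \<longrightarrow>
               label_dim i = n \<and> (\<forall>j\<in>{1..num_vars i}. snd (g j) = var_degree i j))) \<and>
         (\<forall>i. \<exists>P a g. small_degree_two_polytope (label_dim i) P a \<and>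
            presents (label_dim i) P (num_vars i) (relations i :: 'k mpoly set) g) \<and>
         (\<forall>n P a m Q b. small_degree_two_polytope n P a \<and> small_degree_two_polytope m Q b \<longrightarrow>
            (lattice_iso n P m Q \<longleftrightarrow>
               (\<exists>i g h. presents n P (num_vars i) (relations i :: 'k mpoly set) g \<and>
                        presents m Q (num_vars i) (relations i :: 'k mpoly set) h)))"
proof (intro conjI allI impI)
  fix n P a assume s: "small_degree_two_polytope n P a"
  obtain i h where i: "label_dim i = n" "label_model n i h P"
    using small_degree_two_model[OF s] by blast
  show "n \<le> 5" using i(1) by (cases i) auto
  show "normalized_volume n P = real (a + 2)" using small_polytope_exists[OF s] small_polytope.volume by blast
  show "\<exists>!i. \<exists>g. presents n P (num_vars i) (relations i :: 'k mpoly set) g"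
    using label_model_presents[OF i(2)] presents_label(1)[OF i(2)] by blast
  show "label_dim i' = n" if "presents n P (num_vars i') (relations i' :: 'k mpoly set) g" for i' g
    using presents_label(1)[OF i(2) that] i(1) by simp
  show "\<forall>j\<in>(vars i'). snd (g j) = var_degree i' j"
    if "presents n P (num_vars i') (relations i' :: 'k mpoly set) g" for i' g
    using presents_label[OF i(2) that] by simp
next
  fix i
  show "\<exists>P a g. small_degree_two_polytope (label_dim i) P a \<and> presents (label_dim i) P (num_vars i) (relations i :: 'k mpoly set) g"
    using label_example[of i] label_model_presents by blast
next
  fix n P a m Q b assume s: "small_degree_two_polytope n P a \<and> small_degree_two_polytope m Q b"
  obtain i g where i: "label_model n i g P"
    using small_degree_two_model s by blast
  obtain i' h where i': "label_model m i' h Q"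
    using small_degree_two_model s by blast
  show "lattice_iso n P m Q \<longleftrightarrow> (\<exists>i g h. presents n P (num_vars i) (relations i :: 'k mpoly set) g \<and>
    presents m Q (num_vars i) (relations i :: 'k mpoly set) h)"
  proof
    assume "lattice_iso n P m Q"
    then obtain h' where "label_model m i h' Q" using model_transport[OF i] by blast
    then show "\<exists>i g h. presents n P (num_vars i) (relations i :: 'k mpoly set) g \<and> presents m Q (num_vars i) (relations i :: 'k mpoly set) h"
      using label_model_presents[OF i] label_model_presents by blast
  next
    assume "\<exists>i g h. presents n P (num_vars i) (relations i :: 'k mpoly set) g \<and> presents m Q (num_vars i) (relations i :: 'k mpoly set) h"
    then have "i = i'" using presents_label(1)[OF i] presents_label(1)[OF i'] by metis
    then show "lattice_iso n P m Q" using models_isomorphic[OF i] i' by simp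
  qed
qed

end
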